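(* Let $L$ be a simple pseudoline arrangement with no contact point, $\chi$ a cut of $L$, and $k$ a positive integer. Then $V(\Gamma_\chi^k(L))=\mathbb G_\chi^k(L)$.
   Context: Pseudoline arrangements in the Möbius strip $\mathcal M=\mathbb R^2/\tau$, $\tau(x,y)=(x+\pi,-y)$: finite sets of pseudolines (projections of graphs of continuous $\pi$-antiperiodic functions) any two with exactly one crossing point and possibly contact points (touching points); simple. Levels: first level = boundary of the external face of the complement of the support; $j$th level inductively. $k$-kernel $\mathcal S^k$: support minus first $k$ levels; $V^k$: contact points of $L$ in $\mathcal S^k$. A $k$-pseudotriangulation of $L$ is an arrangement with support $\mathcal S^k$ and contact set containing $V^k$. For a $k$-pseudotriangulation $\Lambda$ of $L$, $V(\Lambda)$ is the set of intersection points of $L$ that are not crossing points of $\Lambda$. Cut: with $\bar{\mathcal S}=\pi^{-1}(\text{support})$ oriented by increasing abscissa and path order $\preceq$, a filter $F$ (nonempty proper upward-closed set of vertices) defines a cut $\chi$; for vertices $v,w$, $v\preceq_\chi w$ iff their unique preimages in $F\setminus\tau(F)$ satisfy $\bar v\preceq\bar w$. A flip (replace a contact point $v$ of two pseudolines by their crossing point $w$) is $\chi$-increasing if $v\prec_\chi w$. The $\chi$-greedy $k$-pseudotriangulation $\Gamma_\chi^k(L)$ is the unique source of the directed graph of $\chi$-increasing flips on $k$-pseudotriangulations of $L$. Index the pseudolines of $L$ as $\ell_1,\dots,\ell_n$ in the order in which they cross $\chi$, and write $\ell_\alpha\wedge\ell_\beta$ for their crossing point. $\mathbb G_\chi^k(L)$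 is the set of crossing points $\ell_\alpha\wedge\ell_\beta$ with $1\le\alpha<\beta\le n$ for which there do NOT exist indices $\gamma_1,\dots,\gamma_k$ and $\delta_1,\dots,\delta_k$ with $\alpha<\gamma_1<\dots<\gamma_k$, $\delta_1<\dots<\delta_k<\beta$, $\delta_k<\gamma_1$, and $\ell_\alpha\wedge\ell_{\gamma_i}\preceq_\chi\ell_\alpha\wedge\ell_\beta$ and $\ell_\beta\wedge\ell_{\delta_i}\preceq_\chi\ell_\alpha\wedge\ell_\beta$ for all $i\in\{1,\dots,k\}$.
   Formalization: In the definition of 𝔾 the comparisons ⪯_χ are taken as strict (γ_i ≠ β, δ_i ≠ α); with the reflexive order γ_1 = β, δ_1 = α is always admissible for k = 1, so 𝔾 would be empty while V(Γ) is not (e.g. n = 2, k = 1). *)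

theory Defs
  imports "HOL-Analysis.Analysis"
begin

subsection \<open>The Moebius strip\<close>

definition tau :: "real \<times> real \<Rightarrow> real \<times> real" where
  "tau p = (fst p + pi, - snd p)"

text \<open>As \<open>tau\<close> is a bijection, this is the orbit relation of the group it generates.\<close>

definition tau_equiv :: "real \<times> real \<Rightarrow> real \<times> real \<Rightarrow> bool" where
  "tau_equiv p q \<longleftrightarrow> (\<exists>m n. (tau ^^ m) p = (tau ^^ n) q)"

lemma equivp_tau_equiv: "equivp tau_equiv"
proof (rule equivpI)
  show "reflp tau_equiv"
    unfolding reflp_def tau_equiv_def by blast
  show "symp tau_equiv"
    unfolding symp_def tau_equiv_def by metis
  show "transp tau_equiv"
  proof (rule transpI)
    fix p q r
    assume "tau_equiv p q" "tau_equiv q r"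
    then obtain m n a b where 1: "(tau ^^ m) p = (tau ^^ n) q" and 2: "(tau ^^ a) q = (tau ^^ b) r"
      unfolding tau_equiv_def by blast
    have "(tau ^^ (a + m)) p = (tau ^^ (a + n)) q"
      using 1 by (simp add: funpow_add)
    also have "\<dots> = (tau ^^ (n + a)) q"
      by (simp add: add.commute)
    also have "\<dots> = (tau ^^ (n + b)) r"
      using 2 by (simp add: funpow_add)
    finally show "tau_equiv p r"
      unfolding tau_equiv_def by blast
  qed
qed

quotient_type moebius = "real \<times> real" / tau_equiv
  morphisms rep_moebius mproj
  by (rule equivp_tau_equiv)

instantiation moebius :: topological_space
begin

definition open_moebius :: "moebius set \<Rightarrow> bool" where
  "open_moebius U \<longleftrightarrow> open (mproj -` U)"

instance
  by standard (auto simp: open_moebius_def vimage_Int vimage_Union)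

end

subsection \<open>Pseudolines and arrangements\<close>

definition represents :: "(real \<Rightarrow> real) \<Rightarrow> moebius set \<Rightarrow> bool" where
  "represents f P \<longleftrightarrow>
     continuous_on UNIV f \<and> (\<forall>x. f (x + pi) = - f x) \<and> P = range (\<lambda>x. mproj (x, f x))"

definition pseudoline :: "moebius set \<Rightarrow> bool" where
  "pseudoline P \<longleftrightarrow> (\<exists>f. represents f P)"

definition crossing_point :: "moebius set \<Rightarrow> moebius set \<Rightarrow> moebius \<Rightarrow> bool" where
  "crossing_point P Q p \<longleftrightarrow>
     (\<exists>f g x. represents f P \<and> represents g Q \<and> p = mproj (x, f x) \<and> f x = g x \<and>
        (\<forall>\<^sub>F h in at_right 0. (f (x - h) - g (x - h)) * (f (x + h) - g (x + h)) < 0))"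

definition contact_point :: "moebius set \<Rightarrow> moebius set \<Rightarrow> moebius \<Rightarrow> bool" where
  "contact_point P Q p \<longleftrightarrow>
     (\<exists>f g x. represents f P \<and> represents g Q \<and> p = mproj (x, f x) \<and> f x = g x \<and>
        (\<forall>\<^sub>F h in at_right 0. (f (x - h) - g (x - h)) * (f (x + h) - g (x + h)) > 0))"

definition arrangement :: "moebius set set \<Rightarrow> bool" where
  "arrangement L \<longleftrightarrow> finite L \<and> (\<forall>P\<in>L. pseudoline P) \<and>
     (\<forall>P\<in>L. \<forall>Q\<in>L. P \<noteq> Q \<longrightarrow> finite (P \<inter> Q) \<and> (\<exists>!p. crossing_point P Q p))"

definition simple_arrangement :: "moebius set set \<Rightarrow> bool" where
  "simple_arrangement L \<longleftrightarrow> arrangement L \<and>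
     (\<forall>P\<in>L. \<forall>Q\<in>L. \<forall>R\<in>L. P \<noteq> Q \<and> P \<noteq> R \<and> Q \<noteq> R \<longrightarrow> P \<inter> Q \<inter> R = {})"

definition wedge :: "moebius set \<Rightarrow> moebius set \<Rightarrow> moebius" where
  "wedge P Q = (THE p. crossing_point P Q p)"

definition support :: "moebius set set \<Rightarrow> moebius set" where
  "support L = \<Union>L"

definition crossing_points :: "moebius set set \<Rightarrow> moebius set" where
  "crossing_points L = {p. \<exists>P\<in>L. \<exists>Q\<in>L. P \<noteq> Q \<and> crossing_point P Q p}"

definition contact_points :: "moebius set set \<Rightarrow> moebius set" where
  "contact_points L = {p. \<exists>P\<in>L. \<exists>Q\<in>L. P \<noteq> Q \<and> contact_point P Q p}"

definition intersection_points :: "moebius set set \<Rightarrow> moebius set" where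
  "intersection_points L = {p. \<exists>P\<in>L. \<exists>Q\<in>L. P \<noteq> Q \<and> p \<in> P \<inter> Q}"

subsection \<open>Levels, kernels, pseudotriangulations\<close>

text \<open>The strip has no boundary, so the external face is the face which is not relatively compact.\<close>

definition external_face :: "moebius set \<Rightarrow> moebius set" where
  "external_face S = \<Union>{C \<in> components (- S). \<not> compact (closure C)}"

definition external_hull :: "moebius set \<Rightarrow> moebius set" where
  "external_hull S = frontier (external_face S)"

text \<open>Consecutive levels meet at vertices. Removing a level means removing its edges: the vertices
  which it shares with the next level stay in the support, whence the closure.
  The \<open>(j + 1)\<close>st level of \<open>L\<close> is \<open>external_hull (kernel L j)\<close>.\<close>

fun kernel :: "moebius set set \<Rightarrow> nat \<Rightarrow> moebius set" where
  "kernel L 0 = support L"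
| "kernel L (Suc j) = closure (kernel L j - external_hull (kernel L j))"

definition pseudotriangulation :: "moebius set set \<Rightarrow> nat \<Rightarrow> moebius set set \<Rightarrow> bool" where
  "pseudotriangulation L k \<Lambda> \<longleftrightarrow> simple_arrangement \<Lambda> \<and> support \<Lambda> = kernel L k \<and>
     contact_points L \<inter> kernel L k \<subseteq> contact_points \<Lambda>"

definition pt_vertices :: "moebius set set \<Rightarrow> moebius set set \<Rightarrow> moebius set" where
  "pt_vertices L \<Lambda> = intersection_points L - crossing_points \<Lambda>"

subsection \<open>Cuts\<close>

definition lifted_vertices :: "moebius set set \<Rightarrow> (real \<times> real) set" where
  "lifted_vertices L = mproj -` intersection_points L"

definition lifted_edge :: "moebius set set \<Rightarrow> real \<times> real \<Rightarrow> real \<times> real \<Rightarrow> bool" where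
  "lifted_edge L z z' \<longleftrightarrow>
     (\<exists>P\<in>L. z \<in> lifted_vertices L \<inter> mproj -` P \<and> z' \<in> lifted_vertices L \<inter> mproj -` P \<and>
        fst z < fst z' \<and>
        (\<forall>u \<in> lifted_vertices L \<inter> mproj -` P. \<not> (fst z < fst u \<and> fst u < fst z')))"

definition path_le :: "moebius set set \<Rightarrow> real \<times> real \<Rightarrow> real \<times> real \<Rightarrow> bool" where
  "path_le L = (lifted_edge L)\<^sup>*\<^sup>*"

definition cut_filter :: "moebius set set \<Rightarrow> (real \<times> real) set \<Rightarrow> bool" where
  "cut_filter L F \<longleftrightarrow> F \<subseteq> lifted_vertices L \<and> F \<noteq> {} \<and> F \<noteq> lifted_vertices L \<and>
     (\<forall>z\<in>F. \<forall>z'\<in>lifted_vertices L. path_le L z z' \<longrightarrow> z' \<in> F)"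

definition cut_le :: "moebius set set \<Rightarrow> (real \<times> real) set \<Rightarrow> moebius \<Rightarrow> moebius \<Rightarrow> bool" where
  "cut_le L F v w \<longleftrightarrow>
     (\<exists>v'\<in>F - tau ` F. \<exists>w'\<in>F - tau ` F. mproj v' = v \<and> mproj w' = w \<and> path_le L v' w')"

definition cut_less :: "moebius set set \<Rightarrow> (real \<times> real) set \<Rightarrow> moebius \<Rightarrow> moebius \<Rightarrow> bool" where
  "cut_less L F v w \<longleftrightarrow> cut_le L F v w \<and> v \<noteq> w"

text \<open>The cut as a curve: \<open>c\<close> parametrizes a vertical curve in the plane which separates the filter
  from its complement. It may run downwards or upwards, as the order in which the pseudolines cross
  a cut is determined only up to reversal.\<close>

definition cut_curve ::
  "moebius set set \<Rightarrow> (real \<times> real) set \<Rightarrow> (real \<Rightarrow> real \<times> real) \<Rightarrow> bool" where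
  "cut_curve L F c \<longleftrightarrow> continuous_on UNIV c \<and> inj c \<and>
     (filterlim (snd \<circ> c) at_top at_bot \<and> filterlim (snd \<circ> c) at_bot at_top \<or>
      filterlim (snd \<circ> c) at_bot at_bot \<and> filterlim (snd \<circ> c) at_top at_top) \<and>
     (\<forall>P\<in>L. \<exists>!t. c t \<in> mproj -` P) \<and>
     (\<forall>P\<in>L. \<forall>t. c t \<in> mproj -` P \<longrightarrow>
        (\<forall>z \<in> lifted_vertices L \<inter> mproj -` P.
           (z \<in> F \<longrightarrow> fst (c t) < fst z) \<and> (z \<notin> F \<longrightarrow> fst z < fst (c t))))"

definition crossing_order ::
  "moebius set set \<Rightarrow> (real \<Rightarrow> real \<times> real) \<Rightarrow> nat \<Rightarrow> (nat \<Rightarrow> moebius set) \<Rightarrow> bool" where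
  "crossing_order L c n l \<longleftrightarrow> bij_betw l {1..n} L \<and>
     (\<exists>t. strict_mono_on {1..n} t \<and> (\<forall>i\<in>{1..n}. c (t i) \<in> mproj -` l i))"

subsection \<open>Flips and greedy pseudotriangulations\<close>

text \<open>Since an arrangement is determined by its support and its contact points, exchanging a contact
  point for a crossing point is expressed through these data.\<close>

definition flip :: "moebius set set \<Rightarrow> moebius set set \<Rightarrow> moebius \<Rightarrow> moebius \<Rightarrow> bool" where
  "flip \<Lambda> \<Lambda>' v w \<longleftrightarrow>
     (\<exists>P\<in>\<Lambda>. \<exists>Q\<in>\<Lambda>. P \<noteq> Q \<and> contact_point P Q v \<and> crossing_point P Q w) \<and>
     support \<Lambda>' = support \<Lambda> \<and> contact_points \<Lambda>' = (contact_points \<Lambda> - {v}) \<union> {w}"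

definition increasing_flip_arc ::
  "moebius set set \<Rightarrow> (real \<times> real) set \<Rightarrow> nat \<Rightarrow> moebius set set \<Rightarrow> moebius set set \<Rightarrow> bool" where
  "increasing_flip_arc L F k \<Lambda> \<Lambda>' \<longleftrightarrow>
     pseudotriangulation L k \<Lambda> \<and> pseudotriangulation L k \<Lambda>' \<and>
     (\<exists>v w. flip \<Lambda> \<Lambda>' v w \<and> cut_less L F v w)"

definition greedy_pseudotriangulation ::
  "moebius set set \<Rightarrow> (real \<times> real) set \<Rightarrow> nat \<Rightarrow> moebius set set" where
  "greedy_pseudotriangulation L F k =
     (THE \<Lambda>. pseudotriangulation L k \<Lambda> \<and> (\<nexists>\<Lambda>'. increasing_flip_arc L F k \<Lambda>' \<Lambda>))"

text \<open>The comparisons have to be strict: \<open>\<gamma> i = \<beta>\<close> and \<open>\<delta> i = \<alpha>\<close> must not count as witnesses.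
  With a reflexive order, \<open>\<gamma> 1 = \<beta>\<close> and \<open>\<delta> 1 = \<alpha>\<close> would make this set empty for \<open>k = 1\<close>.\<close>

definition greedy_crossings ::
  "moebius set set \<Rightarrow> (real \<times> real) set \<Rightarrow> nat \<Rightarrow> nat \<Rightarrow> (nat \<Rightarrow> moebius set) \<Rightarrow> moebius set" where
  "greedy_crossings L F k n l =
     {wedge (l \<alpha>) (l \<beta>) | \<alpha> \<beta>. 1 \<le> \<alpha> \<and> \<alpha> < \<beta> \<and> \<beta> \<le> n \<and>
        \<not> (\<exists>\<gamma> \<delta>. \<gamma> ` {1..k} \<subseteq> {1..n} \<and> \<delta> ` {1..k} \<subseteq> {1..n} \<and>
              strict_mono_on {1..k} \<gamma> \<and> strict_mono_on {1..k} \<delta> \<and>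
              \<alpha> < \<gamma> 1 \<and> \<delta> k < \<beta> \<and> \<delta> k < \<gamma> 1 \<and>
              (\<forall>i\<in>{1..k}. cut_less L F (wedge (l \<alpha>) (l (\<gamma> i))) (wedge (l \<alpha>) (l \<beta>)) \<and>
                          cut_less L F (wedge (l \<beta>) (l (\<delta> i))) (wedge (l \<alpha>) (l \<beta>))))}"

end

theory Submission
  imports Defs
begin

text \<open>Pull everything back to the plane: a pseudoline is the graph of a continuous \<open>pi\<close>-antiperiodic
  function, and the \<open>k\<close>-kernel consists of the levels \<open>k + 1, ..., n - k\<close> of the lines. A curve of a
  \<open>k\<close>-pseudotriangulation follows the lines, going straight at its crossing points and changing line
  at every other vertex, so it is determined by the set of crossing points.

  If a pair of curves crosses before it touches (inside the window \<open>F - tau ` F\<close>), exchanging the two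
  curves between these points yields a flip into the arrangement. Hence in a source all contacts of a
  pair precede its crossing. Two arrangements with this property coincide: at the last vertex where they
  differ one of them has a contact; following its two curves up to their later crossing shows that the
  other arrangement has a pair that crosses twice.

  The source is given explicitly by the 0-1 principle for sorting networks. Fix a threshold \<open>t\<close>,
  call the lines with index \<open>> t\<close> ones and the others zeros, and let a point of the window have
  \<open>A\<close> ones above and \<open>B\<close> zeros below it. Sweeping backwards over a vertex, the number \<open>h i\<close> of ones
  among the \<open>i\<close> uppermost wires becomes \<open>max (h (i - 1)) (h (i + 1) - 1)\<close>. This rule is linear in max-plus
  algebra, so the greedy count is a maximum of known solutions: \<open>A - min A (min B k)\<close> curves with
  index \<open>> t - k\<close> lie above the point. At a vertex \<open>l i \<inter> l j\<close> this number changes for some \<open>t\<close> with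
  \<open>i \<le> t < j\<close> exactly if \<open>A \<ge> k\<close> and \<open>B \<ge> k\<close>, and this is the complement of the condition which
  defines \<open>greedy_crossings\<close>.\<close>

section \<open>Pseudolines as graphs\<close>

text \<open>The greedy pseudotriangulation is given by a definite description, so existence and
  uniqueness of a source both have to be proved; both are reduced to the property
  \<open>early\<close>, which for pseudotriangulations is equivalent to being a source. The backward
  sweep only serves to find the formula. Nothing is built vertex by vertex: the count is locally
  constant off the lines, its difference at consecutive thresholds is the indicator of the region
  below one curve, and the curve is defined as the upper boundary of that region. Continuity then
  comes from local constancy, antiperiodicity from the symmetry of the formula under
  \<open>tau\<close>. The obstacle is the shape of the window: it is bounded by a curve and its
  translate, so that at one abscissa some lines are inside and others are not. Hence the formula has
  two versions, and gluing them rests on their agreement wherever the side of the cut is ambiguous.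
  The cut may be crossed downwards or upwards; a sign \<sigma> reflects the plane to the descending
  case.\<close>

definition sg :: "int \<Rightarrow> real" where
  "sg r = (if even r then 1 else - 1)"

lemma sg_simps [simp]: "sg 0 = 1" "sg 1 = - 1" "sg (- r) = sg r" "sg (r + s) = sg r * sg s"
  "sg (r - s) = sg r * sg s" "sg r * sg r = 1" "sg r * (sg r * y) = y" "sg r \<noteq> 0"
  by (auto simp: sg_def)

lemma sg_cancel [simp]: "(sg r * a) * (sg r * b) = a * b"
  by (auto simp: sg_def)

section \<open>The deck group and the covering projection\<close>

lemma funpow_tau: "(tau ^^ m) p = (fst p + real m * pi, sg (int m) * snd p)"
  by (induction m) (auto simp: tau_def sg_def algebra_simps)

lemma mproj_eq_iff:
  "mproj (x, y) = mproj (x', y') \<longleftrightarrow> (\<exists>r::int. x' = x + of_int r * pi \<and> y' = sg r * y)"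
proof -
  have "mproj (x, y) = mproj (x', y') \<longleftrightarrow> tau_equiv (x, y) (x', y')"
    by (rule moebius.abs_eq_iff)
  also have "\<dots> \<longleftrightarrow> (\<exists>r::int. x' = x + of_int r * pi \<and> y' = sg r * y)"
  proof
    assume "tau_equiv (x, y) (x', y')"
    then obtain m n where "x + real m * pi = x' + real n * pi" "sg (int m) * y = sg (int n) * y'"
      by (auto simp: tau_equiv_def funpow_tau)
    then have "x' = x + of_int (int m - int n) * pi" "sg (int n) * (sg (int n) * y') = sg (int n) * (sg (int m) * y)"
      by (simp_all add: left_diff_distrib)
    then have "x' = x + of_int (int m - int n) * pi" "y' = sg (int m - int n) * y"
      by (simp_all only: sg_simps mult_ac)
    then show "\<exists>r::int. x' = x + of_int r * pi \<and> y' = sg r * y" by blast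
  next
    assume "\<exists>r::int. x' = x + of_int r * pi \<and> y' = sg r * y"
    then obtain r :: int where r: "x' = x + of_int r * pi" "y' = sg r * y" by blast
    show "tau_equiv (x, y) (x', y')"
    proof (cases "r \<ge> 0")
      case True
      then have "(tau ^^ nat r) (x, y) = (tau ^^ 0) (x', y')"
        using r by (auto simp: funpow_tau)
      then show ?thesis unfolding tau_equiv_def by blast
    next
      case False
      then have "(tau ^^ 0) (x, y) = (tau ^^ nat (- r)) (x', y')"
        using r by (auto simp: funpow_tau)
      then show ?thesis unfolding tau_equiv_def by blast
    qed
  qed
  finally show ?thesis .
qed

lemma mproj_tau [simp]: "mproj (x + pi, - y) = mproj (x, y)"
proof -
  have "x + pi = x + of_int 1 * pi \<and> - y = sg 1 * y" by simp
  then have "mproj (x, y) = mproj (x + pi, - y)" unfolding mproj_eq_iff by blast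
  then show ?thesis by simp
qed

lemma mproj_cases: obtains x y where "p = mproj (x, y)"
  using Quotient_abs_rep[OF Quotient_moebius, of p] by (metis surj_pair)

lemma continuous_mproj: "continuous_on UNIV mproj"
  by (auto simp: continuous_on_open_vimage open_moebius_def)

text \<open>The saturation of an open set is the union of its translates under the deck group, and
  each translate is open.\<close>

lemma open_mproj_image:
  assumes "open U" shows "open (mproj ` U)"
proof -
  have "mproj -` (mproj ` U) = (\<Union>r::int. (\<lambda>z. (fst z + of_int r * pi, sg r * snd z)) -` U)"
  proof (intro set_eqI)
    fix z
    have "z \<in> mproj -` (mproj ` U) \<longleftrightarrow> (\<exists>w\<in>U. mproj (fst z, snd z) = mproj (fst w, snd w))" by auto
    also have "\<dots> \<longleftrightarrow> (\<exists>r::int. (fst z + of_int r * pi, sg r * snd z) \<in> U)"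
      unfolding mproj_eq_iff by (metis fst_conv snd_conv surjective_pairing)
    finally show "z \<in> mproj -` (mproj ` U) \<longleftrightarrow>
        z \<in> (\<Union>r::int. (\<lambda>z. (fst z + of_int r * pi, sg r * snd z)) -` U)" by simp
  qed
  moreover have "open ((\<lambda>z. (fst z + of_int r * pi, sg r * snd z)) -` U)" for r :: int
    by (intro open_vimage assms continuous_intros)
  ultimately show ?thesis by (simp add: open_moebius_def open_UN)
qed

text \<open>One inclusion is continuity. The other uses that \<open>mproj\<close> is open: the
  complement of the upstairs closure has an open image, which would meet \<open>S\<close>. Closures
  in the strip can thus be computed in the plane.\<close>

lemma vimage_mproj_closure: "mproj -` closure S = closure (mproj -` S)"
proof
  have "closed (mproj -` closure S)"
    by (rule closed_vimage) (auto simp: continuous_mproj)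
  then show "closure (mproj -` S) \<subseteq> mproj -` closure S"
    using closure_subset[of S] by (intro closure_minimal) auto
  show "mproj -` closure S \<subseteq> closure (mproj -` S)"
  proof (rule ccontr)
    assume "\<not> ?thesis"
    then obtain z where z: "mproj z \<in> closure S" "z \<notin> closure (mproj -` S)" by blast
    have "open (mproj ` (- closure (mproj -` S)))"
      by (intro open_mproj_image) auto
    moreover have "mproj z \<in> mproj ` (- closure (mproj -` S))" using z by blast
    ultimately have "S \<inter> mproj ` (- closure (mproj -` S)) \<noteq> {}"
      using z open_Int_closure_eq_empty[of "mproj ` (- closure (mproj -` S))" S] by blast
    then obtain w where "mproj w \<in> S" "w \<notin> closure (mproj -` S)" by auto
    then show False using closure_subset[of "mproj -` S"] by auto
  qed
qed

text \<open>A pseudoline determines its function, since every vertical line meets its lift in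
  exactly one point. So the representatives quantified in the definitions of crossings and contacts
  can all be replaced by \<open>pfun\<close>.\<close>

definition pfun :: "moebius set \<Rightarrow> real \<Rightarrow> real" where
  "pfun P = (THE f. represents f P)"

definition antiper :: "(real \<Rightarrow> real) \<Rightarrow> bool" where
  "antiper f \<longleftrightarrow> continuous_on UNIV f \<and> (\<forall>x. f (x + pi) = - f x)"

definition pline :: "(real \<Rightarrow> real) \<Rightarrow> moebius set" where
  "pline f = range (\<lambda>x. mproj (x, f x))"

lemma represents_iff: "represents f P \<longleftrightarrow> antiper f \<and> P = pline f"
  by (simp add: represents_def antiper_def pline_def)

lemma antiper_shift:
  assumes "antiper f" shows "f (x + of_int r * pi) = sg r * f x"
proof -
  have *: "f (x + real m * pi) = sg (int m) * f x" for m x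
  proof (induction m)
    case (Suc m)
    have "f (x + real (Suc m) * pi) = f ((x + real m * pi) + pi)" by (simp add: algebra_simps)
    also have "\<dots> = - f (x + real m * pi)" using assms unfolding antiper_def by blast
    finally show ?case using Suc by (simp add: sg_def)
  qed simp
  show ?thesis
  proof (cases "r \<ge> 0")
    case True
    then show ?thesis using *[of x "nat r"] by simp
  next
    case False
    then have "f x = sg r * f (x + of_int r * pi)"
      using *[of "x + of_int r * pi" "nat (- r)"] by simp
    then show ?thesis by (metis sg_simps(7))
  qed
qed

lemma antiper_simps: "antiper f \<Longrightarrow> f (x + pi) = - f x" "antiper f \<Longrightarrow> f (x - pi) = - f x"
  using antiper_shift[of f x 1] antiper_shift[of f x "-1"] by auto

lemma antiper_cont: "antiper f \<Longrightarrow> continuous_on S f"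
  by (auto simp: antiper_def intro: continuous_on_subset)

lemma mem_pline: "antiper f \<Longrightarrow> mproj (x, y) \<in> pline f \<longleftrightarrow> y = f x"
  unfolding pline_def
  by (auto simp: mproj_eq_iff antiper_shift image_iff)

lemma represents_unique: "represents f P \<Longrightarrow> represents g P \<Longrightarrow> f = g"
  unfolding represents_iff by (metis ext mem_pline)

lemma pfun_eq: "represents f P \<Longrightarrow> pfun P = f"
  unfolding pfun_def by (blast intro: the_equality represents_unique)

lemma represents_pfun: "pseudoline P \<Longrightarrow> represents (pfun P) P"
  using pfun_eq pseudoline_def by auto

lemma antiper_pfun: "pseudoline P \<Longrightarrow> antiper (pfun P)"
  using represents_pfun represents_iff by blast

lemma pline_pfun: "pseudoline P \<Longrightarrow> pline (pfun P) = P"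
  using represents_pfun represents_iff by blast

lemma pfun_pline [simp]: "antiper f \<Longrightarrow> pfun (pline f) = f"
  by (rule pfun_eq) (simp add: represents_iff)

lemma pseudoline_pline: "antiper f \<Longrightarrow> pseudoline (pline f)"
  using represents_iff pseudoline_def by blast

lemma mem_pseudoline: "pseudoline P \<Longrightarrow> mproj (x, y) \<in> P \<longleftrightarrow> y = pfun P x"
  by (metis mem_pline antiper_pfun pline_pfun)

section \<open>Crossings and contacts as sign changes\<close>

definition crosses :: "(real \<Rightarrow> real) \<Rightarrow> (real \<Rightarrow> real) \<Rightarrow> real \<Rightarrow> bool" where
  "crosses f g x \<longleftrightarrow> f x = g x \<and> (\<forall>\<^sub>F h in at_right 0. (f (x - h) - g (x - h)) * (f (x + h) - g (x + h)) < 0)"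

definition touches :: "(real \<Rightarrow> real) \<Rightarrow> (real \<Rightarrow> real) \<Rightarrow> real \<Rightarrow> bool" where
  "touches f g x \<longleftrightarrow> f x = g x \<and> (\<forall>\<^sub>F h in at_right 0. (f (x - h) - g (x - h)) * (f (x + h) - g (x + h)) > 0)"

text \<open>Both factors acquire the same sign \<open>sg r\<close>, so the product that
  distinguishes crossings from contacts is invariant under the deck group.\<close>

lemma antiper_diff_shift:
  assumes "antiper f" "antiper g"
  shows "(f (x + of_int r * pi - h) - g (x + of_int r * pi - h)) *
         (f (x + of_int r * pi + h) - g (x + of_int r * pi + h)) =
         (f (x - h) - g (x - h)) * (f (x + h) - g (x + h))"
proof -
  have "x + of_int r * pi - h = (x - h) + of_int r * pi" "x + of_int r * pi + h = (x + h) + of_int r * pi"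
    by auto
  then show ?thesis
    using assms by (simp only: antiper_shift right_diff_distrib[symmetric] sg_cancel)
qed

lemma crosses_shift: "antiper f \<Longrightarrow> antiper g \<Longrightarrow> crosses f g (x + of_int r * pi) \<longleftrightarrow> crosses f g x"
  by (simp add: crosses_def antiper_diff_shift antiper_shift)

lemma touches_shift: "antiper f \<Longrightarrow> antiper g \<Longrightarrow> touches f g (x + of_int r * pi) \<longleftrightarrow> touches f g x"
  by (simp add: touches_def antiper_diff_shift antiper_shift)

lemma crossing_point_iff:
  assumes "pseudoline P" "pseudoline Q"
  shows "crossing_point P Q (mproj (x, y)) \<longleftrightarrow> y = pfun P x \<and> crosses (pfun P) (pfun Q) x"
proof
  assume "crossing_point P Q (mproj (x, y))"
  then obtain f g u where "represents f P" "represents g Q" "mproj (x, y) = mproj (u, f u)" "crosses f g u"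
    unfolding crossing_point_def crosses_def by blast
  then have u: "mproj (x, y) = mproj (u, pfun P u)" "crosses (pfun P) (pfun Q) u"
    by (simp_all add: pfun_eq)
  from u(1) obtain r where r: "u = x + of_int r * pi" "pfun P u = sg r * y"
    by (auto simp: mproj_eq_iff)
  then have "y = pfun P x"
    using antiper_shift[OF antiper_pfun[OF assms(1)], of x r] by simp
  with u(2) r show "y = pfun P x \<and> crosses (pfun P) (pfun Q) x"
    using crosses_shift antiper_pfun assms by auto
next
  assume "y = pfun P x \<and> crosses (pfun P) (pfun Q) x"
  then show "crossing_point P Q (mproj (x, y))"
    unfolding crossing_point_def crosses_def using represents_pfun assms by blast
qed

lemma contact_point_iff:
  assumes "pseudoline P" "pseudoline Q"
  shows "contact_point P Q (mproj (x, y)) \<longleftrightarrow> y = pfun P x \<and> touches (pfun P) (pfun Q) x"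
proof
  assume "contact_point P Q (mproj (x, y))"
  then obtain f g u where "represents f P" "represents g Q" "mproj (x, y) = mproj (u, f u)" "touches f g u"
    unfolding contact_point_def touches_def by blast
  then have u: "mproj (x, y) = mproj (u, pfun P u)" "touches (pfun P) (pfun Q) u"
    by (simp_all add: pfun_eq)
  from u(1) obtain r where r: "u = x + of_int r * pi" "pfun P u = sg r * y"
    by (auto simp: mproj_eq_iff)
  then have "y = pfun P x"
    using antiper_shift[OF antiper_pfun[OF assms(1)], of x r] by simp
  with u(2) r show "y = pfun P x \<and> touches (pfun P) (pfun Q) x"
    using touches_shift antiper_pfun assms by auto
next
  assume "y = pfun P x \<and> touches (pfun P) (pfun Q) x"
  then show "contact_point P Q (mproj (x, y))"
    unfolding contact_point_def touches_def using represents_pfun assms by blast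
qed

lemma crosses_commute: "crosses f g x \<longleftrightarrow> crosses g f x"
proof -
  have "(f a - g a) * (f b - g b) = (g a - f a) * (g b - f b)" for a b by (simp add: algebra_simps)
  then show ?thesis unfolding crosses_def by (auto simp: eq_commute)
qed

lemma touches_commute: "touches f g x \<longleftrightarrow> touches g f x"
proof -
  have "(f a - g a) * (f b - g b) = (g a - f a) * (g b - f b)" for a b by (simp add: algebra_simps)
  then show ?thesis unfolding touches_def by (auto simp: eq_commute)
qed

lemma nonzero_same_sign:
  fixes d :: "real \<Rightarrow> real"
  assumes "continuous_on UNIV d" "\<And>t. min u v \<le> t \<Longrightarrow> t \<le> max u v \<Longrightarrow> d t \<noteq> 0"
  shows "d u * d v > 0"
proof (rule ccontr)
  assume "\<not> ?thesis"
  moreover have "d u \<noteq> 0" "d v \<noteq> 0" using assms(2) by auto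
  ultimately have "d u < 0 \<and> 0 < d v \<or> d v < 0 \<and> 0 < d u"
    by (smt (verit) mult_pos_pos mult_neg_neg)
  then have "\<exists>t. min u v \<le> t \<and> t \<le> max u v \<and> d t = 0"
    using IVT'[of d u 0 v] IVT'[of d v 0 u] IVT2'[of d u 0 v] IVT2'[of d v 0 u]
      continuous_on_subset[OF assms(1) subset_UNIV]
    by (cases "u \<le> v") (auto simp: min_def max_def less_imp_le)
  then show False using assms(2) by blast
qed

text \<open>On each side of an isolated coincidence the difference keeps its sign, so one sample per
  side decides the type. Unlike in the definitions, the two samples need not be symmetric about
  \<open>x\<close>.\<close>

lemma crosses_touches_sep:
  fixes f g :: "real \<Rightarrow> real"
  assumes "continuous_on UNIV f" "continuous_on UNIV g" "e > 0" "f x = g x"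
    and sep: "\<And>t. t \<noteq> x \<Longrightarrow> \<bar>t - x\<bar> < e \<Longrightarrow> f t \<noteq> g t"
    and "0 < h" "h < e" "0 < h'" "h' < e"
  shows "crosses f g x \<longleftrightarrow> (f (x - h) - g (x - h)) * (f (x + h') - g (x + h')) < 0"
    and "touches f g x \<longleftrightarrow> (f (x - h) - g (x - h)) * (f (x + h') - g (x + h')) > 0"
proof -
  define d where "d t = f t - g t" for t
  have d: "continuous_on UNIV d" unfolding d_def using assms by (intro continuous_intros)
  have l: "d (x - s) * d (x - h) > 0" and r: "d (x + s) * d (x + h') > 0" if "0 < s" "s < e" for s
    by (rule nonzero_same_sign[OF d], use sep that assms in \<open>force simp: d_def min_def max_def split: if_splits\<close>)+
  have *: "sgn (d (x - s) * d (x + s)) = sgn (d (x - h) * d (x + h'))" if "0 < s" "s < e" for s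
    using l[OF that] r[OF that] by (auto simp: sgn_mult zero_less_mult_iff)
  have ev: "\<forall>\<^sub>F s in at_right 0. 0 < s \<and> s < e"
    using \<open>e > 0\<close> by (auto simp: eventually_at_right_field)
  \<comment> \<open>An arbitrary predicate of the sign, so that crossings and contacts are treated
    at once.\<close>
  have e1: "(\<forall>\<^sub>F s in at_right 0. Q (sgn (d (x - s) * d (x + s)))) \<longleftrightarrow> Q (sgn (d (x - h) * d (x + h')))"
    for Q :: "real \<Rightarrow> bool"
  proof -
    have "(\<forall>\<^sub>F s in at_right 0. Q (sgn (d (x - s) * d (x + s)))) \<longleftrightarrow>
        (\<forall>\<^sub>F s in at_right (0::real). Q (sgn (d (x - h) * d (x + h'))))"
      by (rule eventually_subst, rule eventually_mono[OF ev]) (use * in auto)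
    then show ?thesis by simp
  qed
  show "crosses f g x \<longleftrightarrow> (f (x - h) - g (x - h)) * (f (x + h') - g (x + h')) < 0"
    using e1[of "\<lambda>u. u < 0"] assms(4) by (simp add: crosses_def d_def)
  show "touches f g x \<longleftrightarrow> (f (x - h) - g (x - h)) * (f (x + h') - g (x + h')) > 0"
    using e1[of "\<lambda>u. u > 0"] assms(4) by (simp add: touches_def d_def)
qed

lemma crosses_xor_touches:
  fixes f g :: "real \<Rightarrow> real"
  assumes "continuous_on UNIV f" "continuous_on UNIV g" "e > 0" "f x = g x"
    and sep: "\<And>t. t \<noteq> x \<Longrightarrow> \<bar>t - x\<bar> < e \<Longrightarrow> f t \<noteq> g t"
  shows "crosses f g x \<longleftrightarrow> \<not> touches f g x"
proof -
  have "f (x - e/2) \<noteq> g (x - e/2)" "f (x + e/2) \<noteq> g (x + e/2)" using sep[of "x - e/2"] sep[of "x + e/2"] assms by auto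
  then have "(f (x - e/2) - g (x - e/2)) * (f (x + e/2) - g (x + e/2)) \<noteq> 0" by simp
  then show ?thesis
    using crosses_touches_sep[OF assms, of "e/2" "e/2"] assms(3) by (auto simp: less_le)
qed

section \<open>Local finiteness of coincidences\<close>

lemma finite_pi_multiples: "finite {r::int. a \<le> t + of_int r * pi \<and> t + of_int r * pi \<le> b}"
proof (rule finite_subset)
  show "{r::int. a \<le> t + of_int r * pi \<and> t + of_int r * pi \<le> b} \<subseteq> {\<lfloor>(a - t) / pi\<rfloor>..\<lceil>(b - t) / pi\<rceil>}"
  proof (clarsimp, intro conjI)
    fix r :: int assume r: "a \<le> t + of_int r * pi" "t + of_int r * pi \<le> b"
    then have "(a - t) / pi \<le> of_int r" "of_int r \<le> (b - t) / pi" by (auto simp: field_simps)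
    then show "\<lfloor>(a - t) / pi\<rfloor> \<le> r" "r \<le> \<lceil>(b - t) / pi\<rceil>"
      by (linarith, linarith)
  qed
qed simp

text \<open>The fibre of each point of \<open>P \<inter> Q\<close> has abscissas spaced by
  \<open>pi\<close>, and a bounded interval contains only finitely many of them.\<close>

lemma finite_coincidences:
  assumes "pseudoline P" "pseudoline Q" "finite (P \<inter> Q)"
  shows "finite {t. a \<le> t \<and> t \<le> b \<and> pfun P t = pfun Q t}"
proof -
  let ?h = "\<lambda>t. mproj (t, pfun P t)"
  have "finite (?h -` (P \<inter> Q) \<inter> {a..b})"
  proof (rule finite_finite_vimage_IntI[OF assms(3)])
    fix p assume "p \<in> P \<inter> Q"
    obtain t0 y0 where p: "p = mproj (t0, y0)" by (rule mproj_cases)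
    have "?h -` {p} \<inter> {a..b} \<subseteq> (\<lambda>r::int. t0 + of_int r * pi) ` {r. a \<le> t0 + of_int r * pi \<and> t0 + of_int r * pi \<le> b}"
    proof
      fix t assume t: "t \<in> ?h -` {p} \<inter> {a..b}"
      then have "mproj (t0, y0) = mproj (t, pfun P t)" using p by simp
      then obtain r :: int where "t = t0 + of_int r * pi" unfolding mproj_eq_iff by blast
      then show "t \<in> (\<lambda>r::int. t0 + of_int r * pi) ` {r. a \<le> t0 + of_int r * pi \<and> t0 + of_int r * pi \<le> b}"
        using t by auto
    qed
    then show "finite (?h -` {p} \<inter> {a..b})"
      by (rule finite_subset) (intro finite_imageI finite_pi_multiples)
  qed
  then show ?thesis
    by (rule rev_finite_subset) (auto simp: mem_pseudoline assms)
qed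

definition coin :: "moebius set set \<Rightarrow> real set" where
  "coin S = {t. \<exists>P\<in>S. \<exists>Q\<in>S. P \<noteq> Q \<and> pfun P t = pfun Q t}"

lemma arrangement_pseudoline: "arrangement S \<Longrightarrow> P \<in> S \<Longrightarrow> pseudoline P"
  by (simp add: arrangement_def)

lemma finite_coin:
  assumes "arrangement S" shows "finite (coin S \<inter> {a..b})"
proof -
  have "coin S \<inter> {a..b} \<subseteq> (\<Union>P\<in>S. \<Union>Q\<in>S - {P}. {t. a \<le> t \<and> t \<le> b \<and> pfun P t = pfun Q t})"
  proof
    fix t assume "t \<in> coin S \<inter> {a..b}"
    then obtain P Q where "P \<in> S" "Q \<in> S - {P}" "t \<in> {t. a \<le> t \<and> t \<le> b \<and> pfun P t = pfun Q t}"
      by (auto simp: coin_def)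
    then show "t \<in> (\<Union>P\<in>S. \<Union>Q\<in>S - {P}. {t. a \<le> t \<and> t \<le> b \<and> pfun P t = pfun Q t})" by blast
  qed
  moreover have "finite (\<Union>P\<in>S. \<Union>Q\<in>S - {P}. {t. a \<le> t \<and> t \<le> b \<and> pfun P t = pfun Q t})"
    using assms unfolding arrangement_def by (intro finite_UN_I finite_coincidences) auto
  ultimately show ?thesis by (rule finite_subset)
qed

lemma finite_sep:
  fixes T :: "real set"
  assumes "\<And>a b. finite (T \<inter> {a..b})"
  obtains e where "e > 0" "\<And>t. t \<noteq> x \<Longrightarrow> \<bar>t - x\<bar> < e \<Longrightarrow> t \<notin> T"
proof -
  obtain d where d: "d > 0" "\<forall>t\<in>T \<inter> {x - 1..x + 1}. t \<noteq> x \<longrightarrow> d \<le> dist x t"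
    using finite_set_avoid[OF assms[of "x - 1" "x + 1"], of x] by metis
  show thesis
  proof
    show "min d 1 > 0" using d by simp
    show "t \<notin> T" if "t \<noteq> x" "\<bar>t - x\<bar> < min d 1" for t
    proof
      assume "t \<in> T"
      moreover have "\<bar>t - x\<bar> < 1" "\<bar>t - x\<bar> < d" using that(2) by auto
      then have "x - 1 \<le> t" "t \<le> x + 1" by linarith+
      ultimately have "d \<le> dist x t" using d(2) that(1) by simp
      with \<open>\<bar>t - x\<bar> < d\<close> show False by (simp add: dist_real_def abs_minus_commute)
    qed
  qed
qed

text \<open>The difference satisfies \<open>d (t + pi) = - d t\<close>, so it takes both signs
  within a period. The supremum \<open>s\<close> of the abscissas of one period with
  \<open>d > 0\<close> is a zero that has positive values arbitrarily close on its left and none on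
  its right in that period; as zeros are isolated, the sign changes at \<open>s\<close>.\<close>

lemma antiper_has_crossing:
  assumes f: "antiper f" "antiper g" and fin: "\<And>a b. finite ({t. f t = g t} \<inter> {a..b})"
  obtains x where "crosses f g x"
proof -
  define d where "d t = f t - g t" for t
  have d: "continuous_on UNIV d" unfolding d_def using f by (intro continuous_intros antiper_cont)
  have dp: "d (t + pi) = - d t" for t using f by (simp add: d_def antiper_simps)
  obtain e where e: "e > 0" "\<And>t. t \<noteq> 0 \<Longrightarrow> \<bar>t - 0\<bar> < e \<Longrightarrow> t \<notin> {t. f t = g t}"
    using finite_sep[OF fin] by blast
  have "d (e/2) \<noteq> 0" using e(2)[of "e/2"] e(1) by (auto simp: d_def)
  then obtain a where a: "d a > 0"
    using dp[of "e/2"] by (metis neg_0_less_iff_less linorder_neqE_linordered_idom)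
  define A where "A = {t. a \<le> t \<and> t \<le> a + pi \<and> d t > 0}"
  have bdd: "bdd_above A" unfolding A_def bdd_above_def by blast
  have ne: "a \<in> A" using a by (simp add: A_def)
  define s where "s = Sup A"
  have sa: "a \<le> s" unfolding s_def using bdd ne by (simp add: cSup_upper)
  have sb: "s \<le> a + pi" unfolding s_def by (rule cSup_least) (use ne in blast, simp add: A_def)
  have dc: "isCont d t" for t using d by (simp add: continuous_on_eq_continuous_at)
  have pos_nb: "\<exists>e>0. \<forall>u. \<bar>u - t\<bar> < e \<longrightarrow> d u > 0" if "d t > 0" for t
  proof -
    have "\<forall>\<^sub>F u in nhds t. d u > 0"
      using order_tendstoD(1)[of d "d t" "nhds t" 0] dc[of t] that
      by (simp add: continuous_at tendsto_at_iff_tendsto_nhds)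
    then show ?thesis by (auto simp: eventually_nhds_metric dist_real_def)
  qed
  \<comment> \<open>Negative values are positive values one period later.\<close>
  have neg_nb: "\<exists>e>0. \<forall>u. \<bar>u - t\<bar> < e \<longrightarrow> d u < 0" if neg: "d t < 0" for t
  proof -
    obtain e where e: "e > 0" "\<And>u. \<bar>u - (t + pi)\<bar> < e \<Longrightarrow> d u > 0"
      using pos_nb[of "t + pi"] neg dp[of t] by auto
    have "d u < 0" if "\<bar>u - t\<bar> < e" for u using e(2)[of "u + pi"] that dp[of u] by simp
    then show ?thesis using e(1) by blast
  qed
  have s0: "d s = 0"
  proof (rule ccontr)
    assume "d s \<noteq> 0"
    then consider "d s > 0" | "d s < 0" by linarith
    then show False
    proof cases
      case 1
      then obtain e where e: "e > 0" "\<And>u. \<bar>u - s\<bar> < e \<Longrightarrow> d u > 0" using pos_nb by blast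
      have "s \<noteq> a + pi" using 1 a dp[of a] by auto
      then have "s < min (s + e) (a + pi)" using sb e(1) by simp
      then obtain u where "s < u" "u < s + e" "u \<le> a + pi"
        using dense[of s "min (s + e) (a + pi)"] by auto
      then have "u \<in> A" using e(2)[of u] sa by (auto simp: A_def)
      then show False using \<open>s < u\<close> bdd unfolding s_def by (meson cSup_upper not_less)
    next
      case 2
      then obtain e where e: "e > 0" "\<And>u. \<bar>u - s\<bar> < e \<Longrightarrow> d u < 0" using neg_nb by blast
      have "s - e < Sup A" using e by (simp add: s_def)
      then obtain u where "u \<in> A" "s - e < u" using ne less_cSup_iff[OF _ bdd, of "s - e"] by auto
      moreover have "u \<le> s" using \<open>u \<in> A\<close> bdd by (simp add: s_def cSup_upper)
      ultimately have "d u < 0" using e by auto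
      then show False using \<open>u \<in> A\<close> by (auto simp: A_def)
    qed
  qed
  have s1: "s < a + pi" using s0 sb a dp[of a] by (cases "s = a + pi") auto
  obtain e where e: "e > 0" "\<And>t. t \<noteq> s \<Longrightarrow> \<bar>t - s\<bar> < e \<Longrightarrow> t \<notin> {t. f t = g t}"
    using finite_sep[OF fin] by blast
  have "s - e < Sup A" using e by (simp add: s_def)
  then obtain u where u: "u \<in> A" "s - e < u" using ne less_cSup_iff[OF _ bdd, of "s - e"] by auto
  have "u \<le> s" using u bdd by (simp add: s_def cSup_upper)
  moreover have "u \<noteq> s" using u s0 by (auto simp: A_def)
  ultimately have us: "u < s" by simp
  obtain v where v: "s < v" "v < s + e" "v < a + pi"
    using s1 e(1) dense[of s "min (s + e) (a + pi)"] by auto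
  have "v \<notin> A" using v bdd by (metis cSup_upper not_less s_def)
  then have "d v \<le> 0" using v sa by (auto simp: A_def)
  moreover have "d v \<noteq> 0" using e(2)[of v] v by (auto simp: d_def)
  ultimately have dv: "d v < 0" by simp
  have du: "d u > 0" using u by (simp add: A_def)
  have "crosses f g s"
    using crosses_touches_sep(1)[of f g e s "s - u" "v - s"] f e s0 us u v dv du
    by (auto simp: antiper_def d_def mult_pos_neg)
  then show thesis using that by blast
qed

lemma eventually_not_coin:
  assumes "arrangement S" shows "\<forall>\<^sub>F t in at x. t \<notin> coin S"
proof -
  obtain e where "e > 0" "\<And>t. t \<noteq> x \<Longrightarrow> \<bar>t - x\<bar> < e \<Longrightarrow> t \<notin> coin S"
    using finite_sep[OF finite_coin[OF assms]] by metis
  then show ?thesis by (auto simp: eventually_at dist_real_def)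
qed

section \<open>Kernels as sets of middle levels\<close>

lemma openI_eventually:
  assumes "\<And>z. z \<in> S \<Longrightarrow> \<forall>\<^sub>F w in nhds z. w \<in> S" shows "open S"
proof (subst open_subopen, intro ballI)
  fix z assume "z \<in> S"
  from assms[OF this] obtain T where "open T" "z \<in> T" "\<forall>w\<in>T. w \<in> S"
    by (auto simp: eventually_nhds)
  then show "\<exists>T. open T \<and> z \<in> T \<and> T \<subseteq> S" by (intro exI[of _ T]) auto
qed

lemma vimage_mproj_image:
  assumes "\<And>x y r. (x, y) \<in> T \<Longrightarrow> (x + of_int r * pi, sg r * y) \<in> T"
  shows "mproj -` (mproj ` T) = T"
proof
  show "mproj -` (mproj ` T) \<subseteq> T"
  proof
    fix z assume "z \<in> mproj -` (mproj ` T)"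
    then obtain w where w: "w \<in> T" "mproj (fst w, snd w) = mproj (fst z, snd z)" by auto
    then obtain r :: int where "fst z = fst w + of_int r * pi" "snd z = sg r * snd w"
      unfolding mproj_eq_iff by blast
    then show "z \<in> T" using assms[of "fst w" "snd w" r] w(1) by (metis prod.collapse)
  qed
qed auto

lemma closed_moebius: "closed S \<longleftrightarrow> closed (mproj -` S)"
  by (simp add: closed_def open_moebius_def vimage_Compl)

lemma clopen_connected_component:
  assumes "connected C" "C \<noteq> {}" "C \<subseteq> S" "open C" "open (S - C)"
  shows "C \<in> components S"
  unfolding in_components_maximal
proof (intro conjI allI impI)
  fix d assume d: "d \<noteq> {} \<and> C \<subseteq> d \<and> d \<subseteq> S \<and> connected d"
  then have "C \<inter> d = {} \<or> (S - C) \<inter> d = {}"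
    using connectedD[of d C "S - C"] assms by blast
  then show "d = C" using d assms by blast
qed (use assms in auto)

text \<open>The absolute value has period \<open>pi\<close>, so its bound on the compact interval
  \<open>{0..pi}\<close> holds everywhere.\<close>

lemma antiper_bounded:
  assumes "antiper f" obtains M where "\<And>x. \<bar>f x\<bar> \<le> M"
proof -
  have "bounded (f ` {0..pi})"
    by (intro compact_imp_bounded compact_continuous_image antiper_cont[OF assms]) auto
  then obtain M where M: "\<And>x. x \<in> {0..pi} \<Longrightarrow> \<bar>f x\<bar> \<le> M" unfolding bounded_iff by force
  have "\<bar>f x\<bar> \<le> M" for x
  proof -
    have 1: "of_int \<lfloor>x / pi\<rfloor> * pi \<le> x" "x \<le> (of_int \<lfloor>x / pi\<rfloor> + 1) * pi"
      using floor_divide_lower[of pi x] floor_divide_upper[of pi x] by auto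
    have "x = (x - of_int \<lfloor>x / pi\<rfloor> * pi) + of_int \<lfloor>x / pi\<rfloor> * pi" by simp
    then have "\<bar>f x\<bar> = \<bar>sg \<lfloor>x / pi\<rfloor> * f (x - of_int \<lfloor>x / pi\<rfloor> * pi)\<bar>"
      using antiper_shift[OF assms] by metis
    also have "\<dots> = \<bar>f (x - of_int \<lfloor>x / pi\<rfloor> * pi)\<bar>" by (simp add: abs_mult sg_def)
    also have "\<dots> \<le> M" using 1 by (intro M) (auto simp: algebra_simps)
    finally show ?thesis .
  qed
  then show thesis by (rule that)
qed

locale simple_arr =
  fixes L :: "moebius set set"
  assumes simple: "simple_arrangement L"
begin

lemma arr: "arrangement L" and fin: "finite L" and ps: "P \<in> L \<Longrightarrow> pseudoline P"
  using simple by (auto simp: simple_arrangement_def arrangement_def)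

lemma ap: "P \<in> L \<Longrightarrow> antiper (pfun P)"
  by (simp add: ps antiper_pfun)

lemma isCont_pfun: "P \<in> L \<Longrightarrow> isCont (pfun P) x"
  using antiper_cont[OF ap, of P UNIV] by (simp add: continuous_on_eq_continuous_at)

lemma no_triple: "P \<in> L \<Longrightarrow> Q \<in> L \<Longrightarrow> R \<in> L \<Longrightarrow> P \<noteq> Q \<Longrightarrow> P \<noteq> R \<Longrightarrow> Q \<noteq> R \<Longrightarrow>
    pfun P x = pfun Q x \<Longrightarrow> pfun P x = pfun R x \<Longrightarrow> False"
proof -
  assume a: "P \<in> L" "Q \<in> L" "R \<in> L" "P \<noteq> Q" "P \<noteq> R" "Q \<noteq> R"
    "pfun P x = pfun Q x" "pfun P x = pfun R x"
  then have "mproj (x, pfun P x) \<in> P \<inter> Q \<inter> R" by (simp add: mem_pseudoline ps)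
  then show False using simple a unfolding simple_arrangement_def by blast
qed

section \<open>Counting lines above and below a point\<close>

definition nge :: "real \<Rightarrow> real \<Rightarrow> nat" where "nge x y = card {P \<in> L. y \<le> pfun P x}"
definition nle :: "real \<Rightarrow> real \<Rightarrow> nat" where "nle x y = card {P \<in> L. pfun P x \<le> y}"
definition ngt :: "real \<Rightarrow> real \<Rightarrow> nat" where "ngt x y = card {P \<in> L. y < pfun P x}"
definition nlt :: "real \<Rightarrow> real \<Rightarrow> nat" where "nlt x y = card {P \<in> L. pfun P x < y}"
definition on :: "real \<Rightarrow> real \<Rightarrow> bool" where "on x y \<longleftrightarrow> (\<exists>P\<in>L. pfun P x = y)"
text \<open>If \<open>n = 2 * k\<close>, the conditions on \<open>nge\<close> and \<open>nle\<close> alone hold at the vertices where the two middle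
  levels meet, although the kernel is empty.\<close>

definition inK :: "nat \<Rightarrow> real \<Rightarrow> real \<Rightarrow> bool" where
  "inK k x y \<longleftrightarrow> 2 * k < card L \<and> on x y \<and> k < nge x y \<and> k < nle x y"

lemma count_compl: "ngt x y + nle x y = card L" "nlt x y + nge x y = card L"
proof -
  have *: "card {P \<in> L. A P} + card {P \<in> L. \<not> A P} = card L" for A
  proof -
    have "card ({P \<in> L. A P} \<union> {P \<in> L. \<not> A P}) = card {P \<in> L. A P} + card {P \<in> L. \<not> A P}"
      using fin by (intro card_Un_disjoint) auto
    moreover have "{P \<in> L. A P} \<union> {P \<in> L. \<not> A P} = L" by auto
    ultimately show ?thesis by simp
  qed
  show "ngt x y + nle x y = card L" "nlt x y + nge x y = card L"
    using *[of "\<lambda>P. y < pfun P x"] *[of "\<lambda>P. pfun P x < y"]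
    by (simp_all add: ngt_def nle_def nlt_def nge_def not_less)
qed

lemma count_eq: "nge x y = ngt x y + card {P \<in> L. pfun P x = y}" "nle x y = nlt x y + card {P \<in> L. pfun P x = y}"
proof -
  have "{P \<in> L. y \<le> pfun P x} = {P \<in> L. y < pfun P x} \<union> {P \<in> L. pfun P x = y}"
    "{P \<in> L. pfun P x \<le> y} = {P \<in> L. pfun P x < y} \<union> {P \<in> L. pfun P x = y}" by auto
  then show "nge x y = ngt x y + card {P \<in> L. pfun P x = y}" "nle x y = nlt x y + card {P \<in> L. pfun P x = y}"
    using fin by (auto simp: nge_def ngt_def nle_def nlt_def intro!: card_Un_disjoint)
qed

lemma on_card: "on x y \<longleftrightarrow> card {P \<in> L. pfun P x = y} > 0"
  using fin by (auto simp: on_def card_gt_0_iff)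

lemma count_shift: "nge (x + of_int r * pi) (sg r * y) = (if even r then nge x y else nle x y)"
  "nle (x + of_int r * pi) (sg r * y) = (if even r then nle x y else nge x y)"
proof -
  have *: "P \<in> L \<Longrightarrow> pfun P (x + of_int r * pi) = sg r * pfun P x" for P
    by (rule antiper_shift[OF ap])
  show "nge (x + of_int r * pi) (sg r * y) = (if even r then nge x y else nle x y)"
    "nle (x + of_int r * pi) (sg r * y) = (if even r then nle x y else nge x y)"
    unfolding nge_def nle_def by (auto simp: * sg_def intro!: arg_cong[where f = card])
qed

lemma stable:
  "\<forall>\<^sub>F z in nhds z0. \<forall>P\<in>L. (pfun P (fst z0) < snd z0 \<longrightarrow> pfun P (fst z) < snd z) \<and>
     (snd z0 < pfun P (fst z0) \<longrightarrow> snd z < pfun P (fst z))"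
proof (intro eventually_ball_finite[OF fin] ballI eventually_conj)
  fix P assume "P \<in> L"
  have 1: "((\<lambda>z. pfun P (fst z)) \<longlongrightarrow> pfun P (fst z0)) (nhds z0)" "(snd \<longlongrightarrow> snd z0) (nhds z0)"
    by (intro isCont_tendsto_compose[OF isCont_pfun[OF \<open>P \<in> L\<close>]] tendsto_intros filterlim_ident)+
  have 2: "((\<lambda>z. pfun P (fst z) - snd z) \<longlongrightarrow> pfun P (fst z0) - snd z0) (nhds z0)"
    by (intro tendsto_diff 1)
  show "\<forall>\<^sub>F z in nhds z0. pfun P (fst z0) < snd z0 \<longrightarrow> pfun P (fst z) < snd z"
    using order_tendstoD(2)[OF 2, of 0] by (cases "pfun P (fst z0) < snd z0") auto
  show "\<forall>\<^sub>F z in nhds z0. snd z0 < pfun P (fst z0) \<longrightarrow> snd z < pfun P (fst z)"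
    using order_tendstoD(1)[OF 2, of 0] by (cases "snd z0 < pfun P (fst z0)") auto
qed

text \<open>Strict inequalities survive small perturbations, so \<open>ngt\<close> and
  \<open>nlt\<close> can only grow nearby; \<open>nle\<close> and \<open>nge\<close> are their
  complements and can only shrink.\<close>

lemma ev_counts:
  "\<forall>\<^sub>F z in nhds z0. ngt (fst z0) (snd z0) \<le> ngt (fst z) (snd z) \<and> nlt (fst z0) (snd z0) \<le> nlt (fst z) (snd z) \<and>
     nge (fst z) (snd z) \<le> nge (fst z0) (snd z0) \<and> nle (fst z) (snd z) \<le> nle (fst z0) (snd z0) \<and>
     (\<not> on (fst z0) (snd z0) \<longrightarrow> \<not> on (fst z) (snd z))"
  using stable[of z0]
proof eventually_elim
  case (elim z)
  have 1: "ngt (fst z0) (snd z0) \<le> ngt (fst z) (snd z)" "nlt (fst z0) (snd z0) \<le> nlt (fst z) (snd z)"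
    unfolding ngt_def nlt_def using elim fin by (auto intro!: card_mono)
  have "\<not> on (fst z) (snd z)" if "\<not> on (fst z0) (snd z0)"
    using that elim unfolding on_def by (metis less_irrefl linorder_neqE)
  then show ?case using 1 count_compl[of "fst z" "snd z"] count_compl[of "fst z0" "snd z0"] by auto
qed

section \<open>The external face of a kernel\<close>

definition Ext :: "nat \<Rightarrow> (real \<times> real) set" where
  "Ext k = {z. nge (fst z) (snd z) \<le> k} \<union> {z. nle (fst z) (snd z) \<le> k}"

lemma vimage_Ext: "mproj -` (mproj ` Ext k) = Ext k"
  by (rule vimage_mproj_image) (auto simp: Ext_def count_shift)

lemma vimage_inK: "mproj -` (mproj ` {z. inK k (fst z) (snd z)}) = {z. inK k (fst z) (snd z)}"
proof (rule vimage_mproj_image)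
  fix x y and r :: int assume "(x, y) \<in> {z. inK k (fst z) (snd z)}"
  moreover have "on x y \<Longrightarrow> on (x + of_int r * pi) (sg r * y)"
    unfolding on_def using antiper_shift[OF ap] by metis
  ultimately show "(x + of_int r * pi, sg r * y) \<in> {z. inK k (fst z) (snd z)}"
    by (auto simp: inK_def count_shift)
qed

lemma open_Ext: "open (Ext k)"
proof (rule openI_eventually)
  fix z assume "z \<in> Ext k"
  then show "\<forall>\<^sub>F w in nhds z. w \<in> Ext k"
    using eventually_mono[OF ev_counts[of z], of "\<lambda>w. w \<in> Ext k"] by (auto simp: Ext_def)
qed

lemma bound: obtains M where "M > 0" "\<And>P x. P \<in> L \<Longrightarrow> \<bar>pfun P x\<bar> < M"
proof -
  have "\<forall>P\<in>L. \<exists>M. \<forall>x. \<bar>pfun P x\<bar> \<le> M" by (meson ap antiper_bounded)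
  then obtain B where B: "\<And>P x. P \<in> L \<Longrightarrow> \<bar>pfun P x\<bar> \<le> B P" by metis
  show thesis
  proof
    show "Max (insert 0 (B ` L)) + 1 > 0" using fin by (simp add: add_nonneg_pos)
    fix P x assume "P \<in> L"
    then have "B P \<le> Max (insert 0 (B ` L))" using fin by (intro Max_ge) auto
    then show "\<bar>pfun P x\<bar> < Max (insert 0 (B ` L)) + 1" using B[OF \<open>P \<in> L\<close>, of x] by linarith
  qed
qed

text \<open>A point with at most \<open>k\<close> lines above it is joined by its upward vertical
  ray to a half-plane above all lines. The half with few lines below is carried by
  \<open>tau\<close> into the first half, so both have the same projection: the strip has only one
  end.\<close>

lemma connected_mproj_Ext: "connected (mproj ` Ext k)"
proof -
  let ?U = "{z. nge (fst z) (snd z) \<le> k}"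
  obtain M where M: "M > 0" "\<And>P x. P \<in> L \<Longrightarrow> \<bar>pfun P x\<bar> < M" using bound by blast
  define T where "T z = ({fst z} \<times> {snd z..}) \<union> (UNIV \<times> {M..})" for z :: "real \<times> real"
  have big: "(x, y) \<in> ?U" if "M \<le> y" for x y
  proof -
    have "{P \<in> L. y \<le> pfun P x} = {}" using M(2)[of _ x] that by force
    then show ?thesis by (simp add: nge_def del: Collect_empty_eq)
  qed
  have mono: "nge x y' \<le> nge x y" if "y \<le> y'" for x y y'
    unfolding nge_def using fin that by (auto intro!: card_mono)
  have "T z \<subseteq> ?U" if "z \<in> ?U" for z
    using that big mono[of "snd z" _ "fst z"] by (force simp: T_def intro: order_trans)
  moreover have "z \<in> T z" for z by (cases z) (simp add: T_def)
  ultimately have U: "?U = \<Union> (T ` ?U)" by blast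
  have "connected (\<Union> (T ` ?U))"
  proof (rule connected_Union)
    fix S assume "S \<in> T ` ?U"
    then obtain z where "S = T z" by blast
    moreover have "(fst z, max M (snd z)) \<in> ({fst z} \<times> {snd z..}) \<inter> (UNIV \<times> {M..})" by simp
    then have "({fst z} \<times> {snd z..}) \<inter> (UNIV \<times> {M..}) \<noteq> {}" by blast
    then have "connected (T z)" unfolding T_def
      by (intro connected_Un connected_Times) auto
    ultimately show "connected S" by simp
  next
    have "(0, M) \<in> \<Inter> (T ` ?U)" by (auto simp: T_def)
    then show "\<Inter> (T ` ?U) \<noteq> {}" by blast
  qed
  then have "connected ?U" using U by simp
  then have "connected (mproj ` ?U)"
    by (rule connected_continuous_image[OF continuous_on_subset[OF continuous_mproj subset_UNIV]])
  moreover have "mproj ` Ext k = mproj ` ?U"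
  proof -
    have "mproj z \<in> mproj ` ?U" if "nle (fst z) (snd z) \<le> k" for z
    proof -
      have "mproj z = mproj (fst z + pi, - snd z)" by simp
      moreover have "(fst z + pi, - snd z) \<in> ?U" using that count_shift(1)[of "fst z" 1 "snd z"] by simp
      ultimately show ?thesis by (rule image_eqI)
    qed
    then show ?thesis by (auto simp: Ext_def)
  qed
  ultimately show ?thesis by simp
qed

text \<open>\<open>Ext k\<close> projects to a connected set that is open and relatively closed in
  the complement of the kernel, hence to a component. It reaches all large heights, so its closure
  is not compact; every other component is confined to the compact band of heights at most
  \<open>M\<close> in absolute value.\<close>

lemma external_face_K:
  assumes k: "2 * k < card L"
  shows "external_face (mproj ` {z. inK k (fst z) (snd z)}) = mproj ` Ext k"
proof -
  let ?K = "mproj ` {z. inK k (fst z) (snd z)}"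
  obtain M where M: "M > 0" "\<And>P x. P \<in> L \<Longrightarrow> \<bar>pfun P x\<bar> < M" using bound by blast
  have Ext_big: "(x, y) \<in> Ext k" if "M \<le> \<bar>y\<bar>" for x y
  proof -
    have "{P \<in> L. y \<le> pfun P x} = {} \<or> {P \<in> L. pfun P x \<le> y} = {}"
      using M(2)[of _ x] that by (cases "y \<ge> 0") (force+)
    then have "nge x y = 0 \<or> nle x y = 0" unfolding nge_def nle_def by (metis card.empty)
    then show ?thesis by (auto simp: Ext_def)
  qed
  have ne: "mproj ` Ext k \<noteq> {}" using Ext_big[of M 0] M(1) by auto
  have op: "open (mproj ` Ext k)" by (intro open_mproj_image open_Ext)
  have "Ext k \<inter> {z. inK k (fst z) (snd z)} = {}" by (auto simp: Ext_def inK_def)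
  then have "mproj -` (mproj ` Ext k) \<inter> mproj -` ?K = {}" by (simp only: vimage_Ext vimage_inK)
  then have sub: "mproj ` Ext k \<subseteq> - ?K" by fastforce
  \<comment> \<open>Off the lines the weak counts equal the strict ones, and these cannot drop
    nearby; so both weak counts stay above \<open>k\<close>.\<close>
  have op2: "open (- ?K - mproj ` Ext k)"
  proof -
    have "mproj -` (- ?K - mproj ` Ext k) = - {z. inK k (fst z) (snd z)} - Ext k"
      using vimage_Ext vimage_inK by (simp add: vimage_Diff vimage_Compl)
    also have "open \<dots>"
    proof (rule openI_eventually)
      fix z assume z: "z \<in> - {z. inK k (fst z) (snd z)} - Ext k"
      then have 1: "\<not> on (fst z) (snd z)" "nge (fst z) (snd z) > k" "nle (fst z) (snd z) > k"
        using k by (auto simp: inK_def Ext_def)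
      show "\<forall>\<^sub>F w in nhds z. w \<in> - {z. inK k (fst z) (snd z)} - Ext k"
        using ev_counts[of z]
      proof eventually_elim
        case (elim w)
        have "nge (fst z) (snd z) = ngt (fst z) (snd z)" "nle (fst z) (snd z) = nlt (fst z) (snd z)"
          using 1(1) count_eq[of "fst z" "snd z"] on_card[of "fst z" "snd z"] by auto
        then show ?case using elim 1 count_eq[of "fst w" "snd w"] by (auto simp: inK_def Ext_def)
      qed
    qed
    finally show ?thesis by (simp add: open_moebius_def)
  qed
  have comp: "mproj ` Ext k \<in> components (- ?K)"
    by (rule clopen_connected_component[OF connected_mproj_Ext ne sub op op2])
  have nocomp: "\<not> compact (closure (mproj ` Ext k))"
  proof
    assume c: "compact (closure (mproj ` Ext k))"
    \<comment> \<open>The bands of heights below \<open>r\<close> are an increasing open cover that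
      has no finite subcover.\<close>
    define U where "U r = mproj ` {z. \<bar>snd z\<bar> < real r}" for r :: nat
    have oU: "open (U r)" for r unfolding U_def
      by (intro open_mproj_image open_Collect_less continuous_intros)
    have cov: "closure (mproj ` Ext k) \<subseteq> (\<Union>r\<in>UNIV. U r)"
    proof
      fix p
      obtain x y where "p = mproj (x, y)" by (rule mproj_cases)
      moreover obtain r :: nat where "\<bar>y\<bar> < real r" using reals_Archimedean2 by blast
      ultimately show "p \<in> (\<Union>r\<in>UNIV. U r)" unfolding U_def by force
    qed
    obtain D where D: "finite D" "closure (mproj ` Ext k) \<subseteq> (\<Union>r\<in>D. U r)"
      using compactE_image[OF c _ cov] oU by metis
    define y where "y = max M (real (Max (insert 0 D)))"
    have "(0, y) \<in> Ext k" using Ext_big[of y 0] M(1) by (simp add: y_def)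
    then have "mproj (0, y) \<in> closure (mproj ` Ext k)" by (intro subsetD[OF closure_subset] imageI)
    then obtain r where r: "r \<in> D" "mproj (0, y) \<in> U r" using subsetD[OF D(2)] by (auto simp del: image_iff)
    then obtain z where z: "mproj (0, y) = mproj (fst z, snd z)" "\<bar>snd z\<bar> < real r" unfolding U_def by auto
    from z(1) have "\<bar>snd z\<bar> = \<bar>y\<bar>" unfolding mproj_eq_iff by (auto simp: abs_mult sg_def)
    moreover have "r \<le> Max (insert 0 D)" using D(1) r(1) by simp
    then have "real r \<le> real (Max (insert 0 D))" by (simp only: of_nat_le_iff)
    ultimately show False using z(2) unfolding y_def by linarith
  qed
  have oth: "compact (closure C)" if C: "C \<in> components (- ?K)" "C \<noteq> mproj ` Ext k" for C
  proof -
    let ?Q = "mproj ` {z. \<bar>snd z\<bar> \<le> M}"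
    have vQ: "mproj -` ?Q = {z. \<bar>snd z\<bar> \<le> M}"
      by (rule vimage_mproj_image) (auto simp: abs_mult sg_def)
    have clQ: "closed ?Q" unfolding closed_moebius vQ
      by (intro closed_Collect_le continuous_intros)
    \<comment> \<open>The band is already covered by one compact period.\<close>
    have "?Q = mproj ` ({0..pi} \<times> {-M..M})"
    proof
      show "?Q \<subseteq> mproj ` ({0..pi} \<times> {-M..M})"
      proof
        fix p assume "p \<in> ?Q"
        then obtain x y where p: "p = mproj (x, y)" "\<bar>y\<bar> \<le> M" by auto
        define r where "r = - \<lfloor>x / pi\<rfloor>"
        have "0 \<le> x + of_int r * pi" "x + of_int r * pi \<le> pi"
          using floor_divide_lower[of pi x] floor_divide_upper[of pi x] by (auto simp: r_def algebra_simps)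
        moreover have "\<bar>sg r * y\<bar> \<le> M" using p(2) by (simp add: abs_mult sg_def)
        ultimately have "(x + of_int r * pi, sg r * y) \<in> {0..pi} \<times> {-M..M}" by (auto simp: abs_le_iff)
        moreover have "p = mproj (x + of_int r * pi, sg r * y)" unfolding p mproj_eq_iff by blast
        ultimately show "p \<in> mproj ` ({0..pi} \<times> {-M..M})" by blast
      qed
      show "mproj ` ({0..pi} \<times> {-M..M}) \<subseteq> ?Q" by (intro image_mono) auto
    qed
    moreover have "compact (mproj ` ({0..pi} \<times> {-M..M}))"
      by (intro compact_continuous_image continuous_on_subset[OF continuous_mproj] compact_Times) auto
    ultimately have cQ: "compact ?Q" by simp
    have "C \<inter> mproj ` Ext k = {}" using components_nonoverlap[OF C(1) comp] C(2) by simp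
    have "C \<subseteq> ?Q"
    proof
      fix p assume "p \<in> C"
      obtain x y where p: "p = mproj (x, y)" by (rule mproj_cases)
      then have "(x, y) \<notin> Ext k" using \<open>p \<in> C\<close> \<open>C \<inter> mproj ` Ext k = {}\<close> by blast
      then have "\<bar>y\<bar> \<le> M" using Ext_big[of y x] by linarith
      then show "p \<in> ?Q" unfolding p by force
    qed
    then have "closure C \<subseteq> ?Q" using clQ by (simp add: closure_minimal)
    then show ?thesis using compact_Int_closed[OF cQ closed_closure, of C] by (simp add: Int_absorb1)
  qed
  have "{C \<in> components (- ?K). \<not> compact (closure C)} = {mproj ` Ext k}"
    using comp nocomp oth by auto
  then show ?thesis by (simp add: external_face_def)
qed

text \<open>The lines weakly above a slightly higher point are strictly above the given one, so
  moving up enters \<open>Ext k\<close> when \<open>ngt\<close> is at most \<open>k\<close>; moving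
  down is symmetric. If both strict counts exceed \<open>k\<close>, semicontinuity keeps a whole
  neighbourhood out of \<open>Ext k\<close>.\<close>

lemma closure_Ext_iff:
  assumes "inK k x y"
  shows "(x, y) \<in> closure (Ext k) \<longleftrightarrow> ngt x y \<le> k \<or> nlt x y \<le> k"
proof
  assume c: "(x, y) \<in> closure (Ext k)"
  show "ngt x y \<le> k \<or> nlt x y \<le> k"
  proof (rule ccontr)
    assume n: "\<not> ?thesis"
    have "\<forall>\<^sub>F w in nhds (x, y). w \<notin> Ext k"
      using ev_counts[of "(x, y)"]
    proof eventually_elim
      case (elim w)
      then show ?case using n count_eq[of "fst w" "snd w"] by (auto simp: Ext_def)
    qed
    then obtain U where "open U" "(x, y) \<in> U" "U \<inter> Ext k = {}" by (auto simp: eventually_nhds)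
    then show False using c open_Int_closure_eq_empty[of U "Ext k"] by auto
  qed
next
  assume a: "ngt x y \<le> k \<or> nlt x y \<le> k"
  show "(x, y) \<in> closure (Ext k)"
    unfolding closure_approachable
  proof (intro allI impI)
    fix e :: real assume "e > 0"
    have "nge x (y + e/2) \<le> ngt x y" "nle x (y - e/2) \<le> nlt x y"
      using \<open>e > 0\<close> fin by (auto simp: nge_def ngt_def nle_def nlt_def intro!: card_mono)
    then have "(x, y + e/2) \<in> Ext k \<or> (x, y - e/2) \<in> Ext k" using a by (auto simp: Ext_def)
    moreover have "dist (x, y + e/2) (x, y) < e" "dist (x, y - e/2) (x, y) < e"
      using \<open>e > 0\<close> by (auto simp: dist_Pair_Pair dist_real_def)
    ultimately show "\<exists>w\<in>Ext k. dist w (x, y) < e" by blast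
  qed
qed

text \<open>At a vertex on the boundary of the next kernel only one of the two germs survives: the upper one if
  enough lines lie above the vertex, the lower one otherwise.\<close>

lemma closure_step:
  assumes "z \<in> {z. on (fst z) (snd z) \<and> Suc k < nge (fst z) (snd z) \<and> Suc k < nle (fst z) (snd z)}"
    and n: "2 * Suc k < card L"
  shows "z \<in> closure {z. on (fst z) (snd z) \<and> k < ngt (fst z) (snd z) \<and> k < nlt (fst z) (snd z)}" (is "z \<in> closure ?C")
proof -
  obtain x y where z: "z = (x, y)" by (cases z)
  let ?E = "{P \<in> L. pfun P x = y}"
  have a: "on x y" "Suc k < nge x y" "Suc k < nle x y" using assms(1) by (auto simp: z)
  show ?thesis
  proof (cases "k < ngt x y \<and> k < nlt x y")
    case True
    then have "z \<in> ?C" using a by (simp add: z)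
    then show ?thesis by (rule subsetD[OF closure_subset])
  next
    case False
    have "card ?E \<noteq> 1" using False a count_eq[of x y] by auto
    moreover have "card ?E > 0" using a on_card by simp
    ultimately have "card ?E \<ge> 2" by simp
    obtain P where P: "P \<in> ?E" using a(1) by (auto simp: on_def)
    have "card (?E - {P}) = card ?E - 1" by (rule card_Diff_singleton[OF P])
    then have "card (?E - {P}) \<ge> 1" using \<open>card ?E \<ge> 2\<close> by linarith
    then have "?E - {P} \<noteq> {}" by (metis card.empty not_one_le_zero)
    then obtain Q where "Q \<in> ?E - {P}" by (meson ex_in_conv)
    then have PQ: "P \<in> ?E" "Q \<in> ?E" "P \<noteq> Q" using P by auto
    have "R \<in> {P, Q}" if "R \<in> ?E" for R
    proof (rule ccontr)
      assume "R \<notin> {P, Q}"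
      then have "R \<noteq> P" "R \<noteq> Q" by simp_all
      then show False using no_triple[of R P Q x] PQ that by simp
    qed
    then have "?E \<subseteq> {P, Q}" by (rule subsetI)
    then have "card ?E \<le> card {P, Q}" by (intro card_mono) simp_all
    then have "card ?E = 2" using PQ(3) \<open>card ?E \<ge> 2\<close> by simp
    then have cnt: "ngt x y \<ge> k" "nlt x y \<ge> k" "ngt x y > k \<or> nlt x y > k"
      using a count_eq[of x y] count_compl[of x y] n by auto
    show ?thesis unfolding closure_approachable
    proof (intro allI impI)
      fix e :: real assume "e > 0"
      have lim: "((\<lambda>t. (t, pfun R t)) \<longlongrightarrow> z) (at_right x)" if "R \<in> ?E" for R
      proof -
        have "(pfun R \<longlongrightarrow> pfun R x) (at_right x)"
          using isCont_pfun[of R x] that by (simp add: filterlim_at_split isCont_def)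
        then show ?thesis unfolding z using that by (intro tendsto_Pair tendsto_ident_at) auto
      qed
      \<comment> \<open>\<open>G R t\<close> says that the point of \<open>R\<close> over
        \<open>t\<close> is close to \<open>z\<close> and ordered as \<open>z\<close> is against all
        lines that miss \<open>z\<close>.\<close>
      define G where "G R t \<longleftrightarrow> (\<forall>S\<in>L. (pfun S x < y \<longrightarrow> pfun S t < pfun R t) \<and> (y < pfun S x \<longrightarrow> pfun R t < pfun S t))
          \<and> dist (t, pfun R t) z < e" for R t
      have G: "\<forall>\<^sub>F t in at_right x. G R t" if "R \<in> ?E" for R
        unfolding G_def
        using eventually_conj[OF eventually_compose_filterlim[OF stable[of z] lim[OF that]]
            tendstoD[OF lim[OF that] \<open>e > 0\<close>]] by (simp add: z)
      have nc: "\<forall>\<^sub>F t in at_right x. t \<notin> coin L"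
        using eventually_not_coin[OF arr, of x] by (simp add: eventually_at_split)
      have "\<exists>t. G P t \<and> G Q t \<and> t \<notin> coin L"
        using eventually_happens'[OF trivial_limit_at_right_real eventually_conj[OF G[OF PQ(1)] eventually_conj[OF G[OF PQ(2)] nc]]]
        by blast
      then obtain t where t: "G P t" "G Q t" "t \<notin> coin L" by blast
      have "pfun P t \<noteq> pfun Q t" using t(3) PQ by (auto simp: coin_def)
      \<comment> \<open>\<open>U\<close> is the upper germ and gains \<open>V\<close> as a line
        strictly below, while \<open>V\<close> gains \<open>U\<close> as a line strictly
        above.\<close>
      then obtain U V where UV: "{U, V} = {P, Q}" "pfun V t < pfun U t"
        by (metis insert_commute linorder_neqE)
      then have UV': "U \<in> ?E" "V \<in> ?E" "G U t" "G V t" using PQ t by (auto simp: doubleton_eq_iff)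
      have "{S \<in> L. pfun S x < y} \<union> {V} \<subseteq> {S \<in> L. pfun S t < pfun U t}"
        "{S \<in> L. y < pfun S x} \<subseteq> {S \<in> L. pfun U t < pfun S t}"
        using UV' UV by (auto simp: G_def)
      then have "card ({S \<in> L. pfun S x < y} \<union> {V}) \<le> nlt t (pfun U t)" "ngt x y \<le> ngt t (pfun U t)"
        using fin by (auto simp: nlt_def ngt_def intro!: card_mono)
      moreover have "card ({S \<in> L. pfun S x < y} \<union> {V}) = nlt x y + 1"
        using UV' fin by (simp add: nlt_def)
      ultimately have up: "nlt t (pfun U t) > k" "ngt t (pfun U t) \<ge> ngt x y" using cnt by auto
      have "{S \<in> L. y < pfun S x} \<union> {U} \<subseteq> {S \<in> L. pfun V t < pfun S t}"
        "{S \<in> L. pfun S x < y} \<subseteq> {S \<in> L. pfun S t < pfun V t}"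
        using UV' UV by (auto simp: G_def)
      then have "card ({S \<in> L. y < pfun S x} \<union> {U}) \<le> ngt t (pfun V t)" "nlt x y \<le> nlt t (pfun V t)"
        using fin by (auto simp: nlt_def ngt_def intro!: card_mono)
      moreover have "card ({S \<in> L. y < pfun S x} \<union> {U}) = ngt x y + 1"
        using UV' fin by (simp add: ngt_def)
      ultimately have dn: "ngt t (pfun V t) > k" "nlt t (pfun V t) \<ge> nlt x y" using cnt by auto
      have "on t (pfun U t)" "on t (pfun V t)" using UV' by (auto simp: on_def)
      then have "(t, pfun U t) \<in> ?C \<or> (t, pfun V t) \<in> ?C" using up dn cnt by auto
      then show "\<exists>w\<in>?C. dist w z < e" using UV' by (auto simp: G_def)
    qed
  qed
qed

text \<open>As the external face is open, its frontier is its closure minus itself. Removing it from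
  the \<open>k\<close>-kernel leaves the points with more than \<open>k\<close> lines strictly above
  and strictly below, and the closure restores the vertices lost in this way. The computation takes
  place on preimages in the plane.\<close>

theorem kernel_eq: "kernel L k = mproj ` {z. inK k (fst z) (snd z)}"
proof (induction k)
  case 0
  have "p \<in> support L \<longleftrightarrow> p \<in> mproj ` {z. inK 0 (fst z) (snd z)}" for p
  proof -
    obtain x y where p: "p = mproj (x, y)" by (rule mproj_cases)
    have "on x y \<Longrightarrow> nge x y > 0 \<and> nle x y > 0 \<and> card L > 0"
      using count_eq[of x y] count_compl[of x y] on_card[of x y] by auto
    then have "inK 0 x y \<longleftrightarrow> on x y" by (auto simp: inK_def)
    moreover have "p \<in> support L \<longleftrightarrow> on x y"
      by (auto simp: p support_def on_def mem_pseudoline ps)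
    moreover have "p \<in> mproj ` {z. inK 0 (fst z) (snd z)} \<longleftrightarrow> inK 0 x y"
      using vimage_inK[of 0] unfolding p by (metis (mono_tags) fst_conv snd_conv mem_Collect_eq vimage_eq)
    ultimately show ?thesis by simp
  qed
  then show ?case by auto
next
  case (Suc k)
  let ?K = "\<lambda>k. {z. inK k (fst z) (snd z)}"
  let ?C = "{z. on (fst z) (snd z) \<and> k < ngt (fst z) (snd z) \<and> k < nlt (fst z) (snd z)}"
  show ?case
  proof (cases "2 * k < card L")
    case False
    then have "?K k = {}" "?K (Suc k) = {}" by (auto simp: inK_def)
    then show ?thesis using Suc by simp
  next
    case True
    have op: "open (mproj ` Ext k)" by (intro open_mproj_image open_Ext)
    have "mproj -` (kernel L k - external_hull (kernel L k)) = ?K k - (closure (Ext k) - Ext k)"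
      unfolding Suc external_hull_def external_face_K[OF True] frontier_def interior_open[OF op]
      using vimage_inK[of k] vimage_Ext[of k] by (simp add: vimage_Diff vimage_mproj_closure)
    also have "\<dots> = ?C"
    proof -
      have "z \<in> ?K k - (closure (Ext k) - Ext k) \<longleftrightarrow> z \<in> ?C" for z
      proof -
        have "z \<in> ?C \<Longrightarrow> inK k (fst z) (snd z)"
          using True count_eq[of "fst z" "snd z"] by (auto simp: inK_def)
        moreover have "inK k (fst z) (snd z) \<Longrightarrow> z \<notin> Ext k" by (auto simp: inK_def Ext_def)
        ultimately show ?thesis using closure_Ext_iff[of k "fst z" "snd z"] by (auto simp: inK_def)
      qed
      then show ?thesis by blast
    qed
    finally have "mproj -` (kernel L (Suc k)) = closure ?C"
      by (simp add: vimage_mproj_closure)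
    also have "\<dots> = ?K (Suc k)"
    proof (cases "2 * Suc k < card L")
      case False
      \<comment> \<open>A point of \<open>?C\<close> would account for \<open>k + 1\<close> lines
        above, \<open>k + 1\<close> lines below and one through it, that is for at least
        \<open>2 * k + 3\<close> lines.\<close>
      have "?C = {}"
      proof (intro equals0I)
        fix z assume "z \<in> ?C"
        then show False
          using False count_eq[of "fst z" "snd z"] count_compl[of "fst z" "snd z"] on_card[of "fst z" "snd z"] by auto
      qed
      then show ?thesis using False by (simp add: inK_def)
    next
      case n: True
      have "closed (?K (Suc k))" unfolding closed_def
      proof (rule openI_eventually)
        fix z assume z: "z \<in> - ?K (Suc k)"
        show "\<forall>\<^sub>F w in nhds z. w \<in> - ?K (Suc k)"
          using ev_counts[of z]
        proof eventually_elim
          case (elim w)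
          then show ?case using z n by (auto simp: inK_def)
        qed
      qed
      moreover have "?C \<subseteq> ?K (Suc k)"
      proof
        fix z assume "z \<in> ?C"
        then show "z \<in> ?K (Suc k)"
          using n count_eq[of "fst z" "snd z"] on_card[of "fst z" "snd z"] by (auto simp: inK_def)
      qed
      ultimately have "closure ?C \<subseteq> ?K (Suc k)" by (rule closure_minimal[rotated])
      moreover have "?K (Suc k) \<subseteq> closure ?C"
        using closure_step[OF _ n] by (auto simp: inK_def)
      ultimately show ?thesis by blast
    qed
    finally have *: "mproj -` (kernel L (Suc k)) = ?K (Suc k)" .
    have "p \<in> kernel L (Suc k) \<longleftrightarrow> p \<in> mproj ` ?K (Suc k)" for p
    proof -
      obtain x y where p: "p = mproj (x, y)" by (rule mproj_cases)
      have "(x, y) \<in> mproj -` (kernel L (Suc k)) \<longleftrightarrow> (x, y) \<in> mproj -` (mproj ` ?K (Suc k))"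
        unfolding * vimage_inK ..
      then show ?thesis unfolding p by simp
    qed
    then show ?thesis by blast
  qed
qed

lemma mem_kernel: "mproj (x, y) \<in> kernel L k \<longleftrightarrow> inK k x y"
proof -
  have "mproj (x, y) \<in> kernel L k \<longleftrightarrow> (x, y) \<in> mproj -` (mproj ` {z. inK k (fst z) (snd z)})"
    unfolding kernel_eq by simp
  then show ?thesis unfolding vimage_inK by simp
qed

end

section \<open>The greedy wires\<close>

text \<open>By \<open>h (a + pi) = - h a\<close> consecutive pieces agree at their common end, so
  \<open>piece\<close> holds on closed intervals, and two adjacent closed pieces cover a
  neighbourhood of any point.\<close>

lemma antiper_extension:
  fixes h :: "real \<Rightarrow> real"
  assumes h: "continuous_on {a..a + pi} h" "h (a + pi) = - h a"
  obtains g where "antiper g" "\<And>x. a \<le> x \<Longrightarrow> x \<le> a + pi \<Longrightarrow> g x = h x"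
proof -
  define R where "R x = \<lfloor>(x - a) / pi\<rfloor>" for x
  define g where "g x = sg (R x) * h (x - of_int (R x) * pi)" for x
  have piece: "g x = sg r * h (x - of_int r * pi)"
    if "a + of_int r * pi \<le> x" "x \<le> a + of_int (r + 1) * pi" for x r
  proof (cases "x = a + of_int (r + 1) * pi")
    case True
    then have "(x - a) / pi = of_int (r + 1)" by simp
    then have "R x = r + 1" unfolding R_def by (simp only: floor_of_int)
    then have "g x = sg (r + 1) * h a" using True by (simp add: g_def)
    also have "\<dots> = sg r * h (a + pi)" using h(2) by simp
    finally show ?thesis using True by (simp add: algebra_simps)
  next
    case False
    then have "of_int r \<le> (x - a) / pi" "(x - a) / pi < of_int r + 1"
      using that by (auto simp: field_simps)
    then have "R x = r" unfolding R_def by linarith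
    then show ?thesis by (simp add: g_def)
  qed
  have cp: "continuous_on {a + of_int r * pi..a + of_int (r + 1) * pi} g" for r
  proof -
    have "continuous_on {a + of_int r * pi..a + of_int (r + 1) * pi} (\<lambda>x. sg r * h (x - of_int r * pi))"
      by (intro continuous_intros continuous_on_compose2[OF h(1)]) (auto simp: algebra_simps)
    then show ?thesis by (rule continuous_on_eq) (rule piece[symmetric], auto)
  qed
  have "isCont g x" for x
  proof -
    define r where "r = R x"
    have "of_int r \<le> (x - a) / pi" "(x - a) / pi < of_int r + 1" unfolding r_def R_def by linarith+
    then have x: "a + of_int (r - 1) * pi < x" "x < a + of_int (r + 1) * pi"
      by (auto simp: field_simps)
    have "continuous_on ({a + of_int (r - 1) * pi..a + of_int (r - 1 + 1) * pi} \<union> {a + of_int r * pi..a + of_int (r + 1) * pi}) g"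
      by (intro continuous_on_closed_Un cp) auto
    then have "continuous_on {a + of_int (r - 1) * pi<..<a + of_int (r + 1) * pi} g"
      by (rule continuous_on_subset) auto
    then show ?thesis using x by (simp add: continuous_on_eq_continuous_at)
  qed
  moreover have "g (x + pi) = - g x" for x
  proof -
    have "(x + pi - a) / pi = (x - a) / pi + 1" by (simp add: field_simps)
    then have "R (x + pi) = R x + 1" by (simp add: R_def)
    then show ?thesis by (simp add: g_def algebra_simps)
  qed
  ultimately have "antiper g" by (simp add: antiper_def continuous_on_eq_continuous_at)
  moreover have "g x = h x" if "a \<le> x" "x \<le> a + pi" for x using piece[of 0 x] that by simp
  ultimately show thesis by (rule that)
qed

text \<open>The data of the sorting network: line \<open>f \<alpha>\<close> meets the cut at
  abscissa \<open>c \<alpha>\<close>, and \<open>X \<alpha> \<beta>\<close> is the abscissa of the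
  vertex of two lines inside the window. By \<open>before\<close>, the smaller index runs above
  between two consecutive meetings, which fixes the direction of the cut. Genericity of abscissas
  and simplicity appear as \<open>gen\<close> and \<open>two\<close>.\<close>

locale wiring =
  fixes n k :: nat and f :: "nat \<Rightarrow> real \<Rightarrow> real" and X :: "nat \<Rightarrow> nat \<Rightarrow> real" and c :: "nat \<Rightarrow> real"
  assumes nk: "2 * k < n"
    and ap: "\<alpha> \<in> {1..n} \<Longrightarrow> antiper (f \<alpha>)"
    and cX: "\<alpha> \<in> {1..n} \<Longrightarrow> \<beta> \<in> {1..n} \<Longrightarrow> \<alpha> < \<beta> \<Longrightarrow>
       X \<alpha> \<beta> - pi < c \<alpha> \<and> c \<alpha> < X \<alpha> \<beta> \<and> X \<alpha> \<beta> - pi < c \<beta> \<and> c \<beta> < X \<alpha> \<beta>"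
    and before: "\<alpha> \<in> {1..n} \<Longrightarrow> \<beta> \<in> {1..n} \<Longrightarrow> \<alpha> < \<beta> \<Longrightarrow> X \<alpha> \<beta> - pi < x \<Longrightarrow> x < X \<alpha> \<beta> \<Longrightarrow> f \<beta> x < f \<alpha> x"
    and atX: "\<alpha> \<in> {1..n} \<Longrightarrow> \<beta> \<in> {1..n} \<Longrightarrow> \<alpha> < \<beta> \<Longrightarrow> f \<alpha> (X \<alpha> \<beta>) = f \<beta> (X \<alpha> \<beta>)"
    and gen: "\<forall>\<^sub>F x' in at x. inj_on (\<lambda>\<alpha>. f \<alpha> x') {1..n}"
    and two: "card {\<gamma> \<in> {1..n}. f \<gamma> x = y} \<le> 2"
begin

text \<open>The lines cross the cut at the abscissas \<open>c\<close>, hence the window of the cut is not a vertical strip. On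
  \<open>J\<close> every line is inside this window or inside the preceding one. \<open>NR\<close> counts the greedy curves
  with index \<open>> t - k\<close> above a point of the window, \<open>NL\<close> is its image under \<open>tau\<close> for points of
  the preceding window, and \<open>left\<close> tells which of the two applies.\<close>

definition J :: "real \<Rightarrow> bool" where "J x \<longleftrightarrow> (\<forall>\<alpha>\<in>{1..n}. c \<alpha> - pi < x \<and> x < c \<alpha> + pi)"
definition A :: "nat \<Rightarrow> real \<Rightarrow> real \<Rightarrow> nat" where "A t x y = card {\<gamma> \<in> {t<..n}. y < f \<gamma> x}"
definition B :: "nat \<Rightarrow> real \<Rightarrow> real \<Rightarrow> nat" where "B t x y = card {\<delta> \<in> {1..t}. f \<delta> x < y}"
definition ab :: "real \<Rightarrow> real \<Rightarrow> nat" where "ab x y = card {\<gamma> \<in> {1..n}. y < f \<gamma> x}"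
definition off :: "real \<Rightarrow> real \<Rightarrow> bool" where "off x y \<longleftrightarrow> (\<forall>\<gamma>\<in>{1..n}. f \<gamma> x \<noteq> y)"
text \<open>This is the maximum of \<open>0\<close>, \<open>a - b\<close> and \<open>a - k\<close>.
  For \<open>a = A\<close> and \<open>b = B\<close> the terms are a constant, the number of lines
  above the point minus \<open>t\<close> (by \<open>A_B_ab\<close>), and the number of ones above
  minus \<open>k\<close>; each of them obeys the rule of the sweep by itself.\<close>

definition nr :: "nat \<Rightarrow> nat \<Rightarrow> int" where "nr a b = int a - int (min a (min b k))"
definition NR :: "nat \<Rightarrow> real \<Rightarrow> real \<Rightarrow> int" where "NR t x y = nr (A t x y) (B t x y)"
definition NL :: "nat \<Rightarrow> real \<Rightarrow> real \<Rightarrow> int" where "NL t x y = int n - int k - int t - NR t (x + pi) (- y)"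
definition left :: "nat \<Rightarrow> real \<Rightarrow> real \<Rightarrow> bool" where "left t x y \<longleftrightarrow> (\<exists>\<gamma>\<in>{t<..n}. y < f \<gamma> x \<and> x < c \<gamma>)"
text \<open>The first two branches extend the count beyond the kernel, where none or all of the
  \<open>n - k - t\<close> curves with index \<open>> t - k\<close> lie above the point.\<close>

definition N :: "nat \<Rightarrow> real \<Rightarrow> real \<Rightarrow> int" where
  "N t x y = (if ab x y \<le> k then 0 else if n - k \<le> ab x y then int n - int k - int t
     else if left t x y then NL t x y else NR t x y)"

section \<open>Symmetry and local dependence of the count\<close>

lemma fpi: "\<alpha> \<in> {1..n} \<Longrightarrow> f \<alpha> (x + pi) = - f \<alpha> x"
  using ap antiper_simps by blast

lemma isCont_f: "\<alpha> \<in> {1..n} \<Longrightarrow> isCont (f \<alpha>) x"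
  using antiper_cont[OF ap, of \<alpha> UNIV] by (simp add: continuous_on_eq_continuous_at)

lemma after:
  assumes "\<alpha> \<in> {1..n}" "\<beta> \<in> {1..n}" "\<alpha> < \<beta>" "X \<alpha> \<beta> < x" "x < X \<alpha> \<beta> + pi" shows "f \<alpha> x < f \<beta> x"
  using before[OF assms(1-3), of "x - pi"] assms antiper_simps(2)[OF ap[OF assms(1)]]
    antiper_simps(2)[OF ap[OF assms(2)]] by simp

lemma card_split:
  assumes "finite S" shows "card {s \<in> S. P s} + card {s \<in> S. \<not> P s} = card S"
proof -
  have "card ({s \<in> S. P s} \<union> {s \<in> S. \<not> P s}) = card {s \<in> S. P s} + card {s \<in> S. \<not> P s}"
    using assms by (intro card_Un_disjoint) auto
  moreover have "{s \<in> S. P s} \<union> {s \<in> S. \<not> P s} = S" by auto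
  ultimately show ?thesis by simp
qed

lemma A_B_ab:
  assumes "off x y" "t \<le> n" shows "A t x y + t = ab x y + B t x y"
proof -
  have "{\<gamma> \<in> {1..n}. y < f \<gamma> x} = {\<gamma> \<in> {t<..n}. y < f \<gamma> x} \<union> {\<gamma> \<in> {1..t}. y < f \<gamma> x}"
    using assms(2) by auto
  then have "ab x y = A t x y + card {\<gamma> \<in> {1..t}. y < f \<gamma> x}"
    unfolding ab_def A_def by (simp add: card_Un_disjoint disjoint_iff)
  moreover have "{\<gamma> \<in> {1..t}. y < f \<gamma> x} = {\<gamma> \<in> {1..t}. \<not> f \<gamma> x < y}"
    using assms unfolding off_def by force
  ultimately show ?thesis using card_split[of "{1..t}" "\<lambda>\<gamma>. f \<gamma> x < y"] by (simp add: B_def)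
qed

lemma A_pi:
  assumes "off x y" shows "A t (x + pi) (- y) + A t x y = n - t"
proof -
  have "- y < f \<gamma> (x + pi) \<longleftrightarrow> \<not> y < f \<gamma> x" if "1 \<le> \<gamma>" "\<gamma> \<le> n" for \<gamma>
    using fpi[of \<gamma> x] assms that unfolding off_def by force
  then have "{\<gamma> \<in> {t<..n}. - y < f \<gamma> (x + pi)} = {\<gamma> \<in> {t<..n}. \<not> y < f \<gamma> x}"
    by (intro Collect_cong) auto
  then show ?thesis using card_split[of "{t<..n}" "\<lambda>\<gamma>. y < f \<gamma> x"] by (simp add: A_def)
qed

lemma B_pi:
  assumes "off x y" "t \<le> n" shows "B t (x + pi) (- y) + B t x y = t"
proof -
  have "f \<gamma> (x + pi) < - y \<longleftrightarrow> \<not> f \<gamma> x < y" if "1 \<le> \<gamma>" "\<gamma> \<le> n" for \<gamma>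
    using fpi[of \<gamma> x] assms that unfolding off_def by force
  then have "{\<delta> \<in> {1..t}. f \<delta> (x + pi) < - y} = {\<delta> \<in> {1..t}. \<not> f \<delta> x < y}"
    using assms(2) by (intro Collect_cong) auto
  then show ?thesis using card_split[of "{1..t}" "\<lambda>\<delta>. f \<delta> x < y"] by (simp add: B_def)
qed

lemma ab_pi:
  assumes "off x y" shows "ab (x + pi) (- y) + ab x y = n"
proof -
  have "- y < f \<gamma> (x + pi) \<longleftrightarrow> \<not> y < f \<gamma> x" if "1 \<le> \<gamma>" "\<gamma> \<le> n" for \<gamma>
    using fpi[of \<gamma> x] assms that unfolding off_def by force
  then have "{\<gamma> \<in> {1..n}. - y < f \<gamma> (x + pi)} = {\<gamma> \<in> {1..n}. \<not> y < f \<gamma> x}"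
    by (intro Collect_cong) auto
  then show ?thesis using card_split[of "{1..n}" "\<lambda>\<gamma>. y < f \<gamma> x"] by (simp add: ab_def)
qed

text \<open>Under \<open>tau\<close> both counts are complemented, to \<open>n - t - A\<close> and
  \<open>t - B\<close>; the relations are packaged for linear arithmetic.\<close>

lemma NL_alt:
  assumes "off x y" "t \<le> n"
  obtains A' B' where "A' + A t x y + t = n" "B' + B t x y = t" "NL t x y = int n - int k - int t - nr A' B'"
    "A t x y + t = ab x y + B t x y"
  using A_pi[OF assms(1), of t] B_pi[OF assms] A_B_ab[OF assms] assms(2)
  by (intro that[of "A t (x + pi) (- y)" "B t (x + pi) (- y)"]) (auto simp: NL_def NR_def)

text \<open>If \<open>A\<close> or \<open>B\<close> vanishes, no inverted pair around the point
  reveals its side of the cut. The two candidates then agree: both are \<open>0\<close> if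
  \<open>A\<close> vanishes, and both are \<open>ab x y - t\<close> if \<open>B\<close> does. This
  is what glues the two versions.\<close>

lemma NR_eq_NL:
  assumes "off x y" "k \<le> ab x y" "ab x y \<le> n - k" "k \<le> t" "t \<le> n - k" "A t x y = 0 \<or> B t x y = 0"
  shows "NL t x y = NR t x y"
proof -
  obtain A' B' where *: "A' + A t x y + t = n" "B' + B t x y = t" "NL t x y = int n - int k - int t - nr A' B'"
    "A t x y + t = ab x y + B t x y"
    using NL_alt[OF assms(1), of t] assms by (metis diff_le_self le_trans)
  have "k \<le> A'" "k \<le> B'" using * assms nk by linarith+
  then show ?thesis using * assms(6) unfolding NR_def *(3) nr_def by (auto simp: min_def)
qed

text \<open>On the two bounding levels the formulas already have the values prescribed outside the
  kernel, so cutting \<open>N\<close> off there creates no jump.\<close>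

lemma NR_NL_at_boundary:
  assumes "off x y" "k \<le> t" "t \<le> n - k"
  shows "ab x y = k \<Longrightarrow> NR t x y = 0 \<and> NL t x y = 0"
    and "ab x y = n - k \<Longrightarrow> NR t x y = int n - int k - int t \<and> NL t x y = int n - int k - int t"
proof -
  obtain A' B' where *: "A' + A t x y + t = n" "B' + B t x y = t" "NL t x y = int n - int k - int t - nr A' B'"
    "A t x y + t = ab x y + B t x y"
    using NL_alt[OF assms(1), of t] assms by (metis diff_le_self le_trans)
  have n: "t + k \<le> n" using assms nk by simp
  { assume "ab x y = k"
    then have "A t x y \<le> B t x y" "A t x y \<le> k" "B' \<le> A'" "B' \<le> k" "int A' - int B' = int n - int k - int t"
      using * n assms(2) by linarith+
    then show "NR t x y = 0 \<and> NL t x y = 0" unfolding NR_def *(3) nr_def by (simp add: min_def) }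
  { assume "ab x y = n - k"
    then have "B t x y \<le> A t x y" "B t x y \<le> k" "A' \<le> B'" "A' \<le> k" "int (A t x y) - int (B t x y) = int n - int k - int t"
      using * n assms(2) nk by linarith+
    then show "NR t x y = int n - int k - int t \<and> NL t x y = int n - int k - int t"
      unfolding NR_def *(3) nr_def by (simp add: min_def) }
qed

lemma N_cases:
  assumes "off x y" "k \<le> t" "t \<le> n - k" "k \<le> ab x y" "ab x y \<le> n - k"
  shows "N t x y = (if left t x y then NL t x y else NR t x y)"
  using NR_NL_at_boundary[OF assms(1-3)] assms nk by (auto simp: N_def)

text \<open>All lines with index \<open>> t\<close> above a point are inverted with all lines with index \<open>\<le> t\<close> below it, so
  these lines are all on the same side of the cut: \<open>left\<close> does not depend on the choice of \<open>\<gamma>\<close>.\<close>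

lemma inverted:
  assumes "J x" "\<gamma> \<in> {1..n}" "\<delta> \<in> {1..n}" "\<delta> < \<gamma>" "f \<delta> x < f \<gamma> x"
  shows "c \<gamma> < x \<and> c \<delta> < x \<or> x < c \<gamma> \<and> x < c \<delta>"
proof -
  have "\<not> (X \<delta> \<gamma> - pi < x \<and> x < X \<delta> \<gamma>)" using before[of \<delta> \<gamma> x] assms by auto
  moreover have "x \<noteq> X \<delta> \<gamma>" using atX[of \<delta> \<gamma>] assms by auto
  moreover have "x \<noteq> X \<delta> \<gamma> - pi"
    using atX[of \<delta> \<gamma>] assms antiper_simps(2)[OF ap, of \<delta> "X \<delta> \<gamma>"] antiper_simps(2)[OF ap, of \<gamma> "X \<delta> \<gamma>"] by auto
  ultimately have "x < X \<delta> \<gamma> - pi \<or> X \<delta> \<gamma> < x" by linarith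
  then show ?thesis using cX[of \<delta> \<gamma>] assms by auto
qed

text \<open>The count depends only on the order of the point among the lines and on the side of the
  cut. If neither \<open>A\<close> nor \<open>B\<close> vanishes, \<open>inverted\<close> keeps the
  cut abscissas of the ones above the point away from \<open>x0\<close>, so their side is controlled
  by the last assumption; otherwise \<open>NR\<close> and \<open>NL\<close> agree.\<close>

lemma N_cong:
  assumes "off x y" "off x0 y0" "J x" "J x0" "k \<le> t" "t \<le> n - k"
    and up: "\<And>\<gamma>. \<gamma> \<in> {1..n} \<Longrightarrow> y < f \<gamma> x \<longleftrightarrow> y0 < f \<gamma> x0"
    and cc: "\<And>\<gamma>. \<gamma> \<in> {1..n} \<Longrightarrow> c \<gamma> \<noteq> x0 \<Longrightarrow> x < c \<gamma> \<longleftrightarrow> x0 < c \<gamma>"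
  shows "N t x y = N t x0 y0"
proof -
  have dn: "f \<gamma> x < y \<longleftrightarrow> f \<gamma> x0 < y0" if "\<gamma> \<in> {1..n}" for \<gamma>
    using up[OF that] assms(1,2) that unfolding off_def by (metis less_asym linorder_neqE)
  have t: "t \<le> n" using assms by simp
  have A: "A t x y = A t x0 y0" unfolding A_def using up by (intro arg_cong[where f = card]) auto
  have B: "B t x y = B t x0 y0" unfolding B_def using dn t by (intro arg_cong[where f = card]) auto
  have ab: "ab x y = ab x0 y0" unfolding ab_def using up by (intro arg_cong[where f = card]) auto
  have NR: "NR t x y = NR t x0 y0" by (simp add: NR_def A B)
  have NL: "NL t x y = NL t x0 y0"
  proof -
    have "A t (x + pi) (- y) = A t (x0 + pi) (- y0)" "B t (x + pi) (- y) = B t (x0 + pi) (- y0)"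
      using A_pi[OF assms(1), of t] A_pi[OF assms(2), of t] B_pi[OF assms(1) t] B_pi[OF assms(2) t] A B by linarith+
    then show ?thesis by (simp add: NL_def NR_def)
  qed
  show ?thesis
  proof (cases "k < ab x y \<and> ab x y < n - k \<and> A t x0 y0 \<noteq> 0 \<and> B t x0 y0 \<noteq> 0")
    case False
    then show ?thesis
      using NR_eq_NL[OF assms(2), of t] assms(5,6) by (auto simp: N_def ab NR NL)
  next
    case True
    then obtain \<delta> where \<delta>: "\<delta> \<in> {1..t}" "f \<delta> x0 < y0" unfolding B_def
      by (metis (mono_tags, lifting) card.empty empty_Collect_eq)
    have "c \<gamma> \<noteq> x0" if "\<gamma> \<in> {t<..n}" "y0 < f \<gamma> x0" for \<gamma>
      using inverted[OF assms(4), of \<gamma> \<delta>] that \<delta> t by auto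
    then have "left t x y \<longleftrightarrow> left t x0 y0" unfolding left_def using up cc by force
    then show ?thesis by (simp add: N_def ab NR NL)
  qed
qed

text \<open>For \<open>y \<noteq> f \<alpha> x\<close> this places \<open>y\<close> in one of the
  two faces adjacent to the line at abscissa \<open>x\<close>, and it implies that
  \<open>(x, f \<alpha> x)\<close> is not a vertex.\<close>

definition adj :: "nat \<Rightarrow> real \<Rightarrow> real \<Rightarrow> bool" where
  "adj \<alpha> x y \<longleftrightarrow> (\<forall>\<gamma>\<in>{1..n}. \<gamma> \<noteq> \<alpha> \<longrightarrow> (y < f \<gamma> x \<longleftrightarrow> f \<alpha> x < f \<gamma> x) \<and> (f \<gamma> x < y \<longleftrightarrow> f \<gamma> x < f \<alpha> x))"

text \<open>The adjacent line can decide the side of the cut. If neither count vanishes, there are a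
  one above and a zero below, and \<alpha> is inverted with one of these kinds; so \<alpha> is on
  the same side as the lines consulted by \<open>left\<close>. If a count vanishes, both sides give
  the same value.\<close>

lemma N_side:
  assumes o: "off x y" and J: "J x" and t: "k \<le> t" "t \<le> n - k" and ab: "k \<le> ab x y" "ab x y \<le> n - k"
    and \<alpha>: "\<alpha> \<in> {1..n}"
    and adj: "adj \<alpha> x y"
  shows "N t x y = (if c \<alpha> \<le> x then NR t x y else NL t x y)"
proof (cases "A t x y = 0 \<or> B t x y = 0")
  case True
  then show ?thesis using NR_eq_NL[OF o ab t] N_cases[OF o t ab] by auto
next
  case False
  then obtain \<delta> \<gamma> where \<delta>: "\<delta> \<in> {1..t}" "f \<delta> x < y" and \<gamma>: "\<gamma> \<in> {t<..n}" "y < f \<gamma> x"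
    unfolding A_def B_def by (metis (mono_tags, lifting) card.empty empty_Collect_eq)
  have inv: "c \<gamma>' < x \<and> c \<delta> < x \<or> x < c \<gamma>' \<and> x < c \<delta>" if "\<gamma>' \<in> {t<..n}" "y < f \<gamma>' x" for \<gamma>'
    using inverted[OF J, of \<gamma>' \<delta>] that \<delta> t by force
  have "left t x y \<longleftrightarrow> \<not> c \<alpha> \<le> x"
  proof (cases "t < \<alpha>")
    case True
    then have "f \<delta> x < f \<alpha> x" using bspec[OF adj[unfolded adj_def], of \<delta>] \<delta> t by auto
    then have "c \<alpha> < x \<and> c \<delta> < x \<or> x < c \<alpha> \<and> x < c \<delta>" using inverted[OF J \<alpha>, of \<delta>] \<delta> True t by auto
    then show ?thesis using inv \<gamma> unfolding left_def by (metis less_asym not_less)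
  next
    case False
    have "c \<gamma>' < x \<and> c \<alpha> < x \<or> x < c \<gamma>' \<and> x < c \<alpha>" if "\<gamma>' \<in> {t<..n}" "y < f \<gamma>' x" for \<gamma>'
      using inverted[OF J, of \<gamma>' \<alpha>] bspec[OF adj[unfolded adj_def], of \<gamma>'] that \<alpha> False by auto
    then show ?thesis using \<gamma> unfolding left_def by (metis less_asym not_less)
  qed
  then show ?thesis using N_cases[OF o t ab] by auto
qed

text \<open>A wire carries a greedy curve with index \<open>> t - k\<close> iff its bit at \<open>t\<close> is set. As bits are antitone
  in \<open>t\<close>, they encode the index.\<close>

definition bitR :: "nat \<Rightarrow> nat \<Rightarrow> real \<Rightarrow> bool" where
  "bitR \<alpha> t x \<longleftrightarrow> t < \<alpha> \<and> min (B t x (f \<alpha> x)) k \<le> A t x (f \<alpha> x) \<or> \<alpha> \<le> t \<and> B t x (f \<alpha> x) < min (A t x (f \<alpha> x)) k"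

definition bit :: "nat \<Rightarrow> nat \<Rightarrow> real \<Rightarrow> bool" where
  "bit \<alpha> t x \<longleftrightarrow> (if c \<alpha> \<le> x then bitR \<alpha> t x else bitR \<alpha> t (x + pi))"

definition Ker :: "nat \<Rightarrow> real \<Rightarrow> bool" where
  "Ker \<alpha> x \<longleftrightarrow> k \<le> ab x (f \<alpha> x) \<and> ab x (f \<alpha> x) < n - k"

lemma wire_counts:
  assumes \<alpha>: "\<alpha> \<in> {1..n}" and y: "y2 < f \<alpha> x" "f \<alpha> x < y1" and t: "t \<le> n"
    and adj: "adj \<alpha> x y1" "adj \<alpha> x y2"
  shows "off x y1" "off x y2" "ab x y1 = ab x (f \<alpha> x)" "ab x y2 = ab x (f \<alpha> x) + 1"
    "A t x y1 = A t x (f \<alpha> x)" "A t x y2 = A t x (f \<alpha> x) + (if t < \<alpha> then 1 else 0)"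
    "B t x y2 = B t x (f \<alpha> x)" "B t x y1 = B t x (f \<alpha> x) + (if t < \<alpha> then 0 else 1)"
proof -
  have 1: "y1 < f \<gamma> x \<longleftrightarrow> f \<alpha> x < f \<gamma> x" "y2 < f \<gamma> x \<longleftrightarrow> f \<alpha> x < f \<gamma> x \<or> \<gamma> = \<alpha>" 
    "f \<gamma> x < y2 \<longleftrightarrow> f \<gamma> x < f \<alpha> x" "f \<gamma> x < y1 \<longleftrightarrow> f \<gamma> x < f \<alpha> x \<or> \<gamma> = \<alpha>" if "\<gamma> \<in> {1..n}" for \<gamma>
    using bspec[OF adj(1)[unfolded adj_def] that] bspec[OF adj(2)[unfolded adj_def] that] y
    by (cases "\<gamma> = \<alpha>"; auto)+
  show "off x y1" "off x y2" unfolding off_def using 1 y by (metis less_irrefl linorder_neqE)+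
  show "ab x y1 = ab x (f \<alpha> x)" unfolding ab_def using 1 by (intro arg_cong[where f = card]) auto
  show "A t x y1 = A t x (f \<alpha> x)" unfolding A_def using 1 by (intro arg_cong[where f = card]) auto
  show "B t x y2 = B t x (f \<alpha> x)" unfolding B_def using 1 t by (intro arg_cong[where f = card]) auto
  have "{\<gamma> \<in> {1..n}. y2 < f \<gamma> x} = insert \<alpha> {\<gamma> \<in> {1..n}. f \<alpha> x < f \<gamma> x}" using 1 \<alpha> by auto
  then show "ab x y2 = ab x (f \<alpha> x) + 1" unfolding ab_def by simp
  have "{\<gamma> \<in> {t<..n}. y2 < f \<gamma> x} = (if t < \<alpha> then {\<alpha>} else {}) \<union> {\<gamma> \<in> {t<..n}. f \<alpha> x < f \<gamma> x}" using 1 \<alpha> by auto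
  then show "A t x y2 = A t x (f \<alpha> x) + (if t < \<alpha> then 1 else 0)" unfolding A_def by simp
  have "{\<gamma> \<in> {1..t}. f \<gamma> x < y1} = (if t < \<alpha> then {} else {\<alpha>}) \<union> {\<gamma> \<in> {1..t}. f \<gamma> x < f \<alpha> x}" using 1 \<alpha> t by auto
  then show "B t x y1 = B t x (f \<alpha> x) + (if t < \<alpha> then 0 else 1)" unfolding B_def by simp
qed

text \<open>Going down across the line raises \<open>A\<close> by one if the line is a one, and
  lowers \<open>B\<close> by one if it is a zero. The maximum \<open>nr\<close> grows by
  \<open>0\<close> or \<open>1\<close> accordingly, and \<open>bitR\<close> is the condition for
  growth.\<close>

lemma NR_step:
  assumes "\<alpha> \<in> {1..n}" "y2 < f \<alpha> x" "f \<alpha> x < y1" "t \<le> n"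
    and "adj \<alpha> x y1" "adj \<alpha> x y2"
  shows "NR t x y2 - NR t x y1 = of_bool (bitR \<alpha> t x)"
proof -
  have *: "nr (a + 1) b - nr a b = of_bool (min b k \<le> a)" "nr a b - nr a (b + 1) = of_bool (b < min a k)" for a b
    by (auto simp: nr_def min_def)
  have "NR t x y2 - NR t x y1 = nr (A t x (f \<alpha> x) + (if t < \<alpha> then 1 else 0)) (B t x (f \<alpha> x))
      - nr (A t x (f \<alpha> x)) (B t x (f \<alpha> x) + (if t < \<alpha> then 0 else 1))"
    by (simp only: NR_def wire_counts(5-8)[OF assms])
  then show ?thesis using * by (cases "t < \<alpha>") (simp_all add: bitR_def)
qed

text \<open>\<open>tau\<close> turns the picture upside down, so the lower point becomes the upper
  one; this cancels the minus sign in \<open>NL\<close>.\<close>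

lemma NL_step:
  assumes "\<alpha> \<in> {1..n}" "y2 < f \<alpha> x" "f \<alpha> x < y1" "t \<le> n"
    and adj: "adj \<alpha> x y1" "adj \<alpha> x y2"
  shows "NL t x y2 - NL t x y1 = of_bool (bitR \<alpha> t (x + pi))"
proof -
  have "NR t (x + pi) (- y1) - NR t (x + pi) (- y2) = of_bool (bitR \<alpha> t (x + pi))"
  proof (rule NR_step)
    show "adj \<alpha> (x + pi) (- y2)" "adj \<alpha> (x + pi) (- y1)"
      using adj assms(1) unfolding adj_def by (auto simp: fpi)
  qed (use assms in \<open>auto simp: fpi\<close>)
  then show ?thesis by (simp add: NL_def)
qed

lemma N_step:
  assumes "\<alpha> \<in> {1..n}" "y2 < f \<alpha> x" "f \<alpha> x < y1" "J x" "k \<le> t" "t \<le> n - k"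
    and adj: "adj \<alpha> x y1" "adj \<alpha> x y2"
  shows "N t x y2 - N t x y1 = of_bool (Ker \<alpha> x \<and> bit \<alpha> t x)"
proof -
  have t: "t \<le> n" using assms by simp
  note w = wire_counts[OF assms(1-3) t adj]
  show ?thesis
  proof (cases "Ker \<alpha> x")
    case True
    then have "N t x y = (if c \<alpha> \<le> x then NR t x y else NL t x y)" if "y \<in> {y1, y2}" for y
      using that assms adj w by (intro N_side) (auto simp: Ker_def)
    then show ?thesis
      using NR_step[OF assms(1-3) t adj] NL_step[OF assms(1-3) t adj] True by (simp add: bit_def)
  next
    case False
    then show ?thesis using w(3,4) nk by (auto simp: N_def Ker_def)
  qed
qed

text \<open>Raising the threshold from \<open>s\<close> to \<open>Suc s\<close> turns the line
  \<open>Suc s\<close> from a one into a zero. This can only lower \<open>A\<close> and raise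
  \<open>B\<close>, and both work against the bit. The line that changes its own type switches
  between the two clauses of \<open>bitR\<close> and is compared separately.\<close>

lemma bitR_antimono:
  assumes "\<alpha> \<in> {1..n}" "bitR \<alpha> t' x" "t \<le> t'" "t' \<le> n" shows "bitR \<alpha> t x"
proof -
  have step: "bitR \<alpha> s x" if "bitR \<alpha> (Suc s) x" "Suc s \<le> n" for s
  proof -
    let ?y = "f \<alpha> x"
    have "{\<gamma> \<in> {s<..n}. ?y < f \<gamma> x} = {\<gamma> \<in> {Suc s<..n}. ?y < f \<gamma> x} \<union> (if ?y < f (Suc s) x then {Suc s} else {})"
      using that(2) by (auto simp: less_Suc_eq) (metis Suc_lessI)+
    then have A: "A s x ?y = A (Suc s) x ?y + (if ?y < f (Suc s) x then 1 else 0)" by (simp add: A_def)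
    have "{\<delta> \<in> {1..Suc s}. f \<delta> x < ?y} = {\<delta> \<in> {1..s}. f \<delta> x < ?y} \<union> (if f (Suc s) x < ?y then {Suc s} else {})"
      by (auto simp: le_Suc_eq)
    then have B: "B (Suc s) x ?y = B s x ?y + (if f (Suc s) x < ?y then 1 else 0)" by (simp add: B_def)
    show ?thesis
    proof (cases "\<alpha> = Suc s")
      case True
      then show ?thesis using that(1) A B by (auto simp: bitR_def min_def split: if_splits)
    next
      case False
      then have "s < \<alpha> \<longleftrightarrow> Suc s < \<alpha>" "\<alpha> \<le> s \<longleftrightarrow> \<alpha> \<le> Suc s" by auto
      then show ?thesis using that(1) A B by (auto simp: bitR_def min_def split: if_splits)
    qed
  qed
  show ?thesis using assms(3,2,4) by (induction t' rule: dec_induct) (auto intro: step)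
qed

text \<open>At the lowest threshold every curve counts, so the result is the number of all curves
  above the point. With the opposite extreme \<open>N_at_nk\<close> it evaluates the telescoping sum
  over \<open>D\<close>.\<close>

lemma N_at_k:
  assumes "off x y" shows "N k x y = int (min (max (ab x y) k) (n - k)) - int k"
proof (cases "k < ab x y \<and> ab x y < n - k")
  case True
  have k: "k \<le> n" "k \<le> k" "k \<le> n - k" using nk by simp_all
  obtain A' B' where *: "A' + A k x y + k = n" "B' + B k x y = k" "NL k x y = int n - int k - int k - nr A' B'"
    "A k x y + k = ab x y + B k x y" by (rule NL_alt[OF assms k(1)])
  have "B k x y \<le> A k x y" "B k x y \<le> k" "B' \<le> A'" "B' \<le> k" using * True by linarith+
  then have "NR k x y = int (A k x y) - int (B k x y)" "NL k x y = int n - int k - int k - int A' + int B'"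
    unfolding NR_def *(3) nr_def by simp_all
  then have "NR k x y = int (ab x y) - int k" "NL k x y = int (ab x y) - int k" using * by linarith+
  then show ?thesis using N_cases[OF assms k(2,3)] True by simp
qed (use nk in \<open>auto simp: N_def of_nat_diff\<close>)

lemma N_at_nk:
  assumes "off x y" shows "N (n - k) x y = 0"
proof (cases "k < ab x y \<and> ab x y < n - k")
  case True
  have k: "n - k \<le> n" "k \<le> n - k" "n - k \<le> n - k" using nk by simp_all
  obtain A' B' where *: "A' + A (n - k) x y + (n - k) = n" "B' + B (n - k) x y = n - k" "NL (n - k) x y = int n - int k - int (n - k) - nr A' B'"
    "A (n - k) x y + (n - k) = ab x y + B (n - k) x y" by (rule NL_alt[OF assms k(1)])
  have "A (n - k) x y \<le> B (n - k) x y" "A (n - k) x y \<le> k" "A' \<le> B'" "A' \<le> k" using * True nk by linarith+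
  then have "NR (n - k) x y = 0" "NL (n - k) x y = 0"
    unfolding NR_def *(3) nr_def using nk by simp_all
  then show ?thesis using N_cases[OF assms k(2,3)] True by simp
qed (use nk in \<open>auto simp: N_def of_nat_diff\<close>)

text \<open>If both abscissas are in \<open>J\<close>, they lie on opposite sides of every cut
  abscissa, so \<open>NL\<close> applies at \<open>x\<close> and \<open>NR\<close> at
  \<open>x + pi\<close>; these are mirror images by definition. If no one is above the point,
  \<open>left\<close> fails at \<open>x\<close> as well, but then \<open>NL\<close> and
  \<open>NR\<close> agree.\<close>

lemma N_pi:
  assumes o: "off x y" and J: "J x" "J (x + pi)" and t: "k \<le> t" "t \<le> n - k"
  shows "N t (x + pi) (- y) = int n - int k - int t - N t x y"
proof -
  have c: "c \<gamma> < x + pi" "x < c \<gamma>" if "\<gamma> \<in> {t<..n}" for \<gamma>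
  proof -
    have "\<gamma> \<in> {1..n}" using that by auto
    then show "c \<gamma> < x + pi" "x < c \<gamma>" using J unfolding J_def by (auto dest!: bspec[of _ _ \<gamma>])
  qed
  have "ab (x + pi) (- y) + ab x y = n" by (rule ab_pi[OF o])
  moreover have "\<not> left t (x + pi) (- y)" using c by (force simp: left_def)
  moreover have "left t x y \<longleftrightarrow> A t x y \<noteq> 0"
  proof -
    have "left t x y \<longleftrightarrow> {\<gamma> \<in> {t<..n}. y < f \<gamma> x} \<noteq> {}" unfolding left_def using c(2) by blast
    then show ?thesis unfolding A_def by (subst card_0_eq) simp_all
  qed
  moreover have "NR t (x + pi) (- y) = int n - int k - int t - NL t x y" by (simp add: NL_def)
  moreover have "k < ab x y \<Longrightarrow> ab x y < n - k \<Longrightarrow> A t x y = 0 \<Longrightarrow> NL t x y = NR t x y"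
    using NR_eq_NL[OF o _ _ t] by simp
  ultimately show ?thesis using nk t by (auto simp: N_def)
qed

text \<open>Off the lines a small move changes neither the order among the lines nor the side of a
  line with \<open>c \<gamma> \<noteq> x0\<close>, which is all that \<open>N_cong\<close> asks
  for.\<close>

lemma N_local:
  assumes o: "off x0 y0" and J: "J x0"
  shows "\<forall>\<^sub>F z in nhds (x0, y0). J (fst z) \<and> off (fst z) (snd z) \<and> (\<forall>t\<in>{k..n - k}. N t (fst z) (snd z) = N t x0 y0)"
proof -
  have ev1: "\<forall>\<^sub>F z in nhds (x0, y0). \<forall>\<gamma>\<in>{1..n}. (y0 < f \<gamma> x0 \<longrightarrow> snd z < f \<gamma> (fst z)) \<and> (f \<gamma> x0 < y0 \<longrightarrow> f \<gamma> (fst z) < snd z)"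
  proof (intro eventually_ball_finite ballI eventually_conj)
    fix \<gamma> assume "\<gamma> \<in> {1..n}"
    have 1: "((\<lambda>z. f \<gamma> (fst z)) \<longlongrightarrow> f \<gamma> (fst (x0, y0))) (nhds (x0, y0))" "(snd \<longlongrightarrow> snd (x0, y0)) (nhds (x0, y0))"
      by (intro isCont_tendsto_compose[OF isCont_f[OF \<open>\<gamma> \<in> {1..n}\<close>]] tendsto_intros filterlim_ident)+
    have 2: "((\<lambda>z. f \<gamma> (fst z) - snd z) \<longlongrightarrow> f \<gamma> (fst (x0, y0)) - snd (x0, y0)) (nhds (x0, y0))"
      by (intro tendsto_diff 1)
    show "\<forall>\<^sub>F z in nhds (x0, y0). y0 < f \<gamma> x0 \<longrightarrow> snd z < f \<gamma> (fst z)"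
      using order_tendstoD(1)[OF 2, of 0] by (cases "y0 < f \<gamma> x0") auto
    show "\<forall>\<^sub>F z in nhds (x0, y0). f \<gamma> x0 < y0 \<longrightarrow> f \<gamma> (fst z) < snd z"
      using order_tendstoD(2)[OF 2, of 0] by (cases "f \<gamma> x0 < y0") auto
  qed simp
  have fs: "(fst \<longlongrightarrow> x0) (nhds (x0, y0))"
    using tendsto_fst[OF filterlim_ident, of "(x0, y0)"] by simp
  have ev2: "\<forall>\<^sub>F z in nhds (x0, y0). \<forall>\<gamma>\<in>{1..n}. (x0 < c \<gamma> \<longrightarrow> fst z < c \<gamma>) \<and> (c \<gamma> < x0 \<longrightarrow> c \<gamma> < fst z) \<and>
      c \<gamma> - pi < fst z \<and> fst z < c \<gamma> + pi"
  proof (intro eventually_ball_finite ballI eventually_conj)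
    fix \<gamma> assume \<gamma>: "\<gamma> \<in> {1..n}"
    show "\<forall>\<^sub>F z in nhds (x0, y0). x0 < c \<gamma> \<longrightarrow> fst z < c \<gamma>"
      using order_tendstoD(2)[OF fs, of "c \<gamma>"] by (cases "x0 < c \<gamma>") auto
    show "\<forall>\<^sub>F z in nhds (x0, y0). c \<gamma> < x0 \<longrightarrow> c \<gamma> < fst z"
      using order_tendstoD(1)[OF fs, of "c \<gamma>"] by (cases "c \<gamma> < x0") auto
    show "\<forall>\<^sub>F z in nhds (x0, y0). c \<gamma> - pi < fst z" "\<forall>\<^sub>F z in nhds (x0, y0). fst z < c \<gamma> + pi"
      using order_tendstoD[OF fs] J \<gamma> unfolding J_def by blast+
  qed simp
  show ?thesis using ev1 ev2
  proof eventually_elim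
    case (elim z)
    have Jz: "J (fst z)" using elim(2) by (auto simp: J_def)
    have up: "snd z < f \<gamma> (fst z) \<longleftrightarrow> y0 < f \<gamma> x0" and off: "f \<gamma> (fst z) \<noteq> snd z" if "\<gamma> \<in> {1..n}" for \<gamma>
      using elim(1) o that unfolding off_def by (metis less_asym less_irrefl linorder_neqE)+
    have cc: "fst z < c \<gamma> \<longleftrightarrow> x0 < c \<gamma>" if "\<gamma> \<in> {1..n}" "c \<gamma> \<noteq> x0" for \<gamma>
      using elim(2) that by (metis less_asym linorder_neqE)
    have "off (fst z) (snd z)" using off by (simp add: off_def)
    then show ?case using Jz N_cong[OF _ o Jz J _ _ up cc] by auto
  qed
qed

text \<open>The thresholds \<open>k + p - 1\<close> and \<open>k + p\<close> select the indices
  \<open>\<ge> p\<close> and \<open>> p\<close>. So this counts the curves with index exactly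
  \<open>p\<close> above the point, and it becomes the indicator of the region below curve
  \<open>p\<close>.\<close>

definition D :: "nat \<Rightarrow> real \<Rightarrow> real \<Rightarrow> int" where "D p x y = N (k + p - 1) x y - N (k + p) x y"

lemma D_local:
  assumes "off x y" "J x" "p \<in> {1..n - 2 * k}"
  shows "\<forall>\<^sub>F z in nhds (x, y). J (fst z) \<and> off (fst z) (snd z) \<and> D p (fst z) (snd z) = D p x y"
  using N_local[OF assms(1,2)]
proof eventually_elim
  case (elim z)
  have "k + p - 1 \<in> {k..n - k}" "k + p \<in> {k..n - k}" using assms(3) nk by auto
  then show ?case using elim by (simp add: D_def)
qed

lemma D_local_x:
  assumes "off x y" "J x" "p \<in> {1..n - 2 * k}"
  shows "\<forall>\<^sub>F x' in nhds x. J x' \<and> off x' y \<and> D p x' y = D p x y"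
proof -
  have "filterlim (\<lambda>x'. (x', y)) (nhds (x, y)) (nhds x)"
    by (intro tendsto_Pair filterlim_ident tendsto_const)
  from eventually_compose_filterlim[OF D_local[OF assms] this] show ?thesis by simp
qed

lemma D_local_y:
  assumes "off x y" "J x" "p \<in> {1..n - 2 * k}"
  shows "\<forall>\<^sub>F y' in nhds y. off x y' \<and> D p x y' = D p x y"
proof -
  have "filterlim (\<lambda>y'. (x, y')) (nhds (x, y)) (nhds y)"
    by (intro tendsto_Pair filterlim_ident tendsto_const)
  from eventually_compose_filterlim[OF D_local[OF assms] this] show ?thesis
    by (rule eventually_mono) simp
qed

lemma bit_antimono: "\<alpha> \<in> {1..n} \<Longrightarrow> bit \<alpha> t' x \<Longrightarrow> t \<le> t' \<Longrightarrow> t' \<le> n \<Longrightarrow> bit \<alpha> t x"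
  using bitR_antimono unfolding bit_def by (cases "c \<alpha> \<le> x") auto

lemma D_step:
  assumes "\<alpha> \<in> {1..n}" "y2 < f \<alpha> x" "f \<alpha> x < y1" "J x" "p \<in> {1..n - 2 * k}" "adj \<alpha> x y1" "adj \<alpha> x y2"
  shows "D p x y2 - D p x y1 = of_bool (Ker \<alpha> x \<and> bit \<alpha> (k + p - 1) x \<and> \<not> bit \<alpha> (k + p) x)"
proof -
  have t: "k \<le> k + p - 1" "k + p - 1 \<le> n - k" "k \<le> k + p" "k + p \<le> n - k" "k + p \<le> n" "k + p - 1 \<le> k + p"
    using assms(5) nk by auto
  have "bit \<alpha> (k + p) x \<Longrightarrow> bit \<alpha> (k + p - 1) x" using bit_antimono[OF assms(1) _ t(6,5)] by simp
  then show ?thesis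
    using N_step[OF assms(1-4) t(1,2) assms(6,7)] N_step[OF assms(1-4) t(3,4) assms(6,7)]
    by (cases "Ker \<alpha> x"; cases "bit \<alpha> (k + p - 1) x"; cases "bit \<alpha> (k + p) x") (simp_all add: D_def)
qed

text \<open>At a generic abscissa the lines between the two heights are passed one at a time, and by
  \<open>D_step\<close> no passage downwards decreases \<open>D\<close>. The induction removes the
  lowest of these lines.\<close>

lemma D_mono_generic:
  assumes inj: "inj_on (\<lambda>\<alpha>. f \<alpha> x) {1..n}" and J: "J x" and p: "p \<in> {1..n - 2 * k}"
    and "off x y1" "off x y2" "y2 \<le> y1"
  shows "D p x y1 \<le> D p x y2"
  using assms(5,6)
proof (induction "card {\<gamma> \<in> {1..n}. y2 < f \<gamma> x \<and> f \<gamma> x < y1}" arbitrary: y2 rule: less_induct)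
  case less
  define S where "S = {\<gamma> \<in> {1..n}. y2 < f \<gamma> x \<and> f \<gamma> x < y1}"
  have fS: "finite S" by (simp add: S_def)
  show ?case
  proof (cases "S = {}")
    case True
    have t: "k \<le> k + p - 1" "k + p - 1 \<le> n - k" "k \<le> k + p" "k + p \<le> n - k" using p nk by auto
    have up: "y1 < f \<gamma> x \<longleftrightarrow> y2 < f \<gamma> x" if "\<gamma> \<in> {1..n}" for \<gamma>
      using True that assms(4) less.prems unfolding S_def off_def by force
    have "N (k + p - 1) x y1 = N (k + p - 1) x y2" "N (k + p) x y1 = N (k + p) x y2"
      using N_cong[OF assms(4) less.prems(1) J J t(1,2) up] N_cong[OF assms(4) less.prems(1) J J t(3,4) up] by auto
    then show ?thesis by (simp add: D_def)
  next
    case False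
    then have "Min ((\<lambda>\<gamma>. f \<gamma> x) ` S) \<in> (\<lambda>\<gamma>. f \<gamma> x) ` S" using fS by (intro Min_in) auto
    then obtain \<alpha> where \<alpha>: "\<alpha> \<in> S" "f \<alpha> x = Min ((\<lambda>\<gamma>. f \<gamma> x) ` S)" by auto
    then have le: "f \<alpha> x \<le> f \<gamma> x" if "\<gamma> \<in> S" for \<gamma> using that fS by simp
    have \<alpha>n: "\<alpha> \<in> {1..n}" "y2 < f \<alpha> x" "f \<alpha> x < y1" using \<alpha>(1) by (auto simp: S_def)
    have ne: "f \<gamma> x \<noteq> f \<alpha> x" if "\<gamma> \<in> {1..n}" "\<gamma> \<noteq> \<alpha>" for \<gamma>
      using inj_onD[OF inj, of \<gamma> \<alpha>] that \<alpha>n by auto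
    define T where "T = insert y1 ((\<lambda>\<gamma>. f \<gamma> x) ` (S - {\<alpha>}))"
    have fT: "finite T" "T \<noteq> {}" using fS by (auto simp: T_def)
    define w where "w = Min T"
    have "f \<alpha> x < w" unfolding w_def using fT
    proof (subst Min_gr_iff)
      show "\<forall>a\<in>T. f \<alpha> x < a"
      proof
        fix a assume "a \<in> T"
        then consider "a = y1" | \<gamma> where "\<gamma> \<in> S" "\<gamma> \<noteq> \<alpha>" "a = f \<gamma> x" by (auto simp: T_def)
        then show "f \<alpha> x < a"
        proof cases
          case 2
          then have "\<gamma> \<in> {1..n}" by (auto simp: S_def)
          then show ?thesis using le[OF 2(1)] ne[of \<gamma>] 2 by force
        qed (use \<alpha>n in simp)
      qed
    qed auto
    have wy: "w \<le> y1" and wS: "\<gamma> \<in> S \<Longrightarrow> \<gamma> \<noteq> \<alpha> \<Longrightarrow> w \<le> f \<gamma> x" for \<gamma>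
      unfolding w_def using fT by (auto simp: T_def)
    \<comment> \<open>Halfway between the lowest line and the next obstacle above it, which may be
      \<open>y1\<close> itself.\<close>
    define y' where "y' = (f \<alpha> x + w) / 2"
    have y': "f \<alpha> x < y'" "y' < w" "y' < y1" using \<open>f \<alpha> x < w\<close> wy by (auto simp: y'_def)
    have adj2: "adj \<alpha> x y2" unfolding adj_def
    proof (intro ballI impI)
      fix \<gamma> assume \<gamma>: "\<gamma> \<in> {1..n}" "\<gamma> \<noteq> \<alpha>"
      show "(y2 < f \<gamma> x \<longleftrightarrow> f \<alpha> x < f \<gamma> x) \<and> (f \<gamma> x < y2 \<longleftrightarrow> f \<gamma> x < f \<alpha> x)"
      proof (cases "\<gamma> \<in> S")
        case True
        then show ?thesis using le[OF True] ne[OF \<gamma>] \<alpha>n by (auto simp: S_def)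
      next
        case False
        then have "f \<gamma> x < y2 \<or> y1 \<le> f \<gamma> x" using \<gamma> less.prems(1) by (force simp: S_def off_def)
        then show ?thesis using \<alpha>n by auto
      qed
    qed
    have adj': "adj \<alpha> x y'" unfolding adj_def
    proof (intro ballI impI)
      fix \<gamma> assume \<gamma>: "\<gamma> \<in> {1..n}" "\<gamma> \<noteq> \<alpha>"
      show "(y' < f \<gamma> x \<longleftrightarrow> f \<alpha> x < f \<gamma> x) \<and> (f \<gamma> x < y' \<longleftrightarrow> f \<gamma> x < f \<alpha> x)"
      proof (cases "\<gamma> \<in> S")
        case True
        then show ?thesis using wS[OF True \<gamma>(2)] y' by auto
      next
        case False
        then have "f \<gamma> x < y2 \<or> y1 \<le> f \<gamma> x" using \<gamma> less.prems(1) by (force simp: S_def off_def)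
        then show ?thesis using \<alpha>n y' by auto
      qed
    qed
    have o': "off x y'" using wire_counts(1)[OF \<alpha>n(1,2) y'(1) _ adj' adj2, of n] by simp
    have "{\<gamma> \<in> {1..n}. y' < f \<gamma> x \<and> f \<gamma> x < y1} \<subset> S"
    proof
      show "{\<gamma> \<in> {1..n}. y' < f \<gamma> x \<and> f \<gamma> x < y1} \<subseteq> S" using y' \<alpha>n by (auto simp: S_def)
      have "\<alpha> \<notin> {\<gamma> \<in> {1..n}. y' < f \<gamma> x \<and> f \<gamma> x < y1}" using y' by auto
      then show "{\<gamma> \<in> {1..n}. y' < f \<gamma> x \<and> f \<gamma> x < y1} \<noteq> S" using \<alpha>(1) by metis
    qed
    then have "card {\<gamma> \<in> {1..n}. y' < f \<gamma> x \<and> f \<gamma> x < y1} < card S" by (rule psubset_card_mono[OF fS])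
    then have "D p x y1 \<le> D p x y'" using less.hyps[of y'] o' y'(3) by (simp add: S_def)
    moreover have "D p x y2 - D p x y' \<ge> 0" unfolding D_step[OF \<alpha>n(1,2) y'(1) J p adj' adj2] by simp
    ultimately show ?thesis by simp
  qed
qed

text \<open>Both heights are off the lines, where \<open>D\<close> is locally constant, so the
  abscissa can be moved to a generic one.\<close>

lemma D_mono:
  assumes J: "J x" and p: "p \<in> {1..n - 2 * k}" and "off x y1" "off x y2" "y2 \<le> y1"
  shows "D p x y1 \<le> D p x y2"
proof -
  have 1: "\<forall>\<^sub>F x' in at x. J x' \<and> off x' y1 \<and> D p x' y1 = D p x y1"
    "\<forall>\<^sub>F x' in at x. J x' \<and> off x' y2 \<and> D p x' y2 = D p x y2"
    using D_local_x[OF assms(3) J p] D_local_x[OF assms(4) J p] by (auto simp: eventually_nhds_conv_at)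
  obtain x' where "J x'" "off x' y1" "off x' y2" "D p x' y1 = D p x y1" "D p x' y2 = D p x y2"
    "inj_on (\<lambda>\<alpha>. f \<alpha> x') {1..n}"
    using eventually_happens'[OF at_neq_bot eventually_conj[OF 1(1) eventually_conj[OF 1(2) gen]]] by blast
  then show ?thesis using D_mono_generic[of x' p y1 y2] p assms(5) by simp
qed

section \<open>The curves as boundaries of regions\<close>

lemma D_low: "p \<in> {1..n - 2 * k} \<Longrightarrow> ab x y \<ge> n - k \<Longrightarrow> D p x y = 1"
  using nk by (auto simp: D_def N_def of_nat_diff)

lemma D_high: "ab x y \<le> k \<Longrightarrow> D p x y = 0"
  by (simp add: D_def N_def)

lemma off_between:
  assumes "u < v" obtains y where "u < y" "y < v" "off x y"
proof -
  have "infinite ({u<..<v} - (\<lambda>\<gamma>. f \<gamma> x) ` {1..n})" using assms by (simp add: infinite_Ioo)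
  then obtain y where "y \<in> {u<..<v} - (\<lambda>\<gamma>. f \<gamma> x) ` {1..n}" using infinite_imp_nonempty by blast
  then show thesis by (intro that[of y]) (auto simp: off_def)
qed

lemma low_high:
  obtains l h where "off x l" "ab x l = n" "off x h" "ab x h = 0"
proof -
  define V where "V = insert 0 ((\<lambda>\<gamma>. f \<gamma> x) ` {1..n})"
  have V: "finite V" "\<gamma> \<in> {1..n} \<Longrightarrow> f \<gamma> x \<in> V" for \<gamma> by (auto simp: V_def)
  have 1: "Min V - 1 < f \<gamma> x" "f \<gamma> x < Max V + 1" if "\<gamma> \<in> {1..n}" for \<gamma>
    using Min_le[OF V(1) V(2)[OF that]] Max_ge[OF V(1) V(2)[OF that]] by linarith+
  have "{\<gamma> \<in> {1..n}. Min V - 1 < f \<gamma> x} = {1..n}" "{\<gamma> \<in> {1..n}. Max V + 1 < f \<gamma> x} = {}"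
    using 1 by fastforce+
  moreover have "off x (Min V - 1)" "off x (Max V + 1)" using 1 by (force simp: off_def)+
  ultimately show thesis by (intro that[of "Min V - 1" "Max V + 1"]) (simp_all add: ab_def)
qed

lemma ab_mono: "y2 \<le> y1 \<Longrightarrow> ab x y1 \<le> ab x y2"
  by (auto simp: ab_def intro!: card_mono)

definition lam :: "nat \<Rightarrow> real \<Rightarrow> real" where "lam p x = Sup {y. off x y \<and> D p x y = 1}"

lemma D_01:
  assumes "J x" "p \<in> {1..n - 2 * k}" "off x y" shows "D p x y = 0 \<or> D p x y = 1"
proof -
  obtain l h where lh: "off x l" "ab x l = n" "off x h" "ab x h = 0" by (rule low_high)
  have "D p x y \<le> 1"
  proof (cases "l \<le> y")
    case True
    then show ?thesis using D_mono[OF assms(1,2,3) lh(1) True] D_low[OF assms(2), of x l] lh(2) by simp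
  next
    case False
    then have "ab x y \<ge> n - k" using ab_mono[of y l x] lh by simp
    then show ?thesis using D_low[OF assms(2)] by simp
  qed
  moreover have "0 \<le> D p x y"
  proof (cases "y \<le> h")
    case True
    then show ?thesis using D_mono[OF assms(1,2) lh(3) assms(3) True] D_high[of x h p] lh(4) by simp
  next
    case False
    then have "ab x y \<le> k" using ab_mono[of h y x] lh by simp
    then show ?thesis using D_high by simp
  qed
  ultimately show ?thesis by linarith
qed

lemma lam_char:
  assumes "J x" "p \<in> {1..n - 2 * k}" "off x y"
  shows "y < lam p x \<Longrightarrow> D p x y = 1" "lam p x < y \<Longrightarrow> D p x y = 0"
proof -
  let ?S = "{y. off x y \<and> D p x y = 1}"
  obtain l h where lh: "off x l" "ab x l = n" "off x h" "ab x h = 0" by (rule low_high)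
  have ne: "l \<in> ?S" using lh D_low[OF assms(2)] by simp
  have bdd: "bdd_above ?S"
  proof (rule bdd_aboveI[of _ h])
    fix y assume y: "y \<in> ?S"
    show "y \<le> h"
    proof (rule ccontr)
      assume "\<not> y \<le> h"
      then have "ab x y \<le> k" using ab_mono[of h y x] lh by simp
      then show False using y D_high[of x y p] by simp
    qed
  qed
  { assume "y < lam p x"
    then obtain y' where "y' \<in> ?S" "y < y'" unfolding lam_def using less_cSup_iff[OF _ bdd] ne by blast
    then have "1 \<le> D p x y" using D_mono[OF assms(1,2), of y' y] assms(3) by simp
    then show "D p x y = 1" using D_01[OF assms] by auto }
  { assume "lam p x < y"
    then have "y \<notin> ?S" using cSup_upper[OF _ bdd, of y] unfolding lam_def by auto
    then show "D p x y = 0" using D_01[OF assms] assms(3) by auto }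
qed

lemma lam_unique:
  assumes "J x" "p \<in> {1..n - 2 * k}"
    and "\<And>y. off x y \<Longrightarrow> y < v \<Longrightarrow> D p x y = 1" "\<And>y. off x y \<Longrightarrow> v < y \<Longrightarrow> D p x y = 0"
  shows "lam p x = v"
proof (rule ccontr)
  assume "lam p x \<noteq> v"
  then consider "lam p x < v" | "v < lam p x" by linarith
  then show False
  proof cases
    case 1
    obtain y where "lam p x < y" "y < v" "off x y" using off_between[OF 1] .
    then show False using assms lam_char(2)[OF assms(1,2)] by force
  next
    case 2
    obtain y where "v < y" "y < lam p x" "off x y" using off_between[OF 2] .
    then show False using assms lam_char(1)[OF assms(1,2)] by force
  qed
qed

text \<open>\<open>D\<close> is locally constant off the lines but jumps at the boundary of its
  region, so the boundary runs on lines.\<close>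

lemma lam_not_off:
  assumes "J x" "p \<in> {1..n - 2 * k}" shows "\<not> off x (lam p x)"
proof
  assume o: "off x (lam p x)"
  obtain e where e: "e > 0" "\<And>y. dist y (lam p x) < e \<Longrightarrow> off x y \<and> D p x y = D p x (lam p x)"
    using D_local_y[OF o assms] unfolding eventually_nhds_metric by blast
  have "off x (lam p x + e/2) \<and> D p x (lam p x + e/2) = D p x (lam p x)"
    "off x (lam p x - e/2) \<and> D p x (lam p x - e/2) = D p x (lam p x)"
    using e(1) by (intro e(2), simp add: dist_real_def)+
  then show False
    using lam_char[OF assms, of "lam p x + e/2"] lam_char[OF assms, of "lam p x - e/2"] e(1) by auto
qed

text \<open>Heights slightly below and slightly above the curve that avoid the lines keep their
  values \<open>1\<close> and \<open>0\<close> for nearby abscissas and trap the curve between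
  them.\<close>

lemma isCont_lam:
  assumes "J x" "p \<in> {1..n - 2 * k}" shows "isCont (lam p) x"
  unfolding isCont_def tendsto_iff
proof (intro allI impI)
  fix e :: real assume "e > 0"
  obtain y1 where y1: "lam p x - e < y1" "y1 < lam p x" "off x y1"
    using off_between[of "lam p x - e" "lam p x"] \<open>e > 0\<close> by auto
  obtain y2 where y2: "lam p x < y2" "y2 < lam p x + e" "off x y2"
    using off_between[of "lam p x" "lam p x + e"] \<open>e > 0\<close> by auto
  have "\<forall>\<^sub>F x' in nhds x. dist (lam p x') (lam p x) < e"
    using D_local_x[OF y1(3) assms] D_local_x[OF y2(3) assms]
  proof eventually_elim
    case (elim x')
    have "D p x' y1 = 1" "D p x' y2 = 0"
      using elim lam_char(1)[OF assms y1(3,2)] lam_char(2)[OF assms y2(3,1)] by auto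
    then have "y1 \<le> lam p x'" "lam p x' \<le> y2"
      using lam_char[of x' p y1] lam_char[of x' p y2] elim assms(2) by force+
    then show ?case using y1 y2 by (auto simp: dist_real_def)
  qed
  then show "\<forall>\<^sub>F x' in at x. dist (lam p x') (lam p x) < e"
    by (simp add: eventually_nhds_conv_at)
qed

text \<open>Applied at both thresholds of \<open>D\<close>, \<open>N_pi\<close> gives
  \<open>D p (x + pi) y = 1 - D p x (- y)\<close>, so the regions above and below the curve are
  exchanged.\<close>

lemma lam_pi:
  assumes "J x" "J (x + pi)" "p \<in> {1..n - 2 * k}" shows "lam p (x + pi) = - lam p x"
proof (rule lam_unique[OF assms(2,3)])
  fix y assume o: "off (x + pi) y"
  then have o': "off x (- y)" by (auto simp: off_def fpi)
  have t: "k \<le> k + p - 1" "k + p - 1 \<le> n - k" "k \<le> k + p" "k + p \<le> n - k" using assms(3) nk by auto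
  have "D p (x + pi) y = 1 - D p x (- y)"
    using N_pi[OF o' assms(1,2) t(1,2)] N_pi[OF o' assms(1,2) t(3,4)] assms(3) by (simp add: D_def of_nat_diff)
  then show "y < - lam p x \<Longrightarrow> D p (x + pi) y = 1" "- lam p x < y \<Longrightarrow> D p (x + pi) y = 0"
    using lam_char[OF assms(1,3) o'] by auto
qed

text \<open>Clamping to the levels of the kernel: by \<open>N_at_k\<close>,
  \<open>cl (ab x y) - k\<close> is the number of all curves above a point off the lines.\<close>

definition cl :: "nat \<Rightarrow> nat" where "cl i = min (max i k) (n - k)"

lemma isolate:
  obtains d where "d > 0" "\<And>\<gamma>. \<gamma> \<in> {1..n} \<Longrightarrow> f \<gamma> x \<noteq> y \<Longrightarrow> d < \<bar>f \<gamma> x - y\<bar>"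
proof -
  obtain d where d: "d > 0" "\<forall>v\<in>(\<lambda>\<gamma>. f \<gamma> x) ` {1..n}. v \<noteq> y \<longrightarrow> d \<le> dist y v"
    using finite_set_avoid[of "(\<lambda>\<gamma>. f \<gamma> x) ` {1..n}" y] by auto
  show thesis
  proof
    show "d/2 > 0" using d by simp
    show "d/2 < \<bar>f \<gamma> x - y\<bar>" if "\<gamma> \<in> {1..n}" "f \<gamma> x \<noteq> y" for \<gamma>
    proof -
      have "d \<le> dist y (f \<gamma> x)" using d(2) that by blast
      then show ?thesis using d(1) by (simp add: dist_real_def abs_minus_commute)
    qed
  qed
qed

text \<open>Summed over \<open>p\<close>, \<open>D\<close> telescopes to the number of all curves
  above a point. Its jump across the height \<open>y\<close> is the number of curves through the
  point.\<close>

lemma card_lam: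
  assumes J: "J x"
  shows "card {p \<in> {1..n - 2 * k}. lam p x = y} =
    cl (card {\<gamma> \<in> {1..n}. y \<le> f \<gamma> x}) - cl (card {\<gamma> \<in> {1..n}. y < f \<gamma> x})"
proof -
  obtain d where d: "d > 0" "\<And>\<gamma>. \<gamma> \<in> {1..n} \<Longrightarrow> f \<gamma> x \<noteq> y \<Longrightarrow> d < \<bar>f \<gamma> x - y\<bar>" using isolate[of x y] by blast
  have d': "y - d < f \<gamma> x \<longleftrightarrow> y \<le> f \<gamma> x" "y + d < f \<gamma> x \<longleftrightarrow> y < f \<gamma> x" "f \<gamma> x \<noteq> y - d" "f \<gamma> x \<noteq> y + d" if "\<gamma> \<in> {1..n}" for \<gamma>
    using d(2)[OF that] d(1) by (cases "f \<gamma> x = y"; auto)+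
  have o: "off x (y - d)" "off x (y + d)" using d' by (auto simp: off_def)
  have ab: "ab x (y - d) = card {\<gamma> \<in> {1..n}. y \<le> f \<gamma> x}" "ab x (y + d) = card {\<gamma> \<in> {1..n}. y < f \<gamma> x}"
    unfolding ab_def using d' by (auto intro!: arg_cong[where f = card])
  have tel: "(\<Sum>p = 1..j. D p x y') = N k x y' - N (k + j) x y'" for j y'
    by (induction j) (auto simp: D_def)
  have nn: "k + (n - 2 * k) = n - k" using nk by simp
  have sum: "(\<Sum>p = 1..n - 2 * k. D p x y') = int (cl (ab x y')) - int k" if "off x y'" for y'
    unfolding tel nn using N_at_k[OF that] N_at_nk[OF that] by (simp add: cl_def)
  have "D p x (y - d) - D p x (y + d) = of_bool (lam p x = y)" if p: "p \<in> {1..n - 2 * k}" for p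
  proof -
    obtain \<gamma> where \<gamma>: "\<gamma> \<in> {1..n}" "f \<gamma> x = lam p x" using lam_not_off[OF J p] by (auto simp: off_def)
    consider "lam p x = y" | "lam p x < y - d" | "lam p x > y + d"
      using d(2)[OF \<gamma>(1)] \<gamma>(2) by fastforce
    then show ?thesis
      using lam_char[OF J p o(1)] lam_char[OF J p o(2)] d(1) by cases auto
  qed
  then have "(\<Sum>p = 1..n - 2 * k. D p x (y - d)) - (\<Sum>p = 1..n - 2 * k. D p x (y + d)) =
      (\<Sum>p = 1..n - 2 * k. of_bool (lam p x = y))"
    unfolding sum_subtractf[symmetric] by (intro sum.cong) auto
  also have "\<dots> = int (card {p \<in> {1..n - 2 * k}. lam p x = y})"
    by (simp add: of_bool_def sum.If_cases Int_def)
  finally have "int (card {p \<in> {1..n - 2 * k}. lam p x = y}) = int (cl (ab x (y - d))) - int (cl (ab x (y + d)))"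
    using sum[OF o(1)] sum[OF o(2)] by simp
  then show ?thesis using ab by simp
qed

lemma lam_bit:
  assumes J: "J x" and inj: "inj_on (\<lambda>\<alpha>. f \<alpha> x) {1..n}" and \<alpha>: "\<alpha> \<in> {1..n}" and p: "p \<in> {1..n - 2 * k}"
  shows "lam p x = f \<alpha> x \<longleftrightarrow> Ker \<alpha> x \<and> bit \<alpha> (k + p - 1) x \<and> \<not> bit \<alpha> (k + p) x"
proof -
  let ?y = "f \<alpha> x"
  obtain d where d: "d > 0" "\<And>\<gamma>. \<gamma> \<in> {1..n} \<Longrightarrow> f \<gamma> x \<noteq> ?y \<Longrightarrow> d < \<bar>f \<gamma> x - ?y\<bar>" using isolate[of x ?y] by blast
  have ad: "adj \<alpha> x (?y + d)" "adj \<alpha> x (?y - d)" unfolding adj_def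
    using d inj_onD[OF inj] \<alpha> by (smt (verit))+
  have o: "off x (?y + d)" "off x (?y - d)"
    using wire_counts(1,2)[OF \<alpha> _ _ _ ad, of n] d(1) by auto
  obtain \<gamma> where \<gamma>: "\<gamma> \<in> {1..n}" "f \<gamma> x = lam p x" using lam_not_off[OF J p] by (auto simp: off_def)
  consider "lam p x = ?y" | "lam p x < ?y - d" | "lam p x > ?y + d"
    using d(2)[OF \<gamma>(1)] \<gamma>(2) by fastforce
  then have "D p x (?y - d) - D p x (?y + d) = of_bool (lam p x = ?y)"
    using lam_char[OF J p o(1)] lam_char[OF J p o(2)] d(1) by cases auto
  then show ?thesis using D_step[OF \<alpha> _ _ J p ad] d(1) by auto
qed

section \<open>Extension of the curves to all abscissas\<close>

lemma c_dist:
  assumes "\<alpha> \<in> {1..n}" "\<beta> \<in> {1..n}" shows "\<bar>c \<alpha> - c \<beta>\<bar> < pi"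
proof -
  consider "\<alpha> < \<beta>" | "\<beta> < \<alpha>" | "\<alpha> = \<beta>" by linarith
  then show ?thesis
    by cases (use cX[OF assms] cX[OF assms(2,1)] in \<open>auto simp: abs_if\<close>)
qed

text \<open>The cut abscissas differ by less than \<open>pi\<close>, so the intervals from
  \<open>c \<gamma> - pi\<close> to \<open>c \<gamma>\<close> have a common point. The closed period
  that starts there lies in \<open>J\<close>.\<close>

lemma ex_base: obtains a where "\<And>\<gamma>. \<gamma> \<in> {1..n} \<Longrightarrow> c \<gamma> - pi < a \<and> a < c \<gamma>"
proof -
  let ?C = "c ` {1..n}"
  have C: "finite ?C" "?C \<noteq> {}" using nk by auto
  obtain \<alpha> \<beta> where "\<alpha> \<in> {1..n}" "Min ?C = c \<alpha>" "\<beta> \<in> {1..n}" "Max ?C = c \<beta>"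
    using Min_in[OF C] Max_in[OF C] by auto
  then have 1: "Max ?C - pi < Min ?C" using c_dist[of \<alpha> \<beta>] by (auto simp: abs_if split: if_splits)
  show thesis
  proof
    fix \<gamma> assume "\<gamma> \<in> {1..n}"
    then have "Min ?C \<le> c \<gamma>" "c \<gamma> \<le> Max ?C" by simp_all
    then show "c \<gamma> - pi < (Max ?C - pi + Min ?C) / 2 \<and> (Max ?C - pi + Min ?C) / 2 < c \<gamma>" using 1 by (auto simp: field_simps)
  qed
qed

text \<open>One closed period inside \<open>J\<close> determines the antiperiodic curve.
  \<open>J\<close> extends beyond this period at both ends, where \<open>lam_pi\<close> yields the
  agreement.\<close>

lemma ex_wire:
  assumes p: "p \<in> {1..n - 2 * k}"
  shows "\<exists>g. antiper g \<and> (\<forall>x. J x \<longrightarrow> g x = lam p x)"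
proof -
  obtain a where a: "\<And>\<gamma>. \<gamma> \<in> {1..n} \<Longrightarrow> c \<gamma> - pi < a \<and> a < c \<gamma>" using ex_base by blast
  have Ja: "J x" if "a \<le> x" "x \<le> a + pi" for x using a that unfolding J_def by force
  have "continuous_on {a..a + pi} (lam p)"
    using isCont_lam[OF Ja p] by (intro continuous_at_imp_continuous_on) auto
  moreover have "lam p (a + pi) = - lam p a" by (intro lam_pi p Ja) auto
  ultimately obtain g where g: "antiper g" "\<And>x. a \<le> x \<Longrightarrow> x \<le> a + pi \<Longrightarrow> g x = lam p x"
    using antiper_extension by blast
  have "g x = lam p x" if "J x" for x
  proof -
    obtain \<gamma> where \<gamma>: "\<gamma> \<in> {1..n}" using nk by fastforce
    have x: "a - pi < x" "x < a + pi + pi" using that a[OF \<gamma>] \<gamma> unfolding J_def by force+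
    consider "x < a" | "a \<le> x" "x \<le> a + pi" | "a + pi < x" by linarith
    then show ?thesis
    proof cases
      case 1
      then have "J (x + pi)" "g (x + pi) = lam p (x + pi)" using x by (auto intro: Ja g)
      then show ?thesis using lam_pi[OF that _ p] antiper_simps(1)[OF g(1), of x] by simp
    next
      case 3
      then have "J (x - pi)" "g (x - pi) = lam p (x - pi)" using x by (auto intro: Ja g)
      then show ?thesis using lam_pi[of "x - pi", OF _ _ p] that antiper_simps(2)[OF g(1), of x] by simp
    qed (rule g)
  qed
  then show ?thesis using g(1) by blast
qed

text \<open>The window of line \<alpha> may reach beyond \<open>J\<close>. One period earlier the
  abscissa is in \<open>J\<close> and left of \<open>c \<alpha>\<close>, so that \<open>bit\<close>
  there reads \<open>bitR\<close> at \<open>x\<close>, and the remaining quantities are mirrored by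
  \<open>tau\<close>.\<close>

lemma wire_bit:
  assumes g: "antiper g" "\<And>x. J x \<Longrightarrow> g x = lam p x" and p: "p \<in> {1..n - 2 * k}" and \<alpha>: "\<alpha> \<in> {1..n}"
    and x: "c \<alpha> \<le> x" "x < c \<alpha> + pi" and inj: "inj_on (\<lambda>\<alpha>. f \<alpha> x) {1..n}"
  shows "g x = f \<alpha> x \<longleftrightarrow> Ker \<alpha> x \<and> bitR \<alpha> (k + p - 1) x \<and> \<not> bitR \<alpha> (k + p) x"
proof (cases "J x")
  case True
  then show ?thesis using lam_bit[OF True inj \<alpha> p] g(2)[OF True] x(1) by (simp add: bit_def)
next
  case False
  then obtain \<gamma> where \<gamma>: "\<gamma> \<in> {1..n}" "\<not> (c \<gamma> - pi < x \<and> x < c \<gamma> + pi)" by (auto simp: J_def)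
  \<comment> \<open>From \<open>c \<alpha> \<le> x\<close> and \<open>c_dist\<close>,
    \<open>x\<close> exceeds every \<open>c \<gamma> - pi\<close>; so only the upper bound in
    \<open>J\<close> can fail.\<close>
  have "c \<gamma> \<le> x - pi" using c_dist[OF \<alpha> \<gamma>(1)] \<gamma>(2) x by (auto simp: abs_if split: if_splits)
  then have "c \<delta> - pi < x - pi \<and> x - pi < c \<delta> + pi" if "\<delta> \<in> {1..n}" for \<delta>
    using c_dist[OF \<gamma>(1) that] c_dist[OF \<alpha> that] x by (auto simp: abs_if split: if_splits)
  then have J: "J (x - pi)" by (simp add: J_def)
  have fm: "f \<delta> (x - pi) = - f \<delta> x" if "\<delta> \<in> {1..n}" for \<delta> using antiper_simps(2)[OF ap[OF that]] .
  have inj': "inj_on (\<lambda>\<alpha>. f \<alpha> (x - pi)) {1..n}"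
  proof (rule inj_onI)
    fix a b assume "a \<in> {1..n}" "b \<in> {1..n}" "f a (x - pi) = f b (x - pi)"
    then show "a = b" using inj_onD[OF inj, of a b] fm[of a] fm[of b] by simp
  qed
  have "{\<gamma> \<in> {1..n}. f \<alpha> (x - pi) < f \<gamma> (x - pi)} = {\<gamma> \<in> {1..n}. \<not> f \<alpha> x < f \<gamma> x} - {\<alpha>}"
  proof (intro set_eqI)
    fix \<delta>
    show "\<delta> \<in> {\<gamma> \<in> {1..n}. f \<alpha> (x - pi) < f \<gamma> (x - pi)} \<longleftrightarrow> \<delta> \<in> {\<gamma> \<in> {1..n}. \<not> f \<alpha> x < f \<gamma> x} - {\<alpha>}"
      using fm[OF \<alpha>] fm[of \<delta>] inj_onD[OF inj, of \<delta> \<alpha>] \<alpha> less_linear[of "f \<delta> x" "f \<alpha> x"]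
      by (cases "\<delta> \<in> {1..n}") auto
  qed
  then have "ab (x - pi) (f \<alpha> (x - pi)) = card ({\<gamma> \<in> {1..n}. \<not> f \<alpha> x < f \<gamma> x} - {\<alpha>})" by (simp add: ab_def)
  also have "\<dots> = card {\<gamma> \<in> {1..n}. \<not> f \<alpha> x < f \<gamma> x} - 1" using \<alpha> by (intro card_Diff_singleton) auto
  finally have "ab (x - pi) (f \<alpha> (x - pi)) = n - ab x (f \<alpha> x) - 1"
    using card_split[of "{1..n}" "\<lambda>\<gamma>. f \<alpha> x < f \<gamma> x"] by (simp add: ab_def)
  moreover have s: "{\<gamma> \<in> {1..n}. f \<alpha> x < f \<gamma> x} \<subset> {1..n}" using \<alpha> by force
  have "ab x (f \<alpha> x) < n" unfolding ab_def using psubset_card_mono[OF _ s] by simp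
  ultimately have "Ker \<alpha> (x - pi) \<longleftrightarrow> Ker \<alpha> x" unfolding Ker_def by auto
  moreover have "bit \<alpha> t (x - pi) \<longleftrightarrow> bitR \<alpha> t x" for t using x by (simp add: bit_def)
  moreover have "g x = f \<alpha> x \<longleftrightarrow> lam p (x - pi) = f \<alpha> (x - pi)"
    using g(2)[OF J] antiper_simps(2)[OF g(1), of x] fm[OF \<alpha>] by auto
  ultimately show ?thesis using lam_bit[OF J inj' \<alpha> p] by simp
qed

section \<open>Behaviour of the curves at a vertex\<close>

definition cond :: "nat \<Rightarrow> nat \<Rightarrow> bool" where
  "cond \<alpha> \<beta> \<longleftrightarrow> (\<exists>t. \<alpha> \<le> t \<and> t < \<beta> \<and> k \<le> A t (X \<alpha> \<beta>) (f \<alpha> (X \<alpha> \<beta>)) \<and> k \<le> B t (X \<alpha> \<beta>) (f \<alpha> (X \<alpha> \<beta>)))"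

lemma others_off_vertex:
  assumes "\<alpha> \<in> {1..n}" "\<beta> \<in> {1..n}" "\<alpha> < \<beta>" "\<gamma> \<in> {1..n}" "\<gamma> \<noteq> \<alpha>" "\<gamma> \<noteq> \<beta>"
  shows "f \<gamma> (X \<alpha> \<beta>) \<noteq> f \<alpha> (X \<alpha> \<beta>)"
proof
  assume "f \<gamma> (X \<alpha> \<beta>) = f \<alpha> (X \<alpha> \<beta>)"
  then have s: "{\<alpha>, \<beta>, \<gamma>} \<subseteq> {\<delta> \<in> {1..n}. f \<delta> (X \<alpha> \<beta>) = f \<alpha> (X \<alpha> \<beta>)}" using atX[OF assms(1-3)] assms by auto
  have "card {\<alpha>, \<beta>, \<gamma>} \<le> 2" using two[of "X \<alpha> \<beta>" "f \<alpha> (X \<alpha> \<beta>)"] card_mono[OF _ s] by simp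
  then show False using assms by auto
qed

text \<open>Close to a vertex only its two lines change their mutual order. Compared with the
  vertex, the upper line has the lower one as a further line below, and the lower line has the upper
  one as a further line above.\<close>

lemma vertex_counts:
  assumes ab: "\<alpha> \<in> {1..n}" "\<beta> \<in> {1..n}" "\<alpha> < \<beta>" and ul: "u = \<alpha> \<and> l = \<beta> \<or> u = \<beta> \<and> l = \<alpha>" and lt: "f l x < f u x"
    and near: "\<And>\<gamma>. \<gamma> \<in> {1..n} \<Longrightarrow> \<gamma> \<noteq> \<alpha> \<Longrightarrow> \<gamma> \<noteq> \<beta> \<Longrightarrow>
      (f \<alpha> (X \<alpha> \<beta>) < f \<gamma> (X \<alpha> \<beta>) \<longrightarrow> f u x < f \<gamma> x) \<and> (f \<gamma> (X \<alpha> \<beta>) < f \<alpha> (X \<alpha> \<beta>) \<longrightarrow> f \<gamma> x < f l x)"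
    and t: "t \<le> n"
  shows "A t x (f u x) = A t (X \<alpha> \<beta>) (f \<alpha> (X \<alpha> \<beta>))" "B t x (f u x) = B t (X \<alpha> \<beta>) (f \<alpha> (X \<alpha> \<beta>)) + (if l \<le> t then 1 else 0)"
    "A t x (f l x) = A t (X \<alpha> \<beta>) (f \<alpha> (X \<alpha> \<beta>)) + (if t < u then 1 else 0)" "B t x (f l x) = B t (X \<alpha> \<beta>) (f \<alpha> (X \<alpha> \<beta>))"
proof -
  let ?x = "X \<alpha> \<beta>" and ?y = "f \<alpha> (X \<alpha> \<beta>)"
  have *: "(f u x < f \<gamma> x \<longleftrightarrow> ?y < f \<gamma> ?x) \<and> (f l x < f \<gamma> x \<longleftrightarrow> ?y < f \<gamma> ?x \<or> \<gamma> = u) \<and>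
      (f \<gamma> x < f l x \<longleftrightarrow> f \<gamma> ?x < ?y) \<and> (f \<gamma> x < f u x \<longleftrightarrow> f \<gamma> ?x < ?y \<or> \<gamma> = l)" if "\<gamma> \<in> {1..n}" for \<gamma>
  proof (cases "\<gamma> = \<alpha> \<or> \<gamma> = \<beta>")
    case True
    then show ?thesis using ul lt atX[OF ab] ab by auto
  next
    case False
    then have "f \<gamma> ?x < ?y \<or> ?y < f \<gamma> ?x" "\<gamma> \<noteq> u" "\<gamma> \<noteq> l"
      using others_off_vertex[OF ab that] ul by auto
    then show ?thesis using near[OF that] False lt by auto
  qed
  have u: "u \<in> {1..n}" "l \<in> {1..n}" using ul ab by auto
  have nu: "\<not> ?y < f u ?x" "\<not> f l ?x < ?y" using ul atX[OF ab] by auto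
  show "A t x (f u x) = A t ?x ?y" unfolding A_def using * by (intro arg_cong[where f = card]) auto
  show "B t x (f l x) = B t ?x ?y" unfolding B_def using * t by (intro arg_cong[where f = card]) auto
  have "{\<gamma> \<in> {t<..n}. f l x < f \<gamma> x} = (if t < u then {u} else {}) \<union> {\<gamma> \<in> {t<..n}. ?y < f \<gamma> ?x}"
    using * u by auto
  then show "A t x (f l x) = A t ?x ?y + (if t < u then 1 else 0)" using nu by (simp add: A_def)
  have "{\<gamma> \<in> {1..t}. f \<gamma> x < f u x} = (if l \<le> t then {l} else {}) \<union> {\<gamma> \<in> {1..t}. f \<gamma> ?x < ?y}"
    using * u t by auto
  then show "B t x (f u x) = B t ?x ?y + (if l \<le> t then 1 else 0)" using nu by (simp add: B_def)
qed

lemma near_vertex: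
  assumes ab: "\<alpha> \<in> {1..n}" "\<beta> \<in> {1..n}" "\<alpha> < \<beta>"
  shows "\<forall>\<^sub>F x in nhds (X \<alpha> \<beta>). \<forall>\<gamma>\<in>{1..n} - {\<alpha>, \<beta>}. \<forall>u\<in>{\<alpha>, \<beta>}.
      (f \<alpha> (X \<alpha> \<beta>) < f \<gamma> (X \<alpha> \<beta>) \<longrightarrow> f u x < f \<gamma> x) \<and> (f \<gamma> (X \<alpha> \<beta>) < f \<alpha> (X \<alpha> \<beta>) \<longrightarrow> f \<gamma> x < f u x)"
proof (intro eventually_ball_finite ballI)
  fix \<gamma> u assume \<gamma>: "\<gamma> \<in> {1..n} - {\<alpha>, \<beta>}" and u: "u \<in> {\<alpha>, \<beta>}"
  then have un: "u \<in> {1..n}" "f u (X \<alpha> \<beta>) = f \<alpha> (X \<alpha> \<beta>)" using ab atX[OF ab] by auto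
  have t: "(f v \<longlongrightarrow> f v (X \<alpha> \<beta>)) (nhds (X \<alpha> \<beta>))" if "v \<in> {1..n}" for v
    using isCont_f[OF that, of "X \<alpha> \<beta>"] by (simp add: continuous_at tendsto_at_iff_tendsto_nhds)
  have "((\<lambda>x. f \<gamma> x - f u x) \<longlongrightarrow> f \<gamma> (X \<alpha> \<beta>) - f u (X \<alpha> \<beta>)) (nhds (X \<alpha> \<beta>))"
    using \<gamma> un by (intro tendsto_diff t) auto
  from order_tendstoD[OF this, of 0]
  show "\<forall>\<^sub>F x in nhds (X \<alpha> \<beta>). (f \<alpha> (X \<alpha> \<beta>) < f \<gamma> (X \<alpha> \<beta>) \<longrightarrow> f u x < f \<gamma> x) \<and> (f \<gamma> (X \<alpha> \<beta>) < f \<alpha> (X \<alpha> \<beta>) \<longrightarrow> f \<gamma> x < f u x)"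
    unfolding un(2) by (intro eventually_conj; cases "f \<alpha> (X \<alpha> \<beta>) < f \<gamma> (X \<alpha> \<beta>)"; cases "f \<gamma> (X \<alpha> \<beta>) < f \<alpha> (X \<alpha> \<beta>)") auto
qed auto

text \<open>Left of a vertex the upper index is the smaller one, whether or not the curves cross there. So curves
  that have crossed do not meet again inside the window.\<close>

lemma left_bits:
  assumes ab: "\<alpha> \<in> {1..n}" "\<beta> \<in> {1..n}" "\<alpha> < \<beta>" and "f \<beta> x < f \<alpha> x" "t \<le> n"
    and near: "\<forall>\<gamma>\<in>{1..n} - {\<alpha>, \<beta>}. \<forall>u\<in>{\<alpha>, \<beta>}.
      (f \<alpha> (X \<alpha> \<beta>) < f \<gamma> (X \<alpha> \<beta>) \<longrightarrow> f u x < f \<gamma> x) \<and> (f \<gamma> (X \<alpha> \<beta>) < f \<alpha> (X \<alpha> \<beta>) \<longrightarrow> f \<gamma> x < f u x)"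
    and "bitR \<alpha> t x"
  shows "bitR \<beta> t x"
proof -
  note v = vertex_counts[OF ab _ assms(4) _ assms(5)]
  have 1: "A t x (f \<alpha> x) = A t (X \<alpha> \<beta>) (f \<alpha> (X \<alpha> \<beta>))" "B t x (f \<alpha> x) = B t (X \<alpha> \<beta>) (f \<alpha> (X \<alpha> \<beta>)) + (if \<beta> \<le> t then 1 else 0)"
    "A t x (f \<beta> x) = A t (X \<alpha> \<beta>) (f \<alpha> (X \<alpha> \<beta>)) + (if t < \<alpha> then 1 else 0)" "B t x (f \<beta> x) = B t (X \<alpha> \<beta>) (f \<alpha> (X \<alpha> \<beta>))"
    by (rule v; use near in auto)+
  show ?thesis using assms(7,3) unfolding bitR_def 1 by (auto simp: min_def split: if_splits)
qed

text \<open>Right of the vertex \<beta> is the upper line. If the bits favour \<beta> at some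
  threshold, the upper curve has the larger index, which reverses the order on the left: the curves
  cross. The equivalence identifies these thresholds with the ones in \<open>cond\<close>.\<close>

lemma right_bits:
  assumes ab: "\<alpha> \<in> {1..n}" "\<beta> \<in> {1..n}" "\<alpha> < \<beta>" and "f \<alpha> x < f \<beta> x" "t \<le> n"
    and near: "\<forall>\<gamma>\<in>{1..n} - {\<alpha>, \<beta>}. \<forall>u\<in>{\<alpha>, \<beta>}.
      (f \<alpha> (X \<alpha> \<beta>) < f \<gamma> (X \<alpha> \<beta>) \<longrightarrow> f u x < f \<gamma> x) \<and> (f \<gamma> (X \<alpha> \<beta>) < f \<alpha> (X \<alpha> \<beta>) \<longrightarrow> f \<gamma> x < f u x)"
  shows "bitR \<beta> t x \<and> \<not> bitR \<alpha> t x \<longleftrightarrow> \<alpha> \<le> t \<and> t < \<beta> \<and> k \<le> A t (X \<alpha> \<beta>) (f \<alpha> (X \<alpha> \<beta>)) \<and> k \<le> B t (X \<alpha> \<beta>) (f \<alpha> (X \<alpha> \<beta>))"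
proof -
  note v = vertex_counts[OF ab _ assms(4) _ assms(5)]
  have 1: "A t x (f \<beta> x) = A t (X \<alpha> \<beta>) (f \<alpha> (X \<alpha> \<beta>))" "B t x (f \<beta> x) = B t (X \<alpha> \<beta>) (f \<alpha> (X \<alpha> \<beta>)) + (if \<alpha> \<le> t then 1 else 0)"
    "A t x (f \<alpha> x) = A t (X \<alpha> \<beta>) (f \<alpha> (X \<alpha> \<beta>)) + (if t < \<beta> then 1 else 0)" "B t x (f \<alpha> x) = B t (X \<alpha> \<beta>) (f \<alpha> (X \<alpha> \<beta>))"
    by (rule v; use near in auto)+
  show ?thesis using assms(3) unfolding bitR_def 1 by (auto simp: min_def split: if_splits)
qed

lemma cl_compl: "i \<le> n \<Longrightarrow> cl (n - i) = n - cl i"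
  using nk by (auto simp: cl_def min_def max_def)

text \<open>Every abscissa is a multiple of \<open>pi\<close> away from a point of \<open>J\<close>.
  For odd multiples the picture is upside down, and clamping commutes with complementation by
  \<open>cl_compl\<close>.\<close>

lemma card_wires:
  assumes g: "\<And>p. p \<in> {1..n - 2 * k} \<Longrightarrow> antiper (g p)" "\<And>p x. p \<in> {1..n - 2 * k} \<Longrightarrow> J x \<Longrightarrow> g p x = lam p x"
  shows "card {p \<in> {1..n - 2 * k}. g p x = y} = cl (card {\<gamma> \<in> {1..n}. y \<le> f \<gamma> x}) - cl (card {\<gamma> \<in> {1..n}. y < f \<gamma> x})"
proof -
  obtain a where a: "\<And>\<gamma>. \<gamma> \<in> {1..n} \<Longrightarrow> c \<gamma> - pi < a \<and> a < c \<gamma>" using ex_base by blast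
  define r where "r = \<lfloor>(x - a) / pi\<rfloor>"
  define x' where "x' = x - of_int r * pi"
  have "of_int r \<le> (x - a) / pi" "(x - a) / pi < of_int r + 1" unfolding r_def by linarith+
  then have "a \<le> x'" "x' \<le> a + pi" unfolding x'_def by (auto simp: field_simps)
  then have J: "J x'" using a unfolding J_def by force
  have x: "x = x' + of_int r * pi" by (simp add: x'_def)
  have gx: "g p x = sg r * lam p x'" if "p \<in> {1..n - 2 * k}" for p
    unfolding x using antiper_shift[OF g(1)[OF that]] g(2)[OF that J] by simp
  have fx: "f \<gamma> x = sg r * f \<gamma> x'" if "\<gamma> \<in> {1..n}" for \<gamma>
    unfolding x using antiper_shift[OF ap[OF that]] .
  note cl = card_lam[OF J]
  show ?thesis
  proof (cases "even r")
    case True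
    have "{p \<in> {1..n - 2 * k}. g p x = y} = {p \<in> {1..n - 2 * k}. lam p x' = y}"
      "{\<gamma> \<in> {1..n}. y \<le> f \<gamma> x} = {\<gamma> \<in> {1..n}. y \<le> f \<gamma> x'}" "{\<gamma> \<in> {1..n}. y < f \<gamma> x} = {\<gamma> \<in> {1..n}. y < f \<gamma> x'}"
      using gx fx True by (auto simp: sg_def)
    then show ?thesis using cl[of y] by simp
  next
    case False
    have 1: "{p \<in> {1..n - 2 * k}. g p x = y} = {p \<in> {1..n - 2 * k}. lam p x' = - y}"
      "{\<gamma> \<in> {1..n}. y \<le> f \<gamma> x} = {\<gamma> \<in> {1..n}. \<not> - y < f \<gamma> x'}" "{\<gamma> \<in> {1..n}. y < f \<gamma> x} = {\<gamma> \<in> {1..n}. \<not> - y \<le> f \<gamma> x'}"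
      using gx fx False by (auto simp: sg_def)
    have 2: "card {\<gamma> \<in> {1..n}. \<not> P \<gamma>} = n - card {\<gamma> \<in> {1..n}. P \<gamma>}" "card {\<gamma> \<in> {1..n}. P \<gamma>} \<le> n" for P :: "nat \<Rightarrow> bool"
      using card_split[of "{1..n}" P] by auto
    have 3: "cl i \<le> n" for i by (simp add: cl_def)
    have "cl (card {\<gamma> \<in> {1..n}. \<not> - y < f \<gamma> x'}) = n - cl (card {\<gamma> \<in> {1..n}. - y < f \<gamma> x'})"
      "cl (card {\<gamma> \<in> {1..n}. \<not> - y \<le> f \<gamma> x'}) = n - cl (card {\<gamma> \<in> {1..n}. - y \<le> f \<gamma> x'})"
      by (simp_all only: 2(1) cl_compl[OF 2(2)])
    moreover have "n - u - (n - v) = v - u" if "u \<le> n" "v \<le> n" for u v :: nat using that by arith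
    ultimately show ?thesis unfolding 1 cl by (simp only: 3)
  qed
qed

text \<open>The interface of the network: how many curves pass through each point, and for two
  curves at a vertex of the window, that the smaller index is above on the left and that they cross
  precisely under \<open>cond\<close>.\<close>

theorem greedy_wires:
  "\<exists>g. (\<forall>p\<in>{1..n - 2 * k}. antiper (g p)) \<and>
    (\<forall>x y. card {p \<in> {1..n - 2 * k}. g p x = y} =
       cl (card {\<gamma> \<in> {1..n}. y \<le> f \<gamma> x}) - cl (card {\<gamma> \<in> {1..n}. y < f \<gamma> x})) \<and>
    (\<forall>p\<in>{1..n - 2 * k}. \<forall>q\<in>{1..n - 2 * k}. \<forall>\<alpha>\<in>{1..n}. \<forall>\<beta>\<in>{1..n}. p < q \<longrightarrow> \<alpha> < \<beta> \<longrightarrow>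
      g p (X \<alpha> \<beta>) = f \<alpha> (X \<alpha> \<beta>) \<longrightarrow> g q (X \<alpha> \<beta>) = f \<alpha> (X \<alpha> \<beta>) \<longrightarrow>
      (\<forall>\<^sub>F h in at_right 0. g q (X \<alpha> \<beta> - h) < g p (X \<alpha> \<beta> - h) \<and>
        (if cond \<alpha> \<beta> then g p (X \<alpha> \<beta> + h) < g q (X \<alpha> \<beta> + h) else g q (X \<alpha> \<beta> + h) < g p (X \<alpha> \<beta> + h))))"
proof -
  have "\<forall>p\<in>{1..n - 2 * k}. \<exists>g. antiper g \<and> (\<forall>x. J x \<longrightarrow> g x = lam p x)" using ex_wire by blast
  then obtain g where g: "\<And>p. p \<in> {1..n - 2 * k} \<Longrightarrow> antiper (g p)" "\<And>p x. p \<in> {1..n - 2 * k} \<Longrightarrow> J x \<Longrightarrow> g p x = lam p x"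
    by (metis bchoice)
  have card: "card {p \<in> {1..n - 2 * k}. g p x = y} =
      cl (card {\<gamma> \<in> {1..n}. y \<le> f \<gamma> x}) - cl (card {\<gamma> \<in> {1..n}. y < f \<gamma> x})" for x y
    by (rule card_wires) (use g in auto)
  \<comment> \<open>At a height where no line passes, the two clamped counts are equal, so no curve
    passes either.\<close>
  have on: "\<exists>\<gamma>\<in>{1..n}. g p x = f \<gamma> x" if "p \<in> {1..n - 2 * k}" for p x
  proof (rule ccontr)
    assume no: "\<not> ?thesis"
    then have "{\<gamma> \<in> {1..n}. g p x \<le> f \<gamma> x} = {\<gamma> \<in> {1..n}. g p x < f \<gamma> x}" by force
    then have "card {q \<in> {1..n - 2 * k}. g q x = g p x} = 0" unfolding card by (simp only: diff_self_eq_0)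
    then have "{q \<in> {1..n - 2 * k}. g q x = g p x} = {}" by (subst (asm) card_0_eq) simp_all
    then show False using that by blast
  qed
  show ?thesis
  proof (intro exI[of _ g] conjI ballI allI impI)
    fix p q \<alpha> \<beta>
    assume pq: "p \<in> {1..n - 2 * k}" "q \<in> {1..n - 2 * k}" "p < q"
      and ab: "\<alpha> \<in> {1..n}" "\<beta> \<in> {1..n}" "\<alpha> < \<beta>"
      and gX: "g p (X \<alpha> \<beta>) = f \<alpha> (X \<alpha> \<beta>)" "g q (X \<alpha> \<beta>) = f \<alpha> (X \<alpha> \<beta>)"
    let ?X = "X \<alpha> \<beta>"
    define near where "near x \<longleftrightarrow> (\<forall>\<gamma>\<in>{1..n} - {\<alpha>, \<beta>}. \<forall>u\<in>{\<alpha>, \<beta>}.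
      (f \<alpha> (X \<alpha> \<beta>) < f \<gamma> (X \<alpha> \<beta>) \<longrightarrow> f u x < f \<gamma> x) \<and> (f \<gamma> (X \<alpha> \<beta>) < f \<alpha> (X \<alpha> \<beta>) \<longrightarrow> f \<gamma> x < f u x))" for x
    \<comment> \<open>The other lines miss the vertex, so a curve through it stays on one of the two
      lines nearby.\<close>
    have ev_on: "\<forall>\<^sub>F x in nhds ?X. g p' x = f \<alpha> x \<or> g p' x = f \<beta> x"
      if p': "p' \<in> {1..n - 2 * k}" "g p' ?X = f \<alpha> ?X" for p'
    proof -
      have "\<forall>\<^sub>F x in nhds ?X. \<forall>\<gamma>\<in>{1..n} - {\<alpha>, \<beta>}. g p' x \<noteq> f \<gamma> x"
      proof (intro eventually_ball_finite ballI)
        fix \<gamma> assume \<gamma>: "\<gamma> \<in> {1..n} - {\<alpha>, \<beta>}"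
        have "isCont (g p') ?X" using antiper_cont[OF g(1)[OF p'(1)], of UNIV] by (simp add: continuous_on_eq_continuous_at)
        then have "((\<lambda>x. g p' x - f \<gamma> x) \<longlongrightarrow> g p' ?X - f \<gamma> ?X) (nhds ?X)"
          using isCont_f[of \<gamma> ?X] \<gamma> by (intro tendsto_diff) (simp_all add: continuous_at tendsto_at_iff_tendsto_nhds)
        moreover have "g p' ?X - f \<gamma> ?X \<noteq> 0" using others_off_vertex[OF ab, of \<gamma>] \<gamma> p'(2) by auto
        ultimately have "\<forall>\<^sub>F x in nhds ?X. g p' x - f \<gamma> x \<noteq> 0" by (rule tendsto_imp_eventually_ne)
        then show "\<forall>\<^sub>F x in nhds ?X. g p' x \<noteq> f \<gamma> x" by simp
      qed simp
      then show ?thesis by (rule eventually_mono) (use on[OF p'(1)] in blast)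
    qed
    define Q where "Q x \<longleftrightarrow> inj_on (\<lambda>\<alpha>. f \<alpha> x) {1..n} \<and> near x \<and> (c \<alpha> \<le> x \<and> x < c \<alpha> + pi \<and> c \<beta> \<le> x \<and> x < c \<beta> + pi)
      \<and> (?X - pi < x \<and> x < ?X + pi) \<and> (g p x = f \<alpha> x \<or> g p x = f \<beta> x) \<and> (g q x = f \<alpha> x \<or> g q x = f \<beta> x)" for x
    have cb: "c \<alpha> < ?X" "?X < c \<alpha> + pi" "c \<beta> < ?X" "?X < c \<beta> + pi" using cX[OF ab] by auto
    have id: "((\<lambda>x. x) \<longlongrightarrow> ?X) (nhds ?X)" by (rule filterlim_ident)
    have e1: "\<forall>\<^sub>F x in nhds ?X. c \<alpha> \<le> x \<and> x < c \<alpha> + pi \<and> c \<beta> \<le> x \<and> x < c \<beta> + pi"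
      using order_tendstoD(1)[OF id cb(1)] order_tendstoD(2)[OF id cb(2)] order_tendstoD(1)[OF id cb(3)] order_tendstoD(2)[OF id cb(4)]
      by eventually_elim auto
    have e2: "\<forall>\<^sub>F x in nhds ?X. ?X - pi < x \<and> x < ?X + pi"
      using order_tendstoD(1)[OF id, of "?X - pi"] order_tendstoD(2)[OF id, of "?X + pi"] by (simp add: eventually_conj)
    have e3: "\<forall>\<^sub>F x in nhds ?X. near x" unfolding near_def by (rule near_vertex[OF ab])
    have "\<forall>\<^sub>F x in nhds ?X. near x \<and> (c \<alpha> \<le> x \<and> x < c \<alpha> + pi \<and> c \<beta> \<le> x \<and> x < c \<beta> + pi)
      \<and> (?X - pi < x \<and> x < ?X + pi) \<and> (g p x = f \<alpha> x \<or> g p x = f \<beta> x) \<and> (g q x = f \<alpha> x \<or> g q x = f \<beta> x)"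
      using e1 e2 e3 ev_on[OF pq(1) gX(1)] ev_on[OF pq(2) gX(2)] by eventually_elim auto
    then have "\<forall>\<^sub>F x in at ?X. Q x" unfolding Q_def
      using gen[of ?X] by (simp add: eventually_conj eventually_nhds_conv_at)
    then obtain d where d: "d > 0" "\<And>x. x \<noteq> ?X \<Longrightarrow> dist x ?X < d \<Longrightarrow> Q x" unfolding eventually_at by blast
    have kp: "k + p \<le> n" "k + q \<le> n" "k + p - 1 \<le> n" "k + q - 1 \<le> n" "k + p \<le> k + q - 1" using pq nk by auto
    have bits: "g p' x = f u x \<longleftrightarrow> Ker u x \<and> bitR u (k + p' - 1) x \<and> \<not> bitR u (k + p') x"
      if "Q x" "p' \<in> {1..n - 2 * k}" "u \<in> {\<alpha>, \<beta>}" for p' u x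
      using that ab unfolding Q_def by (intro wire_bit[OF g(1) g(2)]) auto
    \<comment> \<open>A line carrying both curves would have its bit clear at \<open>k + p\<close>
      and set at \<open>k + q - 1\<close>, which is not smaller.\<close>
    have ne: "\<not> (g p x = f u x \<and> g q x = f u x)" if "Q x" "u \<in> {\<alpha>, \<beta>}" for u x
      using bits[OF that(1) pq(1) that(2)] bits[OF that(1) pq(2) that(2)]
        bitR_antimono[of u "k + q - 1" x "k + p"] kp that(2) ab by auto
    have left: "g q x < g p x" if "Q x" "x < ?X" for x
    proof -
      have lt: "f \<beta> x < f \<alpha> x" using before[OF ab, of x] that by (auto simp: Q_def)
      have "\<not> (g p x = f \<beta> x \<and> g q x = f \<alpha> x)"
      proof
        assume a: "g p x = f \<beta> x \<and> g q x = f \<alpha> x"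
        then have "bitR \<alpha> (k + q - 1) x" "\<not> bitR \<beta> (k + p) x"
          using bits[OF that(1) pq(1), of \<beta>] bits[OF that(1) pq(2), of \<alpha>] by auto
        moreover have "near x" using that by (simp add: Q_def)
        ultimately have "bitR \<beta> (k + q - 1) x" using left_bits[OF ab lt kp(4)] unfolding near_def by blast
        then show False using bitR_antimono[OF ab(2) _ kp(5,4)] \<open>\<not> bitR \<beta> (k + p) x\<close> by blast
      qed
      then show ?thesis using that ne[OF that(1)] lt by (auto simp: Q_def)
    qed
    have right: "if cond \<alpha> \<beta> then g p x < g q x else g q x < g p x" if "Q x" "?X < x" for x
    proof -
      have lt: "f \<alpha> x < f \<beta> x" using after[OF ab, of x] that by (auto simp: Q_def)
      have nr: "near x" using that by (simp add: Q_def)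
      note rb = right_bits[OF ab lt _ nr[unfolded near_def]]
      have "\<not> (g p x = f \<beta> x \<and> g q x = f \<alpha> x)" if c: "cond \<alpha> \<beta>"
      proof
        assume a: "g p x = f \<beta> x \<and> g q x = f \<alpha> x"
        then have b: "bitR \<alpha> (k + q - 1) x" "\<not> bitR \<beta> (k + p) x"
          using bits[OF \<open>Q x\<close> pq(1), of \<beta>] bits[OF \<open>Q x\<close> pq(2), of \<alpha>] by auto
        obtain t where t: "\<alpha> \<le> t" "t < \<beta>" "k \<le> A t (X \<alpha> \<beta>) (f \<alpha> (X \<alpha> \<beta>))" "k \<le> B t (X \<alpha> \<beta>) (f \<alpha> (X \<alpha> \<beta>))"
          using c by (auto simp: cond_def)
        have tn: "t \<le> n" using t ab by auto
        have bt: "bitR \<beta> t x" "\<not> bitR \<alpha> t x" using rb[OF tn] t by auto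
        \<comment> \<open>Otherwise the bit of \<beta> at \<open>t\<close> would entail the one at
          \<open>k + p\<close>. So \<open>t\<close> is at most \<open>k + q - 1\<close>, and the bit
          of \<alpha> at that threshold entails the one at \<open>t\<close>, against the choice of
          \<open>t\<close>.\<close>
        have "\<not> k + p \<le> t" using bitR_antimono[OF ab(2) bt(1) _ tn] b(2) by blast
        then have "t \<le> k + q - 1" using kp by linarith
        then show False using bitR_antimono[OF ab(1) b(1) _ kp(4)] bt(2) by blast
      qed
      moreover have "\<not> (g p x = f \<alpha> x \<and> g q x = f \<beta> x)" if c: "\<not> cond \<alpha> \<beta>"
      proof
        assume a: "g p x = f \<alpha> x \<and> g q x = f \<beta> x"
        then have b: "bitR \<beta> (k + q - 1) x" "\<not> bitR \<alpha> (k + p) x"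
          using bits[OF \<open>Q x\<close> pq(1), of \<alpha>] bits[OF \<open>Q x\<close> pq(2), of \<beta>] by auto
        have "bitR \<beta> (k + p) x" using bitR_antimono[OF ab(2) b(1) kp(5,4)] .
        then show False using rb[OF kp(1)] b(2) c by (auto simp: cond_def)
      qed
      ultimately show ?thesis using that ne[OF that(1)] lt by (auto simp: Q_def)
    qed
    show "\<forall>\<^sub>F h in at_right 0. g q (X \<alpha> \<beta> - h) < g p (X \<alpha> \<beta> - h) \<and>
        (if cond \<alpha> \<beta> then g p (X \<alpha> \<beta> + h) < g q (X \<alpha> \<beta> + h) else g q (X \<alpha> \<beta> + h) < g p (X \<alpha> \<beta> + h))"
      unfolding eventually_at_right_field
    proof (intro exI[of _ d] conjI allI impI d(1))
      fix h assume h: "0 < h" "h < d"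
      then have "Q (?X - h)" "Q (?X + h)" by (auto intro!: d(2) simp: dist_real_def)
      then show "g q (X \<alpha> \<beta> - h) < g p (X \<alpha> \<beta> - h)"
        "if cond \<alpha> \<beta> then g p (X \<alpha> \<beta> + h) < g q (X \<alpha> \<beta> + h) else g q (X \<alpha> \<beta> + h) < g p (X \<alpha> \<beta> + h)"
        using left[of "?X - h"] right[of "?X + h"] h by auto
    qed
  qed (use g(1) card in auto)
qed

end

section \<open>Families of curves\<close>

lemma eventually_at_left_to_0: "eventually P (at_left (x::real)) \<longleftrightarrow> eventually (\<lambda>h. P (x - h)) (at_right 0)"
proof -
  have "eventually P (at_left x) \<longleftrightarrow> eventually (\<lambda>h. P (- h)) (at_right (- x))"
    by (rule eventually_at_left_to_right)
  also have "\<dots> \<longleftrightarrow> eventually (\<lambda>h. P (- (h + - x))) (at_right 0)"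
    by (rule eventually_at_right_to_0)
  finally show ?thesis by simp
qed

lemma eventually_at_right_to_0': "eventually P (at_right (x::real)) \<longleftrightarrow> eventually (\<lambda>h. P (x + h)) (at_right 0)"
  by (subst eventually_at_right_to_0) (simp add: add.commute)

text \<open>The finitely many closed sets on which \<open>h\<close> agrees with one of the functions
  are disjoint over the interval and cover it; connectedness leaves only one of them.\<close>

lemma selection:
  fixes h :: "real \<Rightarrow> real" and f :: "'i \<Rightarrow> real \<Rightarrow> real"
  assumes fin: "finite I" and cont: "continuous_on UNIV h" "\<And>\<alpha>. \<alpha> \<in> I \<Longrightarrow> continuous_on UNIV (f \<alpha>)"
    and cov: "\<And>t. a < t \<Longrightarrow> t < b \<Longrightarrow> \<exists>\<alpha>\<in>I. h t = f \<alpha> t"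
    and sep: "\<And>t \<alpha> \<beta>. a < t \<Longrightarrow> t < b \<Longrightarrow> \<alpha> \<in> I \<Longrightarrow> \<beta> \<in> I \<Longrightarrow> h t = f \<alpha> t \<Longrightarrow> h t = f \<beta> t \<Longrightarrow> \<alpha> = \<beta>"
    and "a < b"
  obtains \<alpha> where "\<alpha> \<in> I" "\<And>t. a < t \<Longrightarrow> t < b \<Longrightarrow> h t = f \<alpha> t"
proof -
  obtain u where u: "a < u" "u < b" using \<open>a < b\<close> dense by blast
  then obtain \<alpha> where \<alpha>: "\<alpha> \<in> I" "h u = f \<alpha> u" using cov by blast
  define A where "A = {t. h t = f \<alpha> t}"
  define B where "B = (\<Union>\<beta>\<in>I - {\<alpha>}. {t. h t = f \<beta> t})"
  have "closed A" "closed B" unfolding A_def B_def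
    using cont \<alpha> fin by (auto intro!: closed_UN closed_Collect_eq)
  moreover have "{a<..<b} \<subseteq> A \<union> B" using cov by (fastforce simp: A_def B_def)
  moreover have "A \<inter> B \<inter> {a<..<b} = {}" using sep \<alpha>(1) by (fastforce simp: A_def B_def)
  moreover have "u \<in> A \<inter> {a<..<b}" using u \<alpha> by (simp add: A_def)
  ultimately have "B \<inter> {a<..<b} = {}"
    using connected_Ioo[of a b] unfolding connected_closed by blast
  then have "h t = f \<alpha> t" if "a < t" "t < b" for t
    using cov[OF that] that by (auto simp: B_def)
  then show thesis using that \<alpha>(1) by blast
qed

text \<open>Congruence modulo \<open>pi\<close>: the same position along a curve of the
  strip.\<close>

definition eqv :: "real \<Rightarrow> real \<Rightarrow> bool" where
  "eqv x x' \<longleftrightarrow> (\<exists>r::int. x' = x + of_int r * pi)"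

lemma eqv_sym: "eqv x x' \<longleftrightarrow> eqv x' x"
proof -
  have "eqv x x' \<Longrightarrow> eqv x' x" for x x'
  proof -
    assume "eqv x x'"
    then obtain r :: int where "x' = x + of_int r * pi" by (auto simp: eqv_def)
    then have "x = x' + of_int (- r) * pi" by simp
    then show "eqv x' x" unfolding eqv_def by blast
  qed
  then show ?thesis by blast
qed

lemma eqv_trans: "eqv x y \<Longrightarrow> eqv y z \<Longrightarrow> eqv x z"
proof -
  assume "eqv x y" "eqv y z"
  then obtain r s :: int where "y = x + of_int r * pi" "z = y + of_int s * pi" by (auto simp: eqv_def)
  then have "z = x + of_int (r + s) * pi" by (simp add: algebra_simps)
  then show "eqv x z" unfolding eqv_def by blast
qed

lemma eqv_less: "eqv x y \<Longrightarrow> x < y \<Longrightarrow> x + pi \<le> y"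
proof -
  assume "eqv x y" "x < y"
  then obtain r :: int where r: "y = x + of_int r * pi" by (auto simp: eqv_def)
  then have "r > 0" using \<open>x < y\<close> by (simp add: zero_less_mult_iff)
  then have "1 * pi \<le> of_int r * pi" by (intro mult_right_mono) auto
  then show ?thesis using r by simp
qed

lemma crosses_eqv: "antiper f \<Longrightarrow> antiper g \<Longrightarrow> eqv x x' \<Longrightarrow> crosses f g x \<longleftrightarrow> crosses f g x'"
  by (auto simp: eqv_def crosses_shift)

lemma touches_eqv: "antiper f \<Longrightarrow> antiper g \<Longrightarrow> eqv x x' \<Longrightarrow> touches f g x \<longleftrightarrow> touches f g x'"
  by (auto simp: eqv_def touches_shift)

lemma antiper_eq_eqv: "antiper f \<Longrightarrow> antiper g \<Longrightarrow> eqv x x' \<Longrightarrow> f x = g x \<longleftrightarrow> f x' = g x'"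
  by (auto simp: eqv_def antiper_shift)

lemma antiper_isCont: "antiper f \<Longrightarrow> isCont f x"
  using antiper_cont[of f UNIV] by (simp add: continuous_on_eq_continuous_at)

lemma antiper_tendsto: "antiper f \<Longrightarrow> (f \<longlongrightarrow> f x) (at x within S)"
  by (rule tendsto_within_subset[OF antiper_isCont[unfolded isCont_def]]) auto

lemma antiper_eq_limit:
  assumes "antiper f" "antiper g" "\<forall>\<^sub>F t in at x within S. f t = g t" "at x within S \<noteq> bot" shows "f x = g x"
  using tendsto_unique[OF assms(4) antiper_tendsto[OF assms(1)]]
    Lim_transform_eventually[OF antiper_tendsto[OF assms(2)]] assms(3) by (metis (mono_tags, lifting) eventually_mono)

text \<open>The lift of a simple arrangement, indexed so that an exchange of curves can keep the
  index set. Crossings are only required to be unique modulo \<open>pi\<close>; their existence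
  follows from antiperiodicity.\<close>

locale family =
  fixes G :: "'i set" and g :: "'i \<Rightarrow> real \<Rightarrow> real"
  assumes fin: "finite G" and ap: "p \<in> G \<Longrightarrow> antiper (g p)"
    and isol: "p \<in> G \<Longrightarrow> q \<in> G \<Longrightarrow> p \<noteq> q \<Longrightarrow> finite ({t. g p t = g q t} \<inter> {a..b})"
    and uniq: "p \<in> G \<Longrightarrow> q \<in> G \<Longrightarrow> p \<noteq> q \<Longrightarrow> crosses (g p) (g q) x \<Longrightarrow> crosses (g p) (g q) x' \<Longrightarrow> eqv x x'"
    and triple: "p \<in> G \<Longrightarrow> q \<in> G \<Longrightarrow> r \<in> G \<Longrightarrow> p \<noteq> q \<Longrightarrow> p \<noteq> r \<Longrightarrow> q \<noteq> r \<Longrightarrow> g p x = g q x \<Longrightarrow> g p x \<noteq> g r x"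
begin

lemma cont: "p \<in> G \<Longrightarrow> continuous_on UNIV (g p)"
  by (simp add: ap antiper_cont)

lemma sep:
  obtains e where "e > 0" "\<And>t p q. t \<noteq> x \<Longrightarrow> \<bar>t - x\<bar> < e \<Longrightarrow> p \<in> G \<Longrightarrow> q \<in> G \<Longrightarrow> g p t = g q t \<Longrightarrow> p = q"
proof -
  define T where "T = (\<Union>p\<in>G. \<Union>q\<in>G - {p}. {t. g p t = g q t})"
  have F: "finite (T \<inter> {a..b})" for a b
  proof -
    have "T \<inter> {a..b} = (\<Union>p\<in>G. \<Union>q\<in>G - {p}. {t. g p t = g q t} \<inter> {a..b})" by (auto simp: T_def)
    moreover have "finite \<dots>" using fin isol by (intro finite_UN_I) auto
    ultimately show ?thesis by simp
  qed
  obtain e where e: "e > 0" "\<And>t. t \<noteq> x \<Longrightarrow> \<bar>t - x\<bar> < e \<Longrightarrow> t \<notin> T" using finite_sep[OF F] by metis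
  show thesis
  proof (rule that[OF e(1)])
    fix t p q assume "t \<noteq> x" "\<bar>t - x\<bar> < e" "p \<in> G" "q \<in> G" "g p t = g q t"
    then show "p = q" using e(2)[of t] by (auto simp: T_def)
  qed
qed

text \<open>Immediately to the right of \<open>x\<close> the curves are pairwise disjoint, so a
  continuous function running on them follows a single one.\<close>

lemma germ_right:
  assumes h: "continuous_on UNIV h" "\<forall>\<^sub>F t in at_right x. \<exists>p\<in>G. h t = g p t"
  shows "\<exists>p\<in>G. \<forall>\<^sub>F t in at_right x. h t = g p t"
proof -
  obtain e where e: "e > 0" "\<And>t p q. t \<noteq> x \<Longrightarrow> \<bar>t - x\<bar> < e \<Longrightarrow> p \<in> G \<Longrightarrow> q \<in> G \<Longrightarrow> g p t = g q t \<Longrightarrow> p = q"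
    using sep[of x] by metis
  obtain b where b: "b > x" "\<And>t. x < t \<Longrightarrow> t < b \<Longrightarrow> \<exists>p\<in>G. h t = g p t"
    using h(2) unfolding eventually_at_right_field by blast
  obtain p where "p \<in> G" "\<And>t. x < t \<Longrightarrow> t < min b (x + e) \<Longrightarrow> h t = g p t"
  proof (rule selection[OF fin h(1) cont, where a = x and b = "min b (x + e)"])
    show "\<exists>p\<in>G. h t = g p t" if "x < t" "t < min b (x + e)" for t by (rule b(2)) (use that in auto)
    show "\<alpha> = \<beta>" if "x < t" "t < min b (x + e)" "\<alpha> \<in> G" "\<beta> \<in> G" "h t = g \<alpha> t" "h t = g \<beta> t" for t \<alpha> \<beta>
      by (rule e(2)[OF _ _ that(3,4)]) (use that in auto)
  qed (use e(1) b(1) in auto)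
  then show ?thesis
    using e(1) b(1) by (auto simp: eventually_at_right_field intro!: bexI[of _ p] exI[of _ "min b (x + e)"])
qed

lemma germ_left:
  assumes h: "continuous_on UNIV h" "\<forall>\<^sub>F t in at_left x. \<exists>p\<in>G. h t = g p t"
  shows "\<exists>p\<in>G. \<forall>\<^sub>F t in at_left x. h t = g p t"
proof -
  obtain e where e: "e > 0" "\<And>t p q. t \<noteq> x \<Longrightarrow> \<bar>t - x\<bar> < e \<Longrightarrow> p \<in> G \<Longrightarrow> q \<in> G \<Longrightarrow> g p t = g q t \<Longrightarrow> p = q"
    using sep[of x] by metis
  obtain b where b: "b < x" "\<And>t. b < t \<Longrightarrow> t < x \<Longrightarrow> \<exists>p\<in>G. h t = g p t"
    using h(2) unfolding eventually_at_left_field by blast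
  obtain p where "p \<in> G" "\<And>t. max b (x - e) < t \<Longrightarrow> t < x \<Longrightarrow> h t = g p t"
  proof (rule selection[OF fin h(1) cont, where a = "max b (x - e)" and b = x])
    show "\<exists>p\<in>G. h t = g p t" if "max b (x - e) < t" "t < x" for t by (rule b(2)) (use that in auto)
    show "\<alpha> = \<beta>" if "max b (x - e) < t" "t < x" "\<alpha> \<in> G" "\<beta> \<in> G" "h t = g \<alpha> t" "h t = g \<beta> t" for t \<alpha> \<beta>
      by (rule e(2)[OF _ _ that(3,4)]) (use that in auto)
  qed (use e(1) b(1) in auto)
  then show ?thesis
    using e(1) b(1) by (auto simp: eventually_at_left_field intro!: bexI[of _ p] exI[of _ "max b (x - e)"])
qed

lemma germ_distinct:
  assumes "p \<in> G" "q \<in> G" "p \<noteq> q"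
  shows "\<forall>\<^sub>F t in at_right x. g p t \<noteq> g q t" "\<forall>\<^sub>F t in at_left x. g p t \<noteq> g q t"
proof -
  obtain e where e: "e > 0" "\<And>t p q. t \<noteq> x \<Longrightarrow> \<bar>t - x\<bar> < e \<Longrightarrow> p \<in> G \<Longrightarrow> q \<in> G \<Longrightarrow> g p t = g q t \<Longrightarrow> p = q"
    using sep[of x] by metis
  have 1: "g p t \<noteq> g q t" if "t \<noteq> x" "\<bar>t - x\<bar> < e" for t using e(2)[OF that assms(1,2)] assms(3) by blast
  show "\<forall>\<^sub>F t in at_right x. g p t \<noteq> g q t"
    unfolding eventually_at_right_field by (intro exI[of _ "x + e"] conjI allI impI 1) (use e(1) in auto)
  show "\<forall>\<^sub>F t in at_left x. g p t \<noteq> g q t"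
    unfolding eventually_at_left_field by (intro exI[of _ "x - e"] conjI allI impI 1) (use e(1) in auto)
qed

lemma germ_unique:
  assumes "p \<in> G" "q \<in> G" "(\<forall>\<^sub>F t in at_right x. g p t = g q t) \<or> (\<forall>\<^sub>F t in at_left x. g p t = g q t)"
  shows "p = q"
proof (rule ccontr)
  assume "p \<noteq> q"
  note d = germ_distinct[OF assms(1,2) this, of x]
  from assms(3) show False
  proof
    assume "\<forall>\<^sub>F t in at_right x. g p t = g q t"
    from eventually_happens'[OF trivial_limit_at_right_real eventually_conj[OF this d(1)]] show False by blast
  next
    assume "\<forall>\<^sub>F t in at_left x. g p t = g q t"
    from eventually_happens'[OF trivial_limit_at_left_real eventually_conj[OF this d(2)]] show False by blast
  qed
qed

lemma cross_xor_touch: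
  assumes "p \<in> G" "q \<in> G" "p \<noteq> q" "g p x = g q x"
  shows "crosses (g p) (g q) x \<longleftrightarrow> \<not> touches (g p) (g q) x"
proof -
  obtain e where e: "e > 0" "\<And>t p q. t \<noteq> x \<Longrightarrow> \<bar>t - x\<bar> < e \<Longrightarrow> p \<in> G \<Longrightarrow> q \<in> G \<Longrightarrow> g p t = g q t \<Longrightarrow> p = q"
    using sep[of x] by metis
  show ?thesis
    by (rule crosses_xor_touches[OF cont[OF assms(1)] cont[OF assms(2)] e(1) assms(4)]) (use e(2) assms in blast)
qed

lemma has_crossing:
  assumes "p \<in> G" "q \<in> G" "p \<noteq> q" obtains x where "crosses (g p) (g q) x"
  using antiper_has_crossing[OF ap[OF assms(1)] ap[OF assms(2)]] isol[OF assms] by blast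

section \<open>Crossings, contacts and vertices of a family\<close>

definition cr :: "real \<Rightarrow> real \<Rightarrow> bool" where
  "cr x y \<longleftrightarrow> (\<exists>p\<in>G. \<exists>q\<in>G. p \<noteq> q \<and> g p x = y \<and> crosses (g p) (g q) x)"

definition ct :: "real \<Rightarrow> real \<Rightarrow> bool" where
  "ct x y \<longleftrightarrow> (\<exists>p\<in>G. \<exists>q\<in>G. p \<noteq> q \<and> g p x = y \<and> touches (g p) (g q) x)"

definition vx :: "real \<Rightarrow> real \<Rightarrow> bool" where
  "vx x y \<longleftrightarrow> (\<exists>p\<in>G. \<exists>q\<in>G. p \<noteq> q \<and> g p x = y \<and> g q x = y)"

lemma pair_through:
  assumes "p \<in> G" "q \<in> G" "p \<noteq> q" "g p x = y" "g q x = y" "r \<in> G" "g r x = y"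
  shows "r = p \<or> r = q"
  using triple[of p q r x] assms by metis

lemma cr_pair:
  assumes "p \<in> G" "q \<in> G" "p \<noteq> q" "g p x = y" "g q x = y"
  shows "cr x y \<longleftrightarrow> crosses (g p) (g q) x"
proof
  assume "cr x y"
  then obtain r s where rs: "r \<in> G" "s \<in> G" "r \<noteq> s" "g r x = y" "crosses (g r) (g s) x" by (auto simp: cr_def)
  then have "g s x = y" by (simp add: crosses_def)
  then have "r = p \<and> s = q \<or> r = q \<and> s = p"
    using pair_through[OF assms rs(1,4)] pair_through[OF assms rs(2)] rs(3) by metis
  then show "crosses (g p) (g q) x" using rs(5) crosses_commute by blast
qed (use assms in \<open>auto simp: cr_def\<close>)

lemma ct_pair:
  assumes "p \<in> G" "q \<in> G" "p \<noteq> q" "g p x = y" "g q x = y"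
  shows "ct x y \<longleftrightarrow> touches (g p) (g q) x"
proof
  assume "ct x y"
  then obtain r s where rs: "r \<in> G" "s \<in> G" "r \<noteq> s" "g r x = y" "touches (g r) (g s) x" by (auto simp: ct_def)
  then have "g s x = y" by (simp add: touches_def)
  then have "r = p \<and> s = q \<or> r = q \<and> s = p"
    using pair_through[OF assms rs(1,4)] pair_through[OF assms rs(2)] rs(3) by metis
  then show "touches (g p) (g q) x" using rs(5) touches_commute by blast
qed (use assms in \<open>auto simp: ct_def\<close>)

lemma cr_vx: "cr x y \<Longrightarrow> vx x y" and ct_vx: "ct x y \<Longrightarrow> vx x y"
  unfolding cr_def ct_def vx_def crosses_def touches_def by metis+

text \<open>Meetings are isolated, so every vertex is of exactly one of the two types. Flips are
  described by contacts and curves are followed by crossings; this converts one into the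
  other.\<close>

lemma cr_iff: "cr x y \<longleftrightarrow> vx x y \<and> \<not> ct x y"
proof (cases "vx x y")
  case True
  then obtain p q where pq: "p \<in> G" "q \<in> G" "p \<noteq> q" "g p x = y" "g q x = y" by (auto simp: vx_def)
  then show ?thesis using cr_pair[OF pq] ct_pair[OF pq] cross_xor_touch[OF pq(1-3)] True by simp
qed (use cr_vx in blast)

lemma vx_shift: "vx (x + of_int r * pi) (sg r * y) \<longleftrightarrow> vx x y"
proof -
  have "g p (x + of_int r * pi) = sg r * y \<longleftrightarrow> g p x = y" if "p \<in> G" for p
    unfolding antiper_shift[OF ap[OF that]] by simp
  then show ?thesis unfolding vx_def by blast
qed

lemma ct_shift: "ct (x + of_int r * pi) (sg r * y) \<longleftrightarrow> ct x y"
proof -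
  have "g p (x + of_int r * pi) = sg r * y \<longleftrightarrow> g p x = y" if "p \<in> G" for p
    unfolding antiper_shift[OF ap[OF that]] by simp
  then show ?thesis unfolding ct_def using touches_shift ap by blast
qed

lemma cr_shift: "cr (x + of_int r * pi) (sg r * y) \<longleftrightarrow> cr x y"
  unfolding cr_iff vx_shift ct_shift ..

end

section \<open>Curves supported by middle levels\<close>

lemma crosses_germs:
  assumes l: "\<forall>\<^sub>F t in at_left x. a t = a' t" "\<forall>\<^sub>F t in at_left x. b t = b' t"
    and r: "\<forall>\<^sub>F t in at_right x. a t = a' t" "\<forall>\<^sub>F t in at_right x. b t = b' t"
    and "a x = b x" "crosses a' b' x"
  shows "crosses a b x"
  unfolding crosses_def
proof
  show "\<forall>\<^sub>F h in at_right 0. (a (x - h) - b (x - h)) * (a (x + h) - b (x + h)) < 0"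
    using l[THEN eventually_at_left_to_0[THEN iffD1]] r[THEN eventually_at_right_to_0'[THEN iffD1]] assms(6)[unfolded crosses_def, THEN conjunct2]
    by eventually_elim simp
qed fact

text \<open>Exchanging the right germs of two crossing curves reverses one factor of the sign
  product.\<close>

lemma touches_germs:
  assumes l: "\<forall>\<^sub>F t in at_left x. a t = a' t" "\<forall>\<^sub>F t in at_left x. b t = b' t"
    and r: "\<forall>\<^sub>F t in at_right x. a t = b' t" "\<forall>\<^sub>F t in at_right x. b t = a' t"
    and "a x = b x" "crosses a' b' x"
  shows "touches a b x"
  unfolding touches_def
proof
  show "\<forall>\<^sub>F h in at_right 0. 0 < (a (x - h) - b (x - h)) * (a (x + h) - b (x + h))"
    using l[THEN eventually_at_left_to_0[THEN iffD1]] r[THEN eventually_at_right_to_0'[THEN iffD1]] assms(6)[unfolded crosses_def, THEN conjunct2]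
  proof eventually_elim
    case (elim h)
    have "(a' (x - h) - b' (x - h)) * (b' (x + h) - a' (x + h)) = - ((a' (x - h) - b' (x - h)) * (a' (x + h) - b' (x + h)))"
      by (simp add: algebra_simps)
    then show ?case using elim by simp
  qed
qed fact

locale lines = family I f for I :: "'a set" and f :: "'a \<Rightarrow> real \<Rightarrow> real" +
  fixes k :: nat
  assumes straight: "\<alpha> \<in> I \<Longrightarrow> \<beta> \<in> I \<Longrightarrow> \<alpha> \<noteq> \<beta> \<Longrightarrow> f \<alpha> x = f \<beta> x \<Longrightarrow> crosses (f \<alpha>) (f \<beta>) x"
begin

definition K :: "real \<Rightarrow> real \<Rightarrow> bool" where
  "K x y \<longleftrightarrow> 2 * k < card I \<and> (\<exists>\<alpha>\<in>I. f \<alpha> x = y) \<and> k < card {\<alpha> \<in> I. y \<le> f \<alpha> x} \<and> k < card {\<alpha> \<in> I. f \<alpha> x \<le> y}"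

text \<open>The index type is left open, because abstract index sets and sets of pseudolines both
  occur as \<open>G\<close>.\<close>

definition pt :: "'j set \<Rightarrow> ('j \<Rightarrow> real \<Rightarrow> real) \<Rightarrow> bool" where
  "pt G g \<longleftrightarrow> family G g \<and> (\<forall>x y. (\<exists>p\<in>G. g p x = y) \<longleftrightarrow> K x y)"

lemma pt_family: "pt G g \<Longrightarrow> family G g" and pt_K: "pt G g \<Longrightarrow> (\<exists>p\<in>G. g p x = y) \<longleftrightarrow> K x y"
  by (auto simp: pt_def)

lemma pt_cont: "pt G g \<Longrightarrow> p \<in> G \<Longrightarrow> continuous_on UNIV (g p)"
  by (rule family.cont[OF pt_family])

section \<open>Germs of curves on the lines\<close>

lemma pt_germ:
  assumes "pt G g" "p \<in> G"
  shows "\<exists>\<alpha>\<in>I. \<forall>\<^sub>F t in at_right x. g p t = f \<alpha> t" "\<exists>\<alpha>\<in>I. \<forall>\<^sub>F t in at_left x. g p t = f \<alpha> t"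
proof -
  have "\<exists>\<alpha>\<in>I. g p t = f \<alpha> t" for t
  proof -
    have "K t (g p t)" using pt_K[OF assms(1), of t "g p t"] assms(2) by blast
    then show ?thesis unfolding K_def by metis
  qed
  then show "\<exists>\<alpha>\<in>I. \<forall>\<^sub>F t in at_right x. g p t = f \<alpha> t" "\<exists>\<alpha>\<in>I. \<forall>\<^sub>F t in at_left x. g p t = f \<alpha> t"
    using germ_right[OF pt_cont[OF assms]] germ_left[OF pt_cont[OF assms]] by simp_all
qed

text \<open>Two pseudotriangulations have the same support, so a curve of one runs on the curves of
  the other.\<close>

lemma common_right_germ:
  assumes "pt G g" "pt G' g'" "p \<in> G"
  shows "\<exists>p'\<in>G'. \<forall>\<^sub>F t in at_right x. g p t = g' p' t"
proof (rule family.germ_right[OF pt_family[OF assms(2)] pt_cont[OF assms(1,3)]])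
  have "\<exists>p'\<in>G'. g p t = g' p' t" for t
    using pt_K[OF assms(1), of t "g p t"] pt_K[OF assms(2), of t "g p t"] assms(3) by metis
  then show "\<forall>\<^sub>F t in at_right x. \<exists>p'\<in>G'. g p t = g' p' t" by simp
qed

lemma pt_ap: "pt G g \<Longrightarrow> p \<in> G \<Longrightarrow> antiper (g p)"
  by (rule family.ap[OF pt_family])

lemma value_r: "antiper a \<Longrightarrow> antiper b \<Longrightarrow> \<forall>\<^sub>F t in at_right x. a t = b t \<Longrightarrow> a x = b x"
  by (rule antiper_eq_limit[OF _ _ _ trivial_limit_at_right_real])

lemma value_l: "antiper a \<Longrightarrow> antiper b \<Longrightarrow> \<forall>\<^sub>F t in at_left x. a t = b t \<Longrightarrow> a x = b x"
  by (rule antiper_eq_limit[OF _ _ _ trivial_limit_at_left_real])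

lemma ev_trans: "\<forall>\<^sub>F t in F. a t = b t \<Longrightarrow> \<forall>\<^sub>F t in F. c t = b t \<Longrightarrow> \<forall>\<^sub>F t in F. a t = c t"
  by (auto elim: eventually_elim2)

lemma coincide_vx:
  assumes "pt G g" "p \<in> G" "q \<in> G" "p \<noteq> q" "g p x = g q x"
  shows "vx x (g p x)"
proof -
  obtain \<alpha> where \<alpha>: "\<alpha> \<in> I" "\<forall>\<^sub>F t in at_right x. g p t = f \<alpha> t" using pt_germ(1)[OF assms(1,2)] by blast
  obtain \<beta> where \<beta>: "\<beta> \<in> I" "\<forall>\<^sub>F t in at_right x. g q t = f \<beta> t" using pt_germ(1)[OF assms(1,3)] by blast
  have "\<alpha> \<noteq> \<beta>"
  proof
    assume "\<alpha> = \<beta>"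
    have "\<forall>\<^sub>F t in at_right x. g p t = g q t" using \<alpha>(2) \<beta>(2) unfolding \<open>\<alpha> = \<beta>\<close> by (rule ev_trans)
    then show False using family.germ_unique[OF pt_family[OF assms(1)] assms(2,3)] assms(4) by blast
  qed
  moreover have "f \<alpha> x = g p x" "f \<beta> x = g p x"
    using value_r[OF pt_ap[OF assms(1,2)] ap[OF \<alpha>(1)] \<alpha>(2)] value_r[OF pt_ap[OF assms(1,3)] ap[OF \<beta>(1)] \<beta>(2)] assms(5) by simp_all
  ultimately show ?thesis unfolding vx_def using \<alpha>(1) \<beta>(1) by blast
qed

text \<open>The two curves through the vertex occupy both lines on the left and both on the right.
  If one of them changed line, so would the other, and crossing lines would produce touching
  curves.\<close>

lemma rule_straight:
  assumes pt: "pt G g" "p \<in> G" and \<alpha>\<beta>: "\<alpha> \<in> I" "\<beta> \<in> I" "\<alpha> \<noteq> \<beta>" "f \<beta> x = f \<alpha> x"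
    and left: "\<forall>\<^sub>F t in at_left x. g p t = f \<alpha> t" and cr: "family.cr G g x (f \<alpha> x)"
  shows "\<forall>\<^sub>F t in at_right x. g p t = f \<alpha> t"
proof -
  interpret G: family G g by (rule pt_family[OF pt(1)])
  have y: "g p x = f \<alpha> x" by (rule value_l[OF pt_ap[OF pt] ap[OF \<alpha>\<beta>(1)] left])
  obtain r s where rs: "r \<in> G" "s \<in> G" "r \<noteq> s" "g r x = f \<alpha> x" "crosses (g r) (g s) x"
    using cr unfolding G.cr_def by blast
  then have "g s x = f \<alpha> x" by (simp add: crosses_def)
  then have "p = r \<or> p = s" using G.pair_through[OF rs(1-4) _ pt(2) y] by blast
  then obtain q where q: "q \<in> G" "p \<noteq> q" "crosses (g p) (g q) x"
    using rs crosses_commute by metis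
  then have qy: "g q x = f \<alpha> x" using y by (simp add: crosses_def)
  obtain \<delta> where \<delta>: "\<delta> \<in> I" "\<forall>\<^sub>F t in at_left x. g q t = f \<delta> t" using pt_germ(2)[OF pt(1) q(1)] by blast
  obtain \<gamma> where \<gamma>: "\<gamma> \<in> I" "\<forall>\<^sub>F t in at_right x. g p t = f \<gamma> t" using pt_germ(1)[OF pt] by blast
  obtain \<epsilon> where \<epsilon>: "\<epsilon> \<in> I" "\<forall>\<^sub>F t in at_right x. g q t = f \<epsilon> t" using pt_germ(1)[OF pt(1) q(1)] by blast
  have "f \<delta> x = f \<alpha> x" "f \<gamma> x = f \<alpha> x" "f \<epsilon> x = f \<alpha> x"
    using value_l[OF pt_ap[OF pt(1) q(1)] ap[OF \<delta>(1)] \<delta>(2)] value_r[OF pt_ap[OF pt] ap[OF \<gamma>(1)] \<gamma>(2)]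
      value_r[OF pt_ap[OF pt(1) q(1)] ap[OF \<epsilon>(1)] \<epsilon>(2)] y qy by simp_all
  then have in2: "\<delta> = \<alpha> \<or> \<delta> = \<beta>" "\<gamma> = \<alpha> \<or> \<gamma> = \<beta>" "\<epsilon> = \<alpha> \<or> \<epsilon> = \<beta>"
    using pair_through[OF \<alpha>\<beta>(1-3) refl \<alpha>\<beta>(4)] \<delta>(1) \<gamma>(1) \<epsilon>(1) by metis+
  have "\<delta> \<noteq> \<alpha>"
  proof
    assume "\<delta> = \<alpha>"
    have "\<forall>\<^sub>F t in at_left x. g p t = g q t" using left \<delta>(2) unfolding \<open>\<delta> = \<alpha>\<close> by (rule ev_trans)
    then show False using G.germ_unique[OF pt(2) q(1)] q(2) by blast
  qed
  then have "\<delta> = \<beta>" using in2 by blast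
  have "\<gamma> \<noteq> \<epsilon>"
  proof
    assume "\<gamma> = \<epsilon>"
    have "\<forall>\<^sub>F t in at_right x. g p t = g q t" using \<gamma>(2) \<epsilon>(2) unfolding \<open>\<gamma> = \<epsilon>\<close> by (rule ev_trans)
    then show False using G.germ_unique[OF pt(2) q(1)] q(2) by blast
  qed
  show ?thesis
  proof (rule ccontr)
    assume "\<not> ?thesis"
    then have "\<gamma> = \<beta>" using in2(2) \<gamma>(2) by blast
    then have "\<epsilon> = \<alpha>" using in2(3) \<open>\<gamma> \<noteq> \<epsilon>\<close> by blast
    have "touches (g p) (g q) x"
      by (rule touches_germs[OF left \<delta>(2)[unfolded \<open>\<delta> = \<beta>\<close>] \<gamma>(2)[unfolded \<open>\<gamma> = \<beta>\<close>] \<epsilon>(2)[unfolded \<open>\<epsilon> = \<alpha>\<close>]])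
        (use y qy straight[OF \<alpha>\<beta>(1-3) \<alpha>\<beta>(4)[symmetric]] in auto)
    then show False using G.cross_xor_touch[OF pt(2) q(1,2)] q(3) y qy by simp
  qed
qed

lemma near:
  assumes "\<alpha> \<in> I" "\<beta> \<in> I" "f \<beta> x = f \<alpha> x"
  shows "\<forall>\<^sub>F t in nhds x. \<forall>\<gamma>\<in>I. (f \<alpha> x < f \<gamma> x \<longrightarrow> f \<alpha> t < f \<gamma> t \<and> f \<beta> t < f \<gamma> t) \<and> (f \<gamma> x < f \<alpha> x \<longrightarrow> f \<gamma> t < f \<alpha> t \<and> f \<gamma> t < f \<beta> t)"
proof (intro eventually_ball_finite[OF fin] ballI)
  fix \<gamma> assume \<gamma>: "\<gamma> \<in> I"
  have t: "(f v \<longlongrightarrow> f v x) (nhds x)" if "v \<in> I" for v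
    using antiper_isCont[OF ap[OF that], of x] by (simp add: continuous_at tendsto_at_iff_tendsto_nhds)
  have 1: "\<forall>\<^sub>F t in nhds x. (f \<alpha> x < f \<gamma> x \<longrightarrow> f u t < f \<gamma> t) \<and> (f \<gamma> x < f \<alpha> x \<longrightarrow> f \<gamma> t < f u t)"
    if "u \<in> I" "f u x = f \<alpha> x" for u
  proof -
    have "((\<lambda>t. f \<gamma> t - f u t) \<longlongrightarrow> f \<gamma> x - f u x) (nhds x)" using \<gamma> that by (intro tendsto_diff t) auto
    from order_tendstoD[OF this, of 0] show ?thesis
      unfolding that(2) by (intro eventually_conj; cases "f \<alpha> x < f \<gamma> x"; cases "f \<gamma> x < f \<alpha> x") auto
  qed
  show "\<forall>\<^sub>F t in nhds x. (f \<alpha> x < f \<gamma> x \<longrightarrow> f \<alpha> t < f \<gamma> t \<and> f \<beta> t < f \<gamma> t) \<and> (f \<gamma> x < f \<alpha> x \<longrightarrow> f \<gamma> t < f \<alpha> t \<and> f \<gamma> t < f \<beta> t)"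
    using 1[OF assms(1) refl] 1[OF assms(2,3)] by eventually_elim auto
qed

text \<open>If the curve went straight, counting lines shows that the other line is in the kernel as well, so it
  carries a second curve, which would cross the first one.\<close>

lemma rule_switch:
  assumes pt: "pt G g" "p \<in> G" and \<alpha>\<beta>: "\<alpha> \<in> I" "\<beta> \<in> I" "\<alpha> \<noteq> \<beta>" "f \<beta> x = f \<alpha> x"
    and left: "\<forall>\<^sub>F t in at_left x. g p t = f \<alpha> t" and cr: "\<not> family.cr G g x (f \<alpha> x)"
  shows "\<forall>\<^sub>F t in at_right x. g p t = f \<beta> t"
proof (rule ccontr)
  assume contr: "\<not> ?thesis"
  interpret G: family G g by (rule pt_family[OF pt(1)])
  have y: "g p x = f \<alpha> x" by (rule value_l[OF pt_ap[OF pt] ap[OF \<alpha>\<beta>(1)] left])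
  obtain \<gamma> where \<gamma>: "\<gamma> \<in> I" "\<forall>\<^sub>F t in at_right x. g p t = f \<gamma> t" using pt_germ(1)[OF pt] by blast
  have "f \<gamma> x = f \<alpha> x" using value_r[OF pt_ap[OF pt] ap[OF \<gamma>(1)] \<gamma>(2)] y by simp
  then have "\<gamma> = \<alpha>" using pair_through[OF \<alpha>\<beta>(1-3) refl \<alpha>\<beta>(4) \<gamma>(1)] \<gamma>(2) contr by blast
  then have right: "\<forall>\<^sub>F t in at_right x. g p t = f \<alpha> t" using \<gamma> by simp
  define near where "near t \<longleftrightarrow> (\<forall>\<gamma>\<in>I. (f \<alpha> x < f \<gamma> x \<longrightarrow> f \<alpha> t < f \<gamma> t \<and> f \<beta> t < f \<gamma> t) \<and>
      (f \<gamma> x < f \<alpha> x \<longrightarrow> f \<gamma> t < f \<alpha> t \<and> f \<gamma> t < f \<beta> t))" for t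
  have nr: "\<forall>\<^sub>F t in nhds x. near t" unfolding near_def by (rule near[OF \<alpha>\<beta>(1,2,4)])
  then have nr': "\<forall>\<^sub>F t in at_left x. near t" "\<forall>\<^sub>F t in at_right x. near t"
    by (auto simp: eventually_nhds_conv_at eventually_at_split)
  let ?U = "{\<gamma> \<in> I. f \<alpha> x < f \<gamma> x}" and ?D = "{\<gamma> \<in> I. f \<gamma> x < f \<alpha> x}"
  have fU: "finite ?U" "finite ?D" using fin by auto
  have cs: "\<forall>\<^sub>F h in at_right 0. (f \<alpha> (x - h) - f \<beta> (x - h)) * (f \<alpha> (x + h) - f \<beta> (x + h)) < 0"
    using straight[OF \<alpha>\<beta>(1-3) \<alpha>\<beta>(4)[symmetric]] by (simp add: crosses_def)
  have "\<forall>\<^sub>F h in at_right 0. near (x - h) \<and> near (x + h) \<and> g p (x - h) = f \<alpha> (x - h) \<and> g p (x + h) = f \<alpha> (x + h)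
     \<and> (f \<alpha> (x - h) - f \<beta> (x - h)) * (f \<alpha> (x + h) - f \<beta> (x + h)) < 0"
    using nr'(1)[THEN eventually_at_left_to_0[THEN iffD1]] nr'(2)[THEN eventually_at_right_to_0'[THEN iffD1]] left[THEN eventually_at_left_to_0[THEN iffD1]]
      right[THEN eventually_at_right_to_0'[THEN iffD1]] cs by eventually_elim auto
  then obtain h where h: "near (x - h)" "near (x + h)" "g p (x - h) = f \<alpha> (x - h)" "g p (x + h) = f \<alpha> (x + h)"
     "(f \<alpha> (x - h) - f \<beta> (x - h)) * (f \<alpha> (x + h) - f \<beta> (x + h)) < 0"
    using eventually_happens'[OF trivial_limit_at_right_real] by blast
  have trich: "f \<alpha> x < f \<gamma> x \<or> f \<gamma> x < f \<alpha> x \<or> \<gamma> = \<alpha> \<or> \<gamma> = \<beta>" if "\<gamma> \<in> I" for \<gamma>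
  proof -
    have "f \<alpha> x < f \<gamma> x \<or> f \<gamma> x < f \<alpha> x \<or> f \<gamma> x = f \<alpha> x" by linarith
    then show ?thesis using pair_through[OF \<alpha>\<beta>(1-3) refl \<alpha>\<beta>(4) that] by blast
  qed
  have KK: "K t (f \<alpha> t)" if "g p t = f \<alpha> t" for t using pt_K[OF pt(1), of t "f \<alpha> t"] pt(2) that by blast
  \<comment> \<open>Where \<alpha> is the upper of the two lines, only \<alpha> and lines above the
    vertex are weakly above it; being in the kernel then forces at least \<open>k\<close> lines
    above the vertex.\<close>
  have up: "k \<le> card ?U" if "near t" "g p t = f \<alpha> t" "f \<beta> t < f \<alpha> t" for t
  proof -
    have "{\<gamma> \<in> I. f \<alpha> t \<le> f \<gamma> t} \<subseteq> insert \<alpha> ?U"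
    proof
      fix \<gamma> assume "\<gamma> \<in> {\<gamma> \<in> I. f \<alpha> t \<le> f \<gamma> t}"
      then have a: "\<gamma> \<in> I" "f \<alpha> t \<le> f \<gamma> t" by simp_all
      have "\<not> f \<gamma> x < f \<alpha> x" using that(1) a unfolding near_def by (meson not_less)
      moreover have "\<gamma> \<noteq> \<beta>" using a(2) that(3) by auto
      ultimately show "\<gamma> \<in> insert \<alpha> ?U" using trich[OF a(1)] a(1) by blast
    qed
    then have "card {\<gamma> \<in> I. f \<alpha> t \<le> f \<gamma> t} \<le> card (insert \<alpha> ?U)" using fU by (intro card_mono) auto
    also have "\<dots> \<le> card ?U + 1" using fU by (simp add: card_insert_if)
    finally show ?thesis using KK[OF that(2)] unfolding K_def by linarith
  qed
  have dn: "k \<le> card ?D" if "near t" "g p t = f \<alpha> t" "f \<alpha> t < f \<beta> t" for t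
  proof -
    have "{\<gamma> \<in> I. f \<gamma> t \<le> f \<alpha> t} \<subseteq> insert \<alpha> ?D"
    proof
      fix \<gamma> assume "\<gamma> \<in> {\<gamma> \<in> I. f \<gamma> t \<le> f \<alpha> t}"
      then have a: "\<gamma> \<in> I" "f \<gamma> t \<le> f \<alpha> t" by simp_all
      have "\<not> f \<alpha> x < f \<gamma> x" using that(1) a unfolding near_def by (meson not_less)
      moreover have "\<gamma> \<noteq> \<beta>" using a(2) that(3) by auto
      ultimately show "\<gamma> \<in> insert \<alpha> ?D" using trich[OF a(1)] a(1) by blast
    qed
    then have "card {\<gamma> \<in> I. f \<gamma> t \<le> f \<alpha> t} \<le> card (insert \<alpha> ?D)" using fU by (intro card_mono) auto
    also have "\<dots> \<le> card ?D + 1" using fU by (simp add: card_insert_if)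
    finally show ?thesis using KK[OF that(2)] unfolding K_def by linarith
  qed
  \<comment> \<open>The lines cross, so \<alpha> is the upper line on one side and the lower one on
    the other, and the curve follows \<alpha> on both sides.\<close>
  have "f \<alpha> (x - h) > f \<beta> (x - h) \<and> f \<alpha> (x + h) < f \<beta> (x + h) \<or> f \<alpha> (x - h) < f \<beta> (x - h) \<and> f \<alpha> (x + h) > f \<beta> (x + h)"
    using h(5) by (auto simp: mult_less_0_iff)
  then have UD: "k \<le> card ?U" "k \<le> card ?D" using up[OF h(1,3)] up[OF h(2,4)] dn[OF h(1,3)] dn[OF h(2,4)] by blast+
  have n2: "2 * k < card I" using KK[OF h(3)] by (simp add: K_def)
  have "K t (f \<beta> t)" if "near t" for t
  proof -
    have "insert \<beta> ?U \<subseteq> {\<gamma> \<in> I. f \<beta> t \<le> f \<gamma> t}" "insert \<beta> ?D \<subseteq> {\<gamma> \<in> I. f \<gamma> t \<le> f \<beta> t}"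
      using that \<alpha>\<beta>(2) unfolding near_def by (auto simp: less_imp_le)
    then have "card (insert \<beta> ?U) \<le> card {\<gamma> \<in> I. f \<beta> t \<le> f \<gamma> t}" "card (insert \<beta> ?D) \<le> card {\<gamma> \<in> I. f \<gamma> t \<le> f \<beta> t}"
      using fin by (auto intro!: card_mono)
    moreover have "card (insert \<beta> ?U) = card ?U + 1" "card (insert \<beta> ?D) = card ?D + 1"
      using fU \<alpha>\<beta>(4) by (simp_all)
    ultimately show ?thesis unfolding K_def using UD n2 \<alpha>\<beta>(2) by auto
  qed
  then have "\<forall>\<^sub>F t in at_left x. \<exists>q\<in>G. f \<beta> t = g q t"
  proof -
    assume KB: "\<And>t. near t \<Longrightarrow> K t (f \<beta> t)"
    show ?thesis
      using nr'(1)
    proof eventually_elim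
      case (elim t)
      then show ?case using KB[OF elim] pt_K[OF pt(1), of t "f \<beta> t"] by force
    qed
  qed
  then obtain q where q: "q \<in> G" "\<forall>\<^sub>F t in at_left x. f \<beta> t = g q t"
    using G.germ_left[OF cont[OF \<alpha>\<beta>(2)]] by blast
  have ql: "\<forall>\<^sub>F t in at_left x. g q t = f \<beta> t" using q(2) by (rule eventually_mono) simp
  have qy: "g q x = f \<alpha> x" using value_l[OF pt_ap[OF pt(1) q(1)] ap[OF \<alpha>\<beta>(2)] ql] \<alpha>\<beta>(4) by simp
  have "p \<noteq> q"
  proof
    assume "p = q"
    have "\<forall>\<^sub>F t in at_left x. f \<alpha> t = f \<beta> t"
      using eventually_conj[OF left ql] by (rule eventually_mono) (auto simp: \<open>p = q\<close>)
    then show False using germ_unique[OF \<alpha>\<beta>(1,2)] \<alpha>\<beta>(3) by blast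
  qed
  obtain \<epsilon> where \<epsilon>: "\<epsilon> \<in> I" "\<forall>\<^sub>F t in at_right x. g q t = f \<epsilon> t" using pt_germ(1)[OF pt(1) q(1)] by blast
  have "f \<epsilon> x = f \<alpha> x" using value_r[OF pt_ap[OF pt(1) q(1)] ap[OF \<epsilon>(1)] \<epsilon>(2)] qy by simp
  moreover have "\<epsilon> \<noteq> \<alpha>"
  proof
    assume "\<epsilon> = \<alpha>"
    have "\<forall>\<^sub>F t in at_right x. g p t = g q t" using right \<epsilon>(2) unfolding \<open>\<epsilon> = \<alpha>\<close> by (rule ev_trans)
    then show False using G.germ_unique[OF pt(2) q(1)] \<open>p \<noteq> q\<close> by blast
  qed
  ultimately have "\<epsilon> = \<beta>" using pair_through[OF \<alpha>\<beta>(1-3) refl \<alpha>\<beta>(4) \<epsilon>(1)] by blast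
  have "crosses (g p) (g q) x"
    using crosses_germs[OF left ql right _ _ straight[OF \<alpha>\<beta>(1-3) \<alpha>\<beta>(4)[symmetric]]] \<epsilon>(2)[unfolded \<open>\<epsilon> = \<beta>\<close>] y qy by simp
  then have "G.cr x (f \<alpha> x)" unfolding G.cr_def using pt(2) q(1) \<open>p \<noteq> q\<close> y by blast
  then show False using cr by blast
qed

section \<open>Propagation of agreement between two families\<close>

lemma rule_plain:
  assumes pt: "pt G g" "p \<in> G" and \<alpha>: "\<alpha> \<in> I" and left: "\<forall>\<^sub>F t in at_left x. g p t = f \<alpha> t"
    and "\<not> vx x (f \<alpha> x)"
  shows "\<forall>\<^sub>F t in at_right x. g p t = f \<alpha> t"
proof -
  have y: "g p x = f \<alpha> x" by (rule value_l[OF pt_ap[OF pt] ap[OF \<alpha>] left])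
  obtain \<gamma> where \<gamma>: "\<gamma> \<in> I" "\<forall>\<^sub>F t in at_right x. g p t = f \<gamma> t" using pt_germ(1)[OF pt] by blast
  have "f \<gamma> x = f \<alpha> x" using value_r[OF pt_ap[OF pt] ap[OF \<gamma>(1)] \<gamma>(2)] y by simp
  then have "\<gamma> = \<alpha>" using assms(5) \<alpha> \<gamma>(1) unfolding vx_def by blast
  then show ?thesis using \<gamma> by simp
qed

text \<open>The rules are deterministic: the line on the left and the type of the vertex fix the
  line on the right.\<close>

lemma agree_past:
  assumes pt: "pt G g" "p \<in> G" "pt G' g'" "p' \<in> G'" and left: "\<forall>\<^sub>F t in at_left x. g p t = g' p' t"
    and cr: "vx x (g p x) \<Longrightarrow> family.cr G g x (g p x) \<longleftrightarrow> family.cr G' g' x (g p x)"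
  shows "\<forall>\<^sub>F t in at_right x. g p t = g' p' t"
proof -
  obtain \<alpha> where \<alpha>: "\<alpha> \<in> I" "\<forall>\<^sub>F t in at_left x. g p t = f \<alpha> t" using pt_germ(2)[OF pt(1,2)] by blast
  have \<alpha>': "\<forall>\<^sub>F t in at_left x. g' p' t = f \<alpha> t" using left \<alpha>(2) by eventually_elim simp
  have y: "g p x = f \<alpha> x" by (rule value_l[OF pt_ap[OF pt(1,2)] ap[OF \<alpha>(1)] \<alpha>(2)])
  show ?thesis
  proof (cases "vx x (f \<alpha> x)")
    case False
    show ?thesis
      by (rule ev_trans[OF rule_plain[OF pt(1,2) \<alpha> False] rule_plain[OF pt(3,4) \<alpha>(1) \<alpha>' False]])
  next
    case True
    then obtain \<beta> where \<beta>: "\<beta> \<in> I" "\<alpha> \<noteq> \<beta>" "f \<beta> x = f \<alpha> x"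
      using \<alpha>(1) unfolding vx_def by metis
    show ?thesis
    proof (cases "family.cr G g x (f \<alpha> x)")
      case c: True
      then have c': "family.cr G' g' x (f \<alpha> x)" using cr True y by simp
      show ?thesis
        by (rule ev_trans[OF rule_straight[OF pt(1,2) \<alpha>(1) \<beta> \<alpha>(2) c] rule_straight[OF pt(3,4) \<alpha>(1) \<beta> \<alpha>' c']])
    next
      case c: False
      then have c': "\<not> family.cr G' g' x (f \<alpha> x)" using cr True y by simp
      show ?thesis
        by (rule ev_trans[OF rule_switch[OF pt(1,2) \<alpha>(1) \<beta> \<alpha>(2) c] rule_switch[OF pt(3,4) \<alpha>(1) \<beta> \<alpha>' c']])
    qed
  qed
qed

text \<open>Continuation: at the supremum of the abscissas up to which the curves agree they agree
  by continuity, and a little beyond it by \<open>agree_past\<close>.\<close>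

lemma agree_along:
  assumes pt: "pt G g" "p \<in> G" "pt G' g'" "p' \<in> G'" and start: "\<forall>\<^sub>F t in at_right a. g p t = g' p' t"
    and cr: "\<And>x. a < x \<Longrightarrow> x < b \<Longrightarrow> vx x (g p x) \<Longrightarrow> family.cr G g x (g p x) \<longleftrightarrow> family.cr G' g' x (g p x)"
    and t: "a \<le> t" "t \<le> b"
  shows "g p t = g' p' t"
proof (rule ccontr)
  assume ne: "g p t \<noteq> g' p' t"
  define S where "S = {s. a < s \<and> s \<le> b \<and> (\<forall>u. a < u \<longrightarrow> u < s \<longrightarrow> g p u = g' p' u)}"
  note apg = pt_ap[OF pt(1,2)] and apg' = pt_ap[OF pt(3,4)]
  have "g p a = g' p' a" by (rule value_r[OF apg apg' start])
  then have "a < t" using ne t by (cases "a = t") auto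
  obtain e where e: "e > a" "\<And>u. a < u \<Longrightarrow> u < e \<Longrightarrow> g p u = g' p' u"
    using start unfolding eventually_at_right_field by blast
  have m: "min e b \<in> S" using e \<open>a < t\<close> t by (auto simp: S_def)
  have bdd: "bdd_above S" by (rule bdd_aboveI[of _ b]) (simp add: S_def)
  define s where "s = Sup S"
  have as: "a < s" using cSup_upper[OF m bdd] e(1) \<open>a < t\<close> t unfolding s_def by simp
  have sb: "s \<le> b" unfolding s_def by (rule cSup_least) (use m in blast, simp add: S_def)
  have eq: "g p u = g' p' u" if au: "a < u" and us: "u < s" for u
  proof -
    have "S \<noteq> {}" using m by blast
    then obtain s' where "s' \<in> S" "u < s'" using us less_cSup_iff[OF _ bdd, of u] unfolding s_def by blast
    then show ?thesis using au by (auto simp: S_def)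
  qed
  have left: "\<forall>\<^sub>F u in at_left s. g p u = g' p' u"
    unfolding eventually_at_left_field using as eq by blast
  then have eqs: "g p s = g' p' s" by (rule value_l[OF apg apg'])
  show False
  proof (cases "s = b")
    case True
    then show False using ne eq[of t] eqs \<open>a < t\<close> t by (cases "t = s") auto
  next
    case False
    then have "\<forall>\<^sub>F u in at_right s. g p u = g' p' u"
      using agree_past[OF pt left] cr[OF as] sb by simp
    then obtain e' where e': "e' > s" "\<And>u. s < u \<Longrightarrow> u < e' \<Longrightarrow> g p u = g' p' u"
      unfolding eventually_at_right_field by blast
    have "g p u = g' p' u" if "a < u" "u < min e' b" for u
      using eq[of u] e'(2)[of u] eqs that by (cases u s rule: linorder_cases) auto
    then have "min e' b \<in> S" using e'(1) as sb False by (auto simp: S_def)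
    then have "min e' b \<le> s" unfolding s_def by (rule cSup_upper[OF _ bdd])
    then show False using e'(1) sb False by (auto simp: min_def split: if_splits)
  qed
qed

text \<open>Distinct curves have distinct right germs, and each germ is followed by a curve of the
  other family; so the second family also has two curves through the point.\<close>

lemma vx_transfer:
  assumes pt: "pt G g" "pt G' g'" "p \<in> G" "q \<in> G" "p \<noteq> q" "g p x = y" "g q x = y"
  obtains p' q' where "p' \<in> G'" "q' \<in> G'" "p' \<noteq> q'" "g' p' x = y" "g' q' x = y"
    "\<forall>\<^sub>F t in at_right x. g p t = g' p' t" "\<forall>\<^sub>F t in at_right x. g q t = g' q' t"
proof -
  obtain p' where p': "p' \<in> G'" "\<forall>\<^sub>F t in at_right x. g p t = g' p' t" using common_right_germ[OF pt(1,2,3)] by blast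
  obtain q' where q': "q' \<in> G'" "\<forall>\<^sub>F t in at_right x. g q t = g' q' t" using common_right_germ[OF pt(1,2,4)] by blast
  have "p' \<noteq> q'"
  proof
    assume "p' = q'"
    have "\<forall>\<^sub>F t in at_right x. g p t = g q t" using p'(2) q'(2) unfolding \<open>p' = q'\<close> by (rule ev_trans)
    then show False using family.germ_unique[OF pt_family[OF pt(1)] pt(3,4)] pt(5) by blast
  qed
  moreover have "g' p' x = y" "g' q' x = y"
    using value_r[OF pt_ap[OF pt(1,3)] pt_ap[OF pt(2) p'(1)] p'(2)] value_r[OF pt_ap[OF pt(1,4)] pt_ap[OF pt(2) q'(1)] q'(2)]
      assms(6,7) by simp_all
  ultimately show thesis using that p' q' by blast
qed

lemma pt_vx_iff:
  assumes "pt G g" "pt G' g'" shows "family.vx G g x y \<longleftrightarrow> family.vx G' g' x y"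
proof -
  interpret G: family G g by (rule pt_family[OF assms(1)])
  interpret G': family G' g' by (rule pt_family[OF assms(2)])
  show ?thesis
  proof
    assume "family.vx G g x y"
    then obtain p q where pq: "p \<in> G" "q \<in> G" "p \<noteq> q" "g p x = y" "g q x = y" unfolding G.vx_def by blast
    show "family.vx G' g' x y" using vx_transfer[OF assms pq] unfolding G'.vx_def by metis
  next
    assume "family.vx G' g' x y"
    then obtain p q where pq: "p \<in> G'" "q \<in> G'" "p \<noteq> q" "g' p x = y" "g' q x = y" unfolding G'.vx_def by blast
    show "family.vx G g x y" using vx_transfer[OF assms(2,1) pq] unfolding G.vx_def by metis
  qed
qed

lemma pt_cr_iff:
  assumes "pt G g" "pt G' g'" "family.ct G g x y \<longleftrightarrow> family.ct G' g' x y"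
  shows "family.cr G g x y \<longleftrightarrow> family.cr G' g' x y"
  using pt_vx_iff[OF assms(1,2)] assms(3) family.cr_iff[OF pt_family[OF assms(1)]] family.cr_iff[OF pt_family[OF assms(2)]]
  by metis

end

section \<open>Uniqueness of the source\<close>

text \<open>\<open>W\<close> represents every vertex modulo \<open>tau\<close>. Along any
  antiperiodic curve that runs on the lines, and not only along the lines, it is an interval of
  vertices shorter than a period; curves of a pseudotriangulation can therefore be followed inside
  it.\<close>

locale window = lines I f k for I :: "'a set" and f :: "'a \<Rightarrow> real \<Rightarrow> real" and k :: nat +
  fixes W :: "(real \<times> real) set"
  assumes W_vx: "z \<in> W \<Longrightarrow> vx (fst z) (snd z)"
    and W_ex: "vx x y \<Longrightarrow> \<exists>r::int. (x + of_int r * pi, sg r * y) \<in> W"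
    and W_fin: "finite W"
    and W_conv: "antiper h \<Longrightarrow> \<forall>x. \<exists>\<alpha>\<in>I. h x = f \<alpha> x \<Longrightarrow> (x1, h x1) \<in> W \<Longrightarrow> (x3, h x3) \<in> W \<Longrightarrow> x1 < x2 \<Longrightarrow> x2 < x3 \<Longrightarrow>
      vx x2 (h x2) \<Longrightarrow> (x2, h x2) \<in> W"
    and W_len: "antiper h \<Longrightarrow> \<forall>x. \<exists>\<alpha>\<in>I. h x = f \<alpha> x \<Longrightarrow> (x1, h x1) \<in> W \<Longrightarrow> (x3, h x3) \<in> W \<Longrightarrow> x3 < x1 + pi"
begin

definition early :: "'j set \<Rightarrow> ('j \<Rightarrow> real \<Rightarrow> real) \<Rightarrow> bool" where
  "early G g \<longleftrightarrow> (\<forall>p\<in>G. \<forall>q\<in>G. \<forall>x x'. p \<noteq> q \<longrightarrow> (x, g p x) \<in> W \<longrightarrow> (x', g p x') \<in> W \<longrightarrow>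
     touches (g p) (g q) x \<longrightarrow> crosses (g p) (g q) x' \<longrightarrow> x < x')"

lemma pt_on_line:
  assumes "pt G g" "p \<in> G" shows "\<forall>x. \<exists>\<alpha>\<in>I. g p x = f \<alpha> x"
proof
  fix x
  have "K x (g p x)" using pt_K[OF assms(1), of x "g p x"] assms(2) by blast
  then show "\<exists>\<alpha>\<in>I. g p x = f \<alpha> x" unfolding K_def by metis
qed

lemma pair_crossing_in_W:
  assumes "pt G g" "p \<in> G" "q \<in> G" "p \<noteq> q"
  obtains x where "(x, g p x) \<in> W" "crosses (g p) (g q) x"
proof -
  interpret G: family G g by (rule pt_family[OF assms(1)])
  obtain x0 where x0: "crosses (g p) (g q) x0" using G.has_crossing[OF assms(2-4)] .
  then have "g p x0 = g q x0" by (simp add: crosses_def)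
  then obtain r :: int where r: "(x0 + of_int r * pi, sg r * g p x0) \<in> W"
    using W_ex[OF coincide_vx[OF assms]] by blast
  show thesis
  proof (rule that)
    show "(x0 + of_int r * pi, g p (x0 + of_int r * pi)) \<in> W"
      using r by (simp only: antiper_shift[OF pt_ap[OF assms(1,2)]])
    show "crosses (g p) (g q) (x0 + of_int r * pi)"
      using x0 by (simp only: crosses_shift[OF pt_ap[OF assms(1,2)] pt_ap[OF assms(1,3)]])
  qed
qed

lemma agree_in_W:
  assumes pt: "pt G g" "p \<in> G" "pt G' g'" "p' \<in> G'" and start: "\<forall>\<^sub>F t in at_right x1. g p t = g' p' t"
    and W: "(x1, g p x1) \<in> W" "(x3, g p x3) \<in> W" "x1 < x3"
    and cr: "\<And>x y. (x, y) \<in> W \<Longrightarrow> x1 < x \<Longrightarrow> x < x3 \<Longrightarrow> family.cr G g x y \<longleftrightarrow> family.cr G' g' x y"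
  shows "g p x3 = g' p' x3"
proof (rule agree_along[OF pt start, of x3])
  fix x assume "x1 < x" "x < x3" "vx x (g p x)"
  then show "family.cr G g x (g p x) \<longleftrightarrow> family.cr G' g' x (g p x)"
    using W_conv[OF pt_ap[OF pt(1,2)] pt_on_line[OF pt(1,2)] W(1,2)] cr by blast
qed (use W(3) in auto)

text \<open>Follow the two curves of \<open>G'\<close> that touch at \<open>(x, y)\<close> up to their crossing. As there is no later
  difference, the two curves of \<open>G\<close> that cross at \<open>(x, y)\<close> run along with them and cross again.\<close>

lemma no_last_difference:
  assumes pt: "pt G g" "pt G' g'" and early: "early G' g'" and W: "(x, y) \<in> W"
    and cr: "family.cr G g x y" "\<not> family.cr G' g' x y"
    and same: "\<And>x' y'. (x', y') \<in> W \<Longrightarrow> x < x' \<Longrightarrow> family.cr G g x' y' \<longleftrightarrow> family.cr G' g' x' y'"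
  shows False
proof -
  interpret G: family G g by (rule pt_family[OF pt(1)])
  interpret G': family G' g' by (rule pt_family[OF pt(2)])
  obtain p q where pq: "p \<in> G" "q \<in> G" "p \<noteq> q" "g p x = y" "crosses (g p) (g q) x"
    using cr(1) unfolding G.cr_def by blast
  then have qy: "g q x = y" by (simp add: crosses_def)
  obtain p' q' where pq': "p' \<in> G'" "q' \<in> G'" "p' \<noteq> q'" "g' p' x = y" "g' q' x = y"
    "\<forall>\<^sub>F t in at_right x. g p t = g' p' t" "\<forall>\<^sub>F t in at_right x. g q t = g' q' t"
    using vx_transfer[OF pt pq(1-4) qy] by blast
  have tc: "touches (g' p') (g' q') x"
    using G'.cr_pair[OF pq'(1-5)] G'.cross_xor_touch[OF pq'(1-3)] cr(2) pq'(4,5) by simp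
  obtain x' where x': "(x', g' p' x') \<in> W" "crosses (g' p') (g' q') x'"
    using pair_crossing_in_W[OF pt(2) pq'(1-3)] .
  have Wx: "(x, g' p' x) \<in> W" "(x, g' q' x) \<in> W" using W pq'(4,5) by simp_all
  have lt: "x < x'" using early x' Wx(1) tc pq'(1-3) unfolding early_def by blast
  have qx': "g' q' x' = g' p' x'" using x'(2) by (simp add: crosses_def)
  have start: "\<forall>\<^sub>F t in at_right x. g' p' t = g p t" "\<forall>\<^sub>F t in at_right x. g' q' t = g q t"
    using pq'(6,7) by (auto elim: eventually_mono)
  have same': "family.cr G' g' u v \<longleftrightarrow> family.cr G g u v" if "(u, v) \<in> W" "x < u" "u < x'" for u v
    using same[OF that(1,2)] by blast
  have ep: "g' p' x' = g p x'" by (rule agree_in_W[OF pt(2) pq'(1) pt(1) pq(1) start(1) Wx(1) x'(1) lt same'])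
  have eq: "g' q' x' = g q x'"
    by (rule agree_in_W[OF pt(2) pq'(2) pt(1) pq(2) start(2) Wx(2) _ lt same']) (use x'(1) qx' in simp)
  have "family.cr G' g' x' (g' p' x')" unfolding G'.cr_def using pq'(1-3) x'(2) by blast
  then have "family.cr G g x' (g' p' x')" using same[OF x'(1) lt] by blast
  then have "crosses (g p) (g q) x'" using G.cr_pair[OF pq(1-3), of x' "g' p' x'"] ep eq qx' by simp
  then have "eqv x x'" using G.uniq[OF pq(1-3) pq(5)] by blast
  then have "x + pi \<le> x'" using lt by (rule eqv_less)
  moreover have "x' < x + pi"
    by (rule W_len[OF pt_ap[OF pt(2) pq'(1)] pt_on_line[OF pt(2) pq'(1)] Wx(1) x'(1)])
  ultimately show False by simp
qed

text \<open>\<open>W\<close> is finite, so some difference has the largest abscissa. Whichever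
  family has its contact there plays the part of \<open>G'\<close> in
  \<open>no_last_difference\<close>.\<close>

lemma early_unique_crossings:
  assumes pt: "pt G g" "pt G' g'" and early: "early G g" "early G' g'" and W: "(x, y) \<in> W"
  shows "family.cr G g x y \<longleftrightarrow> family.cr G' g' x y"
proof (rule ccontr)
  assume diff: "\<not> ?thesis"
  define B where "B = {z \<in> W. \<not> (family.cr G g (fst z) (snd z) \<longleftrightarrow> family.cr G' g' (fst z) (snd z))}"
  have B: "finite B" "(x, y) \<in> B" using W_fin W diff by (auto simp: B_def)
  have "Max (fst ` B) \<in> fst ` B" using B by (intro Max_in) auto
  then obtain z where z: "z \<in> B" "fst z = Max (fst ` B)" by auto
  have zW: "(fst z, snd z) \<in> W" using z(1) by (simp add: B_def)
  have same: "family.cr G g x' y' \<longleftrightarrow> family.cr G' g' x' y'" if "(x', y') \<in> W" "fst z < x'" for x' y'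
  proof (rule ccontr)
    assume "\<not> ?thesis"
    then have "(x', y') \<in> B" using that(1) by (simp add: B_def)
    then have "x' \<in> fst ` B" by force
    then have "x' \<le> fst z" unfolding z(2) using B(1) by (intro Max_ge) auto
    then show False using that(2) by simp
  qed
  show False
  proof (cases "family.cr G g (fst z) (snd z)")
    case True
    then have "\<not> family.cr G' g' (fst z) (snd z)" using z(1) by (simp add: B_def)
    then show False using no_last_difference[OF pt early(2) zW True] same by blast
  next
    case False
    then have "family.cr G' g' (fst z) (snd z)" using z(1) by (simp add: B_def)
    then show False using no_last_difference[OF pt(2,1) early(1) zW _ False] same by blast
  qed
qed

text \<open>The crossings agree in \<open>W\<close> and, by translation, everywhere. A curve is then
  determined by its right germ at \<open>0\<close>, and agreement over one period extends
  antiperiodically.\<close>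

theorem early_unique:
  assumes pt: "pt G g" "pt G' g'" and early: "early G g" "early G' g'" and p: "p \<in> G"
  shows "\<exists>p'\<in>G'. g p = g' p'"
proof -
  interpret G: family G g by (rule pt_family[OF pt(1)])
  interpret G': family G' g' by (rule pt_family[OF pt(2)])
  have cr: "G.cr x y \<longleftrightarrow> G'.cr x y" if vxy: "vx x y" for x y
  proof -
    obtain r :: int where r: "(x + of_int r * pi, sg r * y) \<in> W" using W_ex[OF vxy] by blast
    show ?thesis using early_unique_crossings[OF pt early r] unfolding G.cr_shift G'.cr_shift .
  qed
  obtain p' where p': "p' \<in> G'" "\<forall>\<^sub>F t in at_right 0. g p t = g' p' t" using common_right_germ[OF pt p] by blast
  have eq: "g p t = g' p' t" if "0 \<le> t" "t \<le> pi" for t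
    by (rule agree_along[OF pt(1) p pt(2) p'(1) p'(2), of pi]) (use cr that in auto)
  have "g p x = g' p' x" for x
  proof -
    define r where "r = \<lfloor>x / pi\<rfloor>"
    have x0: "0 \<le> x - of_int r * pi" "x - of_int r * pi \<le> pi"
      unfolding r_def using floor_divide_lower[of pi x] floor_divide_upper[of pi x] by (auto simp: algebra_simps)
    have "x = (x - of_int r * pi) + of_int r * pi" by simp
    then show ?thesis
      using antiper_shift[OF pt_ap[OF pt(1) p], of "x - of_int r * pi" r] antiper_shift[OF pt_ap[OF pt(2) p'(1)], of "x - of_int r * pi" r]
        eq[OF x0] by simp
  qed
  then show ?thesis using p'(1) by blast
qed

text \<open>Between \<open>xv\<close> and \<open>xw\<close> the two families have the same
  crossings, so the pair of \<open>G'\<close> through \<open>xv\<close> accompanies the pair of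
  \<open>G\<close> up to \<open>xw\<close>. It crosses at \<open>xv\<close> and touches at
  \<open>xw\<close>, contrary to \<open>early\<close>.\<close>

lemma early_no_incoming_flip:
  assumes pt: "pt G g" "pt G' g'" and early: "early G' g'" and pq: "p \<in> G" "q \<in> G" "p \<noteq> q"
    and v: "touches (g p) (g q) xv" "(xv, g p xv) \<in> W" and w: "crosses (g p) (g q) xw" "(xw, g p xw) \<in> W"
    and lt: "xv < xw"
    and ct: "\<not> family.ct G' g' xv (g p xv)" "family.ct G' g' xw (g p xw)"
      "\<And>x y. \<not> eqv xv x \<Longrightarrow> \<not> eqv xw x \<Longrightarrow> family.ct G g x y \<longleftrightarrow> family.ct G' g' x y"
  shows False
proof -
  interpret G: family G g by (rule pt_family[OF pt(1)])
  interpret G': family G' g' by (rule pt_family[OF pt(2)])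
  have qv: "g q xv = g p xv" and qw: "g q xw = g p xw" using v w by (auto simp: touches_def crosses_def)
  obtain p' q' where pq': "p' \<in> G'" "q' \<in> G'" "p' \<noteq> q'" "g' p' xv = g p xv" "g' q' xv = g p xv"
    "\<forall>\<^sub>F t in at_right xv. g p t = g' p' t" "\<forall>\<^sub>F t in at_right xv. g q t = g' q' t"
    using vx_transfer[OF pt pq refl qv] by blast
  have cv: "crosses (g' p') (g' q') xv"
    using G'.ct_pair[OF pq'(1-5)] G'.cross_xor_touch[OF pq'(1-3)] ct(1) pq'(4,5) by simp
  have len: "xw < xv + pi"
    by (rule W_len[OF pt_ap[OF pt(1) pq(1)] pt_on_line[OF pt(1) pq(1)] v(2) w(2)])
  have cr: "family.cr G g x y \<longleftrightarrow> family.cr G' g' x y" if "xv < x" "x < xw" for x y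
  proof (rule pt_cr_iff[OF pt])
    have "\<not> eqv xv x" using eqv_less[of xv x] that len by force
    moreover have "\<not> eqv xw x" using eqv_less[of x xw] eqv_sym[of x xw] that len by force
    ultimately show "family.ct G g x y \<longleftrightarrow> family.ct G' g' x y" by (rule ct(3))
  qed
  have ep: "g p xw = g' p' xw" by (rule agree_in_W[OF pt(1) pq(1) pt(2) pq'(1,6) v(2) w(2) lt cr])
  have eq: "g q xw = g' q' xw"
    by (rule agree_in_W[OF pt(1) pq(2) pt(2) pq'(2,7) _ _ lt cr]) (use v w qv qw in simp_all)
  have "touches (g' p') (g' q') xw" using G'.ct_pair[OF pq'(1-3), of xw "g p xw"] ct(2) ep eq qw by simp
  then have "xw < xv"
    using early cv pq'(1-3) v(2) w(2) pq'(4) ep unfolding early_def by metis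
  then show False using lt by simp
qed

end

section \<open>Flips\<close>

lemma crosses_cong:
  assumes "\<forall>\<^sub>F t in nhds x. a t = a' t \<and> b t = b' t" 
  shows "crosses a b x \<longleftrightarrow> crosses a' b' x" "touches a b x \<longleftrightarrow> touches a' b' x"
proof -
  have "\<forall>\<^sub>F t in at_left x. a t = a' t \<and> b t = b' t" "\<forall>\<^sub>F t in at_right x. a t = a' t \<and> b t = b' t"
    using assms unfolding eventually_nhds_conv_at eventually_at_split by auto
  from this(1)[THEN eventually_at_left_to_0[THEN iffD1]] this(2)[THEN eventually_at_right_to_0'[THEN iffD1]]
  have ev: "\<forall>\<^sub>F h in at_right 0. (a (x - h) - b (x - h)) * (a (x + h) - b (x + h)) =
      (a' (x - h) - b' (x - h)) * (a' (x + h) - b' (x + h))"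
    by eventually_elim simp
  have x: "a x = a' x \<and> b x = b' x" using eventually_nhds_x_imp_x[OF assms] .
  have "(\<forall>\<^sub>F h in at_right 0. Q ((a (x - h) - b (x - h)) * (a (x + h) - b (x + h)))) \<longleftrightarrow>
      (\<forall>\<^sub>F h in at_right 0. Q ((a' (x - h) - b' (x - h)) * (a' (x + h) - b' (x + h))))" for Q :: "real \<Rightarrow> bool"
    by (rule eventually_subst, rule eventually_mono[OF ev]) simp
  from this[of "\<lambda>u. u < 0"] this[of "\<lambda>u. u > 0"]
  show "crosses a b x \<longleftrightarrow> crosses a' b' x" "touches a b x \<longleftrightarrow> touches a' b' x"
    unfolding crosses_def touches_def using x by auto
qed

lemma crosses_not_touches: "crosses a b x \<Longrightarrow> \<not> touches a b x"
proof
  assume "crosses a b x" "touches a b x"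
  then have "\<forall>\<^sub>F h in at_right 0. (a (x - h) - b (x - h)) * (a (x + h) - b (x + h)) < 0 \<and>
      (a (x - h) - b (x - h)) * (a (x + h) - b (x + h)) > 0"
    unfolding crosses_def touches_def by (auto intro: eventually_conj)
  then show False using eventually_happens'[OF trivial_limit_at_right_real] by (metis (no_types, lifting) less_asym)
qed

lemma eqv_representative: obtains x0 where "eqv x x0" "a \<le> x0" "x0 < a + pi"
proof -
  define r where "r = - \<lfloor>(x - a) / pi\<rfloor>"
  have "a \<le> x + of_int r * pi" "x + of_int r * pi < a + pi"
    unfolding r_def using floor_divide_lower[of pi "x - a"] floor_divide_upper[of pi "x - a"]
    by (auto simp: algebra_simps)
  then show thesis by (intro that[of "x + of_int r * pi"]) (auto simp: eqv_def)
qed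

context family begin

text \<open>Together the two new curves cross a third one as often as the old ones, that is twice, and each of
  them crosses it at least once by antiperiodicity.\<close>

theorem flip:
  assumes pq: "p \<in> G" "q \<in> G" "p \<noteq> q" and v: "crosses (g p) (g q) xv" and w: "touches (g p) (g q) xw"
    and ord: "xv < xw" "xw < xv + pi"
  obtains g' where "family G g'" "\<And>x y. (\<exists>r\<in>G. g' r x = y) \<longleftrightarrow> (\<exists>r\<in>G. g r x = y)"
    "touches (g' p) (g' q) xv" "crosses (g' p) (g' q) xw"
    "\<And>x y. family.ct G g' x y \<longleftrightarrow> ct x y \<and> \<not> (eqv xw x \<and> y = g p x) \<or> eqv xv x \<and> y = g p x"
    "g' p xv = g p xv" "g' p xw = g p xw"
proof -
  note app = ap[OF pq(1)] and apq = ap[OF pq(2)]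
  have gv: "g p xv = g q xv" and gw: "g p xw = g q xw" using v w by (auto simp: crosses_def touches_def)
  \<comment> \<open>Cut and paste: one curve from \<open>xv\<close> to \<open>xw\<close>, then the
    other up to \<open>xv + pi\<close>. The values fit because the curves meet at \<open>xv\<close>
    and at \<open>xw\<close>.\<close>
  have ext: "\<exists>P. antiper P \<and> (\<forall>t. xv \<le> t \<longrightarrow> t \<le> xv + pi \<longrightarrow> P t = (if t \<le> xw then a t else b t))"
    if ab: "antiper a" "antiper b" "a xv = b xv" "a xw = b xw" for a b
  proof -
    have "continuous_on {xv..xv + pi} (\<lambda>t. if t \<le> xw then a t else b t)"
      using ab by (intro continuous_on_cases_le antiper_cont continuous_intros) auto
    moreover have "(if xv + pi \<le> xw then a (xv + pi) else b (xv + pi)) = - (if xv \<le> xw then a xv else b xv)"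
      using ord ab antiper_simps(1)[OF ab(2), of xv] by auto
    ultimately obtain P where "antiper P" "\<And>t. xv \<le> t \<Longrightarrow> t \<le> xv + pi \<Longrightarrow> P t = (if t \<le> xw then a t else b t)"
      using antiper_extension[of xv "\<lambda>t. if t \<le> xw then a t else b t"] by blast
    then show ?thesis by blast
  qed
  obtain P' where P': "antiper P'" "\<forall>t. xv \<le> t \<longrightarrow> t \<le> xv + pi \<longrightarrow> P' t = (if t \<le> xw then g q t else g p t)"
    using ext[OF apq app] gv gw by auto
  obtain Q' where Q': "antiper Q'" "\<forall>t. xv \<le> t \<longrightarrow> t \<le> xv + pi \<longrightarrow> Q' t = (if t \<le> xw then g p t else g q t)"
    using ext[OF app apq] gv gw by auto
  define g' where "g' r = (if r = p then P' else if r = q then Q' else g r)" for r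
  \<comment> \<open>Between \<open>xv\<close> and \<open>xw\<close> the new family is the old one
    with \<open>p\<close> and \<open>q\<close> transposed.\<close>
  define sw where "sw r = (if r = p then q else if r = q then p else r)" for r
  have sw: "sw r \<in> G" "sw (sw r) = r" if "r \<in> G" for r using that pq by (auto simp: sw_def)
  have sw_eq: "sw r = sw s \<longleftrightarrow> r = s" for r s using pq(3) by (auto simp: sw_def)
  have ap': "antiper (g' r)" if "r \<in> G" for r using that P' Q' ap by (auto simp: g'_def)
  have in1: "g' r t = g (sw r) t" if "xv \<le> t" "t \<le> xw" for r t
    using P'(2) Q'(2) that ord pq(3) by (auto simp: g'_def sw_def)
  have in2: "g' r t = g r t" if "xw \<le> t" "t \<le> xv + pi" for r t
    using P'(2) Q'(2) that ord pq(3) gw by (auto simp: g'_def)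
  have shift_eq: "g' r x = g s x \<longleftrightarrow> g' r x0 = g s x0" if "eqv x x0" "r \<in> G" "s \<in> G" for r s x x0
    using antiper_eq_eqv[OF ap'[OF that(2)] ap[OF that(3)] that(1)] .
  have vals: "(\<forall>r\<in>G. g' r x = g r x) \<or> (\<forall>r\<in>G. g' r x = g (sw r) x)" for x
  proof -
    obtain x0 where x0: "eqv x x0" "xv \<le> x0" "x0 < xv + pi" by (rule eqv_representative)
    show ?thesis
    proof (cases "x0 \<le> xw")
      case True
      then have "\<forall>r\<in>G. g' r x = g (sw r) x" using in1[OF x0(2) True] shift_eq[OF x0(1)] sw by blast
      then show ?thesis ..
    next
      case False
      then have "\<forall>r\<in>G. g' r x = g r x" using in2[of x0] x0 shift_eq[OF x0(1)] by auto
      then show ?thesis ..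
    qed
  qed
  \<comment> \<open>Away from the two exchanged vertices the families coincide up to the
    transposition on a whole neighbourhood, so types of vertices carry over.\<close>
  have Loc: "\<exists>\<sigma>. (\<sigma> = id \<or> \<sigma> = sw) \<and> (\<forall>r\<in>G. \<forall>s\<in>G. (crosses (g' r) (g' s) x \<longleftrightarrow> crosses (g (\<sigma> r)) (g (\<sigma> s)) x) \<and>
      (touches (g' r) (g' s) x \<longleftrightarrow> touches (g (\<sigma> r)) (g (\<sigma> s)) x)) \<and> (\<forall>r\<in>G. g' r x = g (\<sigma> r) x)"
    if ne: "\<not> eqv xv x" "\<not> eqv xw x" for x
  proof -
    obtain x0 where x0: "eqv x x0" "xv \<le> x0" "x0 < xv + pi" by (rule eqv_representative)
    have "x0 \<noteq> xv" "x0 \<noteq> xw" using x0(1) ne eqv_sym by blast+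
    have *: "\<exists>\<sigma>. (\<sigma> = id \<or> \<sigma> = sw) \<and> (\<forall>\<^sub>F t in nhds x0. \<forall>r. g' r t = g (\<sigma> r) t)"
    proof (cases "x0 < xw")
      case True
      then have "x0 \<in> {xv<..<xw}" using x0 \<open>x0 \<noteq> xv\<close> by auto
      then have "\<forall>\<^sub>F t in nhds x0. t \<in> {xv<..<xw}" by (intro eventually_nhds_in_open) auto
      then have "\<forall>\<^sub>F t in nhds x0. \<forall>r. g' r t = g (sw r) t" by (rule eventually_mono) (auto intro: in1)
      then show ?thesis by blast
    next
      case False
      then have "x0 \<in> {xw<..<xv + pi}" using x0 \<open>x0 \<noteq> xw\<close> by auto
      then have "\<forall>\<^sub>F t in nhds x0. t \<in> {xw<..<xv + pi}" by (intro eventually_nhds_in_open) auto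
      then have "\<forall>\<^sub>F t in nhds x0. \<forall>r. g' r t = g (id r) t" by (rule eventually_mono) (auto intro: in2)
      then show ?thesis by blast
    qed
    then obtain \<sigma> where \<sigma>: "\<sigma> = id \<or> \<sigma> = sw" "\<forall>\<^sub>F t in nhds x0. \<forall>r. g' r t = g (\<sigma> r) t" by blast
    have \<sigma>G: "\<sigma> r \<in> G" if "r \<in> G" for r using \<sigma>(1) sw(1)[OF that] that by auto
    have c: "(crosses (g' r) (g' s) x0 \<longleftrightarrow> crosses (g (\<sigma> r)) (g (\<sigma> s)) x0) \<and>
      (touches (g' r) (g' s) x0 \<longleftrightarrow> touches (g (\<sigma> r)) (g (\<sigma> s)) x0)" for r s
      by (intro conjI crosses_cong) (rule eventually_mono[OF \<sigma>(2)], simp)+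
    have "(crosses (g' r) (g' s) x \<longleftrightarrow> crosses (g (\<sigma> r)) (g (\<sigma> s)) x) \<and>
      (touches (g' r) (g' s) x \<longleftrightarrow> touches (g (\<sigma> r)) (g (\<sigma> s)) x)" if "r \<in> G" "s \<in> G" for r s
      using c[of r s] crosses_eqv[OF ap'[OF that(1)] ap'[OF that(2)] x0(1)] touches_eqv[OF ap'[OF that(1)] ap'[OF that(2)] x0(1)]
        crosses_eqv[OF ap[OF \<sigma>G[OF that(1)]] ap[OF \<sigma>G[OF that(2)]] x0(1)] touches_eqv[OF ap[OF \<sigma>G[OF that(1)]] ap[OF \<sigma>G[OF that(2)]] x0(1)]
      by simp
    moreover have "g' r x = g (\<sigma> r) x" if "r \<in> G" for r
      using shift_eq[OF x0(1) that \<sigma>G[OF that]] eventually_nhds_x_imp_x[OF \<sigma>(2)] by blast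
    ultimately show ?thesis using \<sigma>(1) by blast
  qed
  have at_vw: "g p x = g q x" if "eqv xv x \<or> eqv xw x" for x
    using antiper_eq_eqv[OF app apq] gv gw that by blast
  have apart: "g r x \<noteq> g p x" if "eqv xv x \<or> eqv xw x" "r \<in> G" "r \<noteq> p" "r \<noteq> q" for r x
    using triple[OF pq(1,2) that(2) pq(3)] that(3,4) at_vw[OF that(1)] by metis
  have apart': "g' r x \<noteq> g s x" if "eqv xv x \<or> eqv xw x" "r = p \<or> r = q" "s \<in> G" "s \<noteq> p" "s \<noteq> q" for r s x
  proof -
    have "g' r x = g p x" using vals[of x] at_vw[OF that(1)] that(2) pq unfolding sw_def by metis
    then show ?thesis using apart[OF that(1,3-5)] by simp
  qed
  have g'p: "g' p = P'" and g'q: "g' q = Q'" using pq(3) by (auto simp: g'_def)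
  have out: "g' r = g r" if "r \<noteq> p" "r \<noteq> q" for r using that by (simp add: g'_def)
  have cw: "crosses (g' p) (g' q) xw"
    unfolding crosses_def
  proof
    show "g' p xw = g' q xw" using in2[of xw] gw ord by simp
    have "\<forall>\<^sub>F h in at_right 0. 0 < h \<and> h < min (xw - xv) (xv + pi - xw)"
      using ord by (auto simp: eventually_at_right_field intro!: exI[of _ "min (xw - xv) (xv + pi - xw)"])
    with w[unfolded touches_def, THEN conjunct2]
    show "\<forall>\<^sub>F h in at_right 0. (g' p (xw - h) - g' q (xw - h)) * (g' p (xw + h) - g' q (xw + h)) < 0"
    proof eventually_elim
      case (elim h)
      then have "g' p (xw - h) = g q (xw - h)" "g' q (xw - h) = g p (xw - h)" "g' p (xw + h) = g p (xw + h)" "g' q (xw + h) = g q (xw + h)"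
        using in1[of "xw - h"] in2[of "xw + h"] pq(3) by (auto simp: sw_def)
      then show ?case using elim(1) by (simp add: algebra_simps)
    qed
  qed
  have tv: "touches (g' p) (g' q) xv"
    unfolding touches_def
  proof
    show "g' p xv = g' q xv" using in1[of xv] gv ord pq(3) by (simp add: sw_def)
    have "\<forall>\<^sub>F h in at_right 0. 0 < h \<and> h < min (xw - xv) (xv + pi - xw)"
      using ord by (auto simp: eventually_at_right_field intro!: exI[of _ "min (xw - xv) (xv + pi - xw)"])
    with v[unfolded crosses_def, THEN conjunct2]
    show "\<forall>\<^sub>F h in at_right 0. 0 < (g' p (xv - h) - g' q (xv - h)) * (g' p (xv + h) - g' q (xv + h))"
    proof eventually_elim
      case (elim h)
      \<comment> \<open>The left germ at \<open>xv\<close> is seen one period later, just before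
        \<open>xv + pi\<close>, where the new curves are the old ones.\<close>
      have l: "g' r (xv - h) = g r (xv - h)" if "r \<in> G" for r
        using in2[of "xv - h + pi" r] elim(2) antiper_simps(1)[OF ap'[OF that], of "xv - h"] antiper_simps(1)[OF ap[OF that], of "xv - h"] by simp
      have "g' p (xv + h) = g q (xv + h)" "g' q (xv + h) = g p (xv + h)"
        using in1[of "xv + h"] elim(2) pq(3) by (auto simp: sw_def)
      then show ?case using elim(1) l[OF pq(1)] l[OF pq(2)] by (simp add: algebra_simps)
    qed
  qed
  have isol': "finite ({t. g' r t = g' s t} \<inter> {a..b})" if rs: "r \<in> G" "s \<in> G" "r \<noteq> s" for r s a b
  proof (rule finite_subset)
    show "{t. g' r t = g' s t} \<inter> {a..b} \<subseteq> ({t. g r t = g s t} \<inter> {a..b}) \<union> ({t. g (sw r) t = g (sw s) t} \<inter> {a..b})"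
      using vals rs(1,2) by (auto, metis)
    show "finite (({t. g r t = g s t} \<inter> {a..b}) \<union> ({t. g (sw r) t = g (sw s) t} \<inter> {a..b}))"
      using isol[OF rs] isol[OF sw(1)[OF rs(1)] sw(1)[OF rs(2)]] rs(3) sw_eq by simp
  qed
  \<comment> \<open>Up to the transposition, every crossing of a new curve with \<open>s\<close> is
    a crossing of \<open>p\<close> or of \<open>q\<close> with \<open>s\<close>, which makes at most
    two classes modulo \<open>pi\<close>. The other new curve needs one of them, and by simplicity
    (\<open>excl\<close>) it cannot share it with the first curve.\<close>
  have mixed: "eqv x1 x2" if r: "r = p \<or> r = q" and s: "s \<in> G" "s \<noteq> p" "s \<noteq> q"
    and x: "crosses (g' r) (g' s) x1" "crosses (g' r) (g' s) x2" for r s x1 x2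
  proof -
    have rG: "r \<in> G" and swr: "sw r = p \<or> sw r = q" "r \<noteq> sw r" using r pq by (auto simp: sw_def)
    have swG: "sw r \<in> G" "sw r \<noteq> s" by (rule sw(1)[OF rG], use swr s in blast)
    have type: "crosses (g p) (g s) u \<or> crosses (g q) (g s) u" if t: "t = p \<or> t = q" and c: "crosses (g' t) (g' s) u" for t u
    proof -
      have tG: "t \<in> G" using t pq by blast
      have "g' t u = g s u" using c out[OF s(2,3)] by (simp add: crosses_def)
      then have "\<not> (eqv xv u \<or> eqv xw u)" using apart'[OF _ t s] by blast
      then obtain \<sigma> where "\<sigma> = id \<or> \<sigma> = sw" "crosses (g (\<sigma> t)) (g (\<sigma> s)) u"
        using Loc[of u] tG s(1) c by blast
      moreover have "sw s = s" using s by (simp add: sw_def)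
      moreover have "sw t = p \<or> sw t = q" using t by (auto simp: sw_def)
      ultimately show ?thesis using t by auto
    qed
    obtain x3 where x3: "crosses (g' (sw r)) (g' s) x3"
      using antiper_has_crossing[OF ap'[OF swG(1)] ap'[OF s(1)] isol'[OF swG(1) s(1) swG(2)]] by blast
    have excl: "\<not> eqv u x3" if "crosses (g' r) (g' s) u" for u
    proof
      assume e: "eqv u x3"
      have "g' (sw r) x3 = g s x3" "g' r u = g s u" using x3 that out[OF s(2,3)] by (simp_all add: crosses_def)
      then have "g' (sw r) x3 = g s x3" "g' r x3 = g s x3" using shift_eq[OF e rG s(1)] by simp_all
      then have "g r x3 = g s x3 \<and> g (sw r) x3 = g s x3"
        using vals[of x3] rG swG(1) sw(2)[OF rG] by auto
      moreover have "r \<noteq> s" using r s by blast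
      ultimately show False using triple[OF rG swG(1) s(1) swr(2), of x3] swG(2) by auto
    qed
    have u: "eqv a b" if "crosses (g p) (g s) a \<and> crosses (g p) (g s) b \<or> crosses (g q) (g s) a \<and> crosses (g q) (g s) b" for a b
      using that uniq[OF pq(1) s(1)] uniq[OF pq(2) s(1)] s(2,3) by metis
    from type[OF r x(1)] type[OF r x(2)] type[OF swr(1) x3] u excl[OF x(1)] excl[OF x(2)]
    show ?thesis by blast
  qed
  have fam: "family G g'"
  proof
    show "finite G" by (rule fin)
    show "antiper (g' r)" if "r \<in> G" for r by (rule ap'[OF that])
    show "finite ({t. g' r t = g' s t} \<inter> {a..b})" if "r \<in> G" "s \<in> G" "r \<noteq> s" for r s a b
      by (rule isol'[OF that])
    show "g' r x \<noteq> g' u x" if "r \<in> G" "s \<in> G" "u \<in> G" "r \<noteq> s" "r \<noteq> u" "s \<noteq> u" "g' r x = g' s x" for r s u x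
      using vals[of x]
    proof
      assume "\<forall>r\<in>G. g' r x = g r x"
      then show ?thesis using triple[OF that(1-6)] that by simp
    next
      assume "\<forall>r\<in>G. g' r x = g (sw r) x"
      then show ?thesis using triple[OF sw(1)[OF that(1)] sw(1)[OF that(2)] sw(1)[OF that(3)]] sw_eq that by simp
    qed
    show "eqv x x'" if rs: "r \<in> G" "s \<in> G" "r \<noteq> s" and c: "crosses (g' r) (g' s) x" "crosses (g' r) (g' s) x'" for r s x x'
    proof -
      \<comment> \<open>At \<open>xv\<close> the new pair touches; a crossing away from
        \<open>xv\<close> and \<open>xw\<close> would be a second crossing of the old pair.\<close>
      have pqc: "eqv xw u" if cu: "crosses (g' p) (g' q) u" for u
      proof (rule ccontr)
        assume n: "\<not> eqv xw u"
        have "\<not> eqv xv u"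
          using cu tv crosses_not_touches touches_eqv[OF ap'[OF pq(1)] ap'[OF pq(2)], of xv u] by blast
        then obtain \<sigma> where "\<sigma> = id \<or> \<sigma> = sw" "crosses (g (\<sigma> p)) (g (\<sigma> q)) u" using Loc[of u] n cu pq by blast
        moreover have "sw p = q" "sw q = p" using pq(3) by (auto simp: sw_def)
        ultimately have "crosses (g p) (g q) u" using crosses_commute[of "g q" "g p" u] by auto
        then show False using uniq[OF pq v] \<open>\<not> eqv xv u\<close> by blast
      qed
      consider "r = p \<and> s = q \<or> r = q \<and> s = p" | "r = p \<or> r = q" "s \<noteq> p" "s \<noteq> q" | "s = p \<or> s = q" "r \<noteq> p" "r \<noteq> q"
        | "r \<noteq> p" "r \<noteq> q" "s \<noteq> p" "s \<noteq> q" using rs(3) by blast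
      then show ?thesis
      proof cases
        case 1
        then have "crosses (g' p) (g' q) x" "crosses (g' p) (g' q) x'" using c crosses_commute by metis+
        then show ?thesis using pqc eqv_sym eqv_trans by metis
      next
        case 2
        then show ?thesis using mixed[OF 2(1) rs(2) 2(2,3) c] by simp
      next
        case 3
        then show ?thesis using mixed[OF 3(1) rs(1) 3(2,3)] c crosses_commute by metis
      next
        case 4
        then show ?thesis using uniq[OF rs] c out by simp
      qed
    qed
  qed
  interpret G': family G g' by (rule fam)
  have ctI: "ct x y" if "r \<in> G" "s \<in> G" "r \<noteq> s" "g r x = y" "touches (g r) (g s) x" for r s x y
    unfolding ct_def using that by blast
  have ctI': "G'.ct x y" if "r \<in> G" "s \<in> G" "r \<noteq> s" "g' r x = y" "touches (g' r) (g' s) x" for r s x y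
    unfolding G'.ct_def using that by blast
  have ct: "G'.ct x y \<longleftrightarrow> ct x y \<and> \<not> (eqv xw x \<and> y = g p x) \<or> eqv xv x \<and> y = g p x" for x y
  proof (cases "eqv xv x \<or> eqv xw x")
    case False
    then obtain \<sigma> where \<sigma>: "\<sigma> = id \<or> \<sigma> = sw" "\<forall>r\<in>G. \<forall>s\<in>G. touches (g' r) (g' s) x \<longleftrightarrow> touches (g (\<sigma> r)) (g (\<sigma> s)) x"
      "\<forall>r\<in>G. g' r x = g (\<sigma> r) x" using Loc[of x] by blast
    have \<sigma>G: "\<sigma> r \<in> G" "\<sigma> (\<sigma> r) = r" if "r \<in> G" for r using \<sigma>(1) sw[OF that] that by auto
    have \<sigma>i: "\<sigma> r = \<sigma> s \<longleftrightarrow> r = s" for r s using \<sigma>(1) sw_eq by auto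
    have "G'.ct x y \<longleftrightarrow> ct x y"
    proof
      assume "G'.ct x y"
      then obtain r s where "r \<in> G" "s \<in> G" "r \<noteq> s" "g' r x = y" "touches (g' r) (g' s) x" unfolding G'.ct_def by blast
      then show "ct x y" using \<sigma>(2,3) \<sigma>G \<sigma>i by (intro ctI[of "\<sigma> r" "\<sigma> s"]) auto
    next
      assume "ct x y"
      then obtain r s where "r \<in> G" "s \<in> G" "r \<noteq> s" "g r x = y" "touches (g r) (g s) x" unfolding ct_def by blast
      then show "G'.ct x y" using \<sigma>(2,3) \<sigma>G \<sigma>i by (intro ctI'[of "\<sigma> r" "\<sigma> s"]) auto
    qed
    then show ?thesis using False by blast
  next
    case True
    have gx: "g' p x = g p x" "g' q x = g p x" "g q x = g p x"
      using vals[of x] at_vw[OF True] pq unfolding sw_def by metis+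
    have others: "r \<noteq> p \<and> r \<noteq> q \<and> s \<noteq> p \<and> s \<noteq> q"
      if "r \<in> G" "s \<in> G" "g r x = g s x" "\<not> (r = p \<and> s = q)" "\<not> (r = q \<and> s = p)" "r \<noteq> s" for r s
      using apart[OF True that(1)] apart[OF True that(2)] gx(3) that(3-6) by metis
    have others': "r \<noteq> p \<and> r \<noteq> q \<and> s \<noteq> p \<and> s \<noteq> q"
      if "r \<in> G" "s \<in> G" "g' r x = g' s x" "\<not> (r = p \<and> s = q)" "\<not> (r = q \<and> s = p)" "r \<noteq> s" for r s
      using apart[OF True that(1)] apart[OF True that(2)] gx out[of r] out[of s] that(3-6) by metis
    show ?thesis
    proof
      assume "G'.ct x y"
      then obtain r s where rs: "r \<in> G" "s \<in> G" "r \<noteq> s" "g' r x = y" "touches (g' r) (g' s) x" unfolding G'.ct_def by blast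
      show "ct x y \<and> \<not> (eqv xw x \<and> y = g p x) \<or> eqv xv x \<and> y = g p x"
      proof (cases "(r = p \<and> s = q) \<or> (r = q \<and> s = p)")
        case c: True
        then have t: "touches (g' p) (g' q) x" using rs(5) touches_commute by metis
        then have "\<not> eqv xw x" using cw crosses_not_touches crosses_eqv[OF ap'[OF pq(1)] ap'[OF pq(2)], of xw x] by blast
        moreover have "y = g p x" using c rs(4) gx by auto
        ultimately show ?thesis using True by blast
      next
        case False
        then have o: "r \<noteq> p \<and> r \<noteq> q \<and> s \<noteq> p \<and> s \<noteq> q" using others'[OF rs(1,2) _ _ _ rs(3)] rs(5) by (auto simp: touches_def)
        then have "touches (g r) (g s) x" "g r x = y" using rs(4,5) out[of r] out[of s] by simp_all
        moreover have "y \<noteq> g p x" using \<open>g r x = y\<close> apart[OF True rs(1)] o by blast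
        ultimately show ?thesis using ctI[OF rs(1-3)] by blast
      qed
    next
      assume a: "ct x y \<and> \<not> (eqv xw x \<and> y = g p x) \<or> eqv xv x \<and> y = g p x"
      show "G'.ct x y"
      proof (cases "eqv xv x \<and> y = g p x")
        case c: True
        then have "touches (g' p) (g' q) x" using tv touches_eqv[OF ap'[OF pq(1)] ap'[OF pq(2)], of xv x] by blast
        then show ?thesis using ctI'[OF pq, of x y] gx(1) c by simp
      next
        case False
        then have "ct x y" "\<not> (eqv xw x \<and> y = g p x)" using a by blast+
        then obtain r s where rs: "r \<in> G" "s \<in> G" "r \<noteq> s" "g r x = y" "touches (g r) (g s) x" unfolding ct_def by blast
        have "\<not> (r = p \<and> s = q)" "\<not> (r = q \<and> s = p)"
          using False \<open>\<not> (eqv xw x \<and> y = g p x)\<close> rs(4) gx(3) True by metis+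
        then have "r \<noteq> p \<and> r \<noteq> q \<and> s \<noteq> p \<and> s \<noteq> q" using others[OF rs(1,2) _ _ _ rs(3)] rs(5) by (auto simp: touches_def)
        then show ?thesis using ctI'[OF rs(1-3), of x y] rs(4,5) out[of r] out[of s] by simp
      qed
    qed
  qed
  have supp: "(\<exists>r\<in>G. g' r x = y) \<longleftrightarrow> (\<exists>r\<in>G. g r x = y)" for x y
    using vals[of x] sw by metis
  show thesis
    by (rule that[of g']) (use fam supp tv cw ct in1[of xv p] in2[of xw p] ord gv gw pq(3) in \<open>auto simp: sw_def\<close>)
qed

end

section \<open>Families of curves and arrangements\<close>

lemma mproj_eq_curve:
  assumes "antiper h" shows "mproj (x, y) = mproj (u, h u) \<longleftrightarrow> eqv u x \<and> y = h x"
proof -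
  have "mproj (x, y) = mproj (u, h u) \<longleftrightarrow> mproj (u, h u) = mproj (x, y)" by (rule eq_commute)
  also have "\<dots> \<longleftrightarrow> (\<exists>r::int. x = u + of_int r * pi \<and> y = sg r * h u)" by (rule mproj_eq_iff)
  also have "\<dots> \<longleftrightarrow> eqv u x \<and> y = h x" unfolding eqv_def using antiper_shift[OF assms] by metis
  finally show ?thesis .
qed

definition plines :: "'i set \<Rightarrow> ('i \<Rightarrow> real \<Rightarrow> real) \<Rightarrow> moebius set set" where
  "plines G g = (\<lambda>p. pline (g p)) ` G"

context family begin

lemma plinesE: assumes "P \<in> plines G g" obtains p where "p \<in> G" "P = pline (g p)"
  using assms unfolding plines_def by blast

lemma plines_pseudoline: "p \<in> G \<Longrightarrow> pseudoline (pline (g p))"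
  by (rule pseudoline_pline[OF ap])

lemma pline_inj: assumes "p \<in> G" "q \<in> G" "pline (g p) = pline (g q)" shows "p = q"
proof (rule ccontr)
  assume "p \<noteq> q"
  have "g p = g q" using assms ap pfun_pline by metis
  then have "finite {0..1::real}" using isol[OF assms(1,2) \<open>p \<noteq> q\<close>, of 0 1] by simp
  then show False using infinite_Icc[of "0::real" 1] by simp
qed

lemma crossing_point_pline:
  assumes "p \<in> G" "q \<in> G"
  shows "crossing_point (pline (g p)) (pline (g q)) (mproj (x, y)) \<longleftrightarrow> y = g p x \<and> crosses (g p) (g q) x"
    "contact_point (pline (g p)) (pline (g q)) (mproj (x, y)) \<longleftrightarrow> y = g p x \<and> touches (g p) (g q) x"
  using crossing_point_iff[OF plines_pseudoline[OF assms(1)] plines_pseudoline[OF assms(2)]]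
    contact_point_iff[OF plines_pseudoline[OF assms(1)] plines_pseudoline[OF assms(2)]]
  by (simp_all add: ap assms)

lemma mem_crossing_points: "mproj (x, y) \<in> crossing_points (plines G g) \<longleftrightarrow> cr x y"
proof
  assume "mproj (x, y) \<in> crossing_points (plines G g)"
  then obtain P Q where PQ: "P \<in> plines G g" "Q \<in> plines G g" "P \<noteq> Q" "crossing_point P Q (mproj (x, y))"
    unfolding crossing_points_def by blast
  obtain p q where pq: "p \<in> G" "P = pline (g p)" "q \<in> G" "Q = pline (g q)"
    using plinesE[OF PQ(1)] plinesE[OF PQ(2)] by metis
  then have "p \<noteq> q" "y = g p x" "crosses (g p) (g q) x" using PQ(3,4) crossing_point_pline(1) by metis+
  then show "cr x y" unfolding cr_def using pq by metis
next
  assume "cr x y"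
  then obtain p q where pq: "p \<in> G" "q \<in> G" "p \<noteq> q" "g p x = y" "crosses (g p) (g q) x" unfolding cr_def by blast
  have "pline (g p) \<in> plines G g" "pline (g q) \<in> plines G g" using pq unfolding plines_def by simp_all
  moreover have "pline (g p) \<noteq> pline (g q)" using pline_inj[OF pq(1,2)] pq(3) by metis
  ultimately show "mproj (x, y) \<in> crossing_points (plines G g)"
    unfolding crossing_points_def using crossing_point_pline(1)[OF pq(1,2)] pq(4,5) by blast
qed

lemma mem_contact_points: "mproj (x, y) \<in> contact_points (plines G g) \<longleftrightarrow> ct x y"
proof
  assume "mproj (x, y) \<in> contact_points (plines G g)"
  then obtain P Q where PQ: "P \<in> plines G g" "Q \<in> plines G g" "P \<noteq> Q" "contact_point P Q (mproj (x, y))"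
    unfolding contact_points_def by blast
  obtain p q where pq: "p \<in> G" "P = pline (g p)" "q \<in> G" "Q = pline (g q)"
    using plinesE[OF PQ(1)] plinesE[OF PQ(2)] by metis
  then have "p \<noteq> q" "y = g p x" "touches (g p) (g q) x" using PQ(3,4) crossing_point_pline(2) by metis+
  then show "ct x y" unfolding ct_def using pq by metis
next
  assume "ct x y"
  then obtain p q where pq: "p \<in> G" "q \<in> G" "p \<noteq> q" "g p x = y" "touches (g p) (g q) x" unfolding ct_def by blast
  have "pline (g p) \<in> plines G g" "pline (g q) \<in> plines G g" using pq unfolding plines_def by simp_all
  moreover have "pline (g p) \<noteq> pline (g q)" using pline_inj[OF pq(1,2)] pq(3) by metis
  ultimately show "mproj (x, y) \<in> contact_points (plines G g)"
    unfolding contact_points_def using crossing_point_pline(2)[OF pq(1,2)] pq(4,5) by blast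
qed

lemma mem_pline_iff: "p \<in> G \<Longrightarrow> mproj (x, y) \<in> pline (g p) \<longleftrightarrow> y = g p x"
  by (rule mem_pline[OF ap])

lemma mem_intersection_points: "mproj (x, y) \<in> intersection_points (plines G g) \<longleftrightarrow> vx x y"
proof
  assume "mproj (x, y) \<in> intersection_points (plines G g)"
  then obtain P Q where PQ: "P \<in> plines G g" "Q \<in> plines G g" "P \<noteq> Q" "mproj (x, y) \<in> P" "mproj (x, y) \<in> Q"
    unfolding intersection_points_def by blast
  obtain p q where pq: "p \<in> G" "P = pline (g p)" "q \<in> G" "Q = pline (g q)"
    using plinesE[OF PQ(1)] plinesE[OF PQ(2)] by metis
  then have "p \<noteq> q" "y = g p x" "y = g q x" using PQ(3-5) mem_pline_iff by metis+
  then show "vx x y" unfolding vx_def using pq by metis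
next
  assume "vx x y"
  then obtain p q where pq: "p \<in> G" "q \<in> G" "p \<noteq> q" "g p x = y" "g q x = y" unfolding vx_def by blast
  have "pline (g p) \<in> plines G g" "pline (g q) \<in> plines G g" using pq unfolding plines_def by simp_all
  moreover have "pline (g p) \<noteq> pline (g q)" using pline_inj[OF pq(1,2)] pq(3) by metis
  moreover have "mproj (x, y) \<in> pline (g p) \<inter> pline (g q)" using pq mem_pline_iff by simp
  ultimately show "mproj (x, y) \<in> intersection_points (plines G g)"
    unfolding intersection_points_def by blast
qed

lemma mem_support: "mproj (x, y) \<in> support (plines G g) \<longleftrightarrow> (\<exists>p\<in>G. g p x = y)"
  unfolding support_def plines_def using mem_pline_iff by auto

theorem simple_plines: "simple_arrangement (plines G g)"
  unfolding simple_arrangement_def arrangement_def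
proof (intro conjI ballI impI)
  show "finite (plines G g)" unfolding plines_def using fin by simp
  show "pseudoline P" if "P \<in> plines G g" for P
    using plinesE[OF that] plines_pseudoline by metis
next
  fix P Q assume PQ: "P \<in> plines G g" "Q \<in> plines G g" "P \<noteq> Q"
  obtain p q where p: "p \<in> G" "P = pline (g p)" and q: "q \<in> G" "Q = pline (g q)"
    using plinesE[OF PQ(1)] plinesE[OF PQ(2)] by metis
  then have pq: "p \<noteq> q" using PQ(3) by metis
  \<comment> \<open>Every common point has a representative over one period, where coincidences are
    finite.\<close>
  have "P \<inter> Q \<subseteq> (\<lambda>t. mproj (t, g p t)) ` ({t. g p t = g q t} \<inter> {0..pi})"
  proof
    fix z assume z: "z \<in> P \<inter> Q"
    obtain x y where xy: "z = mproj (x, y)" by (rule mproj_cases)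
    then have y: "y = g p x" "y = g q x" using z p q mem_pline_iff by auto
    obtain x0 where x0: "eqv x x0" "0 \<le> x0" "x0 < 0 + pi" by (rule eqv_representative)
    have "g p x0 = g q x0" using antiper_eq_eqv[OF ap[OF p(1)] ap[OF q(1)] x0(1)] y by simp
    moreover have "z = mproj (x0, g p x0)"
      unfolding xy mproj_eq_curve[OF ap[OF p(1)]] using x0(1) eqv_sym y by simp
    ultimately show "z \<in> (\<lambda>t. mproj (t, g p t)) ` ({t. g p t = g q t} \<inter> {0..pi})" using x0 by auto
  qed
  then show "finite (P \<inter> Q)" by (rule finite_subset) (intro finite_imageI isol p q pq)
  obtain x where x: "crosses (g p) (g q) x" using has_crossing[OF p(1) q(1) pq] .
  show "\<exists>!z. crossing_point P Q z"
  proof (rule ex1I[of _ "mproj (x, g p x)"])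
    show "crossing_point P Q (mproj (x, g p x))" unfolding p(2) q(2) crossing_point_pline(1)[OF p(1) q(1)] using x by simp
    fix z assume z: "crossing_point P Q z"
    obtain x' y' where xy: "z = mproj (x', y')" by (rule mproj_cases)
    then have "y' = g p x'" "crosses (g p) (g q) x'" using z p q crossing_point_pline(1) by metis+
    moreover from this have "eqv x x'" using uniq[OF p(1) q(1) pq x] by blast
    ultimately show "z = mproj (x, g p x)" unfolding xy mproj_eq_curve[OF ap[OF p(1)]] by simp
  qed
next
  fix P Q R assume PQR: "P \<in> plines G g" "Q \<in> plines G g" "R \<in> plines G g" "P \<noteq> Q \<and> P \<noteq> R \<and> Q \<noteq> R"
  obtain p q r where pqr: "p \<in> G" "P = pline (g p)" "q \<in> G" "Q = pline (g q)" "r \<in> G" "R = pline (g r)"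
    using plinesE[OF PQR(1)] plinesE[OF PQR(2)] plinesE[OF PQR(3)] by metis
  then have ne: "p \<noteq> q" "p \<noteq> r" "q \<noteq> r" using PQR(4) by metis+
  show "P \<inter> Q \<inter> R = {}"
  proof (rule equals0I)
    fix z assume z: "z \<in> P \<inter> Q \<inter> R"
    obtain x y where xy: "z = mproj (x, y)" by (rule mproj_cases)
    have "y = g p x" "y = g q x" "y = g r x" using z pqr mem_pline_iff unfolding xy by auto
    then show False using triple[OF pqr(1,3,5) ne, of x] by simp
  qed
qed

end

section \<open>Arrangements read as families\<close>

lemma plines_pfun: assumes "arrangement S" shows "plines S pfun = S"
proof -
  have "(\<lambda>P. pline (pfun P)) ` S = (\<lambda>P. P) ` S"
    by (rule image_cong[OF refl]) (rule pline_pfun[OF arrangement_pseudoline[OF assms]])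
  then show ?thesis by (simp add: plines_def)
qed

lemma family_pfun: assumes "simple_arrangement S" shows "family S pfun"
proof -
  interpret S: simple_arr S by unfold_locales fact
  show ?thesis
  proof
    show "finite S" by (rule S.fin)
    show "antiper (pfun P)" if "P \<in> S" for P by (rule S.ap[OF that])
    show "finite ({t. pfun P t = pfun Q t} \<inter> {a..b})" if "P \<in> S" "Q \<in> S" "P \<noteq> Q" for P Q a b
    proof -
      have "finite (P \<inter> Q)" using S.arr that unfolding arrangement_def by blast
      from finite_coincidences[OF S.ps[OF that(1)] S.ps[OF that(2)] this, of a b]
      show ?thesis by (rule rev_finite_subset) auto
    qed
    show "eqv x x'" if PQ: "P \<in> S" "Q \<in> S" "P \<noteq> Q" and c: "crosses (pfun P) (pfun Q) x" "crosses (pfun P) (pfun Q) x'" for P Q x x'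
    proof -
      have "crossing_point P Q (mproj (x, pfun P x))" "crossing_point P Q (mproj (x', pfun P x'))"
        using crossing_point_iff[OF S.ps[OF PQ(1)] S.ps[OF PQ(2)]] c by blast+
      moreover have "\<exists>!z. crossing_point P Q z" using S.arr PQ unfolding arrangement_def by blast
      ultimately have "mproj (x', pfun P x') = mproj (x, pfun P x)" by blast
      then show ?thesis unfolding mproj_eq_curve[OF S.ap[OF PQ(1)]] by blast
    qed
    show "pfun P x \<noteq> pfun R x" if "P \<in> S" "Q \<in> S" "R \<in> S" "P \<noteq> Q" "P \<noteq> R" "Q \<noteq> R" "pfun P x = pfun Q x" for P Q R x
      using S.no_triple[OF that] by blast
  qed
qed

locale contactless = simple_arr L for L +
  fixes k :: nat
  assumes no_contact: "contact_points L = {}"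
begin

sublocale lines L pfun k
proof -
  interpret family L pfun by (rule family_pfun[OF simple])
  show "lines L pfun"
  proof
    fix P Q x assume PQ: "P \<in> L" "Q \<in> L" "P \<noteq> Q" "pfun P x = pfun Q x"
    have "\<not> ct x (pfun P x)" using mem_contact_points[of x "pfun P x"] no_contact by (simp add: plines_pfun[OF arr])
    then have "\<not> touches (pfun P) (pfun Q) x" using ct_pair[OF PQ(1-3) refl PQ(4)[symmetric]] by blast
    then show "crosses (pfun P) (pfun Q) x" using cross_xor_touch[OF PQ] by blast
  qed
qed

lemma K_iff: "K x y \<longleftrightarrow> mproj (x, y) \<in> kernel L k"
  unfolding mem_kernel inK_def K_def nge_def nle_def on_def ..

lemma pseudotriangulation_plines:
  assumes "family G g" shows "pseudotriangulation L k (plines G g) \<longleftrightarrow> pt G g"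
proof -
  interpret G: family G g by fact
  have "support (plines G g) = kernel L k \<longleftrightarrow> (\<forall>x y. mproj (x, y) \<in> support (plines G g) \<longleftrightarrow> mproj (x, y) \<in> kernel L k)"
    by (metis mproj_cases set_eqI)
  then show ?thesis
    unfolding pseudotriangulation_def pt_def no_contact using G.simple_plines assms by (simp add: G.mem_support K_iff)
qed

lemma pseudotriangulation_pt:
  assumes "pseudotriangulation L k \<Lambda>" shows "pt \<Lambda> pfun" "plines \<Lambda> pfun = \<Lambda>" "family \<Lambda> pfun"
proof -
  have s: "simple_arrangement \<Lambda>" using assms by (simp add: pseudotriangulation_def)
  show f: "family \<Lambda> pfun" by (rule family_pfun[OF s])
  show p: "plines \<Lambda> pfun = \<Lambda>" using s plines_pfun by (simp add: simple_arrangement_def)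
  show "pt \<Lambda> pfun" using pseudotriangulation_plines[OF f] assms unfolding p by blast
qed

end

section \<open>The window of a cut\<close>

lemma path_le_less: "path_le L z z' \<Longrightarrow> z = z' \<or> fst z < fst z'"
  unfolding path_le_def
proof (induction rule: rtranclp_induct)
  case (step y z)
  then have "fst y < fst z" unfolding lifted_edge_def by blast
  then show ?case using step.IH by auto
qed simp

locale cut_arr = contactless L k for L k +
  fixes F :: "(real \<times> real) set" and c :: "real \<Rightarrow> real \<times> real"
  assumes filter: "cut_filter L F" and curve: "cut_curve L F c"
begin

definition cpar :: "moebius set \<Rightarrow> real" where "cpar P = (THE t. c t \<in> mproj -` P)"
definition cutx :: "moebius set \<Rightarrow> real" where "cutx P = fst (c (cpar P))"
definition W :: "(real \<times> real) set" where "W = F - tau ` F"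

lemmas curve_crosses_once = curve[unfolded cut_curve_def, THEN conjunct2, THEN conjunct2, THEN conjunct2, THEN conjunct1]
  and curve_separates = curve[unfolded cut_curve_def, THEN conjunct2, THEN conjunct2, THEN conjunct2, THEN conjunct2]

lemma filter_sub: "F \<subseteq> lifted_vertices L"
  and filter_up: "z \<in> F \<Longrightarrow> z' \<in> lifted_vertices L \<Longrightarrow> path_le L z z' \<Longrightarrow> z' \<in> F"
  using filter unfolding cut_filter_def by simp_all

lemma cpar: assumes "P \<in> L" shows "c (cpar P) \<in> mproj -` P" "c t \<in> mproj -` P \<Longrightarrow> t = cpar P"
proof -
  have ex: "\<exists>!t. c t \<in> mproj -` P" by (rule curve_crosses_once[THEN bspec, OF assms])
  show "c (cpar P) \<in> mproj -` P" unfolding cpar_def by (rule theI'[OF ex])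
  show "c t \<in> mproj -` P \<Longrightarrow> t = cpar P" unfolding cpar_def by (rule the1_equality[OF ex, symmetric])
qed

lemma mem_P: "P \<in> L \<Longrightarrow> mproj (x, y) \<in> P \<longleftrightarrow> y = pfun P x"
  by (rule mem_pseudoline[OF ps])

lemma c_cpar: assumes "P \<in> L" shows "c (cpar P) = (cutx P, pfun P (cutx P))"
proof -
  have "mproj (cutx P, snd (c (cpar P))) \<in> P" using cpar(1)[OF assms] by (simp add: cutx_def)
  then have "snd (c (cpar P)) = pfun P (cutx P)" using mem_P[OF assms] by blast
  then show ?thesis by (simp add: cutx_def prod_eq_iff)
qed

lemma lifted_iff: "(x, y) \<in> lifted_vertices L \<longleftrightarrow> vx x y"
  using mem_intersection_points[of x y] by (simp add: lifted_vertices_def plines_pfun[OF arr])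

lemma F_iff:
  assumes "P \<in> L" "vx x (pfun P x)"
  shows "(x, pfun P x) \<in> F \<longleftrightarrow> cutx P < x" "(x, pfun P x) \<notin> F \<longleftrightarrow> x < cutx P"
proof -
  have "(x, pfun P x) \<in> lifted_vertices L \<inter> mproj -` P" using assms lifted_iff mem_P by simp
  then have "((x, pfun P x) \<in> F \<longrightarrow> fst (c (cpar P)) < fst (x, pfun P x)) \<and> ((x, pfun P x) \<notin> F \<longrightarrow> fst (x, pfun P x) < fst (c (cpar P)))"
    by (rule curve_separates[THEN bspec, OF assms(1), THEN spec, THEN mp, OF cpar(1)[OF assms(1)], THEN bspec])
  then show "(x, pfun P x) \<in> F \<longleftrightarrow> cutx P < x" "(x, pfun P x) \<notin> F \<longleftrightarrow> x < cutx P" by (auto simp: cutx_def)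
qed

lemma tau_F: "(x, y) \<in> tau ` F \<longleftrightarrow> (x - pi, - y) \<in> F"
proof
  assume "(x, y) \<in> tau ` F"
  then obtain z where z: "z \<in> F" "(x, y) = tau z" by blast
  then have "(x - pi, - y) = z" by (simp add: tau_def prod_eq_iff)
  then show "(x - pi, - y) \<in> F" using z(1) by simp
next
  assume "(x - pi, - y) \<in> F"
  moreover have "(x, y) = tau (x - pi, - y)" by (simp add: tau_def)
  ultimately show "(x, y) \<in> tau ` F" by (rule rev_image_eqI)
qed

lemma vx_minus_pi: "vx (x - pi) (- y) \<longleftrightarrow> vx x y"
  using vx_shift[of x "-1" y] by simp

text \<open>Subtracting the image of \<open>F\<close> under \<open>tau\<close> removes what lies
  more than one period beyond the cut on this line. The intervals vary from line to line, so
  \<open>W\<close> is not a vertical strip.\<close>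

lemma W_iff:
  assumes "P \<in> L" "vx x (pfun P x)"
  shows "(x, pfun P x) \<in> W \<longleftrightarrow> cutx P < x \<and> x < cutx P + pi"
proof -
  have e: "pfun P (x - pi) = - pfun P x" by (rule antiper_simps(2)[OF ap[OF assms(1)]])
  have "vx (x - pi) (pfun P (x - pi))" using assms(2) vx_minus_pi e by simp
  from F_iff(2)[OF assms(1) this] have "(x - pi, - pfun P x) \<notin> F \<longleftrightarrow> x < cutx P + pi" unfolding e by auto
  then show ?thesis unfolding W_def using F_iff(1)[OF assms] tau_F by auto
qed

lemma F_vx: "(x, y) \<in> F \<Longrightarrow> vx x y"
  using filter_sub lifted_iff by blast

lemma vxE: assumes "vx x y" obtains P where "P \<in> L" "y = pfun P x"
  using assms unfolding vx_def by blast

lemma W_vx: "z \<in> W \<Longrightarrow> vx (fst z) (snd z)"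
  using F_vx[of "fst z" "snd z"] by (simp add: W_def)

section \<open>Paths along curves\<close>

lemma finite_vx: "finite ({t. vx t (h t)} \<inter> {a..b})"
proof (rule finite_subset[OF _ finite_coin[OF arr, of a b]])
  show "{t. vx t (h t)} \<inter> {a..b} \<subseteq> coin L \<inter> {a..b}"
  proof
    fix t assume t: "t \<in> {t. vx t (h t)} \<inter> {a..b}"
    then have "vx t (h t)" by simp
    then obtain P Q where PQ: "P \<in> L" "Q \<in> L" "P \<noteq> Q" "pfun P t = h t" "pfun Q t = h t" unfolding vx_def by blast
    have "pfun P t = pfun Q t" using PQ(4,5) by simp
    then have "t \<in> coin L" unfolding coin_def using PQ(1-3) by blast
    then show "t \<in> coin L \<inter> {a..b}" using t by simp
  qed
qed

text \<open>Curves of a pseudotriangulation change lines, so reachability is needed along any curve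
  that runs on the lines. Induction on the number of vertices in between: if there is none,
  \<open>selection\<close> shows that the curve follows one line, and the step is a single
  edge.\<close>

lemma path_along:
  assumes h: "antiper h" "\<forall>x. \<exists>P\<in>L. h x = pfun P x" and v: "vx x1 (h x1)" "vx x2 (h x2)" and le: "x1 \<le> x2"
  shows "path_le L (x1, h x1) (x2, h x2)"
  using v le
proof (induction "card ({t. vx t (h t)} \<inter> {x1<..<x2})" arbitrary: x1 x2 rule: less_induct)
  case less
  let ?V = "\<lambda>a b. {t. vx t (h t)} \<inter> {a<..<b}"
  have fV: "finite (?V a b)" for a b
    by (rule finite_subset[OF _ finite_vx[of h a b]]) auto
  show ?case
  proof (cases "x1 = x2")
    case True
    then show ?thesis by (simp add: path_le_def)
  next
    case False
    then have lt: "x1 < x2" using less.prems by simp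
    show ?thesis
    proof (cases "?V x1 x2 = {}")
      case True
      have novx: "\<not> vx t (h t)" if "x1 < t" "t < x2" for t using True that by auto
      obtain P where P: "P \<in> L" "\<And>t. x1 < t \<Longrightarrow> t < x2 \<Longrightarrow> h t = pfun P t"
      proof (rule selection[OF fin antiper_cont[OF h(1)] cont, where a = x1 and b = x2])
        show "\<exists>P\<in>L. h t = pfun P t" for t using h(2) by blast
        show "P = Q" if "x1 < t" "t < x2" "P \<in> L" "Q \<in> L" "h t = pfun P t" "h t = pfun Q t" for t P Q
          using novx[OF that(1,2)] that(3-6) unfolding vx_def by metis
      qed (use lt in auto)
      have "\<forall>\<^sub>F t in at_right x1. h t = pfun P t" "\<forall>\<^sub>F t in at_left x2. h t = pfun P t"
        unfolding eventually_at_right_field eventually_at_left_field using P(2) lt by blast+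
      then have ends: "h x1 = pfun P x1" "h x2 = pfun P x2"
        using value_r[OF h(1) ap[OF P(1)]] value_l[OF h(1) ap[OF P(1)]] by blast+
      have "lifted_edge L (x1, h x1) (x2, h x2)"
        unfolding lifted_edge_def
      proof (intro bexI[OF _ P(1)] conjI ballI)
        show "(x1, h x1) \<in> lifted_vertices L \<inter> mproj -` P" "(x2, h x2) \<in> lifted_vertices L \<inter> mproj -` P"
          using less.prems ends lifted_iff mem_P[OF P(1)] by auto
        show "fst (x1, h x1) < fst (x2, h x2)" using lt by simp
        fix u assume u: "u \<in> lifted_vertices L \<inter> mproj -` P"
        obtain t y where ty: "u = (t, y)" by (cases u)
        have "vx t y" "y = pfun P t" using u lifted_iff mem_P[OF P(1)] unfolding ty by auto
        then show "\<not> (fst (x1, h x1) < fst u \<and> fst u < fst (x2, h x2))"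
          using novx[of t] P(2)[of t] unfolding ty by auto
      qed
      then show ?thesis unfolding path_le_def by blast
    next
      case False
      then obtain t where t: "vx t (h t)" "x1 < t" "t < x2" by auto
      have "?V x1 t \<subset> ?V x1 x2" "?V t x2 \<subset> ?V x1 x2" using t by auto
      then have "card (?V x1 t) < card (?V x1 x2)" "card (?V t x2) < card (?V x1 x2)"
        using fV by (auto intro: psubset_card_mono)
      then have "path_le L (x1, h x1) (t, h t)" "path_le L (t, h t) (x2, h x2)"
        using less.hyps[of x1 t] less.hyps[of t x2] less.prems t by auto
      then show ?thesis unfolding path_le_def by (rule rtranclp_trans)
    qed
  qed
qed

lemma F_along:
  assumes h: "antiper h" "\<forall>x. \<exists>P\<in>L. h x = pfun P x" and "(x1, h x1) \<in> F" "vx x2 (h x2)" "x1 \<le> x2"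
  shows "(x2, h x2) \<in> F"
proof -
  have "path_le L (x1, h x1) (x2, h x2)" by (rule path_along[OF h F_vx[OF assms(3)] assms(4,5)])
  moreover have "(x2, h x2) \<in> lifted_vertices L" using assms(4) lifted_iff by simp
  ultimately show ?thesis using filter_up[OF assms(3)] by blast
qed

sublocale window L pfun k W
proof
  show "vx (fst z) (snd z)" if "z \<in> W" for z by (rule W_vx[OF that])
  show "\<exists>r::int. (x + of_int r * pi, sg r * y) \<in> W" if v: "vx x y" for x y
  proof -
    obtain P where P: "P \<in> L" "y = pfun P x" using vxE[OF v] .
    obtain x0 where x0: "eqv x x0" "cutx P \<le> x0" "x0 < cutx P + pi" by (rule eqv_representative)
    then obtain r :: int where r: "x0 = x + of_int r * pi" by (auto simp: eqv_def)
    have y0: "pfun P x0 = sg r * y" unfolding r P(2) by (rule antiper_shift[OF ap[OF P(1)]])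
    have "vx (x + of_int r * pi) (sg r * y)" using v vx_shift by blast
    then have v0: "vx x0 (pfun P x0)" unfolding y0 using r by simp
    \<comment> \<open>The cut avoids the vertices: each one is strictly on one side of it.\<close>
    have "x0 \<noteq> cutx P" using F_iff[OF P(1) v0] by auto
    then have "(x0, pfun P x0) \<in> W" using W_iff[OF P(1) v0] x0 by simp
    then have "(x + of_int r * pi, sg r * y) \<in> W" unfolding y0 using r by simp
    then show ?thesis by blast
  qed
  show "finite W"
  proof (rule finite_subset)
    show "W \<subseteq> (\<Union>P\<in>L. (\<lambda>t. (t, pfun P t)) ` (coin L \<inter> {cutx P..cutx P + pi}))"
    proof
      fix z assume z: "z \<in> W"
      obtain x y where xy: "z = (x, y)" by (cases z)
      have v: "vx x y" using W_vx[OF z] by (simp add: xy)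
      obtain P Q where PQ: "P \<in> L" "Q \<in> L" "P \<noteq> Q" "pfun P x = y" "pfun Q x = y" using v unfolding vx_def by blast
      then have "x \<in> coin L" unfolding coin_def by auto
      moreover have "cutx P < x" "x < cutx P + pi" using W_iff[OF PQ(1), of x] z v PQ(4) unfolding xy by auto
      ultimately show "z \<in> (\<Union>P\<in>L. (\<lambda>t. (t, pfun P t)) ` (coin L \<inter> {cutx P..cutx P + pi}))"
        using PQ(1,4) unfolding xy by force
    qed
    show "finite (\<Union>P\<in>L. (\<lambda>t. (t, pfun P t)) ` (coin L \<inter> {cutx P..cutx P + pi}))"
      using fin finite_coin[OF arr] by (intro finite_UN_I finite_imageI) auto
  qed
  fix h :: "real \<Rightarrow> real" and x1 x2 x3
  assume h: "antiper h" "\<forall>x. \<exists>P\<in>L. h x = pfun P x" and W13: "(x1, h x1) \<in> W" "(x3, h x3) \<in> W"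
  \<comment> \<open>Membership in \<open>W\<close> means being in \<open>F\<close> now and not one
    period earlier.\<close>
  have F1: "(x1, h x1) \<in> F" and F3: "(x3 - pi, h (x3 - pi)) \<notin> F"
    using W13 tau_F antiper_simps(2)[OF h(1), of x3] unfolding W_def by auto
  have v3: "vx (x3 - pi) (h (x3 - pi))"
    using W_vx[OF W13(2)] vx_minus_pi[of x3 "h x3"] antiper_simps(2)[OF h(1), of x3] by simp
  show "x3 < x1 + pi"
  proof (rule ccontr)
    assume "\<not> ?thesis"
    then show False using F_along[OF h F1 v3] F3 by simp
  qed
  show "(x2, h x2) \<in> W" if x: "x1 < x2" "x2 < x3" "vx x2 (h x2)"
  proof -
    have "(x2, h x2) \<in> F" using F_along[OF h F1 x(3)] x(1) by simp
    moreover have "(x2 - pi, h (x2 - pi)) \<notin> F" using F_along[OF h _ v3, of "x2 - pi"] F3 x(2) by auto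
    ultimately show ?thesis unfolding W_def using tau_F antiper_simps(2)[OF h(1), of x2] by auto
  qed
qed

text \<open>Both points lie on a common line within an open interval of length
  \<open>pi\<close>.\<close>

lemma W_unique:
  assumes "z \<in> W" "z' \<in> W" "mproj z = mproj z'" shows "z = z'"
proof -
  obtain x y x' y' where zz: "z = (x, y)" "z' = (x', y')" by (cases z, cases z')
  have v: "vx x y" "vx x' y'" using W_vx[OF assms(1)] W_vx[OF assms(2)] by (simp_all add: zz)
  obtain P where P: "P \<in> L" "y = pfun P x" using vxE[OF v(1)] .
  have e: "eqv x x'" "y' = pfun P x'"
    using assms(3) mproj_eq_curve[OF ap[OF P(1)], of x' y' x] unfolding zz P(2) by auto
  have "cutx P < x" "x < cutx P + pi" "cutx P < x'" "x' < cutx P + pi"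
    using W_iff[OF P(1), of x] W_iff[OF P(1), of x'] assms(1,2) v unfolding zz P(2) e(2) by auto
  then have "x = x'" using eqv_less[of x x'] eqv_less[of x' x] e(1) eqv_sym[of x x'] by force
  then show ?thesis using e P by (simp add: zz)
qed

text \<open>Representatives in \<open>W\<close> are unique, so the order of the cut is reachability
  between them. Edges increase the abscissa, and along a curve on the lines
  \<open>path_along\<close> gives the converse.\<close>

lemma cut_less_iff:
  assumes h: "antiper h" "\<forall>x. \<exists>P\<in>L. h x = pfun P x" and W: "(x, h x) \<in> W" "(x', h x') \<in> W"
  shows "cut_less L F (mproj (x, h x)) (mproj (x', h x')) \<longleftrightarrow> x < x'"
proof
  assume c: "cut_less L F (mproj (x, h x)) (mproj (x', h x'))"
  then obtain v w where vw: "v \<in> W" "w \<in> W" "mproj v = mproj (x, h x)" "mproj w = mproj (x', h x')" "path_le L v w"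
    unfolding cut_less_def cut_le_def W_def by blast
  then have "v = (x, h x)" "w = (x', h x')" using W_unique W by blast+
  then have "(x, h x) = (x', h x') \<or> x < x'" using path_le_less[OF vw(5)] by simp
  then show "x < x'" using c unfolding cut_less_def by auto
next
  assume lt: "x < x'"
  have "path_le L (x, h x) (x', h x')"
    using path_along[OF h] W_vx[OF W(1)] W_vx[OF W(2)] lt by simp
  then have "cut_le L F (mproj (x, h x)) (mproj (x', h x'))"
    unfolding cut_le_def W_def[symmetric] using W by blast
  moreover have "mproj (x, h x) \<noteq> mproj (x', h x')" using W_unique[OF W] lt by auto
  ultimately show "cut_less L F (mproj (x, h x)) (mproj (x', h x'))" by (simp add: cut_less_def)
qed

lemma source_early:
  assumes pt: "pseudotriangulation L k \<Lambda>" and source: "\<nexists>\<Lambda>'. increasing_flip_arc L F k \<Lambda>' \<Lambda>"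
  shows "early \<Lambda> pfun"
  unfolding early_def
proof (intro ballI allI impI, rule ccontr)
  note ptf = pseudotriangulation_pt[OF pt]
  interpret G: family \<Lambda> pfun by (rule ptf(3))
  fix P Q xw xv assume PQ: "P \<in> \<Lambda>" "Q \<in> \<Lambda>" "P \<noteq> Q" and W: "(xw, pfun P xw) \<in> W" "(xv, pfun P xv) \<in> W"
    and tc: "touches (pfun P) (pfun Q) xw" "crosses (pfun P) (pfun Q) xv" and "\<not> xw < xv"
  have "xw \<noteq> xv" using tc crosses_not_touches by blast
  then have lt: "xv < xw" using \<open>\<not> xw < xv\<close> by simp
  note line = pt_on_line[OF ptf(1) PQ(1)] and apP = G.ap[OF PQ(1)]
  have len: "xw < xv + pi" by (rule W_len[OF apP line W(2,1)])
  obtain g' where g': "family \<Lambda> g'" "\<And>x y. (\<exists>r\<in>\<Lambda>. g' r x = y) \<longleftrightarrow> (\<exists>r\<in>\<Lambda>. pfun r x = y)"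
    "touches (g' P) (g' Q) xv" "crosses (g' P) (g' Q) xw"
    "\<And>x y. family.ct \<Lambda> g' x y \<longleftrightarrow> G.ct x y \<and> \<not> (eqv xw x \<and> y = pfun P x) \<or> eqv xv x \<and> y = pfun P x"
    "g' P xv = pfun P xv" "g' P xw = pfun P xw"
    using G.flip[OF PQ tc(2,1) lt len] by blast
  interpret G': family \<Lambda> g' by (rule g'(1))
  let ?L = "plines \<Lambda> g'" and ?v = "mproj (xv, pfun P xv)" and ?w = "mproj (xw, pfun P xw)"
  have "pt \<Lambda> g'" unfolding pt_def using g'(1,2) pt_K[OF ptf(1)] by simp
  then have pt': "pseudotriangulation L k ?L" using pseudotriangulation_plines[OF g'(1)] by blast
  have "flip ?L \<Lambda> ?v ?w" unfolding flip_def
  proof (intro conjI)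
    have "contact_point (pline (g' P)) (pline (g' Q)) ?v"
      using G'.crossing_point_pline(2)[OF PQ(1,2)] g'(3,6) by simp
    moreover have "crossing_point (pline (g' P)) (pline (g' Q)) ?w"
      using G'.crossing_point_pline(1)[OF PQ(1,2)] g'(4,7) by simp
    moreover have "pline (g' P) \<in> ?L" "pline (g' Q) \<in> ?L" using PQ unfolding plines_def by simp_all
    moreover have "pline (g' P) \<noteq> pline (g' Q)" using G'.pline_inj[OF PQ(1,2)] PQ(3) by metis
    ultimately show "\<exists>P\<in>?L. \<exists>Q\<in>?L. P \<noteq> Q \<and> contact_point P Q ?v \<and> crossing_point P Q ?w" by blast
    show "support \<Lambda> = support ?L"
      using pt pt' by (simp add: pseudotriangulation_def)
    \<comment> \<open>In the given arrangement the second point is a contact and the first one is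
      not, so the set equation is an exact exchange.\<close>
    show "contact_points \<Lambda> = contact_points ?L - {?v} \<union> {?w}"
    proof (rule set_eqI)
      fix z
      obtain x y where z: "z = mproj (x, y)" by (rule mproj_cases)
      have v: "z = ?v \<longleftrightarrow> eqv xv x \<and> y = pfun P x" and w: "z = ?w \<longleftrightarrow> eqv xw x \<and> y = pfun P x"
        unfolding z by (rule mproj_eq_curve[OF apP])+
      have cL: "z \<in> contact_points \<Lambda> \<longleftrightarrow> G.ct x y"
        unfolding z using G.mem_contact_points unfolding ptf(2) .
      have cL': "z \<in> contact_points ?L \<longleftrightarrow> G.ct x y \<and> z \<noteq> ?w \<or> z = ?v"
        unfolding v w unfolding z G'.mem_contact_points by (rule g'(5))
      have "z = ?w \<Longrightarrow> G.ct x y"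
      proof -
        assume "z = ?w"
        then have xw: "eqv xw x" "y = pfun P x" using w by blast+
        then have "touches (pfun P) (pfun Q) x" using tc(1) touches_eqv[OF apP G.ap[OF PQ(2)] xw(1)] by blast
        then show "G.ct x y" unfolding G.ct_def using PQ xw(2) by blast
      qed
      moreover have "z = ?v \<Longrightarrow> \<not> G.ct x y"
      proof -
        assume "z = ?v"
        then have xv: "eqv xv x" "y = pfun P x" using v by blast+
        then have c: "crosses (pfun P) (pfun Q) x" using tc(2) crosses_eqv[OF apP G.ap[OF PQ(2)] xv(1)] by blast
        then have "pfun Q x = y" using xv(2) by (simp add: crosses_def)
        then show "\<not> G.ct x y" using G.ct_pair[OF PQ, of x y] xv(2) crosses_not_touches[OF c] by simp
      qed
      ultimately show "z \<in> contact_points \<Lambda> \<longleftrightarrow> z \<in> contact_points ?L - {?v} \<union> {?w}"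
        using cL cL' by blast
    qed
  qed
  moreover have "cut_less L F ?v ?w" using cut_less_iff[OF apP line W(2,1)] lt by blast
  ultimately have "increasing_flip_arc L F k ?L \<Lambda>" unfolding increasing_flip_arc_def using pt pt' by blast
  then show False using source by blast
qed

text \<open>In the arrangement before the flip the pair touches first, so following it shows that the corresponding
  pair after the flip crosses first.\<close>

lemma early_source:
  assumes pt: "pt G g" and early: "early G g"
  shows "\<not> increasing_flip_arc L F k \<Lambda>' (plines G g)"
proof
  assume "increasing_flip_arc L F k \<Lambda>' (plines G g)"
  then obtain v w where a: "pseudotriangulation L k \<Lambda>'" "flip \<Lambda>' (plines G g) v w" "cut_less L F v w"
    unfolding increasing_flip_arc_def by blast
  note ptf = pseudotriangulation_pt[OF a(1)]
  interpret G: family G g by (rule pt_family[OF pt])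
  interpret G': family \<Lambda>' pfun by (rule ptf(3))
  obtain P Q where PQ: "P \<in> \<Lambda>'" "Q \<in> \<Lambda>'" "P \<noteq> Q" "contact_point P Q v" "crossing_point P Q w"
    and cts: "contact_points (plines G g) = contact_points \<Lambda>' - {v} \<union> {w}"
    using a(2) unfolding flip_def by blast
  have psP: "pseudoline P" "pseudoline Q" using a(1) PQ unfolding pseudotriangulation_def simple_arrangement_def arrangement_def by blast+
  note apP = G'.ap[OF PQ(1)] and apQ = G'.ap[OF PQ(2)] and line = pt_on_line[OF ptf(1) PQ(1)]
  \<comment> \<open>Meetings of the two curves are moved into \<open>W\<close>, where the order of
    the cut is the order of abscissas.\<close>
  have lift: "\<exists>x. (x, pfun P x) \<in> W \<and> eqv x0 x" if "pfun P x0 = pfun Q x0" for x0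
  proof -
    have "vx x0 (pfun P x0)" by (rule coincide_vx[OF ptf(1) PQ(1-3) that])
    then obtain r :: int where "(x0 + of_int r * pi, sg r * pfun P x0) \<in> W" using W_ex by blast
    then show ?thesis using antiper_shift[OF apP, of x0 r] unfolding eqv_def by metis
  qed
  obtain xv0 yv where v0: "v = mproj (xv0, yv)" by (rule mproj_cases)
  have tv0: "yv = pfun P xv0" "touches (pfun P) (pfun Q) xv0"
    using PQ(4) contact_point_iff[OF psP] unfolding v0 by blast+
  then have "pfun P xv0 = pfun Q xv0" by (simp add: touches_def)
  then obtain xv where xv: "(xv, pfun P xv) \<in> W" "eqv xv0 xv" using lift by blast
  have tv: "touches (pfun P) (pfun Q) xv" using tv0(2) touches_eqv[OF apP apQ xv(2)] by blast
  have v: "v = mproj (xv, pfun P xv)" unfolding v0 mproj_eq_curve[OF apP] using xv(2) eqv_sym tv0(1) by blast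
  obtain xw0 yw where w0: "w = mproj (xw0, yw)" by (rule mproj_cases)
  have tw0: "yw = pfun P xw0" "crosses (pfun P) (pfun Q) xw0"
    using PQ(5) crossing_point_iff[OF psP] unfolding w0 by blast+
  then have "pfun P xw0 = pfun Q xw0" by (simp add: crosses_def)
  then obtain xw where xw: "(xw, pfun P xw) \<in> W" "eqv xw0 xw" using lift by blast
  have cw: "crosses (pfun P) (pfun Q) xw" using tw0(2) crosses_eqv[OF apP apQ xw(2)] by blast
  have w: "w = mproj (xw, pfun P xw)" unfolding w0 mproj_eq_curve[OF apP] using xw(2) eqv_sym tw0(1) by blast
  have lt: "xv < xw" using a(3) cut_less_iff[OF apP line xv(1) xw(1)] unfolding v w by blast
  have "v \<noteq> w" using a(3) unfolding cut_less_def by blast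
  have ct: "G.ct x y \<longleftrightarrow> mproj (x, y) \<in> contact_points \<Lambda>' \<and> mproj (x, y) \<noteq> v \<or> mproj (x, y) = w" for x y
    unfolding G.mem_contact_points[symmetric] cts by blast
  show False
  proof (rule early_no_incoming_flip[OF ptf(1) pt early PQ(1-3) tv xv(1) cw xw(1) lt])
    show "\<not> G.ct xv (pfun P xv)" unfolding ct using v \<open>v \<noteq> w\<close> by blast
    show "G.ct xw (pfun P xw)" unfolding ct using w by blast
    show "G'.ct x y \<longleftrightarrow> G.ct x y" if "\<not> eqv xv x" "\<not> eqv xw x" for x y
    proof -
      have "mproj (x, y) \<noteq> v" "mproj (x, y) \<noteq> w" unfolding v w mproj_eq_curve[OF apP] using that by blast+
      moreover have "mproj (x, y) \<in> contact_points \<Lambda>' \<longleftrightarrow> G'.ct x y" using G'.mem_contact_points unfolding ptf(2) .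
      ultimately show ?thesis unfolding ct by blast
    qed
  qed
qed

text \<open>Any other source is \<open>early\<close> too, so by \<open>early_unique\<close> its
  functions are those of \<open>g\<close>, in both directions; equal functions give equal
  pseudolines.\<close>

theorem greedy_eq:
  assumes pt: "pt G g" and early: "early G g"
  shows "greedy_pseudotriangulation L F k = plines G g"
  unfolding greedy_pseudotriangulation_def
proof (rule the_equality, intro conjI)
  show "pseudotriangulation L k (plines G g)" using pseudotriangulation_plines[OF pt_family[OF pt]] pt by blast
  show "\<nexists>\<Lambda>'. increasing_flip_arc L F k \<Lambda>' (plines G g)" using early_source[OF pt early] by blast
next
  fix \<Lambda> assume a: "pseudotriangulation L k \<Lambda> \<and> (\<nexists>\<Lambda>'. increasing_flip_arc L F k \<Lambda>' \<Lambda>)"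
  note ptf = pseudotriangulation_pt[OF a[THEN conjunct1]]
  have e: "early \<Lambda> pfun" using source_early a by blast
  have arr\<Lambda>: "arrangement \<Lambda>" using a by (simp add: pseudotriangulation_def simple_arrangement_def)
  show "\<Lambda> = plines G g"
  proof (rule subset_antisym; rule subsetI)
    fix P assume "P \<in> \<Lambda>"
    then obtain p where p: "p \<in> G" "pfun P = g p" using early_unique[OF ptf(1) pt e early] by blast
    have "P = pline (pfun P)" using pline_pfun[OF arrangement_pseudoline[OF arr\<Lambda> \<open>P \<in> \<Lambda>\<close>]] by simp
    then show "P \<in> plines G g" unfolding plines_def using p by simp
  next
    fix P assume "P \<in> plines G g"
    then obtain p where p: "p \<in> G" "P = pline (g p)" unfolding plines_def by blast
    then obtain Q where Q: "Q \<in> \<Lambda>" "g p = pfun Q" using early_unique[OF pt ptf(1) early e] by blast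
    have "Q = pline (pfun Q)" using pline_pfun[OF arrangement_pseudoline[OF arr\<Lambda> \<open>Q \<in> \<Lambda>\<close>]] by simp
    then show "P \<in> \<Lambda>" using p Q by simp
  qed
qed

end

section \<open>The order along a cut\<close>

locale ordered_cut = cut_arr L k F c for L k F c +
  fixes n :: nat and l :: "nat \<Rightarrow> moebius set"
  assumes order: "crossing_order L c n l"
begin

section \<open>The lines indexed along the cut\<close>

lemma bij_l: "bij_betw l {1..n} L"
  using order unfolding crossing_order_def by blast

lemma lL: "\<alpha> \<in> {1..n} \<Longrightarrow> l \<alpha> \<in> L"
  using bij_l bij_betwE by blast

lemma l_eq: "\<alpha> \<in> {1..n} \<Longrightarrow> \<beta> \<in> {1..n} \<Longrightarrow> l \<alpha> = l \<beta> \<longleftrightarrow> \<alpha> = \<beta>"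
  using bij_l unfolding bij_betw_def by (auto dest: inj_onD)

lemma l_surj: assumes "P \<in> L" obtains \<alpha> where "\<alpha> \<in> {1..n}" "P = l \<alpha>"
  using assms bij_l unfolding bij_betw_def by blast

lemma card_L: "card L = n"
  using bij_betw_same_card[OF bij_l] by simp

lemma card_count: "card {P \<in> L. \<phi> P} = card {\<gamma> \<in> {1..n}. \<phi> (l \<gamma>)}"
proof -
  have "bij_betw l {\<gamma> \<in> {1..n}. \<phi> (l \<gamma>)} {P \<in> L. \<phi> P}"
    unfolding bij_betw_def
  proof
    show "inj_on l {\<gamma> \<in> {1..n}. \<phi> (l \<gamma>)}" using bij_l unfolding bij_betw_def by (auto intro: inj_on_subset)
    show "l ` {\<gamma> \<in> {1..n}. \<phi> (l \<gamma>)} = {P \<in> L. \<phi> P}"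
    proof (rule subset_antisym; rule subsetI)
      fix P assume "P \<in> {P \<in> L. \<phi> P}"
      moreover from this obtain \<alpha> where "\<alpha> \<in> {1..n}" "P = l \<alpha>" using l_surj by blast
      ultimately show "P \<in> l ` {\<gamma> \<in> {1..n}. \<phi> (l \<gamma>)}" by simp
    next
      fix P assume "P \<in> l ` {\<gamma> \<in> {1..n}. \<phi> (l \<gamma>)}"
      then obtain \<gamma> where "\<gamma> \<in> {1..n}" "\<phi> (l \<gamma>)" "P = l \<gamma>" by blast
      then show "P \<in> {P \<in> L. \<phi> P}" using lL by simp
    qed
  qed
  then show ?thesis by (simp add: bij_betw_same_card)
qed

definition fl :: "nat \<Rightarrow> real \<Rightarrow> real" where "fl \<alpha> = pfun (l \<alpha>)"
definition ctx :: "nat \<Rightarrow> real" where "ctx \<alpha> = cutx (l \<alpha>)"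
text \<open>The abscissa of the vertex of the two lines inside the window. The choice is unambiguous
  for distinct lines by \<open>X_unique\<close>.\<close>

definition X :: "nat \<Rightarrow> nat \<Rightarrow> real" where "X \<alpha> \<beta> = (SOME x. (x, fl \<alpha> x) \<in> W \<and> fl \<alpha> x = fl \<beta> x)"

lemma ap_fl: "\<alpha> \<in> {1..n} \<Longrightarrow> antiper (fl \<alpha>)"
  unfolding fl_def by (rule ap[OF lL])

lemma fl_on_line: "\<alpha> \<in> {1..n} \<Longrightarrow> \<forall>x. \<exists>P\<in>L. fl \<alpha> x = pfun P x"
  unfolding fl_def using lL by blast

lemma X: assumes "\<alpha> \<in> {1..n}" "\<beta> \<in> {1..n}" "\<alpha> \<noteq> \<beta>"
  shows "(X \<alpha> \<beta>, fl \<alpha> (X \<alpha> \<beta>)) \<in> W" "fl \<alpha> (X \<alpha> \<beta>) = fl \<beta> (X \<alpha> \<beta>)"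
proof -
  have ne: "l \<alpha> \<noteq> l \<beta>" using l_eq assms by simp
  obtain x0 where "crosses (fl \<alpha>) (fl \<beta>) x0" using has_crossing[OF lL[OF assms(1)] lL[OF assms(2)] ne] unfolding fl_def .
  then have x0: "fl \<alpha> x0 = fl \<beta> x0" by (simp add: crosses_def)
  have "vx x0 (fl \<alpha> x0)" unfolding vx_def using lL[OF assms(1)] lL[OF assms(2)] ne x0 unfolding fl_def by metis
  then obtain r :: int where "(x0 + of_int r * pi, sg r * fl \<alpha> x0) \<in> W" using W_ex by blast
  then have "(x0 + of_int r * pi, fl \<alpha> (x0 + of_int r * pi)) \<in> W \<and> fl \<alpha> (x0 + of_int r * pi) = fl \<beta> (x0 + of_int r * pi)"
    using x0 antiper_shift[OF ap_fl[OF assms(1)], of x0 r] antiper_shift[OF ap_fl[OF assms(2)], of x0 r] by simp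
  then have "(X \<alpha> \<beta>, fl \<alpha> (X \<alpha> \<beta>)) \<in> W \<and> fl \<alpha> (X \<alpha> \<beta>) = fl \<beta> (X \<alpha> \<beta>)" unfolding X_def by (rule someI)
  then show "(X \<alpha> \<beta>, fl \<alpha> (X \<alpha> \<beta>)) \<in> W" "fl \<alpha> (X \<alpha> \<beta>) = fl \<beta> (X \<alpha> \<beta>)" by blast+
qed

lemma ctx_W: assumes "\<alpha> \<in> {1..n}" "(x, fl \<alpha> x) \<in> W" shows "ctx \<alpha> < x" "x < ctx \<alpha> + pi"
  using W_iff[OF lL[OF assms(1)], of x] W_vx[OF assms(2)] assms(2) unfolding fl_def ctx_def by simp_all

lemma ctx_X:
  assumes "\<alpha> \<in> {1..n}" "\<beta> \<in> {1..n}" "\<alpha> \<noteq> \<beta>"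
  shows "ctx \<alpha> < X \<alpha> \<beta>" "X \<alpha> \<beta> < ctx \<alpha> + pi" "ctx \<beta> < X \<alpha> \<beta>" "X \<alpha> \<beta> < ctx \<beta> + pi"
  using ctx_W[OF assms(1) X(1)[OF assms]] ctx_W[OF assms(2), of "X \<alpha> \<beta>"] X[OF assms] by simp_all

lemma coincidence_eqv:
  assumes "\<alpha> \<in> {1..n}" "\<beta> \<in> {1..n}" "\<alpha> \<noteq> \<beta>" "fl \<alpha> x = fl \<beta> x" shows "eqv (X \<alpha> \<beta>) x"
proof -
  have ne: "l \<alpha> \<noteq> l \<beta>" using l_eq assms by simp
  have "crosses (fl \<alpha>) (fl \<beta>) (X \<alpha> \<beta>)" "crosses (fl \<alpha>) (fl \<beta>) x"
    using straight[OF lL[OF assms(1)] lL[OF assms(2)] ne] X(2)[OF assms(1-3)] assms(4) unfolding fl_def by blast+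
  then show ?thesis using uniq[OF lL[OF assms(1)] lL[OF assms(2)] ne] unfolding fl_def by blast
qed

lemma X_unique:
  assumes "\<alpha> \<in> {1..n}" "\<beta> \<in> {1..n}" "\<alpha> \<noteq> \<beta>" "(x, fl \<alpha> x) \<in> W" "fl \<alpha> x = fl \<beta> x" shows "x = X \<alpha> \<beta>"
proof -
  have "mproj (x, fl \<alpha> x) = mproj (X \<alpha> \<beta>, fl \<alpha> (X \<alpha> \<beta>))"
    unfolding mproj_eq_curve[OF ap_fl[OF assms(1)]] using coincidence_eqv[OF assms(1-3,5)] by simp
  then show ?thesis using W_unique[OF assms(4) X(1)[OF assms(1-3)]] by simp
qed

lemma X_sym: assumes "\<alpha> \<in> {1..n}" "\<beta> \<in> {1..n}" "\<alpha> \<noteq> \<beta>" shows "X \<beta> \<alpha> = X \<alpha> \<beta>"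
proof -
  have "(X \<alpha> \<beta>, fl \<beta> (X \<alpha> \<beta>)) \<in> W" using X(1)[OF assms] unfolding X(2)[OF assms] .
  then show ?thesis by (rule X_unique[OF assms(2,1) assms(3)[symmetric] _ X(2)[OF assms, symmetric], symmetric])
qed

lemma wedge_X: assumes "\<alpha> \<in> {1..n}" "\<beta> \<in> {1..n}" "\<alpha> \<noteq> \<beta>"
  shows "wedge (l \<alpha>) (l \<beta>) = mproj (X \<alpha> \<beta>, fl \<alpha> (X \<alpha> \<beta>))"
proof -
  have ne: "l \<alpha> \<noteq> l \<beta>" using l_eq assms by simp
  have ex: "\<exists>!p. crossing_point (l \<alpha>) (l \<beta>) p" using arr lL[OF assms(1)] lL[OF assms(2)] ne unfolding arrangement_def by blast
  have "crosses (fl \<alpha>) (fl \<beta>) (X \<alpha> \<beta>)"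
    using straight[OF lL[OF assms(1)] lL[OF assms(2)] ne] X(2)[OF assms] unfolding fl_def by blast
  then have "crossing_point (l \<alpha>) (l \<beta>) (mproj (X \<alpha> \<beta>, fl \<alpha> (X \<alpha> \<beta>)))"
    unfolding crossing_point_iff[OF ps[OF lL[OF assms(1)]] ps[OF lL[OF assms(2)]]] fl_def by blast
  then show ?thesis unfolding wedge_def by (rule the1_equality[OF ex])
qed

lemma cut_less_X:
  assumes "\<alpha> \<in> {1..n}" "\<beta> \<in> {1..n}" "\<gamma> \<in> {1..n}" "\<alpha> \<noteq> \<beta>" "\<alpha> \<noteq> \<gamma>"
  shows "cut_less L F (wedge (l \<alpha>) (l \<gamma>)) (wedge (l \<alpha>) (l \<beta>)) \<longleftrightarrow> X \<alpha> \<gamma> < X \<alpha> \<beta>"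
  unfolding wedge_X[OF assms(1,2,4)] wedge_X[OF assms(1,3,5)]
  by (rule cut_less_iff[OF ap_fl[OF assms(1)] fl_on_line[OF assms(1)] X(1)[OF assms(1,3,5)] X(1)[OF assms(1,2,4)]])

section \<open>Direction of the cut\<close>

lemma cpar_mono:
  assumes "\<alpha> \<in> {1..n}" "\<beta> \<in> {1..n}" "\<alpha> < \<beta>" shows "cpar (l \<alpha>) < cpar (l \<beta>)"
proof -
  obtain t where t: "strict_mono_on {1..n} t" "\<forall>i\<in>{1..n}. c (t i) \<in> mproj -` l i"
    using order unfolding crossing_order_def by blast
  have "t \<alpha> = cpar (l \<alpha>)" "t \<beta> = cpar (l \<beta>)"
    using cpar(2)[OF lL[OF assms(1)], of "t \<alpha>"] cpar(2)[OF lL[OF assms(2)], of "t \<beta>"] t(2) assms by blast+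
  moreover have "t \<alpha> < t \<beta>" using strict_mono_onD[OF t(1) assms(1,2,3)] .
  ultimately show ?thesis by simp
qed

definition height :: "moebius set \<Rightarrow> real \<Rightarrow> real" where "height P t = snd (c t) - pfun P (fst (c t))"

lemma cont_height: assumes "P \<in> L" shows "continuous_on UNIV (height P)"
proof -
  have c: "continuous_on UNIV c" using curve unfolding cut_curve_def by (rule conjunct1)
  have "continuous_on UNIV (\<lambda>t. pfun P (fst (c t)))"
    by (rule continuous_on_compose2[OF cont[OF assms] continuous_on_fst[OF c]]) simp
  then show ?thesis unfolding height_def by (intro continuous_on_diff continuous_on_snd[OF c])
qed

lemma height_nonzero: assumes "P \<in> L" "cpar P < t" shows "height P t \<noteq> 0"
proof
  assume "height P t = 0"
  then have "mproj (fst (c t), snd (c t)) \<in> P" unfolding mem_P[OF assms(1)] by (simp add: height_def)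
  then have "c t \<in> mproj -` P" by simp
  then show False using cpar(2)[OF assms(1)] assms(2) by blast
qed

text \<open>Beyond its intersection with a line the curve stays on one side of it, namely on the side where it
  ends.\<close>

lemma ex_sign:
  obtains \<sigma> :: real where "\<sigma> = 1 \<or> \<sigma> = - 1"
    "\<And>\<alpha> \<beta>. \<alpha> \<in> {1..n} \<Longrightarrow> \<beta> \<in> {1..n} \<Longrightarrow> \<alpha> < \<beta> \<Longrightarrow> \<sigma> * fl \<beta> (ctx \<beta>) < \<sigma> * fl \<alpha> (ctx \<beta>)"
proof -
  obtain M where M: "M > 0" "\<And>P x. P \<in> L \<Longrightarrow> \<bar>pfun P x\<bar> < M" using bound by blast
  have dir: "filterlim (snd \<circ> c) at_bot at_top \<or> filterlim (snd \<circ> c) at_top at_top"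
    using curve[unfolded cut_curve_def, THEN conjunct2, THEN conjunct2, THEN conjunct1] by blast
  have hb: "height (l \<alpha>) (cpar (l \<beta>)) = fl \<beta> (ctx \<beta>) - fl \<alpha> (ctx \<beta>)" if "\<beta> \<in> {1..n}" for \<alpha> \<beta>
    unfolding height_def c_cpar[OF lL[OF that]] fl_def ctx_def by simp
  have same: "height P t * height P u > 0" if "P \<in> L" "cpar P < t" "t \<le> u" for P t u
    by (rule nonzero_same_sign[OF cont_height[OF that(1)]]) (use height_nonzero[OF that(1)] that in auto)
  from dir show thesis
  proof
    assume lim: "filterlim (snd \<circ> c) at_bot at_top"
    show thesis
    proof (rule that[of 1])
      fix \<alpha> \<beta> assume ab: "\<alpha> \<in> {1..n}" "\<beta> \<in> {1..n}" "\<alpha> < \<beta>"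
      \<comment> \<open>Far along the curve the point is below all lines, which are bounded by
        \<open>M\<close>.\<close>
      have "\<forall>\<^sub>F t in at_top. (snd \<circ> c) t \<le> - M" using lim unfolding filterlim_at_bot by blast
      then obtain u where u: "cpar (l \<beta>) \<le> u" "snd (c u) \<le> - M"
        unfolding eventually_at_top_linorder by (metis comp_apply linear)
      have "height (l \<alpha>) u < 0" using M(2)[OF lL[OF ab(1)], of "fst (c u)"] u(2) unfolding height_def by linarith
      then have "height (l \<alpha>) (cpar (l \<beta>)) < 0"
        using same[OF lL[OF ab(1)] cpar_mono[OF ab] u(1)] by (auto simp: zero_less_mult_iff)
      then show "1 * fl \<beta> (ctx \<beta>) < 1 * fl \<alpha> (ctx \<beta>)" using hb[OF ab(2), of \<alpha>] by simp
    qed simp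
  next
    assume lim: "filterlim (snd \<circ> c) at_top at_top"
    show thesis
    proof (rule that[of "- 1"])
      fix \<alpha> \<beta> assume ab: "\<alpha> \<in> {1..n}" "\<beta> \<in> {1..n}" "\<alpha> < \<beta>"
      have "\<forall>\<^sub>F t in at_top. M \<le> (snd \<circ> c) t" using lim unfolding filterlim_at_top by blast
      then obtain u where u: "cpar (l \<beta>) \<le> u" "M \<le> snd (c u)"
        unfolding eventually_at_top_linorder by (metis comp_apply linear)
      have "height (l \<alpha>) u > 0" using M(2)[OF lL[OF ab(1)], of "fst (c u)"] u(2) unfolding height_def by linarith
      then have "height (l \<alpha>) (cpar (l \<beta>)) > 0"
        using same[OF lL[OF ab(1)] cpar_mono[OF ab] u(1)] by (auto simp: zero_less_mult_iff)
      then show "- 1 * fl \<beta> (ctx \<beta>) < - 1 * fl \<alpha> (ctx \<beta>)" using hb[OF ab(2), of \<alpha>] by simp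
    qed simp
  qed
qed

lemma card_through: "card {\<gamma> \<in> {1..n}. fl \<gamma> x = y} \<le> 2"
proof (rule ccontr)
  assume "\<not> ?thesis"
  then have "3 \<le> card {\<gamma> \<in> {1..n}. fl \<gamma> x = y}" by simp
  then obtain T where T: "T \<subseteq> {\<gamma> \<in> {1..n}. fl \<gamma> x = y}" "card T = 3"
    by (rule obtain_subset_with_card_n)
  then obtain a b d where abd: "T = {a, b, d}" "a \<noteq> b" "b \<noteq> d" "a \<noteq> d" by (auto simp: card_3_iff)
  then have "a \<in> {1..n}" "b \<in> {1..n}" "d \<in> {1..n}" "fl a x = y" "fl b x = y" "fl d x = y" using T(1) by auto
  then show False using triple[OF lL[of a] lL[of b] lL[of d], of x] l_eq abd unfolding fl_def by simp
qed

text \<open>Intermediate form between the geometric condition \<open>cond\<close> of the network and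
  the index sequences of \<open>greedy_crossings\<close>; it does not involve the sign
  \<sigma>.\<close>

definition cnd :: "nat \<Rightarrow> nat \<Rightarrow> bool" where
  "cnd \<alpha> \<beta> \<longleftrightarrow> (\<exists>t. \<alpha> \<le> t \<and> t < \<beta> \<and> k \<le> card {\<gamma> \<in> {t<..n}. X \<alpha> \<gamma> < X \<alpha> \<beta>} \<and> k \<le> card {\<delta> \<in> {1..t}. X \<beta> \<delta> < X \<alpha> \<beta>})"

lemma antiper_scale: "antiper h \<Longrightarrow> antiper (\<lambda>x. s * h x)"
  unfolding antiper_def by (auto intro: continuous_intros)

text \<open>The order is known at the cut abscissa of \<beta>, which lies between the consecutive
  meetings \<open>X \<alpha> \<beta> - pi\<close> and \<open>X \<alpha> \<beta>\<close>. The lines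
  do not meet in between, so the order persists.\<close>

lemma signed_before:
  assumes \<sigma>: "\<sigma> = 1 \<or> \<sigma> = - 1" and sgn: "\<And>\<alpha> \<beta>. \<alpha> \<in> {1..n} \<Longrightarrow> \<beta> \<in> {1..n} \<Longrightarrow> \<alpha> < \<beta> \<Longrightarrow> \<sigma> * fl \<beta> (ctx \<beta>) < \<sigma> * fl \<alpha> (ctx \<beta>)"
    and ab: "\<alpha> \<in> {1..n}" "\<beta> \<in> {1..n}" "\<alpha> < \<beta>" and x: "X \<alpha> \<beta> - pi < x" "x < X \<alpha> \<beta>"
  shows "\<sigma> * fl \<beta> x < \<sigma> * fl \<alpha> x"
proof -
  have ne: "\<alpha> \<noteq> \<beta>" using ab by simp
  let ?d = "\<lambda>t. \<sigma> * fl \<alpha> t - \<sigma> * fl \<beta> t"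
  have cx: "X \<alpha> \<beta> - pi < ctx \<beta>" "ctx \<beta> < X \<alpha> \<beta>" using ctx_X[OF ab(1,2) ne] by linarith+
  have "?d x * ?d (ctx \<beta>) > 0"
  proof (rule nonzero_same_sign[where d = ?d and u = x and v = "ctx \<beta>"])
    show "continuous_on UNIV ?d"
      using antiper_cont[OF ap_fl[OF ab(1)]] antiper_cont[OF ap_fl[OF ab(2)]] by (intro continuous_intros)
    fix t assume "min x (ctx \<beta>) \<le> t" "t \<le> max x (ctx \<beta>)"
    then have t: "X \<alpha> \<beta> - pi < t" "t < X \<alpha> \<beta>" using x cx by (auto simp: min_def max_def split: if_splits)
    show "?d t \<noteq> 0"
    proof
      assume "?d t = 0"
      then have "fl \<alpha> t = fl \<beta> t" using \<sigma> by auto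
      then have "eqv t (X \<alpha> \<beta>)" using coincidence_eqv[OF ab(1,2) ne] eqv_sym by blast
      then show False using eqv_less[of t "X \<alpha> \<beta>"] t by simp
    qed
  qed
  then show ?thesis using sgn[OF ab] by (auto simp: zero_less_mult_iff)
qed

lemma wiring_fl:
  assumes nk: "2 * k < n" and \<sigma>: "\<sigma> = 1 \<or> \<sigma> = - 1"
    and sgn: "\<And>\<alpha> \<beta>. \<alpha> \<in> {1..n} \<Longrightarrow> \<beta> \<in> {1..n} \<Longrightarrow> \<alpha> < \<beta> \<Longrightarrow> \<sigma> * fl \<beta> (ctx \<beta>) < \<sigma> * fl \<alpha> (ctx \<beta>)"
  shows "wiring n k (\<lambda>\<alpha> x. \<sigma> * fl \<alpha> x) X ctx"
proof
  show "2 * k < n" by fact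
  show "antiper (\<lambda>x. \<sigma> * fl \<alpha> x)" if "\<alpha> \<in> {1..n}" for \<alpha> by (rule antiper_scale[OF ap_fl[OF that]])
  show "X \<alpha> \<beta> - pi < ctx \<alpha> \<and> ctx \<alpha> < X \<alpha> \<beta> \<and> X \<alpha> \<beta> - pi < ctx \<beta> \<and> ctx \<beta> < X \<alpha> \<beta>"
    if "\<alpha> \<in> {1..n}" "\<beta> \<in> {1..n}" "\<alpha> < \<beta>" for \<alpha> \<beta>
    using ctx_X[OF that(1,2)] that(3) by auto
  show "\<sigma> * fl \<beta> x < \<sigma> * fl \<alpha> x"
    if "\<alpha> \<in> {1..n}" "\<beta> \<in> {1..n}" "\<alpha> < \<beta>" "X \<alpha> \<beta> - pi < x" "x < X \<alpha> \<beta>" for \<alpha> \<beta> x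
    by (rule signed_before[OF \<sigma> sgn that])
  show "\<sigma> * fl \<alpha> (X \<alpha> \<beta>) = \<sigma> * fl \<beta> (X \<alpha> \<beta>)" if "\<alpha> \<in> {1..n}" "\<beta> \<in> {1..n}" "\<alpha> < \<beta>" for \<alpha> \<beta>
    using X(2)[OF that(1,2)] that(3) by simp
  show "\<forall>\<^sub>F x' in at x. inj_on (\<lambda>\<alpha>. \<sigma> * fl \<alpha> x') {1..n}" for x
    using eventually_not_coin[OF arr, of x]
  proof eventually_elim
    case (elim x')
    show ?case
    proof (rule inj_onI)
      fix \<alpha> \<beta> assume ab: "\<alpha> \<in> {1..n}" "\<beta> \<in> {1..n}" "\<sigma> * fl \<alpha> x' = \<sigma> * fl \<beta> x'"
      then have "pfun (l \<alpha>) x' = pfun (l \<beta>) x'" using \<sigma> unfolding fl_def by auto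
      then have "l \<alpha> = l \<beta>" using elim lL[OF ab(1)] lL[OF ab(2)] unfolding coin_def by blast
      then show "\<alpha> = \<beta>" using l_eq[OF ab(1,2)] by blast
    qed
  qed
  show "card {\<gamma> \<in> {1..n}. \<sigma> * fl \<gamma> x = y} \<le> 2" for x y
  proof -
    have "{\<gamma> \<in> {1..n}. \<sigma> * fl \<gamma> x = y} = {\<gamma> \<in> {1..n}. fl \<gamma> x = \<sigma> * y}" using \<sigma> by auto
    then show ?thesis using card_through[of x "\<sigma> * y"] by simp
  qed
qed

text \<open>Smaller indices start above. So a line with index \<open>> \<alpha>\<close> is above the
  vertex exactly if it has crossed \<open>l \<alpha>\<close> earlier in the window, and a line with
  index \<open>< \<beta>\<close> is below it exactly if it has crossed \<open>l \<beta>\<close>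
  earlier. Counts of lines become counts of earlier vertices.\<close>

lemma cond_cnd:
  assumes nk: "2 * k < n" and \<sigma>: "\<sigma> = 1 \<or> \<sigma> = - 1"
    and sgn: "\<And>\<alpha> \<beta>. \<alpha> \<in> {1..n} \<Longrightarrow> \<beta> \<in> {1..n} \<Longrightarrow> \<alpha> < \<beta> \<Longrightarrow> \<sigma> * fl \<beta> (ctx \<beta>) < \<sigma> * fl \<alpha> (ctx \<beta>)"
    and ab: "\<alpha> \<in> {1..n}" "\<beta> \<in> {1..n}" "\<alpha> < \<beta>"
  shows "wiring.cond n k (\<lambda>\<alpha> x. \<sigma> * fl \<alpha> x) X \<alpha> \<beta> \<longleftrightarrow> cnd \<alpha> \<beta>"
proof -
  interpret w: wiring n k "\<lambda>\<alpha> x. \<sigma> * fl \<alpha> x" X ctx by (rule wiring_fl[OF nk \<sigma> sgn])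
  let ?x = "X \<alpha> \<beta>"
  have ne: "\<alpha> \<noteq> \<beta>" using ab by simp
  have above: "\<sigma> * fl \<alpha> ?x < \<sigma> * fl \<gamma> ?x \<longleftrightarrow> X \<alpha> \<gamma> < ?x" if g: "\<gamma> \<in> {1..n}" "\<alpha> < \<gamma>" for \<gamma>
  proof -
    have d: "\<bar>?x - X \<alpha> \<gamma>\<bar> < pi" using ctx_X[OF ab(1,2) ne] ctx_X[OF ab(1) g(1)] g(2) by (auto simp: abs_if)
    consider "X \<alpha> \<gamma> < ?x" | "X \<alpha> \<gamma> = ?x" | "?x < X \<alpha> \<gamma>" by linarith
    then show ?thesis
    proof cases
      case 1
      then show ?thesis using w.after[OF ab(1) g, of ?x] d by (auto simp: abs_if split: if_splits)
    next
      case 2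
      have "\<sigma> * fl \<alpha> ?x = \<sigma> * fl \<gamma> ?x" using w.atX[OF ab(1) g] unfolding 2 .
      then show ?thesis by (simp only: 2 less_irrefl)
    next
      case 3
      then show ?thesis using w.before[OF ab(1) g, of ?x] d by (auto simp: abs_if split: if_splits)
    qed
  qed
  have below: "\<sigma> * fl \<delta> ?x < \<sigma> * fl \<alpha> ?x \<longleftrightarrow> X \<beta> \<delta> < ?x" if dl: "\<delta> \<in> {1..n}" "\<delta> < \<beta>" for \<delta>
  proof -
    have dn: "\<delta> \<noteq> \<beta>" using dl by simp
    have s: "X \<beta> \<delta> = X \<delta> \<beta>" by (rule X_sym[OF dl(1) ab(2) dn])
    have y: "fl \<alpha> ?x = fl \<beta> ?x" by (rule X(2)[OF ab(1,2) ne])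
    have d: "\<bar>?x - X \<delta> \<beta>\<bar> < pi" using ctx_X[OF ab(1,2) ne] ctx_X[OF dl(1) ab(2) dn] by (auto simp: abs_if)
    consider "X \<delta> \<beta> < ?x" | "X \<delta> \<beta> = ?x" | "?x < X \<delta> \<beta>" by linarith
    then show ?thesis unfolding s y
    proof cases
      case 1
      then show "\<sigma> * fl \<delta> ?x < \<sigma> * fl \<beta> ?x \<longleftrightarrow> X \<delta> \<beta> < ?x"
        using w.after[OF dl(1) ab(2) dl(2), of ?x] d by (auto simp: abs_if split: if_splits)
    next
      case 2
      have "\<sigma> * fl \<delta> ?x = \<sigma> * fl \<beta> ?x" using w.atX[OF dl(1) ab(2) dl(2)] unfolding 2 .
      then show "\<sigma> * fl \<delta> ?x < \<sigma> * fl \<beta> ?x \<longleftrightarrow> X \<delta> \<beta> < ?x" by (simp only: 2 less_irrefl)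
    next
      case 3
      then show "\<sigma> * fl \<delta> ?x < \<sigma> * fl \<beta> ?x \<longleftrightarrow> X \<delta> \<beta> < ?x"
        using w.before[OF dl(1) ab(2) dl(2), of ?x] d by (auto simp: abs_if split: if_splits)
    qed
  qed
  have "w.A t ?x (\<sigma> * fl \<alpha> ?x) = card {\<gamma> \<in> {t<..n}. X \<alpha> \<gamma> < X \<alpha> \<beta>}" if "\<alpha> \<le> t" for t
    unfolding w.A_def using above ab that by (intro arg_cong[where f = card] Collect_cong) auto
  moreover have "w.B t ?x (\<sigma> * fl \<alpha> ?x) = card {\<delta> \<in> {1..t}. X \<beta> \<delta> < X \<alpha> \<beta>}" if "t < \<beta>" for t
    unfolding w.B_def using below ab that by (intro arg_cong[where f = card] Collect_cong) auto
  ultimately show ?thesis unfolding w.cond_def cnd_def by auto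
qed

text \<open>The network is run on the lines multiplied by \<sigma>, and its curves are multiplied
  back. Uniqueness of crossings and \<open>early\<close> both follow from the same fact: two curves
  that have crossed do not meet again inside the window. Simplicity and support come from the number
  of curves through a point.\<close>

lemma ex_greedy:
  assumes nk: "2 * k < n"
  shows "\<exists>g. pt {1..n - 2 * k} g \<and> early {1..n - 2 * k} g \<and>
    (\<forall>\<alpha>\<in>{1..n}. \<forall>\<beta>\<in>{1..n}. \<alpha> < \<beta> \<longrightarrow> (family.cr {1..n - 2 * k} g (X \<alpha> \<beta>) (fl \<alpha> (X \<alpha> \<beta>)) \<longleftrightarrow> cnd \<alpha> \<beta>))"
proof -
  obtain \<sigma> :: real where \<sigma>: "\<sigma> = 1 \<or> \<sigma> = - 1"
    and sgn: "\<And>\<alpha> \<beta>. \<alpha> \<in> {1..n} \<Longrightarrow> \<beta> \<in> {1..n} \<Longrightarrow> \<alpha> < \<beta> \<Longrightarrow> \<sigma> * fl \<beta> (ctx \<beta>) < \<sigma> * fl \<alpha> (ctx \<beta>)"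
    using ex_sign by blast
  interpret w: wiring n k "\<lambda>\<alpha> x. \<sigma> * fl \<alpha> x" X ctx by (rule wiring_fl[OF nk \<sigma> sgn])
  let ?G = "{1..n - 2 * k}"
  obtain g0 where ap0': "\<forall>p\<in>?G. antiper (g0 p)"
    and card0': "\<forall>x y. card {p \<in> ?G. g0 p x = y} =
      w.cl (card {\<gamma> \<in> {1..n}. y \<le> \<sigma> * fl \<gamma> x}) - w.cl (card {\<gamma> \<in> {1..n}. y < \<sigma> * fl \<gamma> x})"
    and law0': "\<forall>p\<in>?G. \<forall>q\<in>?G. \<forall>\<alpha>\<in>{1..n}. \<forall>\<beta>\<in>{1..n}. p < q \<longrightarrow> \<alpha> < \<beta> \<longrightarrow>
      g0 p (X \<alpha> \<beta>) = \<sigma> * fl \<alpha> (X \<alpha> \<beta>) \<longrightarrow> g0 q (X \<alpha> \<beta>) = \<sigma> * fl \<alpha> (X \<alpha> \<beta>) \<longrightarrow>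
      (\<forall>\<^sub>F h in at_right 0. g0 q (X \<alpha> \<beta> - h) < g0 p (X \<alpha> \<beta> - h) \<and>
        (if w.cond \<alpha> \<beta> then g0 p (X \<alpha> \<beta> + h) < g0 q (X \<alpha> \<beta> + h) else g0 q (X \<alpha> \<beta> + h) < g0 p (X \<alpha> \<beta> + h)))"
    using w.greedy_wires by (elim exE conjE)
  note ap0 = ap0'[rule_format] and card0 = card0'[rule_format]
  have ss: "\<sigma> * (\<sigma> * a) = a" for a :: real using \<sigma> by auto
  define g where "g p x = \<sigma> * g0 p x" for p x
  have g0: "g0 p x = \<sigma> * g p x" for p x by (simp add: g_def ss)
  have apg: "antiper (g p)" if "p \<in> ?G" for p
    using antiper_scale[OF ap0[OF that], of \<sigma>] by (simp add: g_def[abs_def])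
  define a where "a x y = card {\<gamma> \<in> {1..n}. \<sigma> * y \<le> \<sigma> * fl \<gamma> x}" for x y
  define b where "b x y = card {\<gamma> \<in> {1..n}. \<sigma> * y < \<sigma> * fl \<gamma> x}" for x y
  define e where "e x y = card {\<gamma> \<in> {1..n}. fl \<gamma> x = y}" for x y
  have card_g: "card {p \<in> ?G. g p x = y} = w.cl (a x y) - w.cl (b x y)" for x y
  proof -
    have "{p \<in> ?G. g p x = y} = {p \<in> ?G. g0 p x = \<sigma> * y}" using ss by (auto simp: g_def)
    then show ?thesis unfolding a_def b_def using card0[of x "\<sigma> * y"] by simp
  qed
  have abe: "a x y = b x y + e x y" for x y
  proof -
    have "{\<gamma> \<in> {1..n}. \<sigma> * y \<le> \<sigma> * fl \<gamma> x} = {\<gamma> \<in> {1..n}. \<sigma> * y < \<sigma> * fl \<gamma> x} \<union> {\<gamma> \<in> {1..n}. fl \<gamma> x = y}"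
      using \<sigma> by auto
    then show ?thesis unfolding a_def b_def e_def by (auto intro: card_Un_disjoint)
  qed
  have an: "a x y \<le> n" for x y
  proof -
    have "a x y \<le> card {1..n}" unfolding a_def by (intro card_mono) auto
    then show ?thesis by simp
  qed
  have e2: "e x y \<le> 2" for x y unfolding e_def by (rule card_through)
  \<comment> \<open>Clamping encodes the kernel: a curve passes exactly where a line passes at one
    of the levels \<open>k + 1, ..., n - k\<close>.\<close>
  have cl_pos: "0 < w.cl (a x y) - w.cl (b x y) \<longleftrightarrow> 0 < e x y \<and> k < a x y \<and> b x y < n - k" for x y
    using abe[of x y] nk unfolding w.cl_def by (auto simp: min_def max_def)
  \<comment> \<open>There are at most as many curves as lines through a point, hence at most
    two.\<close>
  have cl_le: "w.cl (a x y) - w.cl (b x y) \<le> e x y" for x y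
    using abe[of x y] nk unfolding w.cl_def by (auto simp: min_def max_def)
  have K_ab: "K x y \<longleftrightarrow> 0 < e x y \<and> k < a x y \<and> b x y < n - k" for x y
  proof -
    have ex: "(\<exists>P\<in>L. pfun P x = y) \<longleftrightarrow> 0 < e x y"
    proof -
      have "(\<exists>P\<in>L. pfun P x = y) \<longleftrightarrow> {\<gamma> \<in> {1..n}. fl \<gamma> x = y} \<noteq> {}"
        unfolding fl_def using lL l_surj by blast
      then show ?thesis unfolding e_def by (simp add: card_gt_0_iff)
    qed
    have c1: "card {P \<in> L. y \<le> pfun P x} = card {\<gamma> \<in> {1..n}. y \<le> fl \<gamma> x}" "card {P \<in> L. pfun P x \<le> y} = card {\<gamma> \<in> {1..n}. fl \<gamma> x \<le> y}"
      unfolding fl_def by (rule card_count)+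
    have "b x y + card {\<gamma> \<in> {1..n}. \<not> \<sigma> * y < \<sigma> * fl \<gamma> x} = n"
      unfolding b_def using w.card_split[of "{1..n}"] by simp
    \<comment> \<open>For \<sigma> equal to \<open>- 1\<close> above and below are exchanged, but
      the kernel condition is symmetric.\<close>
    moreover from \<sigma> have "a x y = card {\<gamma> \<in> {1..n}. y \<le> fl \<gamma> x} \<and> card {\<gamma> \<in> {1..n}. \<not> \<sigma> * y < \<sigma> * fl \<gamma> x} = card {\<gamma> \<in> {1..n}. fl \<gamma> x \<le> y} \<or>
        a x y = card {\<gamma> \<in> {1..n}. fl \<gamma> x \<le> y} \<and> card {\<gamma> \<in> {1..n}. \<not> \<sigma> * y < \<sigma> * fl \<gamma> x} = card {\<gamma> \<in> {1..n}. y \<le> fl \<gamma> x}"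
      unfolding a_def by (auto simp: not_less)
    ultimately show ?thesis unfolding K_def ex c1 card_L using nk by auto
  qed
  have supp: "(\<exists>p\<in>?G. g p x = y) \<longleftrightarrow> K x y" for x y
  proof -
    have "(\<exists>p\<in>?G. g p x = y) \<longleftrightarrow> {p \<in> ?G. g p x = y} \<noteq> {}" by blast
    also have "\<dots> \<longleftrightarrow> 0 < card {p \<in> ?G. g p x = y}" by (subst card_gt_0_iff) simp
    finally show ?thesis unfolding card_g cl_pos K_ab .
  qed
  have line: "\<forall>x. \<exists>P\<in>L. g p x = pfun P x" if "p \<in> ?G" for p
  proof
    fix x
    have "K x (g p x)" using supp[of x "g p x"] that by blast
    then show "\<exists>P\<in>L. g p x = pfun P x" unfolding K_def by metis
  qed
  have two: "2 \<le> e x y" if "p \<in> ?G" "q \<in> ?G" "p \<noteq> q" "g p x = y" "g q x = y" for p q x y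
  proof -
    have "card {p, q} \<le> card {p \<in> ?G. g p x = y}" using that by (intro card_mono) auto
    then show ?thesis using that(3) cl_le[of x y] unfolding card_g by simp
  qed
  have vertex: "\<exists>\<alpha> \<beta>. \<alpha> \<in> {1..n} \<and> \<beta> \<in> {1..n} \<and> \<alpha> < \<beta> \<and> fl \<alpha> x = y \<and> fl \<beta> x = y" if "2 \<le> e x y" for x y
  proof -
    have "\<not> card {\<gamma> \<in> {1..n}. fl \<gamma> x = y} \<le> Suc 0" using that unfolding e_def by simp
    then obtain \<alpha> \<beta> where "\<alpha> \<in> {1..n}" "\<beta> \<in> {1..n}" "\<alpha> \<noteq> \<beta>" "fl \<alpha> x = y" "fl \<beta> x = y"
      by (subst (asm) card_le_Suc0_iff_eq) auto
    then show ?thesis by (metis linorder_neqE_nat)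
  qed
  have vxI: "vx x y" if "\<alpha> \<in> {1..n}" "\<beta> \<in> {1..n}" "\<alpha> < \<beta>" "fl \<alpha> x = y" "fl \<beta> x = y" for \<alpha> \<beta> x y
    unfolding vx_def using lL[OF that(1)] lL[OF that(2)] l_eq[OF that(1,2)] that(3-5) unfolding fl_def by (metis less_irrefl)
  have gvx: "vx x (g p x)" if "p \<in> ?G" "q \<in> ?G" "p \<noteq> q" "g p x = g q x" for p q x
    using vertex[OF two[OF that(1-3) refl that(4)[symmetric]]] vxI by blast
  \<comment> \<open>The reflection preserves crossings and contacts, because \<sigma> enters the
    sign product twice.\<close>
  have sprod: "(g p u - g q u) * (g p v - g q v) = (g0 p u - g0 q u) * (g0 p v - g0 q v)" for p q u v
  proof -
    have "(g p u - g q u) * (g p v - g q v) = \<sigma> * (\<sigma> * ((g0 p u - g0 q u) * (g0 p v - g0 q v)))"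
      by (simp add: g_def algebra_simps)
    then show ?thesis by (simp add: ss)
  qed
  have law: "(\<forall>\<^sub>F h in at_right 0. g0 q (X \<alpha> \<beta> - h) < g0 p (X \<alpha> \<beta> - h)) \<and>
      (if cnd \<alpha> \<beta> then crosses (g p) (g q) (X \<alpha> \<beta>) else touches (g p) (g q) (X \<alpha> \<beta>))"
    if pq: "p \<in> ?G" "q \<in> ?G" "p < q" and ab: "\<alpha> \<in> {1..n}" "\<beta> \<in> {1..n}" "\<alpha> < \<beta>"
      and y: "g p (X \<alpha> \<beta>) = fl \<alpha> (X \<alpha> \<beta>)" "g q (X \<alpha> \<beta>) = fl \<alpha> (X \<alpha> \<beta>)" for p q \<alpha> \<beta>
  proof -
    have "g0 p (X \<alpha> \<beta>) = \<sigma> * fl \<alpha> (X \<alpha> \<beta>)" "g0 q (X \<alpha> \<beta>) = \<sigma> * fl \<alpha> (X \<alpha> \<beta>)" using y by (simp_all add: g0)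
    note ev0 = law0'[THEN bspec, OF pq(1), THEN bspec, OF pq(2), THEN bspec, OF ab(1), THEN bspec, OF ab(2),
        THEN mp, OF pq(3), THEN mp, OF ab(3), THEN mp, OF this(1), THEN mp, OF this(2)]
    have cc: "w.cond \<alpha> \<beta> \<longleftrightarrow> cnd \<alpha> \<beta>" by (rule cond_cnd[OF nk \<sigma>]) (use sgn ab in auto)
    note ev = ev0[unfolded cc]
    have "\<forall>\<^sub>F h in at_right 0. g0 q (X \<alpha> \<beta> - h) < g0 p (X \<alpha> \<beta> - h)" using ev by (rule eventually_mono) blast
    moreover have "crosses (g p) (g q) (X \<alpha> \<beta>)" if "cnd \<alpha> \<beta>"
      unfolding crosses_def sprod
    proof
      show "\<forall>\<^sub>F h in at_right 0. (g0 p (X \<alpha> \<beta> - h) - g0 q (X \<alpha> \<beta> - h)) * (g0 p (X \<alpha> \<beta> + h) - g0 q (X \<alpha> \<beta> + h)) < 0"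
        using ev by (rule eventually_mono) (use that in \<open>auto intro: mult_pos_neg\<close>)
    qed (use y in simp)
    moreover have "touches (g p) (g q) (X \<alpha> \<beta>)" if "\<not> cnd \<alpha> \<beta>"
      unfolding touches_def sprod
    proof
      show "\<forall>\<^sub>F h in at_right 0. 0 < (g0 p (X \<alpha> \<beta> - h) - g0 q (X \<alpha> \<beta> - h)) * (g0 p (X \<alpha> \<beta> + h) - g0 q (X \<alpha> \<beta> + h))"
        using ev by (rule eventually_mono) (use that in \<open>auto intro: mult_pos_pos\<close>)
    qed (use y in simp)
    ultimately show ?thesis by simp
  qed
  have isol: "finite ({t. g p t = g q t} \<inter> {u..v})" if "p \<in> ?G" "q \<in> ?G" "p \<noteq> q" for p q u v
  proof (rule finite_subset[OF _ finite_vx[of "g p" u v]])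
    show "{t. g p t = g q t} \<inter> {u..v} \<subseteq> {t. vx t (g p t)} \<inter> {u..v}" using gvx[OF that] by blast
  qed
  \<comment> \<open>Every meeting of two curves inside \<open>W\<close> takes place at some
    \<open>X \<alpha> \<beta>\<close>, so the order on the left given by \<open>law\<close> is
    available at all of them.\<close>
  have left: "\<forall>\<^sub>F h in at_right 0. g0 q (x - h) < g0 p (x - h)"
    if pq: "p \<in> ?G" "q \<in> ?G" "p < q" and W: "(x, g p x) \<in> W" and eq: "g p x = g q x" for p q x
  proof -
    have "p \<noteq> q" using pq by simp
    then obtain \<alpha> \<beta> where ab: "\<alpha> \<in> {1..n}" "\<beta> \<in> {1..n}" "\<alpha> < \<beta>" "fl \<alpha> x = g p x" "fl \<beta> x = g p x"
      using vertex[OF two[OF pq(1,2) _ refl eq[symmetric]]] by blast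
    have xX: "x = X \<alpha> \<beta>" by (rule X_unique[OF ab(1,2)]) (use ab W in simp_all)
    have "g p (X \<alpha> \<beta>) = fl \<alpha> (X \<alpha> \<beta>)" "g q (X \<alpha> \<beta>) = fl \<alpha> (X \<alpha> \<beta>)" using ab(4) eq unfolding xX by simp_all
    from law[OF pq ab(1-3) this] show ?thesis unfolding xX by (rule conjunct1)
  qed
  \<comment> \<open>Right of the crossing the larger index is above. At the first later meeting
    \<open>u\<close> it has to be below on the left, yet the difference has no zero in
    between.\<close>
  have after_cross: False
    if pq: "p \<in> ?G" "q \<in> ?G" "p < q" and W: "(x1, g p x1) \<in> W" "(x2, g p x2) \<in> W"
      and c: "crosses (g p) (g q) x1" and eq: "g p x2 = g q x2" and lt: "x1 < x2" for p q x1 x2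
  proof -
    have ne: "p \<noteq> q" using pq by simp
    define Z where "Z = {t. g p t = g q t} \<inter> {x1<..x2}"
    have fZ: "finite Z" unfolding Z_def by (rule finite_subset[OF _ isol[OF pq(1,2) ne, of x1 x2]]) auto
    have "x2 \<in> Z" using eq lt by (simp add: Z_def)
    define u where "u = Min Z"
    have "u \<in> Z" unfolding u_def using fZ \<open>x2 \<in> Z\<close> by (intro Min_in) auto
    then have u: "g p u = g q u" "x1 < u" "u \<le> x2" by (auto simp: Z_def)
    have nz: "g0 p t - g0 q t \<noteq> 0" if "x1 < t" "t < u" for t
    proof
      assume "g0 p t - g0 q t = 0"
      then have "t \<in> Z" using that u(3) by (simp add: Z_def g_def)
      then have "u \<le> t" unfolding u_def using fZ by simp
      then show False using that by simp
    qed
    \<comment> \<open>Convexity of \<open>W\<close> along the curve makes \<open>left\<close>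
      applicable at \<open>u\<close>.\<close>
    have uW: "(u, g p u) \<in> W"
    proof (cases "u = x2")
      case False
      then show ?thesis using W_conv[OF apg[OF pq(1)] line[OF pq(1)] W u(2)] gvx[OF pq(1,2) ne u(1)] u(3) by simp
    qed (use W in simp)
    have x1eq: "g p x1 = g q x1" using c by (simp add: crosses_def)
    have small: "\<forall>\<^sub>F h in at_right 0. 0 < h \<and> h < u - x1"
      using u(2) by (auto simp: eventually_at_right_field intro!: exI[of _ "u - x1"])
    have "\<forall>\<^sub>F h in at_right 0. g0 p (x1 + h) < g0 q (x1 + h) \<and> g0 q (u - h) < g0 p (u - h) \<and> 0 < h \<and> h < u - x1"
      using left[OF pq W(1) x1eq] left[OF pq uW u(1)] c[unfolded crosses_def sprod, THEN conjunct2] small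
      by eventually_elim (auto simp: mult_less_0_iff)
    then obtain h where h: "g0 p (x1 + h) < g0 q (x1 + h)" "g0 q (u - h) < g0 p (u - h)" "0 < h" "h < u - x1"
      using eventually_happens'[OF trivial_limit_at_right_real] by blast
    let ?d = "\<lambda>t. g0 p t - g0 q t"
    have "?d (x1 + h) * ?d (u - h) > 0"
    proof (rule nonzero_same_sign[where d = ?d and u = "x1 + h" and v = "u - h"])
      show "continuous_on UNIV ?d"
        using antiper_cont[OF ap0[OF pq(1)]] antiper_cont[OF ap0[OF pq(2)]] by (intro continuous_on_diff)
      fix t assume "min (x1 + h) (u - h) \<le> t" "t \<le> max (x1 + h) (u - h)"
      then have "x1 < t" "t < u" using h(3,4) by (auto simp: min_def max_def split: if_splits)
      then show "?d t \<noteq> 0" by (rule nz)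
    qed
    then show False using h(1,2) by (auto simp: zero_less_mult_iff)
  qed
  have after_cross': False
    if pq: "p \<in> ?G" "q \<in> ?G" "p \<noteq> q" and W: "(x1, g p x1) \<in> W" "(x2, g p x2) \<in> W"
      and c: "crosses (g p) (g q) x1" and eq: "g p x2 = g q x2" and lt: "x1 < x2" for p q x1 x2
  proof (cases "p < q")
    case True
    then show False using after_cross[OF pq(1,2) True W c eq lt] by simp
  next
    case False
    then have lt': "q < p" using pq(3) by simp
    have c': "crosses (g q) (g p) x1" using c crosses_commute by blast
    have "g q x1 = g p x1" using c by (simp add: crosses_def)
    then show False using after_cross[OF pq(2,1) lt' _ _ c' eq[symmetric] lt] W eq by simp
  qed
  have fam: "family ?G g"
  proof
    show "finite ?G" by simp
    show "antiper (g p)" if "p \<in> ?G" for p by (rule apg[OF that])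
    show "finite ({t. g p t = g q t} \<inter> {u..v})" if "p \<in> ?G" "q \<in> ?G" "p \<noteq> q" for p q u v by (rule isol[OF that])
    show "eqv x x'" if pq: "p \<in> ?G" "q \<in> ?G" "p \<noteq> q" and c: "crosses (g p) (g q) x" "crosses (g p) (g q) x'" for p q x x'
    proof -
      have lift: "\<exists>x1. eqv u x1 \<and> (x1, g p x1) \<in> W" if cu: "crosses (g p) (g q) u" for u
      proof -
        have "g p u = g q u" using cu by (simp add: crosses_def)
        then obtain r :: int where "(u + of_int r * pi, sg r * g p u) \<in> W" using W_ex[OF gvx[OF pq]] by blast
        then show ?thesis using antiper_shift[OF apg[OF pq(1)], of u r] unfolding eqv_def by metis
      qed
      obtain x1 where x1: "eqv x x1" "(x1, g p x1) \<in> W" using lift[OF c(1)] by blast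
      obtain x2 where x2: "eqv x' x2" "(x2, g p x2) \<in> W" using lift[OF c(2)] by blast
      have cc: "crosses (g p) (g q) x1" "crosses (g p) (g q) x2"
        using c crosses_eqv[OF apg[OF pq(1)] apg[OF pq(2)]] x1(1) x2(1) by blast+
      then have "g p x1 = g q x1" "g p x2 = g q x2" by (simp_all add: crosses_def)
      then have "\<not> x1 < x2" "\<not> x2 < x1"
        using after_cross'[OF pq x1(2) x2(2) cc(1)] after_cross'[OF pq x2(2) x1(2) cc(2)] by blast+
      then have "x1 = x2" by simp
      then show ?thesis using x1(1) x2(1) eqv_sym eqv_trans by metis
    qed
    show "g p x \<noteq> g r x" if "p \<in> ?G" "q \<in> ?G" "r \<in> ?G" "p \<noteq> q" "p \<noteq> r" "q \<noteq> r" "g p x = g q x" for p q r x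
    proof
      assume "g p x = g r x"
      then have "card {p, q, r} \<le> card {s \<in> ?G. g s x = g p x}" using that by (intro card_mono) auto
      then show False using that(4-6) cl_le[of x "g p x"] e2[of x "g p x"] unfolding card_g by simp
    qed
  qed
  interpret G: family ?G g by (rule fam)
  have pt: "pt ?G g" unfolding pt_def using fam supp by blast
  have early: "early ?G g" unfolding early_def
  proof (intro ballI allI impI, rule ccontr)
    fix p q x x' assume pq: "p \<in> ?G" "q \<in> ?G" "p \<noteq> q" and W: "(x, g p x) \<in> W" "(x', g p x') \<in> W"
      and tc: "touches (g p) (g q) x" "crosses (g p) (g q) x'" and "\<not> x < x'"
    have "x \<noteq> x'" using tc crosses_not_touches by blast
    then have "x' < x" using \<open>\<not> x < x'\<close> by simp
    then show False using after_cross'[OF pq W(2,1) tc(2)] tc(1) by (simp add: touches_def)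
  qed
  have "G.cr (X \<alpha> \<beta>) (fl \<alpha> (X \<alpha> \<beta>)) \<longleftrightarrow> cnd \<alpha> \<beta>" if ab: "\<alpha> \<in> {1..n}" "\<beta> \<in> {1..n}" "\<alpha> < \<beta>" for \<alpha> \<beta>
  proof
    assume "G.cr (X \<alpha> \<beta>) (fl \<alpha> (X \<alpha> \<beta>))"
    then obtain p q where pq: "p \<in> ?G" "q \<in> ?G" "p \<noteq> q" "g p (X \<alpha> \<beta>) = fl \<alpha> (X \<alpha> \<beta>)" "crosses (g p) (g q) (X \<alpha> \<beta>)"
      unfolding G.cr_def by blast
    have q: "g q (X \<alpha> \<beta>) = fl \<alpha> (X \<alpha> \<beta>)" using pq(4,5) by (simp add: crosses_def)
    have nt: "\<not> touches (g p) (g q) (X \<alpha> \<beta>)" "\<not> touches (g q) (g p) (X \<alpha> \<beta>)"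
      using crosses_not_touches[OF pq(5)] touches_commute by blast+
    show "cnd \<alpha> \<beta>"
    proof (cases "p < q")
      case True
      then show ?thesis using law[OF pq(1,2) True ab pq(4) q] nt(1) by presburger
    next
      case False
      then have "q < p" using pq(3) by simp
      then show ?thesis using law[OF pq(2,1) \<open>q < p\<close> ab q pq(4)] nt(2) by presburger
    qed
  next
    assume cn: "cnd \<alpha> \<beta>"
    let ?x = "X \<alpha> \<beta>" and ?y = "fl \<alpha> (X \<alpha> \<beta>)"
    have ne: "\<alpha> \<noteq> \<beta>" using ab by simp
    obtain t where t: "\<alpha> \<le> t" "t < \<beta>" "k \<le> w.A t ?x (\<sigma> * ?y)" "k \<le> w.B t ?x (\<sigma> * ?y)"
    proof -
      have "w.cond \<alpha> \<beta> \<longleftrightarrow> cnd \<alpha> \<beta>" by (rule cond_cnd[OF nk \<sigma>]) (use sgn ab in auto)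
      then have "w.cond \<alpha> \<beta>" using cn by blast
      then show thesis unfolding w.cond_def using that by blast
    qed
    \<comment> \<open>The lines counted in \<open>cond\<close> are at least \<open>k\<close>
      strictly above and \<open>k\<close> strictly below the vertex. So clamping loses nothing
      there, and two curves pass through the vertex.\<close>
    have "w.A t ?x (\<sigma> * ?y) \<le> b ?x ?y" unfolding w.A_def b_def by (intro card_mono) auto
    moreover have "w.B t ?x (\<sigma> * ?y) \<le> card {\<gamma> \<in> {1..n}. \<not> \<sigma> * ?y \<le> \<sigma> * fl \<gamma> ?x}"
      unfolding w.B_def using t(2) ab(2) by (intro card_mono) auto
    moreover have "a ?x ?y + card {\<gamma> \<in> {1..n}. \<not> \<sigma> * ?y \<le> \<sigma> * fl \<gamma> ?x} = n"
      unfolding a_def using w.card_split[of "{1..n}" "\<lambda>\<gamma>. \<sigma> * ?y \<le> \<sigma> * fl \<gamma> ?x"] by simp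
    ultimately have kb: "k \<le> b ?x ?y" "a ?x ?y \<le> n - k" using t(3,4) by linarith+
    have "card {\<alpha>, \<beta>} \<le> e ?x ?y" unfolding e_def using ab X(2)[OF ab(1,2) ne] by (intro card_mono) auto
    then have "2 \<le> e ?x ?y" using ne by simp
    then have "2 \<le> card {p \<in> ?G. g p ?x = ?y}" unfolding card_g w.cl_def using kb abe[of ?x ?y] by simp
    then have "\<not> card {p \<in> ?G. g p ?x = ?y} \<le> Suc 0" by simp
    then obtain p' q' where pq': "p' \<in> ?G" "q' \<in> ?G" "p' \<noteq> q'" "g p' ?x = ?y" "g q' ?x = ?y"
      by (subst (asm) card_le_Suc0_iff_eq) auto
    then obtain p q where pq: "p \<in> ?G" "q \<in> ?G" "p < q" "g p ?x = ?y" "g q ?x = ?y"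
      by (metis linorder_neqE_nat)
    have "crosses (g p) (g q) ?x" using law[OF pq(1-3) ab pq(4,5)] cn by simp
    then show "G.cr ?x ?y" unfolding G.cr_def using pq by (metis less_irrefl)
  qed
  then show ?thesis using pt early by blast
qed

text \<open>The threshold separates the two index sequences: a set of at least \<open>k\<close>
  indices contains an increasing sequence of length \<open>k\<close>, and conversely a threshold
  fits between \<open>\<delta> k\<close> and \<open>\<gamma> 1\<close>.\<close>

lemma cnd_iff:
  assumes k: "k \<ge> 1" and ab: "1 \<le> \<alpha>" "\<alpha> < \<beta>" "\<beta> \<le> n"
  shows "cnd \<alpha> \<beta> \<longleftrightarrow> (\<exists>\<gamma> \<delta>. \<gamma> ` {1..k} \<subseteq> {1..n} \<and> \<delta> ` {1..k} \<subseteq> {1..n} \<and>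
              strict_mono_on {1..k} \<gamma> \<and> strict_mono_on {1..k} \<delta> \<and>
              \<alpha> < \<gamma> 1 \<and> \<delta> k < \<beta> \<and> \<delta> k < \<gamma> 1 \<and>
              (\<forall>i\<in>{1..k}. cut_less L F (wedge (l \<alpha>) (l (\<gamma> i))) (wedge (l \<alpha>) (l \<beta>)) \<and>
                          cut_less L F (wedge (l \<beta>) (l (\<delta> i))) (wedge (l \<alpha>) (l \<beta>))))"
    (is "_ \<longleftrightarrow> (\<exists>\<gamma> \<delta>. ?R \<gamma> \<delta>)")
proof -
  have \<alpha>n: "\<alpha> \<in> {1..n}" and \<beta>n: "\<beta> \<in> {1..n}" and ne: "\<alpha> \<noteq> \<beta>" using ab by auto
  have up: "cut_less L F (wedge (l \<alpha>) (l \<gamma>)) (wedge (l \<alpha>) (l \<beta>)) \<longleftrightarrow> X \<alpha> \<gamma> < X \<alpha> \<beta>" if "\<gamma> \<in> {1..n}" "\<alpha> \<noteq> \<gamma>" for \<gamma>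
    by (rule cut_less_X[OF \<alpha>n \<beta>n that(1) ne that(2)])
  have comm: "wedge (l \<alpha>) (l \<beta>) = wedge (l \<beta>) (l \<alpha>)"
    unfolding wedge_X[OF \<alpha>n \<beta>n ne] wedge_X[OF \<beta>n \<alpha>n ne[symmetric]] X_sym[OF \<alpha>n \<beta>n ne] X(2)[OF \<alpha>n \<beta>n ne] ..
  have dn: "cut_less L F (wedge (l \<beta>) (l \<delta>)) (wedge (l \<alpha>) (l \<beta>)) \<longleftrightarrow> X \<beta> \<delta> < X \<alpha> \<beta>" if "\<delta> \<in> {1..n}" "\<beta> \<noteq> \<delta>" for \<delta>
    unfolding comm using cut_less_X[OF \<beta>n \<alpha>n that(1) ne[symmetric] that(2)] unfolding X_sym[OF \<alpha>n \<beta>n ne] .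
  show ?thesis
  proof
    assume "cnd \<alpha> \<beta>"
    then obtain t where t: "\<alpha> \<le> t" "t < \<beta>" "k \<le> card {\<gamma> \<in> {t<..n}. X \<alpha> \<gamma> < X \<alpha> \<beta>}" "k \<le> card {\<delta> \<in> {1..t}. X \<beta> \<delta> < X \<alpha> \<beta>}"
      unfolding cnd_def by blast
    have ex: "\<exists>s. strict_mono_on {1..k} s \<and> s ` {1..k} \<subseteq> S" if kS: "k \<le> card S" and fS: "finite S" for S :: "nat set"
    proof -
      obtain h where h: "bij_betw h {..<card S} S" "strict_mono_on {..<card S} h"
        by (rule ex_bij_betw_strict_mono_card[OF fS])
      \<comment> \<open>The enumeration \<open>h\<close> starts at \<open>0\<close>, while the
        sequences are indexed from \<open>1\<close>.\<close>
      have "strict_mono_on {1..k} (\<lambda>i. h (i - 1))"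
      proof (rule strict_mono_onI)
        fix i j assume "i \<in> {1..k}" "j \<in> {1..k}" "i < j"
        then have "i - 1 \<in> {..<card S}" "j - 1 \<in> {..<card S}" "i - 1 < j - 1" using kS by auto
        then show "h (i - 1) < h (j - 1)" by (rule strict_mono_onD[OF h(2)])
      qed
      moreover have "(\<lambda>i. h (i - 1)) ` {1..k} \<subseteq> S"
      proof
        fix u assume "u \<in> (\<lambda>i. h (i - 1)) ` {1..k}"
        then obtain i where "i \<in> {1..k}" "u = h (i - 1)" by blast
        moreover from this have "i - 1 \<in> {..<card S}" using kS by auto
        ultimately show "u \<in> S" using bij_betwE[OF h(1)] by blast
      qed
      ultimately show ?thesis by blast
    qed
    obtain \<gamma> where \<gamma>: "strict_mono_on {1..k} \<gamma>" "\<gamma> ` {1..k} \<subseteq> {\<gamma> \<in> {t<..n}. X \<alpha> \<gamma> < X \<alpha> \<beta>}" using ex[OF t(3)] by auto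
    obtain \<delta> where \<delta>: "strict_mono_on {1..k} \<delta>" "\<delta> ` {1..k} \<subseteq> {\<delta> \<in> {1..t}. X \<beta> \<delta> < X \<alpha> \<beta>}" using ex[OF t(4)] by auto
    have \<gamma>i: "t < \<gamma> i" "\<gamma> i \<le> n" "X \<alpha> (\<gamma> i) < X \<alpha> \<beta>" if "i \<in> {1..k}" for i using subsetD[OF \<gamma>(2) imageI[OF that]] by simp_all
    have \<delta>i: "1 \<le> \<delta> i" "\<delta> i \<le> t" "X \<beta> (\<delta> i) < X \<alpha> \<beta>" if "i \<in> {1..k}" for i using subsetD[OF \<delta>(2) imageI[OF that]] by simp_all
    have "?R \<gamma> \<delta>"
    proof (intro conjI ballI \<gamma>(1) \<delta>(1))
      show "\<gamma> ` {1..k} \<subseteq> {1..n}"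
      proof (rule image_subsetI)
        fix i assume "i \<in> {1..k}"
        then show "\<gamma> i \<in> {1..n}" using \<gamma>i(1,2)[of i] by simp
      qed
      show "\<delta> ` {1..k} \<subseteq> {1..n}"
      proof (rule image_subsetI)
        fix i assume "i \<in> {1..k}"
        then show "\<delta> i \<in> {1..n}" using \<delta>i(1,2)[of i] t(2) ab(3) by simp
      qed
      show "\<alpha> < \<gamma> 1" "\<delta> k < \<beta>" "\<delta> k < \<gamma> 1" using \<gamma>i(1)[of 1] \<delta>i(2)[of k] k t(1,2) by auto
      fix i assume i: "i \<in> {1..k}"
      show "cut_less L F (wedge (l \<alpha>) (l (\<gamma> i))) (wedge (l \<alpha>) (l \<beta>))"
        using up[of "\<gamma> i"] \<gamma>i[OF i] t(1) ab(1) by auto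
      show "cut_less L F (wedge (l \<beta>) (l (\<delta> i))) (wedge (l \<alpha>) (l \<beta>))"
        using dn[of "\<delta> i"] \<delta>i[OF i] t(2) ab(3) by auto
    qed
    then show "\<exists>\<gamma> \<delta>. ?R \<gamma> \<delta>" by blast
  next
    assume "\<exists>\<gamma> \<delta>. ?R \<gamma> \<delta>"
    then obtain \<gamma> \<delta> where R: "?R \<gamma> \<delta>" by blast
    note R2 = R[THEN conjunct2] note R3 = R2[THEN conjunct2] note R4 = R3[THEN conjunct2]
    note R5 = R4[THEN conjunct2] note R6 = R5[THEN conjunct2] note R7 = R6[THEN conjunct2]
    note \<gamma> = R[THEN conjunct1] R3[THEN conjunct1] R5[THEN conjunct1]
      and \<delta> = R2[THEN conjunct1] R4[THEN conjunct1] R6[THEN conjunct1] and dg = R7[THEN conjunct1]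
    note cl = R7[THEN conjunct2, THEN bspec, THEN conjunct1] R7[THEN conjunct2, THEN bspec, THEN conjunct2]
    \<comment> \<open>The least threshold that is at least \<alpha> and leaves all
      \<open>\<delta> i\<close> on its lower side. It stays below \<beta> and
      \<open>\<gamma> 1\<close> since both arguments of the maximum do.\<close>
    define t where "t = max \<alpha> (\<delta> k)"
    have t: "\<alpha> \<le> t" "t < \<beta>" "\<delta> k \<le> t" "t < \<gamma> 1" using ab \<delta>(3) \<gamma>(3) dg by (auto simp: t_def)
    have g1: "\<gamma> 1 \<le> \<gamma> i" and dk: "\<delta> i \<le> \<delta> k" if i: "i \<in> {1..k}" for i
    proof -
      show "\<gamma> 1 \<le> \<gamma> i" using strict_mono_onD[OF \<gamma>(2), of 1 i] i k by (cases "i = 1") auto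
      show "\<delta> i \<le> \<delta> k" using strict_mono_onD[OF \<delta>(2), of i k] i k by (cases "i = k") auto
    qed
    have "\<gamma> ` {1..k} \<subseteq> {\<gamma> \<in> {t<..n}. X \<alpha> \<gamma> < X \<alpha> \<beta>}"
    proof
      fix u assume "u \<in> \<gamma> ` {1..k}"
      then obtain i where i: "i \<in> {1..k}" "u = \<gamma> i" by blast
      then have "u \<in> {1..n}" "t < u" using subsetD[OF \<gamma>(1) imageI[OF i(1)]] g1[OF i(1)] t(4) by simp_all
      then show "u \<in> {\<gamma> \<in> {t<..n}. X \<alpha> \<gamma> < X \<alpha> \<beta>}" using up[of u] cl(1)[OF i(1)] i(2) t(1) by auto
    qed
    then have 1: "card (\<gamma> ` {1..k}) \<le> card {\<gamma> \<in> {t<..n}. X \<alpha> \<gamma> < X \<alpha> \<beta>}" by (intro card_mono) auto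
    have "\<delta> ` {1..k} \<subseteq> {\<delta> \<in> {1..t}. X \<beta> \<delta> < X \<alpha> \<beta>}"
    proof
      fix u assume "u \<in> \<delta> ` {1..k}"
      then obtain i where i: "i \<in> {1..k}" "u = \<delta> i" by blast
      then have "u \<in> {1..n}" "u \<le> t" using subsetD[OF \<delta>(1) imageI[OF i(1)]] dk[OF i(1)] t(3) by simp_all
      then show "u \<in> {\<delta> \<in> {1..t}. X \<beta> \<delta> < X \<alpha> \<beta>}" using dn[of u] cl(2)[OF i(1)] i(2) t(2) by auto
    qed
    then have 2: "card (\<delta> ` {1..k}) \<le> card {\<delta> \<in> {1..t}. X \<beta> \<delta> < X \<alpha> \<beta>}" by (intro card_mono) auto
    have "card (\<gamma> ` {1..k}) = k" "card (\<delta> ` {1..k}) = k"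
      using card_image[OF strict_mono_on_imp_inj_on[OF \<gamma>(2)]] card_image[OF strict_mono_on_imp_inj_on[OF \<delta>(2)]] by simp_all
    then show "cnd \<alpha> \<beta>" unfolding cnd_def using t(1,2) 1 2 by auto
  qed
qed

text \<open>For \<open>2 * k \<ge> n\<close> the kernel is empty and so is the family. There are no
  crossings, hence \<open>cnd\<close> has to fail for every pair.\<close>

lemma ex_greedy_family:
  "\<exists>(G :: nat set) g. pt G g \<and> early G g \<and>
    (\<forall>\<alpha>\<in>{1..n}. \<forall>\<beta>\<in>{1..n}. \<alpha> < \<beta> \<longrightarrow> (family.cr G g (X \<alpha> \<beta>) (fl \<alpha> (X \<alpha> \<beta>)) \<longleftrightarrow> cnd \<alpha> \<beta>))"
proof (cases "2 * k < n")
  case True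
  then show ?thesis using ex_greedy by blast
next
  case False
  define g where "g = (\<lambda>(_::nat) (_::real). 0::real)"
  have fam: "family {} g" by unfold_locales auto
  interpret G: family "{}" g by (rule fam)
  have "pt {} g" unfolding pt_def using fam False by (simp add: K_def card_L)
  moreover have "early {} g" by (simp add: early_def)
  moreover have "\<not> cnd \<alpha> \<beta>" if ab: "\<alpha> \<in> {1..n}" "\<beta> \<in> {1..n}" "\<alpha> < \<beta>" for \<alpha> \<beta>
  proof
    assume "cnd \<alpha> \<beta>"
    then obtain t where t: "\<alpha> \<le> t" "t < \<beta>" "k \<le> card {\<gamma> \<in> {t<..n}. X \<alpha> \<gamma> < X \<alpha> \<beta>}" "k \<le> card {\<delta> \<in> {1..t}. X \<beta> \<delta> < X \<alpha> \<beta>}"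
      unfolding cnd_def by blast
    have "\<alpha> \<noteq> \<beta>" using ab by simp
    \<comment> \<open>The strict comparison excludes \<beta> here and \<alpha> in the second count;
      together they would give \<open>n \<ge> 2 * k + 2\<close>.\<close>
    have "card {\<gamma> \<in> {t<..n}. X \<alpha> \<gamma> < X \<alpha> \<beta>} \<le> card ({t<..n} - {\<beta>})" by (intro card_mono) auto
    also have "\<dots> = n - t - 1" using t(2) ab(2) by simp
    finally have 1: "k \<le> n - t - 1" using t(3) by simp
    have "card {\<delta> \<in> {1..t}. X \<beta> \<delta> < X \<alpha> \<beta>} \<le> card ({1..t} - {\<alpha>})"
      using X_sym[OF ab(1,2) \<open>\<alpha> \<noteq> \<beta>\<close>] by (intro card_mono) auto
    also have "\<dots> = t - 1" using t(1) ab(1) by simp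
    finally have 2: "k \<le> t - 1" using t(4) by simp
    show False using 1 2 False t(1,2) ab by auto
  qed
  ultimately show ?thesis using G.cr_def by blast
qed

text \<open>Every intersection point is the wedge of exactly such a pair of indices \<alpha>
  \<open><\<close> \<beta>, and it is a crossing of the greedy curves exactly if \<open>cnd\<close>
  holds; \<open>cnd_iff\<close> turns the negation into the defining condition.\<close>

theorem greedy_vertices:
  assumes k: "k \<ge> 1"
  shows "pt_vertices L (greedy_pseudotriangulation L F k) = greedy_crossings L F k n l"
proof -
  obtain G :: "nat set" and g where g: "pt G g" "early G g"
    "\<forall>\<alpha>\<in>{1..n}. \<forall>\<beta>\<in>{1..n}. \<alpha> < \<beta> \<longrightarrow> (family.cr G g (X \<alpha> \<beta>) (fl \<alpha> (X \<alpha> \<beta>)) \<longleftrightarrow> cnd \<alpha> \<beta>)"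
    using ex_greedy_family by (elim exE conjE)
  interpret G: family G g by (rule pt_family[OF g(1)])
  have crw: "wedge (l \<alpha>) (l \<beta>) \<in> crossing_points (plines G g) \<longleftrightarrow> cnd \<alpha> \<beta>" if "1 \<le> \<alpha>" "\<alpha> < \<beta>" "\<beta> \<le> n" for \<alpha> \<beta>
  proof -
    have ab: "\<alpha> \<in> {1..n}" "\<beta> \<in> {1..n}" "\<alpha> \<noteq> \<beta>" using that by auto
    show ?thesis unfolding wedge_X[OF ab] G.mem_crossing_points using g(3) ab that(2) by blast
  qed
  have ip: "p \<in> intersection_points L \<longleftrightarrow> (\<exists>\<alpha> \<beta>. p = wedge (l \<alpha>) (l \<beta>) \<and> 1 \<le> \<alpha> \<and> \<alpha> < \<beta> \<and> \<beta> \<le> n)" for p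
  proof
    assume p: "p \<in> intersection_points L"
    obtain x0 y0 where p0: "p = mproj (x0, y0)" by (rule mproj_cases)
    have "vx x0 y0" using p mem_intersection_points[of x0 y0] unfolding p0 plines_pfun[OF arr] by blast
    then obtain P Q where PQ: "P \<in> L" "Q \<in> L" "P \<noteq> Q" "pfun P x0 = y0" "pfun Q x0 = y0" unfolding vx_def by blast
    obtain \<alpha>0 \<beta>0 where a0: "\<alpha>0 \<in> {1..n}" "P = l \<alpha>0" "\<beta>0 \<in> {1..n}" "Q = l \<beta>0" using l_surj PQ(1,2) by metis
    have "\<alpha>0 \<noteq> \<beta>0" using PQ(3) a0 by blast
    moreover have "fl \<alpha>0 x0 = y0" "fl \<beta>0 x0 = y0" using PQ(4,5) a0 by (simp_all add: fl_def)
    ultimately obtain \<alpha> \<beta> where ab: "\<alpha> \<in> {1..n}" "\<beta> \<in> {1..n}" "\<alpha> < \<beta>" "fl \<alpha> x0 = y0" "fl \<beta> x0 = y0"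
      using a0(1,3) by (metis linorder_neqE_nat)
    have ne: "\<alpha> \<noteq> \<beta>" using ab by simp
    have "p = wedge (l \<alpha>) (l \<beta>)"
      unfolding p0 wedge_X[OF ab(1,2) ne] mproj_eq_curve[OF ap_fl[OF ab(1)]]
      using coincidence_eqv[OF ab(1,2) ne] ab(4,5) by simp
    then show "\<exists>\<alpha> \<beta>. p = wedge (l \<alpha>) (l \<beta>) \<and> 1 \<le> \<alpha> \<and> \<alpha> < \<beta> \<and> \<beta> \<le> n" using ab by auto
  next
    assume "\<exists>\<alpha> \<beta>. p = wedge (l \<alpha>) (l \<beta>) \<and> 1 \<le> \<alpha> \<and> \<alpha> < \<beta> \<and> \<beta> \<le> n"
    then obtain \<alpha> \<beta> where p: "p = wedge (l \<alpha>) (l \<beta>)" and "1 \<le> \<alpha>" "\<alpha> < \<beta>" "\<beta> \<le> n" by blast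
    then have ab: "\<alpha> \<in> {1..n}" "\<beta> \<in> {1..n}" "\<alpha> \<noteq> \<beta>" by auto
    have "vx (X \<alpha> \<beta>) (fl \<alpha> (X \<alpha> \<beta>))" using W_vx[OF X(1)[OF ab]] by simp
    then show "p \<in> intersection_points L"
      using mem_intersection_points unfolding p wedge_X[OF ab] plines_pfun[OF arr] by blast
  qed
  have "p \<in> pt_vertices L (plines G g) \<longleftrightarrow> p \<in> greedy_crossings L F k n l" for p
  proof -
    have "p \<in> pt_vertices L (plines G g) \<longleftrightarrow>
        (\<exists>\<alpha> \<beta>. p = wedge (l \<alpha>) (l \<beta>) \<and> 1 \<le> \<alpha> \<and> \<alpha> < \<beta> \<and> \<beta> \<le> n) \<and> p \<notin> crossing_points (plines G g)"
      unfolding pt_vertices_def using ip by blast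
    also have "\<dots> \<longleftrightarrow> (\<exists>\<alpha> \<beta>. p = wedge (l \<alpha>) (l \<beta>) \<and> 1 \<le> \<alpha> \<and> \<alpha> < \<beta> \<and> \<beta> \<le> n \<and> \<not> cnd \<alpha> \<beta>)"
      using crw by blast
    also have "\<dots> \<longleftrightarrow> p \<in> greedy_crossings L F k n l"
      unfolding greedy_crossings_def mem_Collect_eq
      by (intro iff_exI conj_cong refl) (subst cnd_iff[OF k], assumption+, rule refl)
    finally show ?thesis .
  qed
  then show ?thesis unfolding greedy_eq[OF g(1,2)] by (rule set_eqI)
qed

end

theorem theorem41:
  fixes L :: "moebius set set" and F :: "(real \<times> real) set" and c :: "real \<Rightarrow> real \<times> real"
    and n k :: nat and l :: "nat \<Rightarrow> moebius set"
  assumes "simple_arrangement L" and "contact_points L = {}"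
    and "cut_filter L F" and "cut_curve L F c" and "crossing_order L c n l"
    and "k \<ge> 1"
  shows "pt_vertices L (greedy_pseudotriangulation L F k) = greedy_crossings L F k n l"
proof -
  interpret ordered_cut L k F c n l
    using assms(1-5) by unfold_locales
  show ?thesis by (rule greedy_vertices[OF assms(6)])
qed

end
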